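(* Let $K_1, K_2 \subset \mathbb{R}^d$ be two convex bodies such that $K_2$ is contained in the interior of $K_1$. Then there exists a projective transformation $\phi$, admissible with respect to $K_1$, such that \[ \gamma(\phi(K_1)) = \gamma(\phi(K_2)). \] In general, $\phi$ is not unique modulo affine transformations, i.e. there exist $d$, convex bodies $K_1, K_2 \subset \mathbb{R}^d$ with $K_2$ contained in the interior of $K_1$, and two projective transformations $\phi, \psi$, admissible with respect to $K_1$ and satisfying $\gamma(\phi(K_1)) = \gamma(\phi(K_2))$ and $\gamma(\psi(K_1)) = \gamma(\psi(K_2))$, for which $\phi\circ\psi^{-1}$ is not affine. Let now $d \ge 2$. Then $\phi$ is unique modulo post-composition with affine transformations (among projective transformations admissible with respect to $K_1$) if \[ \operatorname{width}_{K_1}(K_2) < \log\frac{1 + \kappa_d}{1 - \kappa_d}, \quad \text{where } \kappa_d = \sqrt{\frac{6}{(d+1)(d+2)}}. \] This bound is sharp: for every $c > \log\frac{1 + \kappa_d}{1 - \kappa_d}$ there are convex bodies $K_1, K_2$ with $K_2 \subset \operatorname{int} K_1$ and $\operatorname{width}_{K_1}(K_2) < c$ for which $\phi$ is not unique modulo affine transformations. It is achieved by a cross-polytope and a rectangular parallelepiped inside it with at least one sufficiently long side: if $K_1$ is the standard cross-polytope $\{x \in \mathbb{R}^d : \sum_i |x_i| \le 1\}$ and $K_2 = \prod_{i=1}^d [-h_i, h_i] \subset \operatorname{int} K_1$ with all $h_i>0$ and $h_j > \kappa_d$ for some $j$, then $\phi$ is not unique modulo affine transformations.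
   Context: $\mathbb{R}^d$ is identified with the affine chart $\{x_0 \neq 0\}$ of $\mathbb{R}\mathrm{P}^d$. A projective transformation $\phi$ is admissible for $K \subset \mathbb{R}^d$ if $\phi(\operatorname{conv}(K)) \subset \mathbb{R}^d$; it is affine if it restricts to a map $x \mapsto Ax+b$ of $\mathbb{R}^d$, $A \in \mathrm{GL}(d)$. A convex body is a compact convex set with non-empty interior; $\gamma(K) = \frac{1}{\operatorname{vol}(K)} \int_K x\, dx$ is the centroid. For collinear points, $\operatorname{cr}(p,q;a,b) = \frac{(p-a)(q-b)}{(p-b)(q-a)}$ (with respect to an affine coordinate on the line). For four hyperplanes containing a common $(d-2)$-dimensional affine subspace, the cross-ratio is that of their intersection points with a generic transversal line. For convex bodies $K_1 \supset K_2$ in $\mathbb{R}^d$, the maximum Hilbert width of $K_2$ with respect to $K_1$ is \[ \operatorname{width}_{K_1}(K_2) = \sup_{\alpha \cap K_1 = \emptyset} \tfrac12 \log |\operatorname{cr}(m_2, \ell_2; \ell_1, m_1)|, \] where $\alpha$ ranges over the $(d-2)$-dimensional affine subspaces disjoint from $K_1$, and $\ell_i, m_i \supset \alpha$ are the two support hyperplanes of $K_i$ containing $\alpha$ (labelled so that the cross-ratio has absolute value at least $1$). *)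

theory Defs
  imports "HOL-Analysis.Analysis"
begin

text \<open>
  The real projective space of dimension \<open>CARD('n)\<close>: lines through the origin in the space of
  homogeneous coordinates \<open>(x\<^sub>0, x)\<close>.
\<close>

typedef 'n rproj = "{L :: (real \<times> (real ^ 'n::finite)) set. subspace L \<and> dim L = 1}"
proof
  have "dim {(1::real, 0 :: real ^ 'n)} = 1"
    by (simp add: dim_eq_card_independent zero_prod_def)
  then show "span {(1, 0)} \<in> {L :: (real \<times> (real ^ 'n)) set. subspace L \<and> dim L = 1}"
    by simp
qed

definition chart :: "real ^ 'n \<Rightarrow> 'n::finite rproj" where
  "chart x = Abs_rproj (span {(1, x)})"

lemma Rep_chart: "Rep_rproj (chart x) = span {(1, x)}"
proof -
  have "dim {(1::real, x)} = 1"
    by (simp add: dim_eq_card_independent zero_prod_def)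
  then show ?thesis
    unfolding chart_def by (simp add: Abs_rproj_inverse)
qed

definition projective_transformation :: "('n::finite rproj \<Rightarrow> 'n rproj) \<Rightarrow> bool" where
  "projective_transformation \<phi> \<longleftrightarrow>
    (\<exists>T. linear T \<and> bij T \<and> (\<forall>P. Rep_rproj (\<phi> P) = T ` Rep_rproj P))"

definition admissible :: "('n::finite rproj \<Rightarrow> 'n rproj) \<Rightarrow> (real ^ 'n) set \<Rightarrow> bool" where
  "admissible \<phi> K \<longleftrightarrow> \<phi> ` chart ` (convex hull K) \<subseteq> range chart"

definition affine_transformation :: "('n::finite rproj \<Rightarrow> 'n rproj) \<Rightarrow> bool" where
  "affine_transformation \<phi> \<longleftrightarrow>
    (\<exists>(A :: real ^ 'n ^ 'n) b. invertible A \<and> (\<forall>x. \<phi> (chart x) = chart (A *v x + b)))"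

text \<open>
  The image of a set of the affine chart, as a set of the affine chart. Points sent to infinity
  are dropped; there are none if the map is admissible for the set.
\<close>

definition chart_image :: "('n::finite rproj \<Rightarrow> 'n rproj) \<Rightarrow> (real ^ 'n) set \<Rightarrow> (real ^ 'n) set" where
  "chart_image \<phi> K = chart -` (\<phi> ` chart ` K)"

definition convex_body :: "(real ^ 'n::finite) set \<Rightarrow> bool" where
  "convex_body K \<longleftrightarrow> compact K \<and> convex K \<and> interior K \<noteq> {}"

definition centroid :: "(real ^ 'n::finite) set \<Rightarrow> real ^ 'n" where
  "centroid K = (1 / measure lborel K) *\<^sub>R (LINT x:K|lborel. x)"

definition equates_centroids ::
    "('n::finite rproj \<Rightarrow> 'n rproj) \<Rightarrow> (real ^ 'n) set \<Rightarrow> (real ^ 'n) set \<Rightarrow> bool" where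
  "equates_centroids \<phi> K1 K2 \<longleftrightarrow>
    projective_transformation \<phi> \<and> admissible \<phi> K1 \<and>
    centroid (chart_image \<phi> K1) = centroid (chart_image \<phi> K2)"

definition unique_modulo_affine :: "(real ^ 'n::finite) set \<Rightarrow> (real ^ 'n) set \<Rightarrow> bool" where
  "unique_modulo_affine K1 K2 \<longleftrightarrow>
    (\<forall>\<phi> \<psi>. equates_centroids \<phi> K1 K2 \<and> equates_centroids \<psi> K1 K2 \<longrightarrow>
      affine_transformation (\<phi> \<circ> inv \<psi>))"

definition cross_ratio :: "real \<Rightarrow> real \<Rightarrow> real \<Rightarrow> real \<Rightarrow> real" where
  "cross_ratio p q a b = ((p - a) * (q - b)) / ((p - b) * (q - a))"

text \<open>
  Cross-ratio of four hyperplanes containing \<open>\<alpha>\<close>, of dimension \<open>d - 2\<close>. The transversal line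
  \<open>{u + t v}\<close> is generic: it misses \<open>\<alpha>\<close> and meets each hyperplane in exactly one point, whose
  affine coordinate on the line is its parameter \<open>t\<close>. The value does not depend on the line.
\<close>

definition pencil_cross_ratio ::
    "(real ^ 'n::finite) set \<Rightarrow> (real ^ 'n) set \<Rightarrow> (real ^ 'n) set \<Rightarrow> (real ^ 'n) set \<Rightarrow>
     (real ^ 'n) set \<Rightarrow> real" where
  "pencil_cross_ratio \<alpha> P Q A B =
    (THE r. \<exists>u v p q a b. v \<noteq> 0 \<and>
      (\<forall>t. u + t *\<^sub>R v \<notin> \<alpha>) \<and>
      (\<forall>t. u + t *\<^sub>R v \<in> P \<longleftrightarrow> t = p) \<and>
      (\<forall>t. u + t *\<^sub>R v \<in> Q \<longleftrightarrow> t = q) \<and>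
      (\<forall>t. u + t *\<^sub>R v \<in> A \<longleftrightarrow> t = a) \<and>
      (\<forall>t. u + t *\<^sub>R v \<in> B \<longleftrightarrow> t = b) \<and>
      r = cross_ratio p q a b)"

definition support_hyperplane :: "(real ^ 'n::finite) set \<Rightarrow> (real ^ 'n) set \<Rightarrow> bool" where
  "support_hyperplane K H \<longleftrightarrow>
    (\<exists>a b. a \<noteq> 0 \<and> H = {x. a \<bullet> x = b} \<and> K \<subseteq> {x. a \<bullet> x \<le> b} \<and> H \<inter> K \<noteq> {})"

text \<open>
  Swapping \<open>l2\<close> and \<open>m2\<close> inverts the cross-ratio, so the condition \<open>1 \<le> \<bar>c\<bar>\<close> only fixes the
  labelling. The cross-ratio is finite and non-zero when \<open>K2\<close> lies in the interior of \<open>K1\<close>; the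
  definition is meant for that case. The supremum is taken in the extended reals so that it needs
  no boundedness assumption.
\<close>

definition hilbert_width :: "(real ^ 'n::finite) set \<Rightarrow> (real ^ 'n) set \<Rightarrow> ereal" where
  "hilbert_width K1 K2 =
    Sup {ereal (1 / 2 * ln \<bar>c\<bar>) | c \<alpha> l1 m1 l2 m2.
      affine \<alpha> \<and> aff_dim \<alpha> = int CARD('n) - 2 \<and> \<alpha> \<inter> K1 = {} \<and>
      l1 \<noteq> m1 \<and> {H. support_hyperplane K1 H \<and> \<alpha> \<subseteq> H} = {l1, m1} \<and>
      l2 \<noteq> m2 \<and> {H. support_hyperplane K2 H \<and> \<alpha> \<subseteq> H} = {l2, m2} \<and>
      c = pencil_cross_ratio \<alpha> m2 l2 l1 m1 \<and> 1 \<le> \<bar>c\<bar>}"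

definition kappa :: "nat \<Rightarrow> real" where
  "kappa d = sqrt (6 / ((real d + 1) * (real d + 2)))"

definition cross_polytope :: "(real ^ 'n::finite) set" where
  "cross_polytope = {x. (\<Sum>i\<in>UNIV. \<bar>x $ i\<bar>) \<le> 1}"

end

theory Submission
  imports Defs
begin

text \<open>
  \<^bold>\<open>Parametrisation.\<close> Fix \<open>p \<in> K2\<close>. Up to post-composition with an affine map, a projective
  transformation admissible for \<open>K1\<close> is determined by the hyperplane that it sends to infinity, and so
  by a vector \<open>c\<close> with \<open>1 + c \<bullet> (x - p) > 0\<close> on \<open>K1\<close>; a representative is
  \<open>x \<mapsto> (x - p) / (1 + c \<bullet> (x - p))\<close> (\<open>admissible_normal_form\<close>, \<open>same_denominator_affine\<close>). Its
  Jacobian determinant is a power of the denominator, so the volumes \<open>V1 c\<close>, \<open>V2 c\<close> and the centroids of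
  the images of \<open>K1\<close>, \<open>K2\<close> are integrals over the original bodies with the weight
  \<open>(1 + c \<bullet> (x - p)) ^ - (d + 1)\<close>. Differentiating under the integral sign shows that the gradient
  of \<open>V1 / V2\<close> at \<open>c\<close> is \<open>- (d + 1) (V1 / V2)\<close> times the difference of the two centroids
  (\<open>volume_ratio_derivative\<close>): the centroids agree exactly at the critical points of \<open>V1 / V2\<close>.

  \<^bold>\<open>Existence.\<close> When the hyperplane sent to infinity approaches \<open>K1\<close>, the volume \<open>V1\<close> tends to
  infinity while \<open>V2\<close> stays bounded. Hence \<open>V1 / V2\<close> attains its minimum on the bounded open set of
  admissible \<open>c\<close> (\<open>volume_ratio_minimiser\<close>).

  \<^bold>\<open>Uniqueness.\<close> Two critical points are joined by a segment with direction \<open>w\<close>. Along it, the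
  \<open>w\<close>-component of the difference of the centroids vanishes at both ends. Wherever it vanishes, its
  derivative is \<open>(d + 2)\<close> times the difference of the variances of \<open>w\<close> on the two image bodies
  (\<open>weighted_mean_derivative\<close>). If \<open>w\<close> always has the larger variance on the image of \<open>K1\<close>, all zeros are
  crossed in the same direction and there cannot be two of them (\<open>no_two_increasing_zeros\<close>).
  To compare the variances, let \<open>w\<close> range over \<open>[-a, b]\<close> on the image of \<open>K1\<close> and over
  \<open>[-p, q]\<close> on that of \<open>K2\<close>, measured from the common mean. Then
  \<^item> the variance on the image of \<open>K1\<close> is at least \<open>2 a b / ((d + 1) (d + 2))\<close>
    (\<open>convex_second_moment_lower\<close>), by shrinking the body towards its extreme points;
  \<^item> the variance on the image of \<open>K2\<close> is at most \<open>p q / 3\<close> (\<open>convex_second_moment_upper\<close>): the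
    distribution of \<open>w\<close> is log-concave, by the Prekopa-Leindler inequality, and among the log-concave
    densities on \<open>[-p, q]\<close> with mean \<open>0\<close> an exponential one has the largest variance, which is explicit.

  Hence \<open>p q < \<kappa>\<^sup>2 a b\<close> suffices, where \<open>\<kappa>\<^sup>2 = 6 / ((d + 1) (d + 2))\<close>. The hyperplanes on
  which the pull-back of \<open>w\<close> takes its extreme values on \<open>K1\<close> and \<open>K2\<close> belong to one pencil, so the width bounds their
  cross-ratio \<open>(q + a) (p + b) / ((b - q) (a - p))\<close>; by the arithmetic-geometric mean inequality this
  is at least \<open>((1 + \<kappa>) / (1 - \<kappa>))\<^sup>2\<close> if \<open>p q \<ge> \<kappa>\<^sup>2 a b\<close> (\<open>cross_ratio_lower_bound\<close>,
  \<open>critical_variance\<close>).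

  \<^bold>\<open>Non-uniqueness.\<close> For the cross-polytope and a centred box both moment estimates are equalities:
  the variances of the \<open>j\<close>-th coordinate are \<open>2 / ((d + 1) (d + 2)) = \<kappa>\<^sup>2 / 3\<close>
  and \<open>h\<^sub>j\<^sup>2 / 3\<close>. By symmetry \<open>c = 0\<close> is critical, but if \<open>h\<^sub>j > \<kappa>\<close>, then the second derivative of
  \<open>V1 / V2\<close> in the \<open>j\<close>-th direction is negative there, so the minimum is attained at another critical
  point (\<open>not_unique_if_variance_larger\<close>). Thin boxes with one side slightly longer than \<open>2 \<kappa>\<close> lie in
  the \<open>s\<close>-fold cross-polytope with \<open>s\<close> close to \<open>\<kappa>\<close>, and so have width close to the bound
  (\<open>hilbert_width_symmetric_le\<close>).
\<close>

section \<open>Integrals over compact sets\<close>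

lemma set_integrable_compact:
  fixes F :: "'a::euclidean_space \<Rightarrow> 'b::{banach, second_countable_topology}"
  assumes "compact K" "continuous_on K F"
  shows "set_integrable lborel K F"
  unfolding set_integrable_def using assms by (rule borel_integrable_compact)

lemma set_integral_const_compact:
  fixes K :: "'a::euclidean_space set" and c :: real
  assumes "compact K"
  shows "(LINT x:K|lborel. c) = measure lborel K * c"
  unfolding set_lebesgue_integral_def
  using assms by (simp add: emeasure_compact_finite borel_compact)

lemma set_integral_mono_compact:
  fixes F G :: "'a::euclidean_space \<Rightarrow> real"
  assumes "compact K" "continuous_on K F" "continuous_on K G" "\<And>x. x \<in> K \<Longrightarrow> F x \<le> G x"
  shows "(LINT x:K|lborel. F x) \<le> (LINT x:K|lborel. G x)"
  by (rule set_integral_mono) (use assms in \<open>auto intro: set_integrable_compact\<close>)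

lemma measure_lborel_pos:
  fixes K :: "'a::euclidean_space set"
  assumes "compact K" "interior K \<noteq> {}"
  shows "0 < measure lborel K"
proof -
  obtain x e where e: "e > 0" "ball x e \<subseteq> K"
    using assms(2) by (meson all_not_in_conv mem_interior)
  have "0 < measure lborel (ball x e)"
    using content_ball_pos[OF e(1)] by (simp add: measure_def)
  also have "\<dots> \<le> measure lborel K"
    using e assms(1) by (intro measure_mono_fmeasurable) (auto simp: fmeasurable_compact)
  finally show ?thesis .
qed

lemma set_integral_pos_compact:
  fixes F :: "'a::euclidean_space \<Rightarrow> real"
  assumes "compact K" "continuous_on K F" "\<And>x. x \<in> K \<Longrightarrow> F x > 0" "0 < measure lborel K"
  shows "0 < (LINT x:K|lborel. F x)"
proof -
  have "K \<noteq> {}" using assms(4) by auto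
  then obtain y where y: "y \<in> K" "\<And>x. x \<in> K \<Longrightarrow> F y \<le> F x"
    using continuous_attains_inf[OF assms(1) _ assms(2)] by blast
  have "0 < measure lborel K * F y" using y(1) assms by simp
  also have "\<dots> = (LINT x:K|lborel. F y)" using set_integral_const_compact[OF assms(1)] by simp
  also have "\<dots> \<le> (LINT x:K|lborel. F x)"
    by (rule set_integral_mono_compact) (use assms y in auto)
  finally show ?thesis .
qed

lemma inner_set_integral:
  fixes F :: "'a::euclidean_space \<Rightarrow> 'b::euclidean_space"
  assumes "compact K" "continuous_on K F"
  shows "w \<bullet> (LINT x:K|lborel. F x) = (LINT x:K|lborel. w \<bullet> F x)"
proof -
  have "integrable lborel (\<lambda>x. indicat_real K x *\<^sub>R F x)"
    using set_integrable_compact[OF assms] by (simp add: set_integrable_def)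
  then show ?thesis unfolding set_lebesgue_integral_def
    by (simp flip: integral_inner_right)
qed

text \<open>
  Dominated convergence with a constant majorant; the parameter space is metric, so continuity can
  be tested on sequences.
\<close>

lemma continuous_set_integral_sequentially:
  fixes F :: "'b::metric_space \<Rightarrow> 'a::euclidean_space \<Rightarrow> real"
  assumes K: "compact K"
    and cont: "\<And>c. c \<in> C \<Longrightarrow> continuous_on K (F c)"
    and ptw: "\<And>x. x \<in> K \<Longrightarrow> continuous_on C (\<lambda>c. F c x)"
    and bd: "\<And>c x. c \<in> C \<Longrightarrow> x \<in> K \<Longrightarrow> \<bar>F c x\<bar> \<le> B"
  shows "continuous_on C (\<lambda>c. LINT x:K|lborel. F c x)"
  unfolding continuous_on_sequentially
proof (intro allI ballI impI)
  fix X c assume c: "c \<in> C" and X: "(\<forall>n. X n \<in> C) \<and> X \<longlonglongrightarrow> c"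
  show "((\<lambda>c. LINT x:K|lborel. F c x) \<circ> X) \<longlonglongrightarrow> (LINT x:K|lborel. F c x)"
    unfolding set_lebesgue_integral_def comp_def
  proof (rule integral_dominated_convergence[where w = "\<lambda>x. indicat_real K x *\<^sub>R B"])
    show "integrable lborel (\<lambda>x. indicat_real K x *\<^sub>R B)"
      by (rule borel_integrable_compact) (use K in auto)
    show "(\<lambda>x. indicat_real K x *\<^sub>R F c x) \<in> borel_measurable lborel"
      by (rule borel_measurable_integrable, rule borel_integrable_compact) (use K c cont in auto)
    show "(\<lambda>x. indicat_real K x *\<^sub>R F (X n) x) \<in> borel_measurable lborel" for n
      by (rule borel_measurable_integrable, rule borel_integrable_compact) (use K X cont in auto)
    show "AE x in lborel. (\<lambda>n. indicat_real K x *\<^sub>R F (X n) x) \<longlonglongrightarrow> indicat_real K x *\<^sub>R F c x"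
    proof (rule AE_I2)
      fix x
      show "(\<lambda>n. indicat_real K x *\<^sub>R F (X n) x) \<longlonglongrightarrow> indicat_real K x *\<^sub>R F c x"
      proof (cases "x \<in> K")
        case True
        then have "(\<lambda>n. F (X n) x) \<longlonglongrightarrow> F c x"
          using ptw[OF True] c X unfolding continuous_on_sequentially comp_def by auto
        with True show ?thesis by simp
      qed simp
    qed
    show "AE x in lborel. norm (indicat_real K x *\<^sub>R F (X n) x) \<le> indicat_real K x *\<^sub>R B" for n
      using bd X by (intro AE_I2) (auto simp: indicator_def)
  qed
qed

text \<open>
  Differentiation under the integral sign: by compactness the denominator is bounded away from zero
  uniformly for \<open>t\<close> near \<open>t0\<close>, and then the mean value theorem provides the majorant for the
  difference quotients.
\<close>

lemma has_real_derivative_set_integral_power: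
  fixes f g q :: "'a::euclidean_space \<Rightarrow> real"
  assumes K: "compact K" and cf: "continuous_on K f" and cg: "continuous_on K g"
    and cq: "continuous_on K q" and pos: "\<And>x. x \<in> K \<Longrightarrow> 0 < f x + t0 * g x"
  shows "((\<lambda>t. LINT x:K|lborel. q x / (f x + t * g x) ^ m) has_real_derivative
           - real m * (LINT x:K|lborel. q x * g x / (f x + t0 * g x) ^ Suc m)) (at t0)"
proof (cases "K = {}")
  case True
  then show ?thesis by (simp add: set_lebesgue_integral_def)
next
  case False
  obtain y where y: "y \<in> K" "\<And>x. x \<in> K \<Longrightarrow> f y + t0 * g y \<le> f x + t0 * g x"
    using continuous_attains_inf[OF K False continuous_on_add[OF cf continuous_on_mult_left[OF cg]]]
    by blast
  define \<delta> where "\<delta> = f y + t0 * g y"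
  have \<delta>: "\<delta> > 0" using pos y by (simp add: \<delta>_def)
  obtain G where G: "G > 0" "\<And>x. x \<in> K \<Longrightarrow> \<bar>g x\<bar> \<le> G"
    using compact_imp_bounded[OF compact_continuous_image[OF cg K]]
    by (force simp: bounded_pos)
  obtain Q where Q: "Q > 0" "\<And>x. x \<in> K \<Longrightarrow> \<bar>q x\<bar> \<le> Q"
    using compact_imp_bounded[OF compact_continuous_image[OF cq K]]
    by (force simp: bounded_pos)
  define r where "r = \<delta> / (2 * G)"
  have r: "r > 0" using \<delta> G by (simp add: r_def)
  have low: "\<delta> / 2 \<le> f x + t * g x" if "x \<in> K" "\<bar>t - t0\<bar> \<le> r" for x t
  proof -
    have "\<bar>(t - t0) * g x\<bar> \<le> r * G" unfolding abs_mult
      using that G r by (intro mult_mono) auto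
    also have "r * G = \<delta> / 2" using G by (simp add: r_def)
    finally have "- (\<delta>/2) \<le> (t - t0) * g x" by linarith
    moreover have "\<delta> \<le> f x + t0 * g x" using y(2) that by (simp add: \<delta>_def)
    ultimately show ?thesis by (simp add: algebra_simps)
  qed
  define P where "P = (\<lambda>t x. q x / (f x + t * g x) ^ m)"
  define D where "D = (\<lambda>t x. - real m * (q x * g x / (f x + t * g x) ^ Suc m))"
  have der: "((\<lambda>t. P t x) has_real_derivative D t x) (at t)" if "x \<in> K" "\<bar>t - t0\<bar> \<le> r" for x t
  proof -
    have p: "f x + t * g x > 0" using low[OF that] \<delta> by linarith
    show ?thesis unfolding P_def D_def
    proof (cases m)
      case 0 then show "((\<lambda>t. q x / (f x + t * g x) ^ m) has_real_derivative
         - real m * (q x * g x / (f x + t * g x) ^ Suc m)) (at t)" by simp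
    next
      case (Suc k)
      define u where "u = f x + t * g x"
      have "((\<lambda>t. (f x + t * g x) ^ Suc k) has_real_derivative real (Suc k) * u ^ k * g x) (at t)"
        unfolding u_def by (rule derivative_eq_intros refl)+ simp
      from DERIV_divide[OF DERIV_const[of "q x"] this]
      have "((\<lambda>t. q x / (f x + t * g x) ^ Suc k) has_real_derivative
        (0 * u ^ Suc k - q x * (real (Suc k) * u ^ k * g x)) / (u ^ Suc k * u ^ Suc k)) (at t)"
        using p by (simp add: u_def)
      also have "(0 * u ^ Suc k - q x * (real (Suc k) * u ^ k * g x)) / (u ^ Suc k * u ^ Suc k)
         = - real m * (q x * g x / u ^ Suc m)"
        using p by (simp add: Suc u_def[symmetric] field_simps)
      finally show "((\<lambda>t. q x / (f x + t * g x) ^ m) has_real_derivative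
         - real m * (q x * g x / (f x + t * g x) ^ Suc m)) (at t)"
        by (simp add: Suc u_def)
    qed
  qed
  define B where "B = real m * (Q * G / (\<delta>/2) ^ Suc m)"
  have Dbd: "\<bar>D t x\<bar> \<le> B" if "x \<in> K" "\<bar>t - t0\<bar> \<le> r" for x t
  proof -
    have "\<bar>q x * g x\<bar> \<le> Q * G" unfolding abs_mult using Q G that by (intro mult_mono) auto
    moreover have "(\<delta>/2) ^ Suc m \<le> (f x + t * g x) ^ Suc m"
      using low[OF that] \<delta> by (intro power_mono) auto
    moreover have "0 < (\<delta>/2) ^ Suc m" using \<delta> by simp
    ultimately have "\<bar>q x * g x / (f x + t * g x) ^ Suc m\<bar> \<le> Q * G / (\<delta>/2) ^ Suc m"
      unfolding abs_divide by (intro frac_le) auto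
    from mult_left_mono[OF this, of "real m"] show ?thesis
      unfolding D_def B_def by (simp only: abs_mult abs_minus_cancel abs_of_nat of_nat_0_le_iff simp_thms)
  qed
  have cP: "continuous_on K (P t)" if "\<bar>t - t0\<bar> \<le> r" for t
  proof -
    have "f x + t * g x \<noteq> 0" if "x \<in> K" for x using low[OF that \<open>\<bar>t - t0\<bar> \<le> r\<close>] \<delta> by linarith
    then show ?thesis unfolding P_def by (intro continuous_intros cf cg cq) auto
  qed
  have cD: "continuous_on K (D t0)"
  proof -
    have "f x + t0 * g x \<noteq> 0" if "x \<in> K" for x using pos[OF that] by linarith
    then show ?thesis unfolding D_def by (intro continuous_intros cf cg cq) auto
  qed
  define J where "J = (\<lambda>t. LINT x:K|lborel. P t x)"
  have diffJ: "(J (t0 + h) - J t0) / h = (LINT x:K|lborel. (P (t0 + h) x - P t0 x) / h)"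
    if "\<bar>h\<bar> \<le> r" for h
    unfolding J_def using that r
    by (subst set_integral_diff(2)[symmetric]) (auto intro!: set_integrable_compact K cP)
  have "((\<lambda>h. (J (t0 + h) - J t0) / h) \<longlongrightarrow> (LINT x:K|lborel. D t0 x)) (at 0)"
    unfolding tendsto_at_iff_sequentially
  proof (intro allI impI)
    fix X :: "nat \<Rightarrow> real" assume X0: "\<forall>i. X i \<in> UNIV - {0}" and X: "X \<longlonglongrightarrow> 0"
    from X have "\<forall>\<^sub>F n in sequentially. \<bar>X n\<bar> < r"
      using r unfolding tendsto_iff by auto
    then obtain N where N: "\<And>n. n \<ge> N \<Longrightarrow> \<bar>X n\<bar> \<le> r"
      unfolding eventually_sequentially by (meson less_imp_le)
    define Y where "Y = (\<lambda>n. X (n + N))"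
    have Y: "\<And>n. \<bar>Y n\<bar> \<le> r" "\<And>n. Y n \<noteq> 0" "Y \<longlonglongrightarrow> 0"
      using N X0 LIMSEQ_ignore_initial_segment[OF X] by (auto simp: Y_def)
    have "(\<lambda>n. LINT x:K|lborel. (P (t0 + Y n) x - P t0 x) / Y n) \<longlonglongrightarrow> (LINT x:K|lborel. D t0 x)"
      unfolding set_lebesgue_integral_def
    proof (rule integral_dominated_convergence[where w = "\<lambda>x. indicat_real K x *\<^sub>R B"])
      show "integrable lborel (\<lambda>x. indicat_real K x *\<^sub>R B)"
        by (rule borel_integrable_compact) (use K in auto)
      show "(\<lambda>x. indicat_real K x *\<^sub>R D t0 x) \<in> borel_measurable lborel"
        by (rule borel_measurable_integrable, rule borel_integrable_compact) (use K cD in auto)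
      show "(\<lambda>x. indicat_real K x *\<^sub>R ((P (t0 + Y n) x - P t0 x) / Y n)) \<in> borel_measurable lborel" for n
        by (rule borel_measurable_integrable, rule borel_integrable_compact)
          (use K cP[of "t0 + Y n"] cP[of t0] Y r in \<open>auto intro!: continuous_intros\<close>)
      show "AE x in lborel. (\<lambda>n. indicat_real K x *\<^sub>R ((P (t0 + Y n) x - P t0 x) / Y n)) \<longlonglongrightarrow>
              indicat_real K x *\<^sub>R D t0 x"
      proof (rule AE_I2)
        fix x show "(\<lambda>n. indicat_real K x *\<^sub>R ((P (t0 + Y n) x - P t0 x) / Y n)) \<longlonglongrightarrow>
              indicat_real K x *\<^sub>R D t0 x"
        proof (cases "x \<in> K")
          case True
          have "((\<lambda>h. (P (t0 + h) x - P t0 x) / h) \<longlongrightarrow> D t0 x) (at 0)"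
            using der[OF True, of t0] r by (simp add: DERIV_def)
          then have "((\<lambda>h. (P (t0 + h) x - P t0 x) / h) \<circ> Y) \<longlonglongrightarrow> D t0 x"
            unfolding tendsto_at_iff_sequentially using Y by auto
          with True show ?thesis by (simp add: comp_def)
        qed simp
      qed
      show "AE x in lborel. norm (indicat_real K x *\<^sub>R ((P (t0 + Y n) x - P t0 x) / Y n))
              \<le> indicat_real K x *\<^sub>R B" for n
      proof (rule AE_I2)
        fix x show "norm (indicat_real K x *\<^sub>R ((P (t0 + Y n) x - P t0 x) / Y n))
              \<le> indicat_real K x *\<^sub>R B"
        proof (cases "x \<in> K")
          case True
          have "norm (P (t0 + Y n) x - P t0 x) \<le> B * norm (t0 + Y n - t0)"
          proof (rule field_differentiable_bound[where S = "cball t0 r" and f' = "\<lambda>t. D t x"])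
            show "((\<lambda>t. P t x) has_field_derivative D z x) (at z within cball t0 r)"
              if "z \<in> cball t0 r" for z
              using der[OF True, of z] that
              by (auto simp: dist_real_def abs_minus_commute intro: has_field_derivative_at_within)
            show "norm (D z x) \<le> B" if "z \<in> cball t0 r" for z
              using Dbd[OF True, of z] that by (auto simp: dist_real_def abs_minus_commute)
          qed (use Y(1)[of n] r in \<open>auto simp: dist_real_def\<close>)
          then show ?thesis using True Y(2)[of n] by (simp add: abs_divide divide_le_eq)
        qed simp
      qed
    qed
    then have "(\<lambda>n. (J (t0 + Y n) - J t0) / Y n) \<longlonglongrightarrow> (LINT x:K|lborel. D t0 x)"
      by (simp only: diffJ[OF Y(1)])
    then show "((\<lambda>h. (J (t0 + h) - J t0) / h) \<circ> X) \<longlonglongrightarrow> (LINT x:K|lborel. D t0 x)"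
      unfolding comp_def Y_def by (rule LIMSEQ_offset)
  qed
  also have "(LINT x:K|lborel. D t0 x) = - real m * (LINT x:K|lborel. q x * g x / (f x + t0 * g x) ^ Suc m)"
    unfolding D_def by (rule set_integral_mult_right)
  finally show ?thesis unfolding DERIV_def J_def P_def .
qed

section \<open>Change of variables under projective maps\<close>

lemma vimage_borel:
  fixes f :: "'a::topological_space \<Rightarrow> 'b::topological_space"
  assumes "f \<in> borel_measurable borel" "B \<in> sets borel"
  shows "f -` B \<in> sets borel"
  using measurable_sets[OF assms] by simp

text \<open>
  The classical uniqueness argument for Haar measure: \<open>E y * A (x + y)\<close> is integrated over \<open>x\<close> and
  \<open>y\<close> in both orders, and each measure absorbs the translation in its own variable. With \<open>E\<close> a unit
  cube this makes \<open>M\<close> proportional to Lebesgue measure.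
\<close>

lemma lborel_translation_invariant_unique:
  fixes M :: "'a::euclidean_space measure"
  assumes [measurable_cong]: "sets M = sets borel" and sf: "sigma_finite_measure M"
    and inv: "\<And>A y. A \<in> sets borel \<Longrightarrow> emeasure M ((\<lambda>x. x + y) -` A) = emeasure M A"
    and [measurable]: "A \<in> sets borel" "E \<in> sets borel"
  shows "emeasure lborel E * emeasure M A = emeasure lborel A * emeasure M (uminus -` E)"
proof -
  interpret M: sigma_finite_measure M by (rule sf)
  interpret pair_sigma_finite M "lborel :: 'a measure" by standard
  have vm: "(\<lambda>x. x + y) -` B \<in> sets M" if [measurable]: "B \<in> sets borel" for y :: 'a and B
    using assms(1) that by (simp add: vimage_borel)
  have um: "(\<lambda>x. y - x) -` B \<in> sets M" if [measurable]: "B \<in> sets borel" for y :: 'a and B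
  proof -
    have "(\<lambda>x. y - x) \<in> borel_measurable borel" by simp
    then show ?thesis using assms(1) that by (simp add: vimage_borel)
  qed
  have "(\<integral>\<^sup>+y. (\<integral>\<^sup>+x. indicator E y * indicator A (x + y) \<partial>M) \<partial>lborel)
      = (\<integral>\<^sup>+y. indicator E y * emeasure M A \<partial>lborel)"
  proof (rule nn_integral_cong)
    fix y :: 'a
    have "(\<integral>\<^sup>+x. indicator E y * indicator A (x + y) \<partial>M)
        = indicator E y * (\<integral>\<^sup>+x. indicator ((\<lambda>x. x + y) -` A) x \<partial>M)"
      by (subst nn_integral_cmult[symmetric]) (auto simp: indicator_def intro!: nn_integral_cong)
    also have "\<dots> = indicator E y * emeasure M A" using vm inv[of A y] by simp
    finally show "(\<integral>\<^sup>+x. indicator E y * indicator A (x + y) \<partial>M) = indicator E y * emeasure M A" .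
  qed
  also have "\<dots> = emeasure lborel E * emeasure M A" by (simp add: nn_integral_multc)
  finally have 1: "(\<integral>\<^sup>+y. (\<integral>\<^sup>+x. indicator E y * indicator A (x + y) \<partial>M) \<partial>lborel)
     = emeasure lborel E * emeasure M A" .
  have "(\<integral>\<^sup>+y. (\<integral>\<^sup>+x. indicator E y * indicator A (x + y) \<partial>M) \<partial>lborel)
     = (\<integral>\<^sup>+x. (\<integral>\<^sup>+y. indicator E y * indicator A (x + y) \<partial>lborel) \<partial>M)"
    by (rule Fubini') simp
  also have "\<dots> = (\<integral>\<^sup>+x. (\<integral>\<^sup>+y. indicator E (y - x) * indicator A y \<partial>lborel) \<partial>M)"
  proof (rule nn_integral_cong)
    fix x :: 'a
    have "(\<integral>\<^sup>+y. indicator E (y - x) * indicator A y \<partial>(lborel::'a measure))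
       = (\<integral>\<^sup>+y. indicator E (y - x) * indicator A y \<partial>distr lborel borel ((+) x))"
      by (simp add: lborel_distr_plus)
    also have "\<dots> = (\<integral>\<^sup>+y. indicator E y * indicator A (x + y) \<partial>lborel)"
      by (subst nn_integral_distr) auto
    finally show "(\<integral>\<^sup>+y. indicator E y * indicator A (x + y) \<partial>lborel)
       = (\<integral>\<^sup>+y. indicator E (y - x) * indicator A y \<partial>lborel)" by simp
  qed
  also have "\<dots> = (\<integral>\<^sup>+y. (\<integral>\<^sup>+x. indicator E (y - x) * indicator A y \<partial>M) \<partial>lborel)"
    by (rule Fubini'[symmetric]) simp
  also have "\<dots> = (\<integral>\<^sup>+y. indicator A y * emeasure M (uminus -` E) \<partial>lborel)"
  proof (rule nn_integral_cong)
    fix y :: 'a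
    have "(\<integral>\<^sup>+x. indicator E (y - x) * indicator A y \<partial>M)
        = indicator A y * (\<integral>\<^sup>+x. indicator ((\<lambda>x. y - x) -` E) x \<partial>M)"
      by (subst nn_integral_cmult[symmetric]) (auto simp: indicator_def um intro!: nn_integral_cong)
    also have "\<dots> = indicator A y * emeasure M ((\<lambda>x. y - x) -` E)" using um by simp
    also have "(\<lambda>x. y - x) -` E = (\<lambda>x. x + (- y)) -` (uminus -` E)" by auto
    also have "emeasure M \<dots> = emeasure M (uminus -` E)"
      by (rule inv) (simp add: vimage_borel)
    finally show "(\<integral>\<^sup>+x. indicator E (y - x) * indicator A y \<partial>M) = indicator A y * emeasure M (uminus -` E)" .
  qed
  also have "\<dots> = emeasure lborel A * emeasure M (uminus -` E)" by (simp add: nn_integral_multc)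
  finally show ?thesis using 1 by simp
qed

text \<open>
  The image of Lebesgue measure under a linear automorphism is again translation invariant, and so a
  multiple of Lebesgue measure. The factor (the inverse of the absolute value of the determinant) is
  left unspecified because centroids are quotients of integrals, from which it cancels.
\<close>

lemma distr_lborel_linear:
  fixes T :: "'a::euclidean_space \<Rightarrow> 'a"
  assumes T: "linear T" "bij T"
  obtains k :: real where "k > 0" "distr lborel borel T = scale_measure (ennreal k) lborel"
proof -
  define M where "M = distr lborel borel T"
  have [measurable]: "T \<in> borel_measurable borel"
    using T by (intro borel_measurable_continuous_onI linear_continuous_on linear_conv_bounded_linear[THEN iffD1])
  define T' where "T' = inv T"
  have T': "linear T'" unfolding T'_def using T by (meson bij_is_inj bij_is_surj inj_linear_imp_inv_linear)
  have TT: "T (T' x) = x" "T' (T x) = x" for x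
    using T(2) unfolding T'_def by (auto simp: bij_is_surj surj_f_inv_f bij_is_inj)
  have bd: "bounded (T -` B)" if "bounded B" for B
  proof -
    have "T -` B = T' ` B" using TT by (auto simp: image_iff) metis
    then show ?thesis using bounded_linear_image[OF that] T' by (simp add: linear_conv_bounded_linear)
  qed
  have M_emeasure: "emeasure M A = emeasure lborel (T -` A)" if "A \<in> sets borel" for A
    unfolding M_def using that by (subst emeasure_distr) auto
  have fin: "emeasure M A < \<infinity>" if "A \<in> sets borel" "bounded A" for A
    using M_emeasure[OF that(1)] emeasure_bounded_finite[OF bd[OF that(2)]] by simp
  have sM[measurable_cong]: "sets M = sets borel" by (simp add: M_def)
  have sf: "sigma_finite_measure M"
  proof
    show "\<exists>A. countable A \<and> A \<subseteq> sets M \<and> \<Union> A = space M \<and> (\<forall>a\<in>A. emeasure M a \<noteq> \<infinity>)"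
    proof (intro exI[of _ "range (\<lambda>n::nat. cball 0 (real n))"] conjI)
      show "\<Union> (range (\<lambda>n::nat. cball 0 (real n))) = space M"
        using real_arch_simple by (auto simp: M_def)
      show "\<forall>a\<in>range (\<lambda>n::nat. cball 0 (real n)). emeasure M a \<noteq> \<infinity>"
        using fin[of "cball 0 _"] by (auto simp: less_top)
    qed (auto simp: M_def)
  qed
  have inv: "emeasure M ((\<lambda>x. x + y) -` A) = emeasure M A" if [measurable]: "A \<in> sets borel" for A y
  proof -
    have "emeasure M ((\<lambda>x. x + y) -` A) = emeasure lborel (T -` ((\<lambda>x. x + y) -` A))"
      by (rule M_emeasure) (simp add: vimage_borel)
    also have "T -` ((\<lambda>x. x + y) -` A) = (+) (T' y) -` (T -` A)"
      using TT linear_add[OF T(1)] by (auto simp: add.commute)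
    also have "emeasure lborel \<dots> = emeasure (distr lborel borel ((+) (T' y))) (T -` A)"
      by (subst emeasure_distr) (auto simp: vimage_borel)
    also have "\<dots> = emeasure M A" by (simp add: lborel_distr_plus M_emeasure)
    finally show ?thesis .
  qed
  define E where "E = (cbox 0 One :: 'a set)"
  have E: "emeasure lborel E = 1" "E \<in> sets borel" by (simp_all add: E_def emeasure_lborel_cbox)
  define K where "K = emeasure M (uminus -` E)"
  have eq: "emeasure M A = K * emeasure lborel A" if "A \<in> sets borel" for A
    using lborel_translation_invariant_unique[OF sM sf inv that E(2)] E(1)
    by (simp add: K_def mult.commute)
  have "bounded (uminus -` E :: 'a set)"
  proof -
    have "uminus -` E = uminus ` E" by (auto simp: image_iff) (metis minus_minus)
    then show ?thesis unfolding E_def by (simp add: bounded_cbox bounded_uminus)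
  qed
  moreover have "uminus -` E \<in> sets borel" using E(2) by (simp add: vimage_borel)
  ultimately have Kfin: "K < \<infinity>" unfolding K_def by (rule fin[rotated])
  have "K \<noteq> 0"
  proof
    assume "K = 0"
    then have "emeasure M UNIV = 0" using eq[of UNIV] by simp
    then show False using M_emeasure[of UNIV] by simp
  qed
  then obtain k where k: "k > 0" "K = ennreal k"
    using Kfin by (metis ennreal_enn2real enn2real_positive_iff infinity_ennreal_def zero_less_iff_neq_zero)
  have "distr lborel borel T = scale_measure (ennreal k) lborel"
  proof (rule measure_eqI)
    fix A assume "A \<in> sets (distr lborel borel T)"
    then show "emeasure (distr lborel borel T) A = emeasure (scale_measure (ennreal k) lborel) A"
      using eq[of A] k by (simp add: M_def)
  qed simp
  then show thesis using that k by blast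
qed

lemma nn_integral_cone:
  fixes \<Phi> :: "'a::euclidean_space \<Rightarrow> ennreal"
  assumes [measurable]: "\<Phi> \<in> borel_measurable borel" and a: "a > 0"
  shows "(\<integral>\<^sup>+z. \<Phi> z \<partial>lborel) = ennreal (a ^ DIM('a)) * (\<integral>\<^sup>+x. \<Phi> (a *\<^sub>R x) \<partial>lborel)"
  by (subst lborel_affine[of a 0])
    (use a in \<open>simp_all add: nn_integral_density nn_integral_distr nn_integral_cmult ennreal_power\<close>)

text \<open>
  The change of variables formula for a projective map \<open>P\<close>, without computing a Jacobian matrix. The
  function \<open>F\<close> is extended to \<open>\<Phi>\<close> on the slab \<open>1 \<le> a \<le> 2\<close> of the homogeneous coordinates \<open>(a, z)\<close>,
  by making it constant on rays up to the factor \<open>a ^ - d\<close>. The integral of \<open>\<Phi>\<close> is that of \<open>F\<close>. The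
  linear map \<open>T\<close> preserves rays and multiplies Lebesgue measure by a constant, and computing the
  integral of \<open>\<Phi> \<circ> T\<close> ray by ray gives the weight \<open>f x ^ - (d + 1)\<close>: the power \<open>d\<close> comes from the
  factor in \<open>\<Phi>\<close>, one more from the length of the interval of the \<open>a\<close> with \<open>1 \<le> a * f x \<le> 2\<close>.
\<close>

lemma nn_integral_projective:
  fixes T :: "real \<times> (real^'n::finite) \<Rightarrow> real \<times> (real^'n)"
    and K :: "(real^'n) set"
  assumes T: "linear T" "bij T" and K: "K \<in> sets borel"
    and pos: "\<And>x. x \<in> K \<Longrightarrow> 0 < fst (T (1, x))"
  defines "f \<equiv> \<lambda>x. fst (T (1, x))" and "P \<equiv> \<lambda>x. inverse (fst (T (1, x))) *\<^sub>R snd (T (1, x))"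
  assumes PK: "P ` K \<in> sets borel"
  obtains k :: real where "k > 0"
    "\<And>F. F \<in> borel_measurable borel \<Longrightarrow>
      (\<integral>\<^sup>+y. F y * indicator (P ` K) y \<partial>lborel) =
      ennreal k * (\<integral>\<^sup>+x. F (P x) * ennreal (inverse (f x ^ Suc CARD('n))) * indicator K x \<partial>lborel)"
proof -
  obtain k0 where k0: "k0 > 0" "distr lborel borel T = scale_measure (ennreal k0) lborel"
    using distr_lborel_linear[OF T] .
  have Tm[measurable]: "T \<in> borel_measurable borel"
    using T by (intro borel_measurable_continuous_onI linear_continuous_on linear_conv_bounded_linear[THEN iffD1])
  note [measurable] = K
  have Tc: "continuous_on UNIV (\<lambda>x. T (1, x))"
    by (intro continuous_on_compose2[OF linear_continuous_on[of T UNIV]] continuous_intros)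
      (use T in \<open>auto simp: linear_conv_bounded_linear\<close>)
  have fm[measurable]: "f \<in> borel_measurable borel"
    unfolding f_def by (intro borel_measurable_continuous_onI continuous_intros Tc)
  have Pm[measurable]: "P \<in> borel_measurable borel"
    unfolding P_def
    by (intro borel_measurable_scaleR borel_measurable_inverse borel_measurable_continuous_onI continuous_intros Tc)
  have Thom: "T (a, a *\<^sub>R x) = a *\<^sub>R T (1, x)" for a x
    using linear_scale[OF T(1), of a "(1, x)"] by simp
  let ?C = "\<integral>\<^sup>+a. indicator {1..2::real} a \<partial>lborel"
  have C: "?C = 1" by simp
  have main: "(\<integral>\<^sup>+y. F y * indicator (P ` K) y \<partial>lborel) =
      ennreal (1 / k0) * (\<integral>\<^sup>+x. F (P x) * ennreal (inverse (f x ^ Suc CARD('n))) * indicator K x \<partial>lborel)"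
    if Fm[measurable]: "F \<in> borel_measurable borel" for F
  proof -
    define G where "G = (\<lambda>y. F y * indicator (P ` K) y)"
    have Gm[measurable]: "G \<in> borel_measurable borel" unfolding G_def using PK by measurable
    \<comment> \<open>The interval of \<open>a\<close> has length \<open>1\<close>, so \<open>\<Phi>\<close> has the same integral as \<open>G\<close>.\<close>
    define \<Phi> where "\<Phi> = (\<lambda>(a::real, z::real^'n). indicator {1..2::real} a *
       ennreal (inverse (a ^ CARD('n))) * G (inverse a *\<^sub>R z))"
    have \<Phi>m'[measurable]: "\<Phi> \<in> borel_measurable (borel \<Otimes>\<^sub>M borel)" unfolding \<Phi>_def by measurable
    then have \<Phi>m: "\<Phi> \<in> borel_measurable borel" by (simp add: borel_prod)
    note [measurable] = \<Phi>m
    have split: "(\<integral>\<^sup>+z. \<Psi> z \<partial>lborel) = (\<integral>\<^sup>+a. (\<integral>\<^sup>+z. \<Psi> (a, z) \<partial>lborel) \<partial>lborel)"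
      if "\<Psi> \<in> borel_measurable borel" for \<Psi> :: "real \<times> (real^'n) \<Rightarrow> ennreal"
      using that unfolding lborel_prod[symmetric]
      by (subst lborel.nn_integral_fst[symmetric]) (auto simp: borel_prod measurable_lborel2 lborel_prod)
    have one: "(\<integral>\<^sup>+z. \<Phi> z \<partial>lborel) = (\<integral>\<^sup>+y. G y \<partial>lborel)"
    proof -
      have "(\<integral>\<^sup>+z. \<Phi> z \<partial>lborel) = (\<integral>\<^sup>+a. (\<integral>\<^sup>+z. \<Phi> (a, z) \<partial>lborel) \<partial>lborel)"
        by (rule split) simp
      also have "\<dots> = (\<integral>\<^sup>+a. indicator {1..2::real} a * (\<integral>\<^sup>+y. G y \<partial>lborel) \<partial>lborel)"
      proof (rule nn_integral_cong)
        fix a :: real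
        show "(\<integral>\<^sup>+z. \<Phi> (a, z) \<partial>lborel) = indicator {1..2::real} a * (\<integral>\<^sup>+y. G y \<partial>lborel)"
        proof (cases "a \<in> {1..2}")
          case True
          then have a: "a > 0" by simp
          have "(\<integral>\<^sup>+z. \<Phi> (a, z) \<partial>lborel) = ennreal (inverse (a ^ CARD('n))) * (\<integral>\<^sup>+z. G (inverse a *\<^sub>R z) \<partial>lborel)"
            using True by (simp add: \<Phi>_def nn_integral_cmult)
          also have "\<dots> = ennreal (inverse (a ^ CARD('n))) * (ennreal (a ^ CARD('n)) * (\<integral>\<^sup>+z. G z \<partial>lborel))"
            using nn_integral_cone[of "\<lambda>z. G (inverse a *\<^sub>R z)" a] a by simp
          also have "\<dots> = (\<integral>\<^sup>+z. G z \<partial>lborel)"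
            using a by (simp add: mult.assoc[symmetric] ennreal_mult[symmetric])
          finally show ?thesis using True by simp
        qed (simp add: \<Phi>_def)
      qed
      also have "\<dots> = (\<integral>\<^sup>+y. G y \<partial>lborel)" by (simp add: nn_integral_multc)
      finally show ?thesis .
    qed
    have two: "(\<integral>\<^sup>+z. \<Phi> (T z) \<partial>lborel) =
       (\<integral>\<^sup>+x. F (P x) * ennreal (inverse (f x ^ Suc CARD('n))) * indicator K x \<partial>lborel)"
    proof -
      have key: "\<Phi> (T (a, a *\<^sub>R x)) =
        indicator K x * (indicator {1..2} (a * f x) * ennreal (inverse ((a * f x) ^ CARD('n))) * F (P x))"
        if a: "a \<noteq> 0" for a x
      proof -
        have P_eq: "inverse (a * f x) *\<^sub>R (a *\<^sub>R snd (T (1, x))) = P x"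
          using a by (simp add: P_def f_def)
        have "P x \<in> P ` K \<longleftrightarrow> x \<in> K" if "f x \<noteq> 0"
        proof
          assume "P x \<in> P ` K"
          then obtain y where y: "y \<in> K" "P x = P y" by auto
          have "f y \<noteq> 0" using pos[OF y(1)] by (simp add: f_def)
          have TP: "T (1, z) = f z *\<^sub>R (1, P z)" if "f z \<noteq> 0" for z
            using that unfolding f_def P_def by (simp add: prod_eq_iff)
          have "T (1, y) = f y *\<^sub>R (1, P y)" using \<open>f y \<noteq> 0\<close> by (rule TP)
          moreover have "T (1, x) = f x *\<^sub>R (1, P x)" using that by (rule TP)
          ultimately have "f y *\<^sub>R T (1, x) = f x *\<^sub>R T (1, y)"
            by (simp only: y(2) scaleR_scaleR mult.commute)
          then have "T (f y *\<^sub>R (1, x)) = T (f x *\<^sub>R (1, y))"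
            unfolding linear_scale[OF T(1)] .
          then have "f y *\<^sub>R (1::real, x) = f x *\<^sub>R (1::real, y)" by (rule injD[OF bij_is_inj[OF T(2)]])
          then have fxy: "f y = f x" and "f y *\<^sub>R x = f x *\<^sub>R y"
            unfolding scaleR_Pair prod.inject real_scaleR_def mult_1_right by blast+
          then have "f y *\<^sub>R x = f y *\<^sub>R y" unfolding fxy by blast
          then have "x = y" using \<open>f y \<noteq> 0\<close> by (simp only: scaleR_cancel_left) simp
          then show "x \<in> K" using y(1) by simp
        qed auto
        then have G: "G (P x) = indicator K x * F (P x)" if "f x \<noteq> 0"
          using that by (auto simp: G_def indicator_def)
        have Tax: "T (a, a *\<^sub>R x) = (a * f x, a *\<^sub>R snd (T (1, x)))"
          unfolding Thom by (simp add: f_def prod_eq_iff)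
        have "\<Phi> (T (a, a *\<^sub>R x)) = indicator {1..2} (a * f x) * ennreal (inverse ((a * f x) ^ CARD('n))) * G (P x)"
          unfolding Tax \<Phi>_def prod.case P_eq ..
        also have "\<dots> = indicator K x * (indicator {1..2} (a * f x) * ennreal (inverse ((a * f x) ^ CARD('n))) * F (P x))"
        proof (cases "f x = 0")
          case False
          show ?thesis unfolding G[OF False] by (simp only: mult.assoc mult.commute mult.left_commute)
        qed simp
        finally show ?thesis .
      qed
      have "(\<integral>\<^sup>+z. \<Phi> (T z) \<partial>lborel) = (\<integral>\<^sup>+a. (\<integral>\<^sup>+z. \<Phi> (T (a, z)) \<partial>lborel) \<partial>lborel)"
        by (rule split[OF measurable_compose[OF Tm \<Phi>m]])
      also have "\<dots> = (\<integral>\<^sup>+a. (\<integral>\<^sup>+x. (indicator {1..2} (a * f x) * ennreal (inverse (f x ^ CARD('n)))) * F (P x)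
                        * indicator K x \<partial>lborel) \<partial>lborel)"
      proof (rule nn_integral_cong_AE, rule AE_mp[OF AE_lborel_singleton[of 0]], rule AE_I2, rule impI)
        fix a :: real assume a: "a \<noteq> 0"
        show "(\<integral>\<^sup>+z. \<Phi> (T (a, z)) \<partial>lborel) = (\<integral>\<^sup>+x. (indicator {1..2} (a * f x) * ennreal (inverse (f x ^ CARD('n)))) * F (P x)
                        * indicator K x \<partial>lborel)"
        proof (cases "a > 0")
          case True
          have "(\<integral>\<^sup>+z. \<Phi> (T (a, z)) \<partial>lborel) = ennreal (a ^ CARD('n)) * (\<integral>\<^sup>+x. \<Phi> (T (a, a *\<^sub>R x)) \<partial>lborel)"
            using nn_integral_cone[of "\<lambda>z. \<Phi> (T (a, z))" a] True by simp
          also have "\<dots> = (\<integral>\<^sup>+x. ennreal (a ^ CARD('n)) * \<Phi> (T (a, a *\<^sub>R x)) \<partial>lborel)"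
            by (rule nn_integral_cmult[symmetric]) simp
          also have "\<dots> = (\<integral>\<^sup>+x. (indicator {1..2} (a * f x) * ennreal (inverse (f x ^ CARD('n)))) * F (P x)
                        * indicator K x \<partial>lborel)"
          proof (rule nn_integral_cong)
            fix x
            have "ennreal (a ^ CARD('n)) * ennreal (inverse ((a * f x) ^ CARD('n))) = ennreal (inverse (f x ^ CARD('n)))"
              if "a * f x \<in> {1..2}"
            proof -
              have "f x > 0" using that True zero_less_mult_pos[of a "f x"] by simp
              then show ?thesis using True by (simp add: ennreal_mult[symmetric] power_mult_distrib)
            qed
            then show "ennreal (a ^ CARD('n)) * \<Phi> (T (a, a *\<^sub>R x)) = (indicator {1..2} (a * f x) * ennreal (inverse (f x ^ CARD('n)))) * F (P x)
                        * indicator K x"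
              unfolding key[OF a] by (cases "a * f x \<in> {1..2}"; cases "x \<in> K") (simp_all only: indicator_simps mult_zero_left mult_zero_right mult_1 mult_1_right mult.assoc[symmetric] simp_thms)
          qed
          finally show ?thesis .
        next
          case False
          then have neg: "a < 0" using a by simp
          have z: "\<Phi> (T (a, z)) = 0" for z
          proof -
            have "\<Phi> (T (a, a *\<^sub>R (inverse a *\<^sub>R z))) = 0"
            proof (cases "inverse a *\<^sub>R z \<in> K")
              case True
              then have "a * f (inverse a *\<^sub>R z) < 0"
                using pos neg by (simp add: f_def mult_neg_pos)
              then show ?thesis unfolding key[OF a] by simp
            next
              case False
              then show ?thesis unfolding key[OF a] by simp
            qed
            then show ?thesis using a by simp
          qed
          have e: "(indicator {1..2} (a * f x) * ennreal (inverse (f x ^ CARD('n)))) * F (P x) * indicator K x = 0" for x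
            using pos[of x] mult_neg_pos[OF neg, of "f x"] by (auto simp: indicator_def f_def)
          show ?thesis unfolding z e by simp
        qed
      qed
      also have "\<dots> = (\<integral>\<^sup>+x. (\<integral>\<^sup>+a. (indicator {1..2} (a * f x) * ennreal (inverse (f x ^ CARD('n)))) * F (P x)
                        * indicator K x \<partial>lborel) \<partial>lborel)"
        by (intro lborel_pair.Fubini') measurable
      also have "\<dots> = (\<integral>\<^sup>+x. F (P x) * ennreal (inverse (f x ^ Suc CARD('n))) * indicator K x \<partial>lborel)"
      proof (rule nn_integral_cong)
        fix x
        show "(\<integral>\<^sup>+a. (indicator {1..2} (a * f x) * ennreal (inverse (f x ^ CARD('n)))) * F (P x)
                        * indicator K x \<partial>lborel) = F (P x) * ennreal (inverse (f x ^ Suc CARD('n))) * indicator K x"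
        proof (cases "x \<in> K")
          case True
          then have fx: "f x > 0" using pos by (simp add: f_def)
          have eq: "indicator {1..2} (a * f x) = (indicator {1 / f x .. 2 / f x} a :: ennreal)" for a
            using fx by (auto simp: indicator_def field_simps)
          have "(\<integral>\<^sup>+a. (indicator {1..2} (a * f x) * ennreal (inverse (f x ^ CARD('n)))) * F (P x) * indicator K x \<partial>lborel)
             = (\<integral>\<^sup>+a. indicator {1 / f x .. 2 / f x} a \<partial>lborel) * (ennreal (inverse (f x ^ CARD('n))) * F (P x))"
            using True unfolding eq by (subst nn_integral_multc[symmetric]) (simp_all add: mult.assoc)
          also have "(\<integral>\<^sup>+a. indicator {1 / f x .. 2 / f x} a \<partial>lborel) = ennreal (inverse (f x))"
            using fx by (simp add: divide_simps)
          also have "ennreal (inverse (f x)) * (ennreal (inverse (f x ^ CARD('n))) * F (P x))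
             = F (P x) * ennreal (inverse (f x ^ Suc CARD('n)))"
          proof -
            have "ennreal (inverse (f x)) * ennreal (inverse (f x ^ CARD('n))) = ennreal (inverse (f x ^ Suc CARD('n)))"
              using fx by (simp add: ennreal_mult[symmetric])
            then show ?thesis by (metis mult.assoc mult.commute)
          qed
          finally show ?thesis using True by simp
        qed simp
      qed
      finally show ?thesis .
    qed
    have "ennreal k0 * (\<integral>\<^sup>+z. \<Phi> z \<partial>lborel) = (\<integral>\<^sup>+z. \<Phi> z \<partial>distr lborel borel T)"
      unfolding k0(2) by (simp add: nn_integral_scale_measure)
    also have "\<dots> = (\<integral>\<^sup>+z. \<Phi> (T z) \<partial>lborel)" by (subst nn_integral_distr) auto
    finally have "ennreal k0 * (\<integral>\<^sup>+y. G y \<partial>lborel) = (\<integral>\<^sup>+z. \<Phi> (T z) \<partial>lborel)" using one by simp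
    then have "ennreal (1 / k0) * (ennreal k0 * (\<integral>\<^sup>+y. G y \<partial>lborel)) = ennreal (1 / k0) * (\<integral>\<^sup>+z. \<Phi> (T z) \<partial>lborel)"
      by simp
    then show ?thesis
      using k0(1) two by (simp add: G_def mult.assoc[symmetric] ennreal_mult[symmetric])
  qed
  show thesis by (rule that[of "1 / k0"]) (use k0 main in auto)
qed

lemma set_integral_eq_nn_integral_compact:
  fixes F :: "'a::euclidean_space \<Rightarrow> real"
  assumes "compact K" "continuous_on K F" "\<And>x. x \<in> K \<Longrightarrow> 0 \<le> F x"
  shows "(LINT x:K|lborel. F x) = enn2real (\<integral>\<^sup>+x. ennreal (indicator K x * F x) \<partial>lborel)"
  unfolding set_lebesgue_integral_def real_scaleR_def
proof (rule integral_eq_nn_integral)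
  show "(\<lambda>x. indicat_real K x * F x) \<in> borel_measurable lborel"
    using borel_measurable_integrable[OF borel_integrable_compact[OF assms(1,2)]] by simp
  show "AE x in lborel. 0 \<le> indicat_real K x * F x"
    using assms(3) by (intro AE_I2) (simp add: indicator_def)
qed

text \<open>
  Real-valued form of the preceding formula. The constant \<open>k\<close> does not depend on \<open>F\<close>, so it cancels
  in a centroid; signed integrands are reduced to their positive and negative parts.
\<close>

lemma set_integral_projective:
  fixes T :: "real \<times> (real^'n::finite) \<Rightarrow> real \<times> (real^'n)"
    and K :: "(real^'n) set"
  assumes T: "linear T" "bij T" and K: "compact K"
    and pos: "\<And>x. x \<in> K \<Longrightarrow> 0 < fst (T (1, x))"
  defines "f \<equiv> \<lambda>x. fst (T (1, x))" and "P \<equiv> \<lambda>x. inverse (fst (T (1, x))) *\<^sub>R snd (T (1, x))"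
  obtains k :: real where "k > 0"
    "\<And>F :: real^'n \<Rightarrow> real. continuous_on (P ` K) F \<Longrightarrow>
      (LINT y:P ` K|lborel. F y) = k * (LINT x:K|lborel. F (P x) / f x ^ Suc CARD('n))"
proof -
  have Tc: "continuous_on K (\<lambda>x. T (1, x))"
    by (intro continuous_on_compose2[OF linear_continuous_on[of T UNIV]] continuous_intros)
      (use T in \<open>auto simp: linear_conv_bounded_linear\<close>)
  have fc: "continuous_on K f" unfolding f_def by (intro continuous_intros Tc)
  have fpos: "f x > 0" if "x \<in> K" for x using pos[OF that] by (simp add: f_def)
  have Pc: "continuous_on K P" unfolding P_def
    by (intro continuous_intros Tc ballI) (metis less_irrefl pos)
  have cdiv: "continuous_on K (\<lambda>x. q x / f x ^ Suc CARD('n))" if "continuous_on K q" for q :: "_ \<Rightarrow> real"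
    by (intro continuous_intros fc that ballI) (metis fpos less_irrefl power_eq_0_iff)
  have cPK: "compact (P ` K)" using Pc K by (rule compact_continuous_image)
  obtain k where k: "k > 0" and eq: "\<And>F. F \<in> borel_measurable borel \<Longrightarrow>
      (\<integral>\<^sup>+y. F y * indicator (P ` K) y \<partial>lborel) =
      ennreal k * (\<integral>\<^sup>+x. F (P x) * ennreal (inverse (f x ^ Suc CARD('n))) * indicator K x \<partial>lborel)"
    unfolding P_def f_def
    by (rule nn_integral_projective[OF T borel_compact[OF K] pos borel_compact[OF cPK[unfolded P_def]]])
      (assumption, rule that[unfolded P_def f_def])
  have nonneg: "(LINT y:P ` K|lborel. F y) = k * (LINT x:K|lborel. F (P x) / f x ^ Suc CARD('n))"
    if F: "continuous_on (P ` K) F" "\<And>y. y \<in> P ` K \<Longrightarrow> 0 \<le> F y" for F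
  proof -
    have c2: "continuous_on K (\<lambda>x. F (P x) / f x ^ Suc CARD('n))"
      by (rule cdiv[OF continuous_on_compose2[OF F(1) Pc]]) auto
    have m: "(\<lambda>y. ennreal (indicator (P ` K) y * F y)) \<in> borel_measurable borel"
      using borel_measurable_integrable[OF borel_integrable_compact[OF cPK F(1)]] by simp
    have "(LINT y:P ` K|lborel. F y) = enn2real (\<integral>\<^sup>+y. ennreal (indicator (P ` K) y * F y) \<partial>lborel)"
      by (rule set_integral_eq_nn_integral_compact[OF cPK F])
    also have "(\<integral>\<^sup>+y. ennreal (indicator (P ` K) y * F y) \<partial>lborel)
      = (\<integral>\<^sup>+y. ennreal (indicator (P ` K) y * F y) * indicator (P ` K) y \<partial>lborel)"
      by (rule nn_integral_cong) (auto simp: indicator_def)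
    also have "\<dots> = ennreal k * (\<integral>\<^sup>+x. ennreal (indicator (P ` K) (P x) * F (P x)) * ennreal (inverse (f x ^ Suc CARD('n))) * indicator K x \<partial>lborel)"
      by (rule eq[OF m])
    also have "(\<integral>\<^sup>+x. ennreal (indicator (P ` K) (P x) * F (P x)) * ennreal (inverse (f x ^ Suc CARD('n))) * indicator K x \<partial>lborel)
      = (\<integral>\<^sup>+x. ennreal (indicator K x * (F (P x) / f x ^ Suc CARD('n))) \<partial>lborel)"
    proof (rule nn_integral_cong)
      fix x
      show "ennreal (indicator (P ` K) (P x) * F (P x)) * ennreal (inverse (f x ^ Suc CARD('n))) * indicator K x
        = ennreal (indicator K x * (F (P x) / f x ^ Suc CARD('n)))"
      proof (cases "x \<in> K")
        case True
        then have "F (P x) \<ge> 0" using F(2) by auto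
        then show ?thesis using True fpos[OF True]
          by (simp add: ennreal_mult[symmetric] divide_inverse)
      qed simp
    qed
    also have "enn2real (ennreal k * (\<integral>\<^sup>+x. ennreal (indicator K x * (F (P x) / f x ^ Suc CARD('n))) \<partial>lborel))
      = k * enn2real (\<integral>\<^sup>+x. ennreal (indicator K x * (F (P x) / f x ^ Suc CARD('n))) \<partial>lborel)"
      using k by (simp add: enn2real_mult)
    also have "enn2real (\<integral>\<^sup>+x. ennreal (indicator K x * (F (P x) / f x ^ Suc CARD('n))) \<partial>lborel)
      = (LINT x:K|lborel. F (P x) / f x ^ Suc CARD('n))"
      by (rule set_integral_eq_nn_integral_compact[symmetric, OF K c2])
        (use F(2) fpos in \<open>auto simp: less_imp_le\<close>)
    finally show ?thesis .
  qed
  have "(LINT y:P ` K|lborel. F y) = k * (LINT x:K|lborel. F (P x) / f x ^ Suc CARD('n))"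
    if F: "continuous_on (P ` K) F" for F
  proof -
    define U V where "U = (\<lambda>y. max (F y) 0)" and "V = (\<lambda>y. max (- F y) 0)"
    have c: "continuous_on (P ` K) U" "continuous_on (P ` K) V"
      unfolding U_def V_def by (intro continuous_intros F)+
    have c2: "continuous_on K (\<lambda>x. U (P x) / f x ^ Suc CARD('n))" "continuous_on K (\<lambda>x. V (P x) / f x ^ Suc CARD('n))"
      by (rule cdiv[OF continuous_on_compose2[OF c(1) Pc]], simp)
        (rule cdiv[OF continuous_on_compose2[OF c(2) Pc]], simp)
    have UV: "F y = U y - V y" for y by (simp add: U_def V_def)
    have "(LINT y:P ` K|lborel. F y) = (LINT y:P ` K|lborel. U y) - (LINT y:P ` K|lborel. V y)"
      unfolding UV by (rule set_integral_diff(2)) (intro set_integrable_compact cPK c)+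
    also have "\<dots> = k * ((LINT x:K|lborel. U (P x) / f x ^ Suc CARD('n)) - (LINT x:K|lborel. V (P x) / f x ^ Suc CARD('n)))"
      using nonneg[OF c(1)] nonneg[OF c(2)] by (simp add: U_def V_def algebra_simps)
    also have "(LINT x:K|lborel. U (P x) / f x ^ Suc CARD('n)) - (LINT x:K|lborel. V (P x) / f x ^ Suc CARD('n))
       = (LINT x:K|lborel. U (P x) / f x ^ Suc CARD('n) - V (P x) / f x ^ Suc CARD('n))"
      by (rule set_integral_diff(2)[symmetric]) (intro set_integrable_compact K c2)+
    finally show ?thesis unfolding UV by (simp add: diff_divide_distrib)
  qed
  with k show thesis by (rule that)
qed

section \<open>The Prekopa-Leindler inequality\<close>

text \<open>
  The one-dimensional Brunn-Minkowski inequality. For points \<open>a\<close> near the top of \<open>A\<close> and \<open>b\<close> near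
  the bottom of \<open>B\<close>, the part of \<open>A + b\<close> up to \<open>a + b\<close> and the part of \<open>a + B\<close> above \<open>a + b\<close> are
  disjoint subsets of \<open>2 C\<close>. Since the supremum and the infimum need not be attained, a loss of \<open>e\<close>
  is allowed for.
\<close>

lemma emeasure_midpoint_real:
  fixes A B C :: "real set"
  assumes [measurable]: "A \<in> sets borel" "B \<in> sets borel" "C \<in> sets borel"
    and ne: "A \<noteq> {}" "B \<noteq> {}" and bdd: "A \<subseteq> {-R..R}" "B \<subseteq> {-R..R}"
    and mid: "\<And>a b. a \<in> A \<Longrightarrow> b \<in> B \<Longrightarrow> (a + b) / 2 \<in> C"
  shows "emeasure lborel A + emeasure lborel B \<le> 2 * emeasure lborel C"
proof (rule ennreal_le_epsilon)
  fix e :: real assume e: "e > 0"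
  define D where "D = {y :: real. y / 2 \<in> C}"
  have D[measurable]: "D \<in> sets borel" unfolding D_def by measurable
  have D2: "emeasure lborel D = 2 * emeasure lborel C"
  proof -
    have "emeasure lborel D = (\<integral>\<^sup>+y. indicator D y \<partial>lborel)" by simp
    also have "\<dots> = 2 * (\<integral>\<^sup>+x. indicator D (0 + 2 * x) \<partial>lborel)"
      by (subst nn_integral_real_affine[of _ 2 0]) auto
    also have "(\<integral>\<^sup>+x. indicator D (0 + 2 * x) \<partial>lborel) = (\<integral>\<^sup>+x. indicator C x \<partial>lborel)"
      by (rule nn_integral_cong) (auto simp: D_def indicator_def)
    finally show ?thesis by simp
  qed
  have bA: "bdd_above A" "bdd_below B" using bdd by (meson bdd_above_Icc bdd_above_mono bdd_below_Icc bdd_below_mono)+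
  obtain a where a: "a \<in> A" "Sup A - e/2 < a"
    using less_cSup_iff[OF ne(1) bA(1), of "Sup A - e/2"] e by auto
  obtain b where b: "b \<in> B" "b < Inf B + e/2"
    using cInf_less_iff[OF ne(2) bA(2), of "Inf B + e/2"] e by auto
  define A1 where "A1 = A \<inter> {..a}"
  define B1 where "B1 = B \<inter> {b<..}"
  have [measurable]: "A1 \<in> sets borel" "B1 \<in> sets borel" by (auto simp: A1_def B1_def)
  have tr: "emeasure lborel {y. y - c \<in> S} = emeasure lborel S" if [measurable]: "S \<in> sets borel" for S and c :: real
  proof -
    have "emeasure lborel S = emeasure (distr lborel borel ((+) (-c))) S" by (simp add: lborel_distr_plus)
    also have "\<dots> = emeasure lborel ((+) (-c) -` S)" by (subst emeasure_distr) auto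
    also have "(+) (-c) -` S = {y. y - c \<in> S}" by auto
    finally show ?thesis by simp
  qed
  have "emeasure lborel A1 + emeasure lborel B1 = emeasure lborel {y. y - b \<in> A1} + emeasure lborel {y. y - a \<in> B1}"
    by (simp add: tr)
  also have "\<dots> = emeasure lborel ({y. y - b \<in> A1} \<union> {y. y - a \<in> B1})"
    by (rule plus_emeasure) (auto simp: A1_def B1_def)
  also have "\<dots> \<le> emeasure lborel D"
  proof (rule emeasure_mono)
    have "y / 2 \<in> C" if "y - b \<in> A" for y using mid[OF that b(1)] by simp
    moreover have "y / 2 \<in> C" if "y - a \<in> B" for y using mid[OF a(1) that] by simp
    ultimately show "{y. y - b \<in> A1} \<union> {y. y - a \<in> B1} \<subseteq> D"
      by (auto simp: D_def A1_def B1_def)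
  qed simp
  finally have main: "emeasure lborel A1 + emeasure lborel B1 \<le> 2 * emeasure lborel C" by (simp add: D2)
  have small: "emeasure lborel A \<le> emeasure lborel A1 + ennreal (e/2)"
  proof -
    have "emeasure lborel A \<le> emeasure lborel (A1 \<union> {Sup A - e/2..Sup A})"
      by (rule emeasure_mono) (use a cSup_upper[OF _ bA(1)] in \<open>force simp: A1_def\<close>)+
    also have "\<dots> \<le> emeasure lborel A1 + emeasure lborel {Sup A - e/2..Sup A}"
      by (rule emeasure_subadditive) auto
    finally show ?thesis using e by simp
  qed
  have small': "emeasure lborel B \<le> emeasure lborel B1 + ennreal (e/2)"
  proof -
    have "emeasure lborel B \<le> emeasure lborel (B1 \<union> {Inf B..Inf B + e/2})"
      by (rule emeasure_mono) (use b cInf_lower[OF _ bA(2)] in \<open>force simp: B1_def\<close>)+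
    also have "\<dots> \<le> emeasure lborel B1 + emeasure lborel {Inf B..Inf B + e/2}"
      by (rule emeasure_subadditive) auto
    finally show ?thesis using e by simp
  qed
  have "emeasure lborel A + emeasure lborel B \<le> (emeasure lborel A1 + ennreal (e/2)) + (emeasure lborel B1 + ennreal (e/2))"
    by (intro add_mono small small')
  also have "\<dots> = (emeasure lborel A1 + emeasure lborel B1) + (ennreal (e/2) + ennreal (e/2))" by (simp only: ac_simps)
  also have "ennreal (e/2) + ennreal (e/2) = ennreal e" using e by (simp flip: ennreal_plus)
  also have "(emeasure lborel A1 + emeasure lborel B1) + ennreal e \<le> 2 * emeasure lborel C + ennreal e"
    by (intro add_right_mono main)
  finally show "emeasure lborel A + emeasure lborel B \<le> 2 * emeasure lborel C + ennreal e" .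
qed

text \<open>
  The levels are parametrised by \<open>\<alpha> * l\<close> with \<open>l \<in> {0<..1}\<close>, so that functions with different
  suprema can be compared at the same \<open>l\<close>. Truncation at \<open>\<alpha>\<close> below the supremum keeps all the level
  sets that occur non-empty.
\<close>

lemma nn_integral_layer_cake:
  fixes U :: "real \<Rightarrow> ennreal"
  assumes [measurable]: "U \<in> borel_measurable borel" and \<alpha>: "\<alpha> > 0"
  shows "(\<integral>\<^sup>+x. min (U x) (ennreal \<alpha>) \<partial>lborel)
       = ennreal \<alpha> * (\<integral>\<^sup>+l. indicator {0<..1} l * emeasure lborel {x. ennreal (\<alpha> * l) \<le> U x} \<partial>lborel)"
proof -
  have pt: "min (U x) (ennreal \<alpha>) = ennreal \<alpha> * (\<integral>\<^sup>+l. indicator {0<..1} l * indicator {x. ennreal (\<alpha> * l) \<le> U x} x \<partial>lborel)" for x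
  proof (cases "U x \<ge> ennreal \<alpha>")
    case True
    have "indicator {0<..1} l * indicator {x. ennreal (\<alpha> * l) \<le> U x} x = (indicator {0<..1} l :: ennreal)" for l :: real
    proof (cases "l \<in> {0<..1}")
      case in01: True
      have "ennreal (\<alpha> * l) \<le> ennreal \<alpha>" using in01 \<alpha> by (intro ennreal_leI) (simp add: mult_left_le)
      from order_trans[OF this True] show ?thesis using in01 by (simp add: indicator_def)
    qed simp
    then show ?thesis using True by (simp add: min_def)
  next
    case False
    then obtain r where r: "U x = ennreal r" "0 \<le> r" "r < \<alpha>"
      by (cases "U x") (auto simp: not_le ennreal_less_iff)
    have "indicator {0<..1} l * indicator {x. ennreal (\<alpha> * l) \<le> U x} x = (indicator {0<..r / \<alpha>} l :: ennreal)" for l :: real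
    proof (cases "l > 0")
      case True
      then have "ennreal (\<alpha> * l) \<le> U x \<longleftrightarrow> l \<le> r / \<alpha>"
        using r \<alpha> by (simp add: field_simps)
      moreover have "r / \<alpha> \<le> 1" using r \<alpha> by simp
      ultimately show ?thesis using True by (auto simp: indicator_def)
    qed simp
    then show ?thesis using r \<alpha> False by (simp add: min_def ennreal_mult[symmetric])
  qed
  have [measurable]: "(\<lambda>(x::real, l::real). indicator {0<..1} l * indicator {x. ennreal (\<alpha> * l) \<le> U x} x :: ennreal)
      \<in> borel_measurable (borel \<Otimes>\<^sub>M borel)"
    by measurable
  have "(\<integral>\<^sup>+x. min (U x) (ennreal \<alpha>) \<partial>lborel)
     = ennreal \<alpha> * (\<integral>\<^sup>+x. (\<integral>\<^sup>+l. indicator {0<..1} l * indicator {x. ennreal (\<alpha> * l) \<le> U x} x \<partial>lborel) \<partial>lborel)"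
    unfolding pt by (subst nn_integral_cmult) (auto intro!: lborel.borel_measurable_nn_integral)
  also have "(\<integral>\<^sup>+x. (\<integral>\<^sup>+l. indicator {0<..1} l * indicator {x. ennreal (\<alpha> * l) \<le> U x} x \<partial>lborel) \<partial>lborel)
     = (\<integral>\<^sup>+l. (\<integral>\<^sup>+x. indicator {0<..1} l * indicator {x. ennreal (\<alpha> * l) \<le> U x} x \<partial>lborel) \<partial>lborel)"
    by (rule lborel_pair.Fubini') simp
  also have "\<dots> = (\<integral>\<^sup>+l. indicator {0<..1} l * emeasure lborel {x. ennreal (\<alpha> * l) \<le> U x} \<partial>lborel)"
    by (rule nn_integral_cong) (simp add: nn_integral_cmult)
  finally show ?thesis .
qed

text \<open>
  Scale \<open>U\<close> and \<open>V\<close> to have the same supremum. The level sets of \<open>U\<close> and \<open>V\<close> at heights \<open>\<alpha> * l\<close> and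
  \<open>\<beta> * l\<close> then average into that of \<open>W\<close> at height \<open>sqrt (\<alpha> * \<beta>) * l\<close>, so Brunn-Minkowski for level
  sets, integrated over \<open>l\<close>, bounds the integral of \<open>W\<close> below by an arithmetic mean; the
  arithmetic-geometric mean inequality turns this into the product form. The suprema need not be
  attained, so heights \<open>\<theta> * a\<close>, \<open>\<theta> * b\<close> are used and \<open>\<theta>\<close> tends to \<open>1\<close>.
\<close>

lemma prekopa_leindler_real:
  fixes U V W :: "real \<Rightarrow> ennreal" and M R :: real
  assumes [measurable]: "U \<in> borel_measurable borel" "V \<in> borel_measurable borel" "W \<in> borel_measurable borel"
    and mid: "\<And>s t. U s * V t \<le> (W ((s + t) / 2))\<^sup>2"
    and supp: "\<And>s. s \<notin> {-R..R} \<Longrightarrow> U s = 0" "\<And>s. s \<notin> {-R..R} \<Longrightarrow> V s = 0"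
    and bd: "\<And>s. U s \<le> ennreal M" "\<And>s. V s \<le> ennreal M"
  shows "(\<integral>\<^sup>+s. U s \<partial>lborel) * (\<integral>\<^sup>+s. V s \<partial>lborel) \<le> (\<integral>\<^sup>+s. W s \<partial>lborel)\<^sup>2"
proof -
  have finite: "(\<integral>\<^sup>+s. X s \<partial>lborel) < \<infinity>"
    if "\<And>s. s \<notin> {-R..R} \<Longrightarrow> X s = 0" "\<And>s. X s \<le> ennreal M" for X :: "real \<Rightarrow> ennreal"
  proof -
    have "(\<integral>\<^sup>+s. X s \<partial>lborel) \<le> (\<integral>\<^sup>+s. ennreal M * indicator {-R..R} s \<partial>lborel)"
      by (rule nn_integral_mono) (metis that indicator_simps mult.right_neutral mult_zero_right order_refl)
    also have "\<dots> < \<infinity>" by (auto simp: nn_integral_cmult ennreal_mult_less_top emeasure_lborel_Icc_eq)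
    finally show ?thesis .
  qed
  obtain x where x: "(\<integral>\<^sup>+s. U s \<partial>lborel) = ennreal x" "x \<ge> 0"
    using finite[where X=U, OF supp(1) bd(1)] by (cases "\<integral>\<^sup>+s. U s \<partial>lborel") auto
  obtain y where y: "(\<integral>\<^sup>+s. V s \<partial>lborel) = ennreal y" "y \<ge> 0"
    using finite[where X=V, OF supp(2) bd(2)] by (cases "\<integral>\<^sup>+s. V s \<partial>lborel") auto
  show ?thesis
  proof (cases "(\<integral>\<^sup>+s. W s \<partial>lborel) = \<infinity> \<or> x = 0 \<or> y = 0")
    case True then show ?thesis using x y by (auto simp: power2_eq_square)
  next
    case False
    then obtain w where w: "(\<integral>\<^sup>+s. W s \<partial>lborel) = ennreal w" "w \<ge> 0"
      by (cases "\<integral>\<^sup>+s. W s \<partial>lborel") auto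
    have xy: "x > 0" "y > 0" using False x y by auto
    have sup: "\<exists>a>0. (SUP s. X s) = ennreal a"
      if "(\<integral>\<^sup>+s. X s \<partial>lborel) = ennreal z" "z > 0" "\<And>s. X s \<le> ennreal M" for X :: "real \<Rightarrow> ennreal" and z
    proof -
      have "(SUP s. X s) \<le> ennreal M" by (rule SUP_least) (use that in auto)
      then obtain a where a: "(SUP s. X s) = ennreal a" "a \<ge> 0" by (cases "SUP s. X s") (auto simp: top_unique)
      have "a \<noteq> 0"
      proof
        assume "a = 0"
        then have "X s \<le> 0" for s using SUP_upper[of s UNIV X] a by simp
        then show False using that by simp
      qed
      then show ?thesis using a by (intro exI[of _ a]) auto
    qed
    obtain a where a: "a > 0" "(SUP s. U s) = ennreal a" using sup[OF x(1) xy(1) bd(1)] by auto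
    obtain b where b: "b > 0" "(SUP s. V s) = ennreal b" using sup[OF y(1) xy(2) bd(2)] by auto
    have main: "(\<theta> * x) * (\<theta> * y) \<le> w\<^sup>2" if th: "0 < \<theta>" "\<theta> < 1" for \<theta>
    proof -
      \<comment> \<open>Heights below the suprema, in the same proportion, so that both level sets are non-empty.\<close>
      define \<alpha> \<beta> \<kappa> where "\<alpha> = \<theta> * a" and "\<beta> = \<theta> * b" and "\<kappa> = sqrt (\<alpha> * \<beta>)"
      have pos: "\<alpha> > 0" "\<beta> > 0" "\<kappa> > 0" using a b th by (auto simp: \<alpha>_def \<beta>_def \<kappa>_def)
      have \<kappa>2: "\<kappa>\<^sup>2 = \<alpha> * \<beta>" using pos by (simp add: \<kappa>_def)
      have "ennreal \<alpha> < (SUP s. U s)" unfolding a(2) using a th by (simp add: \<alpha>_def ennreal_less_iff)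
      then obtain s0 where s0: "ennreal \<alpha> < U s0" by (auto simp: less_SUP_iff)
      have "ennreal \<beta> < (SUP s. V s)" unfolding b(2) using b th by (simp add: \<beta>_def ennreal_less_iff)
      then obtain t0 where t0: "ennreal \<beta> < V t0" by (auto simp: less_SUP_iff)
      have low: "ennreal (\<theta> * z) \<le> (\<integral>\<^sup>+s. min (X s) (ennreal (\<theta> * c)) \<partial>lborel)"
        if "(SUP s. X s) = ennreal c" "c > 0" "(\<integral>\<^sup>+s. X s \<partial>lborel) = ennreal z" "X \<in> borel_measurable borel" "z > 0" for X z c
      proof -
        have pt: "ennreal \<theta> * X s \<le> min (X s) (ennreal (\<theta> * c))" for s
        proof -
          have "X s \<le> ennreal c" using SUP_upper[of s UNIV X] that by simp
          then have "ennreal \<theta> * X s \<le> ennreal \<theta> * ennreal c" by (rule mult_left_mono) simp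
          moreover have "ennreal \<theta> * X s \<le> 1 * X s" using th by (intro mult_right_mono) auto
          ultimately show ?thesis using th that(2) by (simp add: ennreal_mult)
        qed
        have "ennreal (\<theta> * z) = (\<integral>\<^sup>+s. ennreal \<theta> * X s \<partial>lborel)"
          using th that by (simp add: nn_integral_cmult ennreal_mult)
        also have "\<dots> \<le> (\<integral>\<^sup>+s. min (X s) (ennreal (\<theta> * c)) \<partial>lborel)"
          by (rule nn_integral_mono) (rule pt)
        finally show ?thesis .
      qed
      define gU gV gW where "gU = (\<lambda>l. indicator {0<..1} l * emeasure lborel {x. ennreal (\<alpha> * l) \<le> U x})"
        and "gV = (\<lambda>l. indicator {0<..1} l * emeasure lborel {x. ennreal (\<beta> * l) \<le> V x})"
        and "gW = (\<lambda>l. indicator {0<..1::real} l * emeasure lborel {x. ennreal (\<kappa> * l) \<le> W x})"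
      have gm[measurable]: "gU \<in> borel_measurable borel" "gV \<in> borel_measurable borel"
      proof -
        have "(\<lambda>l. emeasure lborel {x. ennreal (c * l) \<le> X x}) \<in> borel_measurable borel"
          if [measurable]: "X \<in> borel_measurable borel" for X :: "real \<Rightarrow> ennreal" and c
        proof -
          have "(\<lambda>l. \<integral>\<^sup>+x. indicator {x. ennreal (c * l) \<le> X x} x \<partial>lborel) \<in> borel_measurable borel"
            by (rule lborel.borel_measurable_nn_integral) measurable
          then show ?thesis by simp
        qed
        then show "gU \<in> borel_measurable borel" "gV \<in> borel_measurable borel"
          unfolding gU_def gV_def by (intro borel_measurable_times_ennreal; simp)+
      qed
      have pt: "gU l + gV l \<le> 2 * gW l" for l
      proof (cases "l \<in> {0<..1}")
        case True
        have "emeasure lborel {x. ennreal (\<alpha> * l) \<le> U x} + emeasure lborel {x. ennreal (\<beta> * l) \<le> V x}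
           \<le> 2 * emeasure lborel {x. ennreal (\<kappa> * l) \<le> W x}"
        proof (rule emeasure_midpoint_real)
          have "ennreal (\<alpha> * l) \<le> ennreal \<alpha>" using True pos by (intro ennreal_leI) (simp add: mult_left_le)
          then show "{x. ennreal (\<alpha> * l) \<le> U x} \<noteq> {}" using less_imp_le[OF s0] by (blast intro: order_trans)
          have "ennreal (\<beta> * l) \<le> ennreal \<beta>" using True pos by (intro ennreal_leI) (simp add: mult_left_le)
          then show "{x. ennreal (\<beta> * l) \<le> V x} \<noteq> {}" using less_imp_le[OF t0] by (blast intro: order_trans)
          have p: "\<alpha> * l > 0" "\<beta> * l > 0" using pos True by auto
          show "{x. ennreal (\<alpha> * l) \<le> U x} \<subseteq> {-R..R}"
          proof
            fix x assume "x \<in> {x. ennreal (\<alpha> * l) \<le> U x}"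
            then have "U x \<noteq> 0" using p by auto
            then show "x \<in> {-R..R}" using supp(1) by blast
          qed
          show "{x. ennreal (\<beta> * l) \<le> V x} \<subseteq> {-R..R}"
          proof
            fix x assume "x \<in> {x. ennreal (\<beta> * l) \<le> V x}"
            then have "V x \<noteq> 0" using p by auto
            then show "x \<in> {-R..R}" using supp(2) by blast
          qed
          fix s t assume s: "s \<in> {x. ennreal (\<alpha> * l) \<le> U x}" and t: "t \<in> {x. ennreal (\<beta> * l) \<le> V x}"
          have "(\<kappa> * l)\<^sup>2 = (\<alpha> * l) * (\<beta> * l)"
            unfolding power_mult_distrib \<kappa>2 by (simp add: power2_eq_square)
          then have "ennreal ((\<kappa> * l)\<^sup>2) = ennreal (\<alpha> * l) * ennreal (\<beta> * l)"
            using p by (simp add: ennreal_mult)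
          also have "\<dots> \<le> U s * V t" using s t by (intro mult_mono) auto
          also have "\<dots> \<le> (W ((s + t) / 2))\<^sup>2" by (rule mid)
          finally have *: "ennreal ((\<kappa> * l)\<^sup>2) \<le> (W ((s + t) / 2))\<^sup>2" .
          show "(s + t) / 2 \<in> {x. ennreal (\<kappa> * l) \<le> W x}"
          proof (cases "W ((s + t) / 2)")
            case (real r)
            then have "(\<kappa> * l)\<^sup>2 \<le> r\<^sup>2" using * by (simp add: ennreal_power)
            then have "\<kappa> * l \<le> r" using real(1) by (rule power2_le_imp_le)
            then show ?thesis using real by (simp add: ennreal_leI)
          qed simp
        qed measurable
        then show ?thesis using True by (simp add: gU_def gV_def gW_def)
      qed (simp add: gU_def gV_def gW_def)
      have UI: "ennreal (\<theta> * x) \<le> ennreal \<alpha> * (\<integral>\<^sup>+l. gU l \<partial>lborel)"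
        using low[OF a(2,1) x(1) _ xy(1)] nn_integral_layer_cake[of U \<alpha>] pos by (simp add: gU_def \<alpha>_def)
      have VI: "ennreal (\<theta> * y) \<le> ennreal \<beta> * (\<integral>\<^sup>+l. gV l \<partial>lborel)"
        using low[OF b(2,1) y(1) _ xy(2)] nn_integral_layer_cake[of V \<beta>] pos by (simp add: gV_def \<beta>_def)
      have "(\<integral>\<^sup>+s. min (W s) (ennreal \<kappa>) \<partial>lborel) \<le> ennreal w"
        unfolding w(1)[symmetric] by (rule nn_integral_mono) simp
      then have WI: "ennreal \<kappa> * (\<integral>\<^sup>+l. gW l \<partial>lborel) \<le> ennreal w"
        using nn_integral_layer_cake[of W \<kappa>] pos by (simp add: gW_def)
      then have "(\<integral>\<^sup>+l. gW l \<partial>lborel) \<noteq> \<infinity>" using pos by (auto simp: ennreal_mult_top top_unique)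
      then obtain G where G: "(\<integral>\<^sup>+l. gW l \<partial>lborel) = ennreal G" "G \<ge> 0" by (cases "\<integral>\<^sup>+l. gW l \<partial>lborel") auto
      have sum: "(\<integral>\<^sup>+l. gU l \<partial>lborel) + (\<integral>\<^sup>+l. gV l \<partial>lborel) \<le> 2 * ennreal G"
      proof -
        have "(\<integral>\<^sup>+l. gU l \<partial>lborel) + (\<integral>\<^sup>+l. gV l \<partial>lborel) = (\<integral>\<^sup>+l. gU l + gV l \<partial>lborel)"
          by (subst nn_integral_add) auto
        also have "\<dots> \<le> (\<integral>\<^sup>+l. 2 * gW l \<partial>lborel)" by (rule nn_integral_mono) (rule pt)
        also have "\<dots> = 2 * ennreal G"
        proof -
          have "(\<lambda>l. emeasure lborel {x. ennreal (\<kappa> * l) \<le> W x}) \<in> borel_measurable borel"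
          proof -
            have "(\<lambda>l. \<integral>\<^sup>+x. indicator {x. ennreal (\<kappa> * l) \<le> W x} x \<partial>lborel) \<in> borel_measurable borel"
              by (rule lborel.borel_measurable_nn_integral) measurable
            then show ?thesis by simp
          qed
          then have "gW \<in> borel_measurable borel" unfolding gW_def by (intro borel_measurable_times_ennreal; simp)
          then show ?thesis using G by (simp add: nn_integral_cmult)
        qed
        finally show ?thesis .
      qed
      then have "(\<integral>\<^sup>+l. gU l \<partial>lborel) < \<infinity>" "(\<integral>\<^sup>+l. gV l \<partial>lborel) < \<infinity>"
        using order.strict_trans1[OF sum, of top] by (auto simp: ennreal_mult_less_top)
      then obtain p q where pq: "(\<integral>\<^sup>+l. gU l \<partial>lborel) = ennreal p" "(\<integral>\<^sup>+l. gV l \<partial>lborel) = ennreal q" "p \<ge> 0" "q \<ge> 0"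
        by (cases "\<integral>\<^sup>+l. gU l \<partial>lborel"; cases "\<integral>\<^sup>+l. gV l \<partial>lborel") auto
      have "ennreal (\<theta> * x) \<le> ennreal (\<alpha> * p)" "ennreal (\<theta> * y) \<le> ennreal (\<beta> * q)" "ennreal (\<kappa> * G) \<le> ennreal w"
        using UI VI WI pos pq G by (simp_all add: ennreal_mult)
      then have 1: "\<theta> * x \<le> \<alpha> * p" "\<theta> * y \<le> \<beta> * q" "\<kappa> * G \<le> w"
        using pos pq w(2) by (simp_all add: ennreal_le_iff)
      have "ennreal (p + q) \<le> ennreal (2 * G)" using sum pq G by (simp add: ennreal_mult)
      then have 2: "p + q \<le> 2 * G" using G by (simp add: ennreal_le_iff)
      have "(\<theta> * x) * (\<theta> * y) \<le> (\<alpha> * p) * (\<beta> * q)"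
        by (rule mult_mono[OF 1(1,2)]) (use pos pq xy th in auto)
      also have "\<dots> = \<kappa>\<^sup>2 * (p * q)" by (simp add: \<kappa>2)
      also have "\<dots> \<le> \<kappa>\<^sup>2 * G\<^sup>2"
      proof (rule mult_left_mono)
        have "4 * (p * q) \<le> (p + q)\<^sup>2" using zero_le_power2[of "p - q"] by (simp add: power2_eq_square algebra_simps)
        also have "\<dots> \<le> (2 * G)\<^sup>2" using 2 pq by (intro power_mono) auto
        finally show "p * q \<le> G\<^sup>2" by (simp add: power2_eq_square)
      qed simp
      also have "\<dots> = (\<kappa> * G)\<^sup>2" by (simp add: power_mult_distrib)
      also have "\<dots> \<le> w\<^sup>2" using 1 pos G by (intro power_mono) auto
      finally show ?thesis .
    qed
    have "x * y \<le> w\<^sup>2"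
    proof (rule field_le_mult_one_interval)
      fix z :: real assume z: "0 < z" "z < 1"
      have "(sqrt z * x) * (sqrt z * y) \<le> w\<^sup>2" by (rule main) (use z in \<open>auto simp: real_sqrt_lt_1_iff\<close>)
      moreover have "(sqrt z * x) * (sqrt z * y) = (sqrt z * sqrt z) * (x * y)" by (simp only: mult_ac)
      moreover have "sqrt z * sqrt z = z" using z by simp
      ultimately show "z * (x * y) \<le> w\<^sup>2" by simp
    qed
    then show ?thesis using x y w by (simp add: ennreal_power ennreal_mult[symmetric] ennreal_leI)
  qed
qed

text \<open>
  Induction on the number of coordinates: by the induction hypothesis the integrals over the other
  coordinates satisfy the hypothesis of the one-dimensional inequality in the remaining coordinate.
  The common bound and the common bounded support pass to these partial integrals.
\<close>

lemma prekopa_leindler_PiM: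
  fixes I :: "'i set" and R :: real
  assumes "finite I"
    and "u \<in> borel_measurable (PiM I (\<lambda>_. lborel))" "v \<in> borel_measurable (PiM I (\<lambda>_. lborel))"
    and "w \<in> borel_measurable (PiM I (\<lambda>_. lborel))"
    and "\<And>x y. x \<in> extensional I \<Longrightarrow> y \<in> extensional I \<Longrightarrow> u x * v y \<le> (w (\<lambda>i\<in>I. (x i + y i) / 2))\<^sup>2"
    and "\<And>x i. i \<in> I \<Longrightarrow> x i \<notin> {-R..R} \<Longrightarrow> u x = 0" "\<And>x i. i \<in> I \<Longrightarrow> x i \<notin> {-R..R} \<Longrightarrow> v x = 0"
    and "\<And>x. u x \<le> ennreal M" "\<And>x. v x \<le> ennreal M"
  shows "(\<integral>\<^sup>+x. u x \<partial>PiM I (\<lambda>_. lborel)) * (\<integral>\<^sup>+x. v x \<partial>PiM I (\<lambda>_. lborel))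
       \<le> (\<integral>\<^sup>+x. w x \<partial>PiM I (\<lambda>_. lborel))\<^sup>2"
  using assms
proof (induction I arbitrary: u v w rule: finite_induct)
  case empty
  interpret product_sigma_finite "\<lambda>_::'i. lborel :: real measure" by standard
  have "u (\<lambda>_. undefined) * v (\<lambda>_. undefined) \<le> (w (\<lambda>i\<in>{}. ((\<lambda>_. undefined) i + (\<lambda>_. undefined) i) / 2))\<^sup>2"
    by (rule empty(4)) auto
  then show ?case by (simp add: nn_integral_empty restrict_def)
next
  case (insert i I)
  interpret product_sigma_finite "\<lambda>_::'i. lborel :: real measure" by standard
  interpret I: sigma_finite_measure "PiM I (\<lambda>_. lborel :: real measure)"
    by (rule sigma_finite[OF insert(1)])
  note ins = insert.prems
  have upd: "(\<lambda>(t::real, x). x(i := t)) \<in> measurable (lborel \<Otimes>\<^sub>M PiM I (\<lambda>_. lborel)) (PiM (insert i I) (\<lambda>_. lborel))"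
    by measurable
  have meas1: "(\<lambda>x. h (x(i := t))) \<in> borel_measurable (PiM I (\<lambda>_. lborel))"
    if "h \<in> borel_measurable (PiM (insert i I) (\<lambda>_. lborel))" for h :: "('i \<Rightarrow> real) \<Rightarrow> ennreal" and t
    by (rule measurable_compose[OF _ that]) simp
  have meas2: "(\<lambda>t. \<integral>\<^sup>+x. h (x(i := t)) \<partial>PiM I (\<lambda>_. lborel)) \<in> borel_measurable borel"
    if h: "h \<in> borel_measurable (PiM (insert i I) (\<lambda>_. lborel))" for h :: "('i \<Rightarrow> real) \<Rightarrow> ennreal"
  proof -
    have "(\<lambda>(t, x). h (x(i := t))) \<in> borel_measurable (lborel \<Otimes>\<^sub>M PiM I (\<lambda>_. lborel))"
      using measurable_compose[OF upd h] by (simp add: case_prod_beta' comp_def)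
    then have "(\<lambda>t. \<integral>\<^sup>+x. h (x(i := t)) \<partial>PiM I (\<lambda>_. lborel)) \<in> borel_measurable lborel"
      by (rule I.borel_measurable_nn_integral)
    then show ?thesis by simp
  qed
  have ext: "x(i := s) \<in> extensional (insert i I)" if "x \<in> extensional I" for x :: "'i \<Rightarrow> real" and s
    using that by (auto simp: extensional_def)
  have mid: "(\<lambda>j\<in>insert i I. ((x(i := s)) j + (y(i := t)) j) / 2) = (\<lambda>j\<in>I. (x j + y j) / 2)(i := (s + t) / 2)"
    for x y :: "'i \<Rightarrow> real" and s t
    using insert.hyps by (auto simp: fun_eq_iff restrict_def)
  have supp: "h (x(i := s)) = 0"
    if "\<forall>x. \<forall>j\<in>insert i I. x j \<notin> {-R..R} \<longrightarrow> h x = 0" "j \<in> I" "x j \<notin> {-R..R}"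
    for h :: "('i \<Rightarrow> real) \<Rightarrow> ennreal" and x s j
  proof -
    have "(x(i := s)) j \<notin> {-R..R}" using that(2,3) insert.hyps by (cases "j = i") simp_all
    then show ?thesis using that(1,2) by blast
  qed
  have supp': "(\<integral>\<^sup>+x. h (x(i := s)) \<partial>PiM I (\<lambda>_. lborel)) = 0"
    if "\<forall>x. \<forall>j\<in>insert i I. x j \<notin> {-R..R} \<longrightarrow> h x = 0" "s \<notin> {-R..R}"
    for h :: "('i \<Rightarrow> real) \<Rightarrow> ennreal" and s
  proof -
    have "h (x(i := s)) = 0" for x using that(1)[rule_format, of i "x(i := s)"] that(2) by simp
    then show ?thesis by simp
  qed
  define M' where "M' = M * (\<Prod>j\<in>I. if - R \<le> R then 2 * R else 0)"
  have bdd: "(\<integral>\<^sup>+x. h (x(i := s)) \<partial>PiM I (\<lambda>_. lborel)) \<le> ennreal M'"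
    if "\<forall>x. \<forall>j\<in>insert i I. x j \<notin> {-R..R} \<longrightarrow> h x = 0" "\<And>x. h x \<le> ennreal M"
    for h :: "('i \<Rightarrow> real) \<Rightarrow> ennreal" and s
  proof -
    have "(\<integral>\<^sup>+x. h (x(i := s)) \<partial>PiM I (\<lambda>_. lborel))
      \<le> (\<integral>\<^sup>+x. ennreal M * indicator (PiE I (\<lambda>_. {-R..R})) x \<partial>PiM I (\<lambda>_. lborel))"
    proof (rule nn_integral_mono)
      fix x assume x: "x \<in> space (PiM I (\<lambda>_. lborel :: real measure))"
      show "h (x(i := s)) \<le> ennreal M * indicator (PiE I (\<lambda>_. {-R..R})) x"
      proof (cases "x \<in> PiE I (\<lambda>_. {-R..R})")
        case True then show ?thesis using that(2) by simp
      next
        case False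
        then obtain j where "j \<in> I" "x j \<notin> {-R..R}" using x by (auto simp: space_PiM PiE_def Pi_def)
        then show ?thesis using supp[OF that(1)] by simp
      qed
    qed
    also have "\<dots> = ennreal M * emeasure (PiM I (\<lambda>_. lborel)) (PiE I (\<lambda>_. {-R..R}))"
      by (rule nn_integral_cmult_indicator) (use insert.hyps in \<open>auto intro!: sets_PiM_I_finite\<close>)
    also have "\<dots> = ennreal M * (\<Prod>j\<in>I. ennreal (if - R \<le> R then 2 * R else 0))"
      using insert.hyps by (subst emeasure_PiM) (auto simp: emeasure_lborel_Icc_eq)
    also have "\<dots> = ennreal M'"
      unfolding M'_def by (subst prod_ennreal) (auto simp: ennreal_mult'' prod_nonneg)
    finally show ?thesis .
  qed
  have i5: "\<forall>x. \<forall>j\<in>insert i I. x j \<notin> {-R..R} \<longrightarrow> u x = 0" using ins(5) by blast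
  have i6: "\<forall>x. \<forall>j\<in>insert i I. x j \<notin> {-R..R} \<longrightarrow> v x = 0" using ins(6) by blast
  have "(\<integral>\<^sup>+s. (\<integral>\<^sup>+x. u (x(i := s)) \<partial>PiM I (\<lambda>_. lborel)) \<partial>lborel)
      * (\<integral>\<^sup>+s. (\<integral>\<^sup>+x. v (x(i := s)) \<partial>PiM I (\<lambda>_. lborel)) \<partial>lborel)
      \<le> (\<integral>\<^sup>+s. (\<integral>\<^sup>+x. w (x(i := s)) \<partial>PiM I (\<lambda>_. lborel)) \<partial>lborel)\<^sup>2"
  proof (rule prekopa_leindler_real[where M = M' and R = R])
    fix s t :: real
    show "(\<integral>\<^sup>+x. u (x(i := s)) \<partial>PiM I (\<lambda>_. lborel)) * (\<integral>\<^sup>+x. v (x(i := t)) \<partial>PiM I (\<lambda>_. lborel))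
      \<le> (\<integral>\<^sup>+x. w (x(i := (s + t) / 2)) \<partial>PiM I (\<lambda>_. lborel))\<^sup>2"
    proof (rule insert.IH)
      fix x y :: "'i \<Rightarrow> real" assume "x \<in> extensional I" "y \<in> extensional I"
      from ins(4)[OF ext[OF this(1), of s] ext[OF this(2), of t]]
      show "u (x(i := s)) * v (y(i := t)) \<le> (w ((\<lambda>i\<in>I. (x i + y i) / 2)(i := (s + t) / 2)))\<^sup>2"
        by (subst (asm) mid)
    next
      fix x :: "'i \<Rightarrow> real" and j assume "j \<in> I" "x j \<notin> {-R..R}"
      then show "u (x(i := s)) = 0" "v (x(i := t)) = 0"
        using supp[OF i5] supp[OF i6] by blast+
    next
      show "(\<lambda>x. u (x(i := s))) \<in> borel_measurable (PiM I (\<lambda>_. lborel))" by (rule meas1[OF ins(1)])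
      show "(\<lambda>x. v (x(i := t))) \<in> borel_measurable (PiM I (\<lambda>_. lborel))" by (rule meas1[OF ins(2)])
      show "(\<lambda>x. w (x(i := (s + t) / 2))) \<in> borel_measurable (PiM I (\<lambda>_. lborel))" by (rule meas1[OF ins(3)])
    next
      fix x
      show "u (x(i := s)) \<le> ennreal M" by (rule ins(7))
      show "v (x(i := t)) \<le> ennreal M" by (rule ins(8))
    qed
  next
    fix s assume s: "s \<notin> {-R..R}"
    show "(\<integral>\<^sup>+x. u (x(i := s)) \<partial>PiM I (\<lambda>_. lborel)) = 0" by (rule supp'[OF i5 s])
    show "(\<integral>\<^sup>+x. v (x(i := s)) \<partial>PiM I (\<lambda>_. lborel)) = 0" by (rule supp'[OF i6 s])
  next
    fix s
    show "(\<integral>\<^sup>+x. u (x(i := s)) \<partial>PiM I (\<lambda>_. lborel)) \<le> ennreal M'" by (rule bdd[OF i5 ins(7)])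
    show "(\<integral>\<^sup>+x. v (x(i := s)) \<partial>PiM I (\<lambda>_. lborel)) \<le> ennreal M'" by (rule bdd[OF i6 ins(8)])
  next
    show "(\<lambda>s. \<integral>\<^sup>+x. u (x(i := s)) \<partial>PiM I (\<lambda>_. lborel)) \<in> borel_measurable borel" by (rule meas2[OF ins(1)])
    show "(\<lambda>s. \<integral>\<^sup>+x. v (x(i := s)) \<partial>PiM I (\<lambda>_. lborel)) \<in> borel_measurable borel" by (rule meas2[OF ins(2)])
    show "(\<lambda>s. \<integral>\<^sup>+x. w (x(i := s)) \<partial>PiM I (\<lambda>_. lborel)) \<in> borel_measurable borel" by (rule meas2[OF ins(3)])
  qed
  then show ?case
    by (simp add: product_nn_integral_insert_rev[OF insert.hyps(1,2)] ins(1-3))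
qed

text \<open>
  The multiplicative Brunn-Minkowski inequality, obtained by applying Prekopa-Leindler to indicator
  functions.
\<close>

lemma emeasure_midpoint:
  fixes A B C :: "'a::euclidean_space set"
  assumes AB: "A \<in> sets borel" "B \<in> sets borel" "C \<in> sets borel" and bdd: "bounded A" "bounded B"
    and mid: "\<And>a b. a \<in> A \<Longrightarrow> b \<in> B \<Longrightarrow> (1/2) *\<^sub>R (a + b) \<in> C"
  shows "emeasure lborel A * emeasure lborel B \<le> (emeasure lborel C)\<^sup>2"
proof -
  define \<iota> where "\<iota> = (\<lambda>f. \<Sum>b\<in>Basis. f b *\<^sub>R b :: 'a)"
  have \<iota>m: "\<iota> \<in> measurable (PiM Basis (\<lambda>_. lborel :: real measure)) borel"
    unfolding \<iota>_def by measurable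
  have em: "emeasure lborel S = (\<integral>\<^sup>+x. indicator S (\<iota> x) \<partial>PiM Basis (\<lambda>_. lborel))" if "S \<in> sets borel" for S
  proof -
    have "emeasure lborel S = (\<integral>\<^sup>+x. indicator S x \<partial>lborel)" using that by simp
    also have "\<dots> = (\<integral>\<^sup>+x. indicator S x \<partial>distr (PiM Basis (\<lambda>_. lborel)) borel \<iota>)"
      by (rule arg_cong[where f = "\<lambda>M. nn_integral M (indicator S)"]) (simp only: \<iota>_def lborel_eq[symmetric])
    also have "\<dots> = (\<integral>\<^sup>+x. indicator S (\<iota> x) \<partial>PiM Basis (\<lambda>_. lborel))"
      using \<iota>m that by (subst nn_integral_distr) auto
    finally show ?thesis .
  qed
  obtain R where R: "\<And>x. x \<in> A \<union> B \<Longrightarrow> norm x \<le> R"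
    using bdd by (metis bounded_Un bounded_iff)
  have comp: "\<iota> x \<bullet> i = x i" if "i \<in> Basis" for x i
    using that by (simp add: \<iota>_def inner_sum_left inner_Basis if_distrib sum.delta cong: if_cong)
  have supp: "indicator S (\<iota> x) = (0::ennreal)" if "S \<subseteq> A \<union> B" "i \<in> Basis" "x i \<notin> {-R..R}" for S x i
  proof -
    have "\<iota> x \<notin> S"
    proof
      assume "\<iota> x \<in> S"
      then have "norm (\<iota> x) \<le> R" using R that by blast
      then have "\<bar>\<iota> x \<bullet> i\<bar> \<le> R" using Basis_le_norm[OF that(2), of "\<iota> x"] by linarith
      then show False using that comp by auto
    qed
    then show ?thesis by simp
  qed
  have m: "(\<lambda>x. indicator S (\<iota> x) :: ennreal) \<in> borel_measurable (PiM Basis (\<lambda>_. lborel :: real measure))"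
    if "S \<in> sets borel" for S
    by (rule measurable_compose[OF \<iota>m]) (use that in simp)
  show ?thesis unfolding em[OF AB(1)] em[OF AB(2)] em[OF AB(3)]
  proof (rule prekopa_leindler_PiM[where R = R and M = 1])
    fix x y :: "'a \<Rightarrow> real"
    have "\<iota> (\<lambda>i\<in>Basis. (x i + y i) / 2) = (1/2) *\<^sub>R (\<iota> x + \<iota> y)"
      by (simp add: \<iota>_def scaleR_sum_right sum.distrib[symmetric] scaleR_add_left[symmetric] cong: sum.cong)
    then show "indicator A (\<iota> x) * indicator B (\<iota> y) \<le> (indicator C (\<iota> (\<lambda>i\<in>Basis. (x i + y i) / 2)) :: ennreal)\<^sup>2"
      using mid by (auto simp: indicator_def)
    show "indicator A (\<iota> x) \<le> ennreal 1" "indicator B (\<iota> x) \<le> ennreal 1"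
      by (simp_all add: indicator_def)
  next
    fix x :: "'a \<Rightarrow> real" and i :: 'a assume "i \<in> Basis" "x i \<notin> {-R..R}"
    then show "indicator A (\<iota> x) = (0::ennreal)" "indicator B (\<iota> x) = (0::ennreal)"
      using supp[of A i x] supp[of B i x] by blast+
  next
    show "finite (Basis :: 'a set)" by (rule finite_Basis)
    show "(\<lambda>x. indicator A (\<iota> x) :: ennreal) \<in> borel_measurable (PiM Basis (\<lambda>_. lborel))" by (rule m[OF AB(1)])
    show "(\<lambda>x. indicator B (\<iota> x) :: ennreal) \<in> borel_measurable (PiM Basis (\<lambda>_. lborel))" by (rule m[OF AB(2)])
    show "(\<lambda>x. indicator C (\<iota> x) :: ennreal) \<in> borel_measurable (PiM Basis (\<lambda>_. lborel))" by (rule m[OF AB(3)])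
  qed
qed

section \<open>Second moments of log-concave densities\<close>

text \<open>
  The function \<open>(1 - x) * exp x\<close> decreases for \<open>x > 0\<close>, so the claim \<open>p \<le> r\<close> with
  \<open>r = 3 q / (3 + 2 q)\<close> amounts to comparing the values at \<open>p\<close> and at \<open>r\<close>. After taking logarithms
  this is a one-variable inequality with equality at \<open>q = 0\<close>, whose derivative is
  \<open>4 q^4 / ((1 + q) (3 - q) (3 + 2 q)\<^sup>2) \<ge> 0\<close>; the case \<open>q \<ge> 3\<close> is trivial as then \<open>r \<ge> 1\<close>.
\<close>

lemma centred_exponential_endpoints:
  fixes p q :: real
  assumes q: "q > 0" and p: "0 < p" "p < 1" and eq: "(1 - p) * exp p = (1 + q) * exp (- q)"
  shows "2 * p * q \<le> 3 * (q - p)"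
proof (rule ccontr)
  assume "\<not> 2 * p * q \<le> 3 * (q - p)"
  then have gt: "p * (3 + 2 * q) > 3 * q" by (simp add: algebra_simps)
  define r where "r = 3 * q / (3 + 2 * q)"
  have rp: "r < p" using gt q by (simp add: r_def field_simps)
  have r0: "r > 0" using q by (simp add: r_def)
  have "r < 1" using rp p by linarith
  then have q3: "q < 3" using q by (simp add: r_def divide_less_eq)
  define g :: "real \<Rightarrow> real" where "g = (\<lambda>q. ln (1 + q) - q - ln (3 - q) + ln (3 + 2 * q) - 3 * q / (3 + 2 * q))"
  have "g 0 \<le> g q"
  proof (rule DERIV_nonneg_imp_nondecreasing[where f = g])
    show "0 \<le> q" using q by simp
    fix x assume x: "0 \<le> x" "x \<le> q"
    have d: "(g has_real_derivative (1 / (1 + x) - 1 + 1 / (3 - x) + 2 / (3 + 2 * x)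
        - (3 * (3 + 2 * x) - 3 * x * 2) / ((3 + 2 * x) * (3 + 2 * x)))) (at x)"
      unfolding g_def using x q3 by (auto intro!: derivative_eq_intros)
    have "1 / (1 + x) - 1 + 1 / (3 - x) + 2 / (3 + 2 * x)
        - (3 * (3 + 2 * x) - 3 * x * 2) / ((3 + 2 * x) * (3 + 2 * x))
       = 4 * x ^ 4 / ((1 + x) * (3 - x) * (3 + 2 * x)\<^sup>2)"
    proof -
      have "1 + x \<noteq> 0" "3 - x \<noteq> 0" "3 + 2 * x \<noteq> 0" using x q3 by auto
      then show ?thesis by (simp add: divide_simps) algebra
    qed
    also have "\<dots> \<ge> 0" using x q3 by (intro divide_nonneg_nonneg mult_nonneg_nonneg) auto
    finally show "\<exists>y. (g has_real_derivative y) (at x) \<and> 0 \<le> y" using d by blast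
  qed
  then have g: "ln (3 - q) + 3 * q / (3 + 2 * q) \<le> ln (1 + q) - q + ln (3 + 2 * q)"
    by (simp add: g_def)
  have r1: "1 - r = (3 - q) / (3 + 2 * q)" using q by (simp add: r_def field_simps)
  have "(1 - r) * exp r \<le> (1 + q) * exp (- q)"
  proof -
    have "(1 - r) * exp r = exp (ln (3 - q) - ln (3 + 2 * q) + r)"
      unfolding r1 using q q3 by (simp add: exp_add exp_diff)
    also have "\<dots> \<le> exp (ln (1 + q) + - q)" using g by (simp add: r_def)
    also have "\<dots> = (1 + q) * exp (- q)" using q by (simp only: exp_add) simp
    finally show ?thesis .
  qed
  moreover have "(1 - p) * exp p < (1 - r) * exp r"
  proof (rule DERIV_neg_imp_decreasing[where f = "\<lambda>x. (1 - x) * exp x", OF rp])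
    fix x assume "r \<le> x" "x \<le> p"
    then show "\<exists>y. ((\<lambda>x. (1 - x) * exp x) has_real_derivative y) (at x) \<and> y < 0"
      using r0 by (intro exI[of _ "- x * exp x"]) (auto intro!: derivative_eq_intros simp: algebra_simps)
  qed
  ultimately show False using eq by simp
qed

lemma set_integral_Icc_FTC:
  fixes F f :: "real \<Rightarrow> real"
  assumes "a \<le> b" "\<And>x. a \<le> x \<Longrightarrow> x \<le> b \<Longrightarrow> (F has_real_derivative f x) (at x)" "continuous_on {a..b} f"
  shows "(LINT x:{a..b}|lborel. f x) = F b - F a"
  unfolding set_lebesgue_integral_def
  by (rule integral_FTC_atLeastAtMost)
    (use assms in \<open>auto simp: has_real_derivative_iff_has_vector_derivative[symmetric]
      intro: has_field_derivative_at_within\<close>)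

text \<open>
  The extremal density. For \<open>P = Q\<close> it is uniform. Otherwise, by continuity, some \<open>\<mu>\<close> makes the mean
  vanish: for \<open>\<mu> = 0\<close> it is positive since \<open>P < Q\<close>, for \<open>\<mu> = 1 / P\<close> it is negative. For this \<open>\<mu>\<close> the
  moments are explicit, and the bound on the second one reduces to the preceding inequality for
  \<open>p = \<mu> P\<close> and \<open>q = \<mu> Q\<close>.
\<close>

lemma exponential_second_moment:
  fixes P Q :: real
  assumes P: "0 < P" and PQ: "P \<le> Q"
  obtains \<mu> :: real where
    "(LINT s:{-P..Q}|lborel. s * exp (- \<mu> * s)) = 0"
    "(LINT s:{-P..Q}|lborel. s\<^sup>2 * exp (- \<mu> * s)) \<le> P * Q / 3 * (LINT s:{-P..Q}|lborel. exp (- \<mu> * s))"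
proof (cases "P = Q")
  case True
  have 0: "(LINT s:{-P..Q}|lborel. s * exp (- 0 * s)) = 0"
    using P True by (subst set_integral_Icc_FTC[where F = "\<lambda>s. s\<^sup>2 / 2"])
      (auto intro!: derivative_eq_intros continuous_intros)
  have 2: "(LINT s:{-P..Q}|lborel. s\<^sup>2 * exp (- 0 * s)) = 2 * P ^ 3 / 3"
    using P True by (subst set_integral_Icc_FTC[where F = "\<lambda>s. s ^ 3 / 3"])
      (auto intro!: derivative_eq_intros continuous_intros)
  have 1: "(LINT s:{-P..Q}|lborel. exp (- 0 * s)) = 2 * P"
    using P True by (subst set_integral_Icc_FTC[where F = "\<lambda>s. s"])
      (auto intro!: derivative_eq_intros continuous_intros)
  show thesis
    by (rule that[OF 0]) (simp only: 1 2, simp add: True power3_eq_cube)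
next
  case False
  then have PQ: "P < Q" using assms by simp
  define M where "M = (\<lambda>\<mu>. LINT s:{-P..Q}|lborel. s * exp (- \<mu> * s))"
  have M0: "M 0 > 0"
  proof -
    have "M 0 = Q\<^sup>2 / 2 - P\<^sup>2 / 2"
      unfolding M_def using P PQ by (subst set_integral_Icc_FTC[where F = "\<lambda>s. s\<^sup>2 / 2"])
        (auto intro!: derivative_eq_intros continuous_intros)
    then show ?thesis using P PQ power_strict_mono[of P Q 2] by simp
  qed
  have M: "M \<mu> = (exp (\<mu> * P) * (1 - \<mu> * P) - exp (- \<mu> * Q) * (1 + \<mu> * Q)) / \<mu>\<^sup>2" if "\<mu> > 0" for \<mu>
  proof -
    have "M \<mu> = - exp (- \<mu> * Q) * (Q / \<mu> + 1 / \<mu>\<^sup>2) - (- exp (- \<mu> * (- P)) * ((- P) / \<mu> + 1 / \<mu>\<^sup>2))"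
      unfolding M_def
    proof (rule set_integral_Icc_FTC[where F = "\<lambda>s. - exp (- \<mu> * s) * (s / \<mu> + 1 / \<mu>\<^sup>2)"])
      fix x show "((\<lambda>s. - exp (- \<mu> * s) * (s / \<mu> + 1 / \<mu>\<^sup>2)) has_real_derivative x * exp (- \<mu> * x)) (at x)"
        using that by (auto intro!: derivative_eq_intros simp: field_simps power2_eq_square)
    qed (use P PQ in \<open>auto intro!: continuous_intros\<close>)
    also have "\<dots> = (exp (\<mu> * P) * (1 - \<mu> * P) - exp (- \<mu> * Q) * (1 + \<mu> * Q)) / \<mu>\<^sup>2"
      using that by (simp add: field_simps power2_eq_square)
    finally show ?thesis .
  qed
  have "M (1 / P) < 0" using M[of "1 / P"] P PQ
    by (auto intro!: divide_pos_pos mult_pos_pos add_pos_pos)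
  have "continuous_on {0..1/P} M"
    unfolding M_def
  proof (rule continuous_set_integral_sequentially[where B = "Q * exp (Q / P)"])
    show "\<bar>x * exp (- c * x)\<bar> \<le> Q * exp (Q / P)" if c: "c \<in> {0..1/P}" and x: "x \<in> {-P..Q}" for c x
    proof -
      have "\<bar>x\<bar> \<le> Q" using x PQ by auto
      moreover have "- c * x \<le> Q / P"
      proof -
        have "- c * x \<le> c * Q" using c x PQ by (simp add: minus_mult_right[symmetric] del: minus_mult_right) (metis abs_le_D2 \<open>\<bar>x\<bar> \<le> Q\<close> mult_left_mono mult_minus_right)
        also have "c * Q \<le> 1 / P * Q" using c P PQ by (intro mult_right_mono) auto
        finally show ?thesis by simp
      qed
      ultimately show ?thesis unfolding abs_mult using P PQ by (intro mult_mono) auto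
    qed
  qed (auto intro!: continuous_intros)
  then have "\<exists>x\<ge>0. x \<le> 1 / P \<and> M x = 0"
    using IVT2'[of M "1/P" 0 0] M0 \<open>M (1 / P) < 0\<close> P by simp
  then obtain \<mu> where \<mu>: "0 \<le> \<mu>" "\<mu> \<le> 1 / P" "M \<mu> = 0" by blast
  have \<mu>': "0 < \<mu>" "\<mu> < 1 / P" using \<mu> M0 \<open>M (1 / P) < 0\<close> by (auto simp: less_le)
  define A B where "A = exp (\<mu> * P)" and "B = exp (- \<mu> * Q)"
  have eq: "A * (1 - \<mu> * P) = B * (1 + \<mu> * Q)"
    using M[OF \<mu>'(1)] \<mu> \<mu>' by (simp add: A_def B_def)
  have p: "0 < \<mu> * P" "\<mu> * P < 1" "0 < \<mu> * Q" using \<mu>' P PQ by (auto simp: field_simps)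
  have key: "2 * (\<mu> * P) * (\<mu> * Q) \<le> 3 * (\<mu> * Q - \<mu> * P)"
    by (rule centred_exponential_endpoints) (use p eq in \<open>auto simp: A_def B_def mult.commute\<close>)
  have I0: "(LINT s:{-P..Q}|lborel. exp (- \<mu> * s)) = (A - B) / \<mu>"
  proof -
    have "(LINT s:{-P..Q}|lborel. exp (- \<mu> * s)) = - exp (- \<mu> * Q) / \<mu> - (- exp (- \<mu> * (- P)) / \<mu>)"
      by (rule set_integral_Icc_FTC[where F = "\<lambda>s. - exp (- \<mu> * s) / \<mu>"])
        (use P PQ \<mu>' in \<open>auto intro!: derivative_eq_intros continuous_intros\<close>)
    then show ?thesis by (simp add: A_def B_def diff_divide_distrib)
  qed
  have I2: "(LINT s:{-P..Q}|lborel. s\<^sup>2 * exp (- \<mu> * s)) = (A * P\<^sup>2 - B * Q\<^sup>2) / \<mu>"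
  proof -
    define c where "c = 1 / \<mu>"
    have c: "\<mu> * c = 1" using \<mu>' by (simp add: c_def)
    have "(LINT s:{-P..Q}|lborel. s\<^sup>2 * exp (- \<mu> * s)) =
       - exp (- \<mu> * Q) * (Q\<^sup>2 * c + 2 * Q * c\<^sup>2 + 2 * c ^ 3)
       - (- exp (- \<mu> * (- P)) * ((- P)\<^sup>2 * c + 2 * (- P) * c\<^sup>2 + 2 * c ^ 3))"
    proof (rule set_integral_Icc_FTC[where F = "\<lambda>s. - exp (- \<mu> * s) * (s\<^sup>2 * c + 2 * s * c\<^sup>2 + 2 * c ^ 3)"])
      fix x
      define E where "E = exp (- \<mu> * x)"
      have "((\<lambda>s. - exp (- \<mu> * s) * (s\<^sup>2 * c + 2 * s * c\<^sup>2 + 2 * c ^ 3)) has_real_derivative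
         \<mu> * E * (x\<^sup>2 * c + 2 * x * c\<^sup>2 + 2 * c ^ 3) + (2 * x * c + 2 * c\<^sup>2) * (- E)) (at x)"
        unfolding E_def by (auto intro!: derivative_eq_intros)
      also have "\<mu> * E * (x\<^sup>2 * c + 2 * x * c\<^sup>2 + 2 * c ^ 3) + (2 * x * c + 2 * c\<^sup>2) * (- E) = x\<^sup>2 * E"
        using c by algebra
      finally show "((\<lambda>s. - exp (- \<mu> * s) * (s\<^sup>2 * c + 2 * s * c\<^sup>2 + 2 * c ^ 3)) has_real_derivative
         x\<^sup>2 * exp (- \<mu> * x)) (at x)" by (simp add: E_def)
    qed (use P PQ in \<open>auto intro!: continuous_intros\<close>)
    also have "\<dots> = A * (P\<^sup>2 * c + 2 * (- P) * c\<^sup>2 + 2 * c ^ 3) - B * (Q\<^sup>2 * c + 2 * Q * c\<^sup>2 + 2 * c ^ 3)"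
      by (simp add: A_def B_def)
    also have "\<dots> = (A * P\<^sup>2 - B * Q\<^sup>2) * c + 2 * c ^ 3 * (A * (1 - \<mu> * P) - B * (1 + \<mu> * Q))"
      using c by algebra
    also have "\<dots> = (A * P\<^sup>2 - B * Q\<^sup>2) / \<mu>" using eq by (simp add: c_def)
    finally show ?thesis .
  qed
  have "A * (3 * P\<^sup>2 - P * Q) \<le> B * (3 * Q\<^sup>2 - P * Q)"
  proof -
    have B: "B = A * (1 - \<mu> * P) / (1 + \<mu> * Q)" using eq p by (simp add: field_simps)
    have A: "A > 0" by (simp add: A_def)
    have "(3 * P\<^sup>2 - P * Q) * (1 + \<mu> * Q) - (1 - \<mu> * P) * (3 * Q\<^sup>2 - P * Q)
       = (P + Q) * (2 * \<mu> * P * Q - 3 * (Q - P))" by (simp add: algebra_simps power2_eq_square)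
    also have "\<dots> \<le> 0"
    proof -
      have "\<mu> * (2 * \<mu> * P * Q) \<le> \<mu> * (3 * (Q - P))" using key by (simp add: algebra_simps)
      then have "2 * \<mu> * P * Q \<le> 3 * (Q - P)" using \<mu>' by simp
      then show ?thesis using P PQ by (intro mult_nonneg_nonpos) auto
    qed
    finally have "(3 * P\<^sup>2 - P * Q) * (1 + \<mu> * Q) \<le> (1 - \<mu> * P) * (3 * Q\<^sup>2 - P * Q)" by simp
    then have "A * ((3 * P\<^sup>2 - P * Q) * (1 + \<mu> * Q)) \<le> A * ((1 - \<mu> * P) * (3 * Q\<^sup>2 - P * Q))" using A by simp
    then show ?thesis unfolding B using p by (simp add: pos_le_divide_eq mult.assoc)
  qed
  then have "3 * (A * P\<^sup>2 - B * Q\<^sup>2) \<le> P * Q * (A - B)" by (simp add: algebra_simps)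
  then have "A * P\<^sup>2 - B * Q\<^sup>2 \<le> P * Q / 3 * (A - B)" by simp
  then have "(A * P\<^sup>2 - B * Q\<^sup>2) / \<mu> \<le> P * Q / 3 * (A - B) / \<mu>"
    using \<mu>' by (intro divide_right_mono) auto
  then show thesis by (intro that[of \<mu>]) (use \<mu>(3) I0 I2 in \<open>simp_all add: M_def\<close>)
qed

lemma midpoint_convex_closed_real:
  fixes D :: "real set"
  assumes D: "closed D" and mid: "\<And>s t. s \<in> D \<Longrightarrow> t \<in> D \<Longrightarrow> (s + t) / 2 \<in> D"
    and s: "a \<in> D" "b \<in> D" "a \<le> s" "s \<le> b"
  shows "s \<in> D"
proof (rule ccontr)
  assume n: "s \<notin> D"
  define u where "u = Sup (D \<inter> {a..s})"
  define v where "v = Inf (D \<inter> {s..b})"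
  have "u \<in> D \<inter> {a..s}" unfolding u_def
    by (rule closed_contains_Sup) (use D s in \<open>auto intro!: bdd_above_Int2\<close>)
  moreover have "v \<in> D \<inter> {s..b}" unfolding v_def
    by (rule closed_contains_Inf) (use D s in \<open>auto intro!: bdd_below_Int2\<close>)
  ultimately have uv: "u \<in> D" "v \<in> D" "u \<le> s" "s \<le> v" "a \<le> u" "v \<le> b" by auto
  have m: "(u + v) / 2 \<in> D" using mid uv by blast
  have "u < s" "s < v" using uv n by (metis less_le)+
  show False
  proof (cases "(u + v) / 2 \<le> s")
    case True
    then have "(u + v) / 2 \<le> u" unfolding u_def
      using m uv by (intro cSup_upper) (auto simp: u_def[symmetric] intro!: bdd_above_Int2)
    then show False using \<open>u < s\<close> \<open>s < v\<close> by (simp add: field_simps)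
  next
    case False
    then have "v \<le> (u + v) / 2" unfolding v_def
      using m uv by (intro cInf_lower) (auto simp: v_def[symmetric] intro!: bdd_below_Int2)
    then show False using \<open>u < s\<close> \<open>s < v\<close> by (simp add: field_simps)
  qed
qed

text \<open>
  Compare \<open>N\<close> with the exponential density \<open>e\<close> that has the same total mass and mean \<open>0\<close>. Since
  \<open>ln N - ln e\<close> is concave, \<open>{e \<le> N}\<close> is an interval, with ends \<open>a\<close> and \<open>b\<close>, and
  \<open>(N - e) (s - a) (s - b) \<le> 0\<close> everywhere. Integrating, the terms of degree \<open>0\<close> and \<open>1\<close> cancel and
  only the inequality between the second moments remains. Concavity at midpoints suffices because
  \<open>{e \<le> N}\<close> is closed.
\<close>

lemma log_concave_second_moment:
  fixes N :: "real \<Rightarrow> real"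
  assumes P: "0 < P" and PQ: "P \<le> Q"
    and N: "continuous_on {-P..Q} N" "\<And>s. 0 \<le> N s"
    and mid: "\<And>s t. s \<in> {-P..Q} \<Longrightarrow> t \<in> {-P..Q} \<Longrightarrow> N s * N t \<le> (N ((s + t) / 2))\<^sup>2"
    and mean: "(LINT s:{-P..Q}|lborel. s * N s) = 0"
  shows "(LINT s:{-P..Q}|lborel. s\<^sup>2 * N s) \<le> P * Q / 3 * (LINT s:{-P..Q}|lborel. N s)"
proof -
  define K where "K = {-P..Q}"
  have K: "compact K" by (simp add: K_def)
  obtain \<mu> where \<mu>: "(LINT s:K|lborel. s * exp (- \<mu> * s)) = 0"
    "(LINT s:K|lborel. s\<^sup>2 * exp (- \<mu> * s)) \<le> P * Q / 3 * (LINT s:K|lborel. exp (- \<mu> * s))"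
    unfolding K_def using exponential_second_moment[OF P PQ] by blast
  define I where "I = (LINT s:K|lborel. N s)"
  define X where "X = (LINT s:K|lborel. exp (- \<mu> * s))"
  have X: "X > 0" unfolding X_def
    by (rule set_integral_pos_compact[OF K]) (use P PQ in \<open>auto simp: K_def intro!: continuous_intros\<close>)
  have cN: "continuous_on K N" using N(1) by (simp add: K_def)
  have I: "I \<ge> 0"
    using set_integral_mono_compact[OF K _ cN, of "\<lambda>_. 0"] N(2) by (simp add: I_def)
  define C where "C = I / X"
  have C: "C \<ge> 0" using I X by (simp add: C_def)
  define e where "e = (\<lambda>s. C * exp (- \<mu> * s))"
  have ce: "continuous_on K e" unfolding e_def by (intro continuous_intros)
  have int: "set_integrable lborel K q" if "continuous_on K q" for q :: "real \<Rightarrow> real"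
    by (rule set_integrable_compact[OF K that])
  have e0: "(LINT s:K|lborel. e s) = I" unfolding e_def using X by (simp add: C_def X_def)
  have e1: "(LINT s:K|lborel. s * e s) = 0"
  proof -
    have "(LINT s:K|lborel. s * e s) = (LINT s:K|lborel. C * (s * exp (- \<mu> * s)))"
      by (simp add: e_def mult_ac)
    then show ?thesis using \<mu>(1) by simp
  qed
  have e2: "(LINT s:K|lborel. s\<^sup>2 * e s) \<le> P * Q / 3 * I"
  proof -
    have "(LINT s:K|lborel. s\<^sup>2 * e s) = (LINT s:K|lborel. C * (s\<^sup>2 * exp (- \<mu> * s)))"
      by (simp add: e_def mult_ac)
    also have "\<dots> = C * (LINT s:K|lborel. s\<^sup>2 * exp (- \<mu> * s))" by simp
    also have "\<dots> \<le> C * (P * Q / 3 * X)" unfolding X_def by (intro mult_left_mono \<mu>(2) C)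
    also have "\<dots> = P * Q / 3 * I" using X by (simp add: C_def)
    finally show ?thesis .
  qed
  define D where "D = {s \<in> K. e s \<le> N s}"
  have cD: "closed D" unfolding D_def
    by (rule continuous_on_closed_Collect_le[OF ce cN compact_imp_closed[OF K]])
  have midD: "(s + t) / 2 \<in> D" if "s \<in> D" "t \<in> D" for s t
  proof -
    have "(e ((s + t) / 2))\<^sup>2 = e s * e t"
      by (simp add: e_def power2_eq_square exp_add[symmetric] mult_ac algebra_simps)
    also have "\<dots> \<le> N s * N t" using that C N(2) by (intro mult_mono) (auto simp: D_def e_def)
    also have "\<dots> \<le> (N ((s + t) / 2))\<^sup>2" using that by (intro mid) (auto simp: D_def K_def)
    finally have "e ((s + t) / 2) \<le> N ((s + t) / 2)" by (rule power2_le_imp_le) (rule N(2))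
    then show ?thesis using that by (auto simp: D_def K_def)
  qed
  \<comment> \<open>The points where \<open>N - e\<close> changes sign; a double point if \<open>N < e\<close> everywhere.\<close>
  obtain a b where ab: "\<And>s. s \<in> K \<Longrightarrow> (N s - e s) * ((s - a) * (s - b)) \<le> 0"
  proof (cases "D = {}")
    case True
    show thesis
    proof (rule that[of 0 0])
      fix s assume "s \<in> K"
      then have "N s \<le> e s" using True by (force simp: D_def)
      then show "(N s - e s) * ((s - 0) * (s - 0)) \<le> 0" by (simp add: mult_nonpos_nonneg)
    qed
  next
    case False
    have bd: "bounded D" using K unfolding D_def by (auto intro: bounded_subset compact_imp_bounded)
    define a b where "a = Inf D" and "b = Sup D"
    have "a \<in> D" unfolding a_def by (rule closed_contains_Inf[OF False _ cD]) (use bd in \<open>auto intro: bounded_imp_bdd_below\<close>)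
    have "b \<in> D" unfolding b_def by (rule closed_contains_Sup[OF False _ cD]) (use bd in \<open>auto intro: bounded_imp_bdd_above\<close>)
    show thesis
    proof (rule that[of a b])
      fix s assume s: "s \<in> K"
      have lo: "s \<in> D \<Longrightarrow> a \<le> s" unfolding a_def by (rule cInf_lower) (use bd in \<open>auto intro: bounded_imp_bdd_below\<close>)
      have hi: "s \<in> D \<Longrightarrow> s \<le> b" unfolding b_def by (rule cSup_upper) (use bd in \<open>auto intro: bounded_imp_bdd_above\<close>)
      have "a \<le> b" unfolding a_def using \<open>b \<in> D\<close> bd by (intro cInf_lower) (auto intro: bounded_imp_bdd_below)
      show "(N s - e s) * ((s - a) * (s - b)) \<le> 0"
      proof (cases "s \<in> D")
        case True
        then show ?thesis using lo hi by (intro mult_nonneg_nonpos mult_nonneg_nonpos) (auto simp: D_def)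
      next
        case False
        then have "s < a \<or> b < s"
          using midpoint_convex_closed_real[OF cD midD \<open>a \<in> D\<close> \<open>b \<in> D\<close>, of s] by fastforce
        then have "(s - a) * (s - b) \<ge> 0" using \<open>a \<le> b\<close>
          by (auto intro: mult_nonpos_nonpos mult_nonneg_nonneg)
        moreover have "N s \<le> e s" using False s by (auto simp: D_def)
        ultimately show ?thesis by (intro mult_nonpos_nonneg) auto
      qed
    qed
  qed
  have "(LINT s:K|lborel. (N s - e s) * ((s - a) * (s - b))) \<le> (LINT s:K|lborel. 0)"
    by (rule set_integral_mono_compact[OF K]) (use ab in \<open>auto intro!: continuous_intros cN ce\<close>)
  then have le: "(LINT s:K|lborel. (N s - e s) * ((s - a) * (s - b))) \<le> 0" by simp
  have expand: "(LINT s:K|lborel. q s * ((s - a) * (s - b)))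
     = (LINT s:K|lborel. s\<^sup>2 * q s) - (a + b) * (LINT s:K|lborel. s * q s) + a * b * (LINT s:K|lborel. q s)"
    if q: "continuous_on K q" for q
  proof -
    have "(LINT s:K|lborel. q s * ((s - a) * (s - b)))
       = (LINT s:K|lborel. (s\<^sup>2 * q s - (a + b) * (s * q s)) + (a * b) * q s)"
      by (simp add: algebra_simps power2_eq_square)
    also have "\<dots> = (LINT s:K|lborel. s\<^sup>2 * q s - (a + b) * (s * q s)) + (LINT s:K|lborel. (a * b) * q s)"
      by (rule set_integral_add(2)) (intro int continuous_intros q)+
    also have "(LINT s:K|lborel. s\<^sup>2 * q s - (a + b) * (s * q s))
       = (LINT s:K|lborel. s\<^sup>2 * q s) - (LINT s:K|lborel. (a + b) * (s * q s))"
      by (rule set_integral_diff(2)) (intro int continuous_intros q)+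
    finally show ?thesis by simp
  qed
  have "(LINT s:K|lborel. (N s - e s) * ((s - a) * (s - b)))
     = (LINT s:K|lborel. N s * ((s - a) * (s - b)) - e s * ((s - a) * (s - b)))"
    by (simp add: left_diff_distrib)
  also have "\<dots> = (LINT s:K|lborel. N s * ((s - a) * (s - b))) - (LINT s:K|lborel. e s * ((s - a) * (s - b)))"
    by (rule set_integral_diff(2)) (intro int continuous_intros cN ce)+
  finally have "(LINT s:K|lborel. s\<^sup>2 * N s) \<le> (LINT s:K|lborel. s\<^sup>2 * e s)"
    using le expand[OF cN] expand[OF ce] mean e0 e1 by (simp add: I_def K_def)
  then show ?thesis using e2 by (simp add: I_def K_def)
qed

section \<open>An upper bound for the variance of a linear function on a convex body\<close>

lemma null_sets_hyperplane:
  fixes w :: "'a::euclidean_space"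
  assumes "w \<noteq> 0"
  shows "{x. w \<bullet> x = c} \<in> null_sets lborel"
proof -
  have "negligible {x. w \<bullet> x = c}" using assms by (intro negligible_hyperplane) auto
  then have "{x. w \<bullet> x = c} \<in> null_sets lebesgue" by (simp add: negligible_iff_null_sets)
  moreover have "{x. w \<bullet> x = c} \<in> sets lborel" by (simp add: closed_hyperplane borel_closed)
  ultimately show ?thesis by (simp add: null_sets_def)
qed

text \<open>
  The marginal of \<open>w\<close> is replaced by the volumes of slabs of thickness \<open>2 * \<delta>\<close>, that is, smoothed
  with a short interval. Such a volume is defined for every \<open>s\<close> and is log-concave by
  Brunn-Minkowski, since the midpoint of points in the slabs at \<open>s\<close> and \<open>t\<close> lies in the slab at
  their midpoint.
\<close>

lemma convex_slab_log_concave: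
  fixes L :: "'a::euclidean_space set" and w :: 'a and m \<delta> :: real
  assumes L: "compact L" "convex L"
  defines "N \<equiv> \<lambda>s. measure lborel {x \<in> L. \<bar>w \<bullet> x - m - s\<bar> \<le> \<delta>}"
  shows "N s * N t \<le> (N ((s + t) / 2))\<^sup>2"
proof -
  define S where "S = (\<lambda>s. {x \<in> L. \<bar>w \<bullet> x - m - s\<bar> \<le> \<delta>})"
  have cS: "compact (S s)" for s
  proof -
    have "S s = L \<inter> {x. \<bar>w \<bullet> x - m - s\<bar> \<le> \<delta>}" by (auto simp: S_def)
    moreover have "closed {x. \<bar>w \<bullet> x - m - s\<bar> \<le> \<delta>}" by (intro closed_Collect_le continuous_intros)
    ultimately show ?thesis using L by (simp add: compact_Int_closed)
  qed
  have fin: "emeasure lborel (S s) = ennreal (N s)" for s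
  proof -
    have "emeasure lborel (S s) = ennreal (measure lborel (S s))"
      by (rule emeasure_eq_ennreal_measure) (use emeasure_compact_finite[OF cS, of s] in auto)
    then show ?thesis by (simp add: N_def S_def)
  qed
  have "emeasure lborel (S s) * emeasure lborel (S t) \<le> (emeasure lborel (S ((s + t) / 2)))\<^sup>2"
  proof (rule emeasure_midpoint)
    fix a b assume a: "a \<in> S s" and b: "b \<in> S t"
    have "(1/2) *\<^sub>R a + (1/2) *\<^sub>R b \<in> L"
      using a b L by (intro convexD) (auto simp: S_def)
    moreover have "\<bar>w \<bullet> ((1/2) *\<^sub>R (a + b)) - m - (s + t) / 2\<bar> \<le> \<delta>"
    proof -
      have eq: "w \<bullet> ((1/2) *\<^sub>R (a + b)) - m - (s + t) / 2 = ((w \<bullet> a - m - s) + (w \<bullet> b - m - t)) / 2"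
        by (simp add: inner_add_right field_simps)
      have "\<bar>w \<bullet> a - m - s\<bar> \<le> \<delta>" "\<bar>w \<bullet> b - m - t\<bar> \<le> \<delta>" using a b by (auto simp: S_def)
      then have "\<bar>(w \<bullet> a - m - s) + (w \<bullet> b - m - t)\<bar> \<le> 2 * \<delta>" by linarith
      then show ?thesis unfolding eq by simp
    qed
    ultimately show "(1/2) *\<^sub>R (a + b) \<in> S ((s + t) / 2)" by (simp add: S_def scaleR_add_right)
  qed (use cS in \<open>auto simp: borel_compact compact_imp_bounded\<close>)
  then have "ennreal (N s * N t) \<le> ennreal ((N ((s + t) / 2))\<^sup>2)"
    by (simp add: fin ennreal_mult ennreal_power N_def)
  then show ?thesis by (simp add: ennreal_le_iff)
qed

text \<open>
  The boundary of a slab consists of two hyperplanes, which have measure zero, so dominated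
  convergence applies.
\<close>

lemma slab_measure_continuous:
  fixes L :: "'a::euclidean_space set" and w :: 'a
  assumes L: "compact L" and w: "w \<noteq> 0" and \<delta>: "\<delta> > 0"
  shows "continuous_on A (\<lambda>s. measure lborel {x \<in> L. \<bar>w \<bullet> x - m - s\<bar> \<le> \<delta>})"
  unfolding continuous_on_sequentially
proof (intro allI ballI impI)
  define S where "S = (\<lambda>s. {x \<in> L. \<bar>w \<bullet> x - m - s\<bar> \<le> \<delta>})"
  have cS: "compact (S s)" for s
  proof -
    have "S s = L \<inter> {x. \<bar>w \<bullet> x - m - s\<bar> \<le> \<delta>}" by (auto simp: S_def)
    moreover have "closed {x. \<bar>w \<bullet> x - m - s\<bar> \<le> \<delta>}" by (intro closed_Collect_le continuous_intros)
    ultimately show ?thesis using L by (simp add: compact_Int_closed)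
  qed
  have mS: "S s \<in> sets lborel" for s using cS by (simp add: borel_compact)
  fix X a assume X: "(\<forall>n. X n \<in> A) \<and> X \<longlonglongrightarrow> a"
  have "(\<lambda>n. LINT x|lborel. indicat_real (S (X n)) x) \<longlonglongrightarrow> (LINT x|lborel. indicat_real (S a) x)"
  proof (rule integral_dominated_convergence[where w = "indicat_real L"])
    show "integrable lborel (indicat_real L)"
      using L emeasure_compact_finite[OF L] by (intro integrable_real_indicator) (auto simp: borel_compact)
    have n1: "{x. w \<bullet> x = m + a + \<delta>} \<in> null_sets lborel" and n2: "{x. w \<bullet> x = m + a - \<delta>} \<in> null_sets lborel"
      using null_sets_hyperplane[OF w] by blast+
    show "AE x in lborel. (\<lambda>n. indicat_real (S (X n)) x) \<longlonglongrightarrow> indicat_real (S a) x"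
      using AE_not_in[OF n1] AE_not_in[OF n2]
    proof eventually_elim
      case (elim x)
      then have ne: "\<bar>w \<bullet> x - m - a\<bar> \<noteq> \<delta>" by auto
      have lim: "(\<lambda>n. \<bar>w \<bullet> x - m - X n\<bar>) \<longlonglongrightarrow> \<bar>w \<bullet> x - m - a\<bar>"
        using X by (intro tendsto_intros) auto
      have "\<forall>\<^sub>F n in sequentially. x \<in> S (X n) \<longleftrightarrow> x \<in> S a"
      proof (cases "\<bar>w \<bullet> x - m - a\<bar> < \<delta>")
        case True
        show ?thesis using order_tendstoD(2)[OF lim True]
          by eventually_elim (use True in \<open>auto simp: S_def\<close>)
      next
        case False
        then have g: "\<bar>w \<bullet> x - m - a\<bar> > \<delta>" using ne by simp
        show ?thesis using order_tendstoD(1)[OF lim g]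
          by eventually_elim (use g in \<open>auto simp: S_def\<close>)
      qed
      then have "\<forall>\<^sub>F n in sequentially. indicat_real (S (X n)) x = indicat_real (S a) x"
        by eventually_elim (simp add: indicator_def)
      then show ?case by (rule tendsto_eventually)
    qed
    show "AE x in lborel. norm (indicat_real (S (X n)) x) \<le> indicat_real L x" for n
      by (rule AE_I2) (auto simp: indicator_def S_def)
  qed (use mS in auto)
  moreover have "{x \<in> L. \<bar>w \<bullet> x - m - s\<bar> \<le> \<delta>} = S s" for s by (simp add: S_def)
  ultimately show "((\<lambda>s. measure lborel {x \<in> L. \<bar>w \<bullet> x - m - s\<bar> \<le> \<delta>}) \<circ> X) \<longlonglongrightarrow> measure lborel {x \<in> L. \<bar>w \<bullet> x - m - a\<bar> \<le> \<delta>}"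
    using mS by (simp add: comp_def)
qed

text \<open>
  Fubini: a point \<open>x\<close> contributes to the slabs at all \<open>s\<close> within \<open>\<delta>\<close> of \<open>w \<bullet> x - m\<close>.
\<close>

lemma slab_measure_moment:
  fixes L :: "'a::euclidean_space set" and w :: 'a
  assumes L: "compact L" and \<delta>: "\<delta> > 0" and K: "\<And>x. x \<in> L \<Longrightarrow> {w \<bullet> x - m - \<delta> .. w \<bullet> x - m + \<delta>} \<subseteq> K"
  shows "(LINT s:K|lborel. s ^ k * measure lborel {x \<in> L. \<bar>w \<bullet> x - m - s\<bar> \<le> \<delta>})
       = (LINT x:L|lborel. (LINT s:{w \<bullet> x - m - \<delta> .. w \<bullet> x - m + \<delta>}|lborel. s ^ k))"
proof -
  define S where "S = (\<lambda>s. {x \<in> L. \<bar>w \<bullet> x - m - s\<bar> \<le> \<delta>})"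
  define Z where "Z = {(s, x). x \<in> S s}"
  have cZ: "compact Z"
  proof -
    have "Z = (UNIV \<times> L) \<inter> {z. \<bar>w \<bullet> snd z - m - fst z\<bar> \<le> \<delta>}" by (auto simp: Z_def S_def)
    moreover have "closed {z::real \<times> 'a. \<bar>w \<bullet> snd z - m - fst z\<bar> \<le> \<delta>}" by (intro closed_Collect_le continuous_intros)
    ultimately have 1: "closed Z" using L by (auto intro!: closed_Int closed_Times simp: compact_imp_closed)
    obtain R where R: "\<And>x. x \<in> L \<Longrightarrow> norm x \<le> R" using L by (metis bounded_iff compact_imp_bounded)
    have "Z \<subseteq> {- (norm w * R + \<bar>m\<bar> + \<delta>) .. norm w * R + \<bar>m\<bar> + \<delta>} \<times> L"
    proof
      fix z assume "z \<in> Z"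
      then obtain s x where z: "z = (s, x)" "x \<in> L" "\<bar>w \<bullet> x - m - s\<bar> \<le> \<delta>" by (auto simp: Z_def S_def)
      have "\<bar>w \<bullet> x\<bar> \<le> norm w * R"
        using Cauchy_Schwarz_ineq2[of w x] R[OF z(2)] by (meson mult_left_mono norm_ge_zero order_trans)
      then show "z \<in> {- (norm w * R + \<bar>m\<bar> + \<delta>) .. norm w * R + \<bar>m\<bar> + \<delta>} \<times> L"
        using z by auto
    qed
    then have "bounded Z" by (rule bounded_subset[rotated]) (use L in \<open>auto intro!: bounded_Times simp: compact_imp_bounded\<close>)
    with 1 show ?thesis by (simp add: compact_eq_bounded_closed)
  qed
  define F where "F = (\<lambda>s x. indicat_real Z (s, x) * s ^ k)"
  have int: "integrable (lborel \<Otimes>\<^sub>M lborel) (case_prod F)"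
  proof -
    have "integrable lborel (\<lambda>z::real \<times> 'a. indicat_real Z z *\<^sub>R (fst z ^ k))"
      by (rule borel_integrable_compact[OF cZ]) (intro continuous_intros)
    then show ?thesis unfolding lborel_prod by (simp add: F_def case_prod_beta')
  qed
  have "(LINT s:K|lborel. s ^ k * measure lborel (S s)) = (LINT s|lborel. (LINT x|lborel. F s x))"
    unfolding set_lebesgue_integral_def
  proof (rule Bochner_Integration.integral_cong)
    fix s :: real
    have "(LINT x|lborel. F s x) = (LINT x|lborel. s ^ k * indicat_real (S s) x)"
      by (rule Bochner_Integration.integral_cong) (auto simp: F_def Z_def indicator_def)
    also have "\<dots> = s ^ k * measure lborel (S s)"
    proof -
      have "S s = L \<inter> {x. \<bar>w \<bullet> x - m - s\<bar> \<le> \<delta>}" by (auto simp: S_def)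
      moreover have "closed {x. \<bar>w \<bullet> x - m - s\<bar> \<le> \<delta>}" by (intro closed_Collect_le continuous_intros)
      ultimately have "compact (S s)" using L by (simp add: compact_Int_closed)
      then show ?thesis by (simp add: borel_compact)
    qed
    finally have *: "(LINT x|lborel. F s x) = s ^ k * measure lborel (S s)" .
    have "S s = {}" if "s \<notin> K"
    proof -
      have "x \<notin> S s" for x
        using that K[of x] by (force simp: S_def abs_le_iff subset_iff)
      then show ?thesis by blast
    qed
    then show "indicat_real K s *\<^sub>R (s ^ k * measure lborel (S s)) = (LINT x|lborel. F s x)"
      unfolding * by (cases "s \<in> K") auto
  qed simp
  also have "\<dots> = (LINT x|lborel. (LINT s|lborel. F s x))"
    by (rule lborel_pair.Fubini_integral[OF int, symmetric])
  also have "\<dots> = (LINT x:L|lborel. (LINT s:{w \<bullet> x - m - \<delta> .. w \<bullet> x - m + \<delta>}|lborel. s ^ k))"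
    unfolding set_lebesgue_integral_def
  proof (rule Bochner_Integration.integral_cong)
    fix x
    have "F s x = indicat_real L x * (indicat_real {w \<bullet> x - m - \<delta> .. w \<bullet> x - m + \<delta>} s *\<^sub>R s ^ k)" for s
      by (auto simp: F_def Z_def S_def indicator_def abs_le_iff)
    then show "(LINT s|lborel. F s x) = indicat_real L x *\<^sub>R (LINT s|lborel. indicat_real {w \<bullet> x - m - \<delta> .. w \<bullet> x - m + \<delta>} s *\<^sub>R s ^ k)"
      by simp
  qed simp
  finally show ?thesis by (simp add: S_def)
qed

text \<open>
  Apply the bound for log-concave densities to the slab volumes, which live on \<open>[-p - \<delta>, q + \<delta>]\<close>,
  have mean zero and whose second moment is not smaller than that of \<open>w\<close>, and let \<open>\<delta>\<close> tend to zero.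
\<close>

lemma convex_second_moment_upper_ordered:
  fixes L :: "'a::euclidean_space set" and w :: 'a
  assumes L: "compact L" "convex L" and w: "w \<noteq> 0" and pq: "0 < p" "p \<le> q"
    and range: "\<And>x. x \<in> L \<Longrightarrow> - p \<le> w \<bullet> x - m" "\<And>x. x \<in> L \<Longrightarrow> w \<bullet> x - m \<le> q"
    and mean: "(LINT x:L|lborel. w \<bullet> x - m) = 0"
  shows "(LINT x:L|lborel. (w \<bullet> x - m)\<^sup>2) \<le> p * q / 3 * measure lborel L"
proof -
  define h where "h = (\<lambda>x. w \<bullet> x - m)"
  define J where "J = (LINT x:L|lborel. (h x)\<^sup>2)"
  have ch: "continuous_on L h" unfolding h_def by (intro continuous_intros)
  have int: "set_integrable lborel L g" if "continuous_on L g" for g :: "'a \<Rightarrow> real"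
    by (rule set_integrable_compact[OF L(1) that])
  have bound: "J \<le> (p + \<delta>) * (q + \<delta>) / 3 * measure lborel L" if \<delta>: "\<delta> > 0" for \<delta>
  proof -
    define N where "N = (\<lambda>s. measure lborel {x \<in> L. \<bar>w \<bullet> x - m - s\<bar> \<le> \<delta>})"
    define K where "K = {- (p + \<delta>) .. q + \<delta>}"
    have mom: "(LINT s:K|lborel. s ^ k * N s) = (LINT x:L|lborel. (LINT s:{h x - \<delta> .. h x + \<delta>}|lborel. s ^ k))" for k
      unfolding N_def h_def by (rule slab_measure_moment[OF L(1) \<delta>]) (use range in \<open>auto simp: K_def\<close>)
    have inner: "(LINT s:{h x - \<delta> .. h x + \<delta>}|lborel. s ^ k) = ((h x + \<delta>) ^ Suc k - (h x - \<delta>) ^ Suc k) / Suc k" for x k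
    proof -
      have "(LINT s:{h x - \<delta> .. h x + \<delta>}|lborel. s ^ k) = (h x + \<delta>) ^ Suc k / Suc k - (h x - \<delta>) ^ Suc k / Suc k"
      proof (rule set_integral_Icc_FTC[where F = "\<lambda>s. s ^ Suc k / Suc k"])
        fix s :: real
        have "((\<lambda>s::real. s ^ Suc k / Suc k) has_real_derivative real (Suc k) * s ^ k / Suc k) (at s)"
          by (rule DERIV_cdivide) (use DERIV_pow[of "Suc k" s] in simp)
        then show "((\<lambda>s::real. s ^ Suc k / Suc k) has_real_derivative s ^ k) (at s)" by simp
      qed (use \<delta> in \<open>auto intro!: continuous_intros\<close>)
      then show ?thesis by (simp add: diff_divide_distrib)
    qed
    have m0: "(LINT s:K|lborel. N s) = 2 * \<delta> * measure lborel L"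
      using mom[of 0, unfolded inner] set_integral_const_compact[OF L(1), of "2 * \<delta>"] by (simp add: mult.commute)
    have m1: "(LINT s:K|lborel. s * N s) = 0"
    proof -
      have "(LINT s:K|lborel. s * N s) = (LINT x:L|lborel. ((h x + \<delta>)\<^sup>2 - (h x - \<delta>)\<^sup>2) / 2)"
        using mom[of 1, unfolded inner] by (simp add: numeral_2_eq_2)
      also have "\<dots> = (LINT x:L|lborel. (2 * \<delta>) * h x)"
        by (rule arg_cong[where f = "set_lebesgue_integral lborel L"]) (simp add: fun_eq_iff power2_eq_square algebra_simps)
      also have "\<dots> = 0" using mean by (simp add: h_def)
      finally show ?thesis .
    qed
    have m2: "(LINT s:K|lborel. s\<^sup>2 * N s) \<ge> 2 * \<delta> * J"
    proof -
      have "2 * \<delta> * J = (LINT x:L|lborel. (2 * \<delta>) * (h x)\<^sup>2)" by (simp add: J_def)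
      also have "\<dots> \<le> (LINT x:L|lborel. ((h x + \<delta>) ^ 3 - (h x - \<delta>) ^ 3) / 3)"
      proof (rule set_integral_mono_compact[OF L(1)])
        fix x
        have "((h x + \<delta>) ^ 3 - (h x - \<delta>) ^ 3) / 3 = 2 * \<delta> * (h x)\<^sup>2 + 2 * \<delta> ^ 3 / 3"
          by (simp add: power2_eq_square power3_eq_cube algebra_simps)
        then show "(2 * \<delta>) * (h x)\<^sup>2 \<le> ((h x + \<delta>) ^ 3 - (h x - \<delta>) ^ 3) / 3" using \<delta> by simp
      qed (use ch in \<open>auto intro!: continuous_intros\<close>)
      also have "\<dots> = (LINT s:K|lborel. s\<^sup>2 * N s)"
        using mom[of 2, unfolded inner] by (simp add: numeral_3_eq_3 numeral_2_eq_2)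
      finally show ?thesis .
    qed
    have "(LINT s:K|lborel. s\<^sup>2 * N s) \<le> (p + \<delta>) * (q + \<delta>) / 3 * (LINT s:K|lborel. N s)"
      unfolding K_def
    proof (rule log_concave_second_moment)
      show "continuous_on {- (p + \<delta>)..q + \<delta>} N"
        unfolding N_def by (rule slab_measure_continuous[OF L(1) w \<delta>])
      show "N s * N t \<le> (N ((s + t) / 2))\<^sup>2" for s t
        unfolding N_def by (rule convex_slab_log_concave[OF L])
    qed (use pq \<delta> m1 in \<open>auto simp: N_def K_def\<close>)
    with m2 m0 have "(2 * \<delta>) * J \<le> (2 * \<delta>) * ((p + \<delta>) * (q + \<delta>) / 3 * measure lborel L)"
      by (simp add: algebra_simps)
    then show ?thesis using \<delta> by simp
  qed
  have "((\<lambda>\<delta>. (p + \<delta>) * (q + \<delta>) / 3 * measure lborel L) \<longlongrightarrow> (p + 0) * (q + 0) / 3 * measure lborel L) (at_right 0)"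
    by (intro tendsto_intros) auto
  moreover have "\<forall>\<^sub>F \<delta> in at_right 0. J \<le> (p + \<delta>) * (q + \<delta>) / 3 * measure lborel L"
    using eventually_at_right_less[of 0] by eventually_elim (rule bound)
  ultimately have "J \<le> (p + 0) * (q + 0) / 3 * measure lborel L"
    by (rule tendsto_lowerbound) simp
  then show ?thesis by (simp add: J_def h_def)
qed

text \<open>
  The case \<open>q < p\<close> follows by replacing \<open>w\<close> with \<open>- w\<close>.
\<close>

lemma convex_second_moment_upper:
  fixes L :: "'a::euclidean_space set" and w :: 'a
  assumes L: "compact L" "convex L" and w: "w \<noteq> 0" and pq: "0 < p" "0 < q"
    and range: "\<And>x. x \<in> L \<Longrightarrow> - p \<le> w \<bullet> x - m" "\<And>x. x \<in> L \<Longrightarrow> w \<bullet> x - m \<le> q"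
    and mean: "(LINT x:L|lborel. w \<bullet> x - m) = 0"
  shows "(LINT x:L|lborel. (w \<bullet> x - m)\<^sup>2) \<le> p * q / 3 * measure lborel L"
proof (cases "p \<le> q")
  case True
  then show ?thesis using convex_second_moment_upper_ordered[OF L w pq(1) True range mean] by blast
next
  case False
  have flip: "(- w) \<bullet> x - (- m) = - (w \<bullet> x - m)" for x by simp
  have "(LINT x:L|lborel. ((- w) \<bullet> x - (- m))\<^sup>2) \<le> q * p / 3 * measure lborel L"
  proof (rule convex_second_moment_upper_ordered[OF L _ pq(2)])
    show "(LINT x:L|lborel. (- w) \<bullet> x - (- m)) = 0"
      unfolding flip using mean by (simp add: set_lebesgue_integral_def del: minus_diff_eq)
    show "- q \<le> (- w) \<bullet> x - (- m)" "(- w) \<bullet> x - (- m) \<le> p" if "x \<in> L" for x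
      using range[OF that] by simp_all
  qed (use w False in auto)
  then show ?thesis unfolding flip power2_minus by (simp add: mult.commute)
qed

section \<open>A lower bound for the variance of a linear function on a convex body\<close>

lemma set_integral_diagonal_affine:
  fixes c :: "'a::euclidean_space \<Rightarrow> real" and t0 :: 'a and \<psi> :: "'a \<Rightarrow> real"
  defines "T \<equiv> \<lambda>x. t0 + (\<Sum>j\<in>Basis. (c j * (x \<bullet> j)) *\<^sub>R j)"
  assumes c: "\<And>j. j \<in> Basis \<Longrightarrow> c j \<noteq> 0" and L: "compact L" and \<psi>: "continuous_on (T ` L) \<psi>"
  shows "(LINT x:T ` L|lborel. \<psi> x) = (\<Prod>j\<in>Basis. \<bar>c j\<bar>) * (LINT x:L|lborel. \<psi> (T x))"
proof -
  have Tm[measurable]: "T \<in> borel_measurable borel" unfolding T_def by measurable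
  have Tc: "continuous_on L T" unfolding T_def by (intro continuous_intros)
  have cT: "compact (T ` L)" using Tc L by (rule compact_continuous_image)
  have inj: "T x = T y \<Longrightarrow> x = y" for x y
  proof -
    assume eq: "T x = T y"
    show "x = y"
    proof (rule euclidean_eqI)
      fix b :: 'a assume b: "b \<in> Basis"
      have "T z \<bullet> b = t0 \<bullet> b + c b * (z \<bullet> b)" for z
        using b by (simp add: T_def inner_add_left inner_sum_left inner_Basis if_distrib sum.delta cong: if_cong)
      then show "x \<bullet> b = y \<bullet> b" using eq c[OF b] by (metis add_left_cancel mult_left_cancel)
    qed
  qed
  define G where "G = (\<lambda>x. indicat_real (T ` L) x *\<^sub>R \<psi> x)"
  have Gm: "G \<in> borel_measurable borel"
    using borel_measurable_integrable[OF borel_integrable_compact[OF cT \<psi>]] by (simp add: G_def)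
  have lb: "lborel = density (distr lborel borel T) (\<lambda>_. ennreal (\<Prod>j\<in>Basis. \<bar>c j\<bar>))"
    unfolding T_def by (rule lborel_affine_euclidean[OF c])
  have "(LINT x:T ` L|lborel. \<psi> x) = (LINT x|lborel. G x)" by (simp add: set_lebesgue_integral_def G_def)
  also have "\<dots> = (LINT x|density (distr lborel borel T) (\<lambda>_. ennreal (\<Prod>j\<in>Basis. \<bar>c j\<bar>)). G x)"
    using lb by simp
  also have "\<dots> = (LINT x|distr lborel borel T. (\<Prod>j\<in>Basis. \<bar>c j\<bar>) *\<^sub>R G x)"
    using Gm by (intro integral_density) (auto simp: prod_nonneg)
  also have "\<dots> = (LINT x|lborel. (\<Prod>j\<in>Basis. \<bar>c j\<bar>) *\<^sub>R G (T x))"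
    using Gm by (intro integral_distr) auto
  also have "\<dots> = (\<Prod>j\<in>Basis. \<bar>c j\<bar>) * (LINT x|lborel. G (T x))" by simp
  also have "(LINT x|lborel. G (T x)) = (LINT x:L|lborel. \<psi> (T x))"
    unfolding set_lebesgue_integral_def G_def
    by (rule Bochner_Integration.integral_cong) (auto simp: indicator_def dest: inj)
  finally show ?thesis .
qed

lemma set_integral_homothety:
  fixes L :: "'a::euclidean_space set" and \<psi> :: "'a \<Rightarrow> real"
  assumes t: "t > 0" and L: "compact L" and \<psi>: "continuous_on ((\<lambda>x. y + t *\<^sub>R (x - y)) ` L) \<psi>"
  shows "(LINT x:(\<lambda>x. y + t *\<^sub>R (x - y)) ` L|lborel. \<psi> x) = t ^ DIM('a) * (LINT x:L|lborel. \<psi> (y + t *\<^sub>R (x - y)))"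
proof -
  have T: "(y - t *\<^sub>R y) + (\<Sum>j\<in>Basis. (t * (x \<bullet> j)) *\<^sub>R j) = y + t *\<^sub>R (x - y)" for x
  proof -
    have "(\<Sum>j\<in>Basis. (t * (x \<bullet> j)) *\<^sub>R j) = t *\<^sub>R x"
      by (simp add: scaleR_scaleR[symmetric] scaleR_sum_right[symmetric] euclidean_representation del: scaleR_scaleR)
    then show ?thesis by (simp add: algebra_simps)
  qed
  show ?thesis
    using set_integral_diagonal_affine[of "\<lambda>_. t" L "y - t *\<^sub>R y" \<psi>] t L \<psi> unfolding T by simp
qed

lemma set_integral_mono_set_compact:
  fixes F :: "'a::euclidean_space \<Rightarrow> real"
  assumes "compact A" "compact B" "A \<subseteq> B" "continuous_on B F" "\<And>x. x \<in> B \<Longrightarrow> 0 \<le> F x"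
  shows "(LINT x:A|lborel. F x) \<le> (LINT x:B|lborel. F x)"
  unfolding set_lebesgue_integral_def
  by (rule integral_mono)
    (use assms set_integrable_compact[OF assms(1) continuous_on_subset[OF assms(4,3)]]
      set_integrable_compact[OF assms(2,4)] in \<open>auto simp: set_integrable_def indicator_def\<close>)

text \<open>
  An integration by parts in the radial direction, without smoothness of the boundary. Shrinking \<open>L\<close>
  towards \<open>y\<close> by the factor \<open>t\<close> maps \<open>L\<close> into itself and multiplies volumes by \<open>t ^ d\<close>; here \<open>g'\<close>
  plays the role of the derivative of \<open>g\<close> in the direction of \<open>y - x\<close>. The claim is the first-order
  term as \<open>t\<close> tends to \<open>1\<close>.
\<close>

lemma star_shaped_integral_bound:
  fixes L :: "'a::euclidean_space set" and g g' :: "'a \<Rightarrow> real"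
  assumes L: "compact L" and star: "\<And>x t. x \<in> L \<Longrightarrow> 0 < t \<Longrightarrow> t < 1 \<Longrightarrow> y + t *\<^sub>R (x - y) \<in> L"
    and g: "continuous_on L g" "continuous_on L g'" "\<And>x. x \<in> L \<Longrightarrow> 0 \<le> g x"
    and conv: "\<And>x t. x \<in> L \<Longrightarrow> 0 < t \<Longrightarrow> t < 1 \<Longrightarrow> g x + (1 - t) * g' x \<le> g (y + t *\<^sub>R (x - y))"
  shows "(LINT x:L|lborel. g' x) \<le> DIM('a) * (LINT x:L|lborel. g x)"
proof -
  define A B where "A = (LINT x:L|lborel. g' x)" and "B = (LINT x:L|lborel. g x)"
  have le: "t ^ DIM('a) * A \<le> (\<Sum>k<DIM('a). t ^ k) * B" if t: "0 < t" "t < 1" for t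
  proof -
    have sub: "(\<lambda>x. y + t *\<^sub>R (x - y)) ` L \<subseteq> L" using star t by auto
    have cS: "continuous_on L (\<lambda>x. y + t *\<^sub>R (x - y))" by (intro continuous_intros)
    have "B + (1 - t) * A = (LINT x:L|lborel. g x + (1 - t) * g' x)"
      unfolding A_def B_def
      by (subst set_integral_add(2)) (auto intro!: set_integrable_compact L g continuous_intros)
    also have "\<dots> \<le> (LINT x:L|lborel. g (y + t *\<^sub>R (x - y)))"
      by (rule set_integral_mono_compact[OF L])
        (use conv t in \<open>auto intro!: continuous_intros g continuous_on_compose2[OF g(1) cS sub]\<close>)
    finally have "t ^ DIM('a) * (B + (1 - t) * A) \<le> t ^ DIM('a) * (LINT x:L|lborel. g (y + t *\<^sub>R (x - y)))"
      using t by simp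
    also have "\<dots> = (LINT x:(\<lambda>x. y + t *\<^sub>R (x - y)) ` L|lborel. g x)"
      by (rule set_integral_homothety[symmetric]) (use t L continuous_on_subset[OF g(1) sub] in auto)
    also have "\<dots> \<le> B" unfolding B_def
      by (rule set_integral_mono_set_compact[OF compact_continuous_image[OF cS L] L sub g(1,3)])
    finally have "(1 - t) * (t ^ DIM('a) * A) \<le> (1 - t ^ DIM('a)) * B" by (simp add: algebra_simps)
    also have "\<dots> = (1 - t) * ((\<Sum>k<DIM('a). t ^ k) * B)" by (simp add: one_diff_power_eq)
    finally show ?thesis using t by simp
  qed
  have "((\<lambda>t. (\<Sum>k<DIM('a). t ^ k) * B - t ^ DIM('a) * A) \<longlongrightarrow> (\<Sum>k<DIM('a). 1 ^ k) * B - 1 ^ DIM('a) * A) (at_left 1)"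
    by (intro tendsto_intros)
  moreover have "\<forall>\<^sub>F t in at_left (1::real). t \<in> {0<..<1}"
    by (rule eventually_at_left_real) simp
  then have "\<forall>\<^sub>F t in at_left (1::real). 0 \<le> (\<Sum>k<DIM('a). t ^ k) * B - t ^ DIM('a) * A"
    by eventually_elim (use le in auto)
  ultimately have "0 \<le> (\<Sum>k<DIM('a). 1 ^ k) * B - 1 ^ DIM('a) * A"
    by (rule tendsto_lowerbound) simp
  then show ?thesis by (simp add: A_def B_def)
qed

text \<open>
  The part of \<open>L\<close> above the mean is shrunk towards a point \<open>y\<close> at maximal height \<open>b\<close>. The quadratic
  function \<open>g = (D + 1) h\<^sup>2 + 2 a h\<close> is nonnegative there, and is chosen so that the resulting
  inequality has the constant term \<open>- 2 a b\<close> and a linear term which is the same for the lower part,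
  with \<open>a\<close> and \<open>b\<close> exchanged and \<open>h\<close> replaced by \<open>- h\<close>.
\<close>

lemma convex_second_moment_half:
  fixes L :: "'a::euclidean_space set" and w :: 'a
  assumes L: "compact L" "convex L" and ab: "0 < a" "0 < b"
    and y: "y \<in> L" "w \<bullet> y - m = b" and range: "\<And>x. x \<in> L \<Longrightarrow> w \<bullet> x - m \<le> b"
  defines "D \<equiv> real (DIM('a))"
  shows "0 \<le> (LINT x:L \<inter> {x. 0 \<le> w \<bullet> x - m}|lborel.
      (D + 1) * (D + 2) * (w \<bullet> x - m)\<^sup>2 + 2 * (D + 1) * (a - b) * (w \<bullet> x - m) - 2 * a * b)"
proof -
  define H where "H = L \<inter> {x. 0 \<le> w \<bullet> x - m}"
  define h where "h = (\<lambda>x. w \<bullet> x - m)"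
  have cH: "compact H" unfolding H_def using L(1)
    by (intro compact_Int_closed closed_Collect_le continuous_intros)
  have ch: "continuous_on H h" unfolding h_def by (intro continuous_intros)
  define g g' where "g = (\<lambda>x. (D + 1) * (h x)\<^sup>2 + 2 * a * h x)"
    and "g' = (\<lambda>x. (2 * (D + 1) * h x + 2 * a) * (b - h x))"
  have D: "D \<ge> 0" by (simp add: D_def)
  have hS: "h (y + t *\<^sub>R (x - y)) = h x + (1 - t) * (b - h x)" for x t
  proof -
    have b: "b = w \<bullet> y - m" using y by simp
    show ?thesis unfolding b h_def by (simp add: inner_add_right inner_diff_right algebra_simps)
  qed
  have "(LINT x:H|lborel. g' x) \<le> D * (LINT x:H|lborel. g x)"
    unfolding D_def
  proof (rule star_shaped_integral_bound[OF cH])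
    fix x t assume x: "x \<in> H" and t: "0 < (t::real)" "t < 1"
    have hx: "0 \<le> h x" "h x \<le> b" using x range by (auto simp: H_def h_def)
    have "(1 - t) *\<^sub>R y + t *\<^sub>R x \<in> L" using x y t L by (intro convexD) (auto simp: H_def)
    then have "y + t *\<^sub>R (x - y) \<in> L" by (simp add: algebra_simps)
    moreover have "0 \<le> h (y + t *\<^sub>R (x - y))" unfolding hS using hx t by simp
    ultimately show "y + t *\<^sub>R (x - y) \<in> H" by (simp add: H_def h_def)
    define u where "u = (1 - t) * (b - h x)"
    have "g (y + t *\<^sub>R (x - y)) = g x + (1 - t) * g' x + (D + 1) * u\<^sup>2"
      unfolding g_def g'_def hS u_def[symmetric] by (simp add: u_def power2_eq_square algebra_simps)
    then show "g x + (1 - t) * g' x \<le> g (y + t *\<^sub>R (x - y))" using D by simp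
  next
    fix x assume "x \<in> H"
    then show "0 \<le> g x" using D ab by (simp add: g_def H_def h_def)
  qed (auto simp: g_def g'_def intro!: continuous_intros ch)
  then have "0 \<le> D * (LINT x:H|lborel. g x) - (LINT x:H|lborel. g' x)" by simp
  also have "\<dots> = (LINT x:H|lborel. D * g x - g' x)"
    by (subst set_integral_diff(2)) (auto simp: g_def g'_def intro!: set_integrable_compact cH continuous_intros ch)
  also have "\<dots> = (LINT x:H|lborel. (D + 1) * (D + 2) * (h x)\<^sup>2 + 2 * (D + 1) * (a - b) * h x - 2 * a * b)"
    by (rule arg_cong[where f = "set_lebesgue_integral lborel H"])
      (simp add: fun_eq_iff g_def g'_def power2_eq_square algebra_simps)
  finally show ?thesis by (simp add: H_def h_def)
qed

text \<open>
  The inequalities for the two parts of \<open>L\<close> above and below the mean have the same integrand, so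
  they add up; the linear term then disappears since the mean is zero.
\<close>

lemma convex_second_moment_lower:
  fixes L :: "'a::euclidean_space set" and w :: 'a
  assumes L: "compact L" "convex L" and ab: "0 < a" "0 < b"
    and x0: "x0 \<in> L" "w \<bullet> x0 - m = - a" and y0: "y0 \<in> L" "w \<bullet> y0 - m = b"
    and range: "\<And>x. x \<in> L \<Longrightarrow> - a \<le> w \<bullet> x - m" "\<And>x. x \<in> L \<Longrightarrow> w \<bullet> x - m \<le> b"
    and mean: "(LINT x:L|lborel. w \<bullet> x - m) = 0"
  defines "D \<equiv> real (DIM('a))"
  shows "2 * a * b * measure lborel L \<le> (D + 1) * (D + 2) * (LINT x:L|lborel. (w \<bullet> x - m)\<^sup>2)"
proof -
  define h where "h = (\<lambda>x. w \<bullet> x - m)"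
  define f where "f = (\<lambda>x. (D + 1) * (D + 2) * (h x)\<^sup>2 + 2 * (D + 1) * (a - b) * h x - 2 * a * b)"
  have cf: "continuous_on A f" "continuous_on A h" for A unfolding f_def h_def by (intro continuous_intros)+
  \<comment> \<open>The two parts overlap where \<open>h = 0\<close>; there the integrand is negative, so counting it twice does no harm.\<close>
  define H1 H2 where "H1 = L \<inter> {x. 0 \<le> h x}" and "H2 = L \<inter> {x. h x \<le> 0}"
  have c: "compact H1" "compact H2" unfolding H1_def H2_def h_def using L(1)
    by (intro compact_Int_closed closed_Collect_le continuous_intros; simp)+
  have 1: "0 \<le> (LINT x:H1|lborel. f x)"
    using convex_second_moment_half[OF L ab y0 range(2)] by (simp add: H1_def f_def h_def D_def)
  have 2: "0 \<le> (LINT x:H2|lborel. f x)"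
  proof -
    have flip: "(- w) \<bullet> x - (- m) = - h x" for x by (simp add: h_def)
    have "0 \<le> (LINT x:L \<inter> {x. 0 \<le> (- w) \<bullet> x - (- m)}|lborel.
      (D + 1) * (D + 2) * ((- w) \<bullet> x - (- m))\<^sup>2 + 2 * (D + 1) * (b - a) * ((- w) \<bullet> x - (- m)) - 2 * b * a)"
      unfolding D_def
    proof (rule convex_second_moment_half[OF L ab(2,1) x0(1)])
      show "(- w) \<bullet> x0 - (- m) = a" using x0(2) by simp
      show "(- w) \<bullet> x - (- m) \<le> a" if "x \<in> L" for x using range(1)[OF that] by simp
    qed
    moreover have "L \<inter> {x. 0 \<le> (- w) \<bullet> x - (- m)} = H2" unfolding flip by (simp add: H2_def)
    moreover have "(D + 1) * (D + 2) * ((- w) \<bullet> x - (- m))\<^sup>2 + 2 * (D + 1) * (b - a) * ((- w) \<bullet> x - (- m)) - 2 * b * a = f x" for x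
      unfolding flip f_def by (simp add: algebra_simps)
    ultimately show ?thesis by simp
  qed
  have i: "integrable lborel (\<lambda>x. indicat_real A x *\<^sub>R f x)" if "compact A" for A
    by (rule borel_integrable_compact[OF that cf(1)])
  have "0 \<le> (LINT x:H1|lborel. f x) + (LINT x:H2|lborel. f x)" using 1 2 by simp
  also have "\<dots> = (LINT x|lborel. indicat_real H1 x *\<^sub>R f x + indicat_real H2 x *\<^sub>R f x)"
    unfolding set_lebesgue_integral_def using i c by simp
  also have "\<dots> \<le> (LINT x:L|lborel. f x)"
    unfolding set_lebesgue_integral_def
  proof (rule integral_mono)
    fix x
    have "f x \<le> 0" if "h x = 0" using that ab by (simp add: f_def)
    then show "indicat_real H1 x *\<^sub>R f x + indicat_real H2 x *\<^sub>R f x \<le> indicat_real L x *\<^sub>R f x"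
      by (auto simp: H1_def H2_def indicator_def)
  qed (use i c L in simp_all)
  also have "\<dots> = (LINT x:L|lborel. (D + 1) * (D + 2) * (h x)\<^sup>2 + 2 * (D + 1) * (a - b) * h x) - (LINT x:L|lborel. 2 * a * b)"
    unfolding f_def
    by (rule set_integral_diff(2)) (intro set_integrable_compact L continuous_intros cf)+
  also have "(LINT x:L|lborel. (D + 1) * (D + 2) * (h x)\<^sup>2 + 2 * (D + 1) * (a - b) * h x)
     = (LINT x:L|lborel. (D + 1) * (D + 2) * (h x)\<^sup>2) + (LINT x:L|lborel. 2 * (D + 1) * (a - b) * h x)"
    by (rule set_integral_add(2)) (intro set_integrable_compact L continuous_intros cf)+
  also have "(LINT x:L|lborel. 2 * (D + 1) * (a - b) * h x) = 0"
    using mean by (simp add: h_def)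
  finally show ?thesis
    unfolding set_integral_const_compact[OF L(1)] by (simp add: h_def mult_ac)
qed

section \<open>Second moments of cross-polytopes and boxes\<close>

text \<open>
  For a cone with apex \<open>y\<close> over its base in \<open>w \<bullet> x = 0\<close>, the homothety at the apex maps the cone
  onto the cap above height \<open>1 - t\<close>, and only a slice of height at most \<open>1 - t\<close> is lost. Comparing
  the moments of cone and cap as \<open>t\<close> tends to \<open>1\<close> yields the recursion \<open>(D + k) I\<^sub>k \<le> k I\<^sub>k\<^sub>-\<^sub>1\<close> for
  \<open>k = 1, 2\<close>.
\<close>

lemma cone_second_moment:
  fixes L :: "'a::euclidean_space set" and w y :: 'a
  assumes L: "compact L" and y: "w \<bullet> y = 1"
    and range: "\<And>x. x \<in> L \<Longrightarrow> 0 \<le> w \<bullet> x" "\<And>x. x \<in> L \<Longrightarrow> w \<bullet> x \<le> 1"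
    and cap: "\<And>t. 0 < t \<Longrightarrow> t < 1 \<Longrightarrow> (\<lambda>x. y + t *\<^sub>R (x - y)) ` L = L \<inter> {x. 1 - t \<le> w \<bullet> x}"
  defines "D \<equiv> real (DIM('a))"
  shows "(D + 1) * (D + 2) * (LINT x:L|lborel. (w \<bullet> x)\<^sup>2) \<le> 2 * measure lborel L"
proof -
  define I where "I = (\<lambda>k::nat. LINT x:L|lborel. (w \<bullet> x) ^ k)"
  have I0: "I 0 = measure lborel L" using set_integral_const_compact[OF L, of 1] by (simp add: I_def)
  have cw: "continuous_on A (\<lambda>x. (w \<bullet> x) ^ k)" for A k by (intro continuous_intros)
  have si: "set_integrable lborel L q" if "continuous_on L q" for q :: "'a \<Rightarrow> real"
    by (rule set_integrable_compact[OF L that])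
  have step: "I k \<le> t ^ DIM('a) * (LINT x:L|lborel. (1 - t + t * (w \<bullet> x)) ^ k) + (1 - t) ^ k * ((1 - t ^ DIM('a)) * I 0)"
    if t: "0 < t" "t < 1" for t k
  proof -
    define S where "S = (\<lambda>x. y + t *\<^sub>R (x - y)) ` L"
    have cS: "compact S" unfolding S_def by (intro compact_continuous_image L continuous_intros)
    have SL: "S = L \<inter> {x. 1 - t \<le> w \<bullet> x}" unfolding S_def by (rule cap[OF t])
    have hom: "(LINT x:S|lborel. (w \<bullet> x) ^ k) = t ^ DIM('a) * (LINT x:L|lborel. (1 - t + t * (w \<bullet> x)) ^ k)" for k
    proof -
      have "(LINT x:S|lborel. (w \<bullet> x) ^ k) = t ^ DIM('a) * (LINT x:L|lborel. (w \<bullet> (y + t *\<^sub>R (x - y))) ^ k)"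
        unfolding S_def by (rule set_integral_homothety) (use t L cw in auto)
      moreover have "w \<bullet> (y + t *\<^sub>R (x - y)) = 1 - t + t * (w \<bullet> x)" for x
        using y by (simp add: inner_add_right inner_diff_right algebra_simps)
      ultimately show ?thesis by simp
    qed
    have "I k - (LINT x:S|lborel. (w \<bullet> x) ^ k)
        = (LINT x|lborel. indicat_real L x *\<^sub>R (w \<bullet> x) ^ k - indicat_real S x *\<^sub>R (w \<bullet> x) ^ k)"
      unfolding I_def set_lebesgue_integral_def
      by (rule Bochner_Integration.integral_diff[symmetric]; rule borel_integrable_compact; (rule L cS cw))
    also have "\<dots> \<le> (LINT x|lborel. (1 - t) ^ k * (indicat_real L x - indicat_real S x))"
    proof (rule integral_mono)
      fix x
      have "(w \<bullet> x) ^ k \<le> (1 - t) ^ k" if "x \<in> L" "x \<notin> S"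
        using that range by (intro power_mono) (auto simp: SL)
      then show "indicat_real L x *\<^sub>R (w \<bullet> x) ^ k - indicat_real S x *\<^sub>R (w \<bullet> x) ^ k
         \<le> (1 - t) ^ k * (indicat_real L x - indicat_real S x)"
        using SL by (auto simp: indicator_def)
    qed (use borel_integrable_compact[OF L cw, of k] borel_integrable_compact[OF cS cw, of k]
          borel_integrable_compact[OF L, of "\<lambda>_. 1::real"] borel_integrable_compact[OF cS, of "\<lambda>_. 1::real"] in simp_all)
    also have "\<dots> = (1 - t) ^ k * ((1 - t ^ DIM('a)) * I 0)"
      using hom[of 0] I0 set_integral_const_compact[OF cS, of 1] set_integral_const_compact[OF L, of 1]
        borel_integrable_compact[OF L, of "\<lambda>_. 1::real"] borel_integrable_compact[OF cS, of "\<lambda>_. 1::real"]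
      by (simp add: set_lebesgue_integral_def algebra_simps)
    finally show ?thesis using hom[of k] by simp
  qed
  have I1: "(D + 1) * I 1 \<le> I 0"
  proof -
    have le: "(\<Sum>k<Suc DIM('a). t ^ k) * I 1 \<le> I 0" if t: "0 < t" "t < 1" for t
    proof -
      have "(LINT x:L|lborel. (1 - t + t * (w \<bullet> x)) ^ 1) = (LINT x:L|lborel. (1 - t)) + (LINT x:L|lborel. t * (w \<bullet> x))"
        unfolding power_one_right by (rule set_integral_add(2)) (intro si continuous_intros)+
      also have "\<dots> = (1 - t) * I 0 + t * I 1"
        unfolding set_integral_const_compact[OF L] I0 by (simp add: I_def)
      finally have e: "(LINT x:L|lborel. (1 - t + t * (w \<bullet> x)) ^ 1) = (1 - t) * I 0 + t * I 1" .
      have "I 1 \<le> t ^ DIM('a) * ((1 - t) * I 0 + t * I 1) + (1 - t) ^ 1 * ((1 - t ^ DIM('a)) * I 0)"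
        using step[OF t, of 1] unfolding e .
      then have "(1 - t ^ Suc DIM('a)) * I 1 \<le> (1 - t) * I 0" by (simp add: algebra_simps)
      then have "(1 - t) * ((\<Sum>k<Suc DIM('a). t ^ k) * I 1) \<le> (1 - t) * I 0"
        unfolding one_diff_power_eq by (simp only: mult.assoc)
      then show ?thesis using t by simp
    qed
    have "((\<lambda>t. I 0 - (\<Sum>k<Suc DIM('a). t ^ k) * I 1) \<longlongrightarrow> I 0 - (\<Sum>k<Suc DIM('a). 1 ^ k) * I 1) (at_left 1)"
      by (intro tendsto_intros)
    moreover have "\<forall>\<^sub>F t in at_left (1::real). t \<in> {0<..<1}" by (rule eventually_at_left_real) simp
    then have "\<forall>\<^sub>F t in at_left (1::real). 0 \<le> I 0 - (\<Sum>k<Suc DIM('a). t ^ k) * I 1"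
      by eventually_elim (use le in auto)
    ultimately have "0 \<le> I 0 - (\<Sum>k<Suc DIM('a). 1 ^ k) * I 1" by (rule tendsto_lowerbound) simp
    then show ?thesis by (simp add: D_def add.commute)
  qed
  have I2: "(D + 2) * I 2 \<le> 2 * I 1"
  proof -
    have le: "(\<Sum>k<DIM('a) + 2. t ^ k) * I 2 \<le> (1 - t) * I 0 + 2 * t ^ Suc DIM('a) * I 1" if t: "0 < t" "t < 1" for t
    proof -
      have "(LINT x:L|lborel. (1 - t + t * (w \<bullet> x))\<^sup>2)
         = (LINT x:L|lborel. ((1 - t)\<^sup>2 + (2 * t * (1 - t)) * (w \<bullet> x)) + t\<^sup>2 * (w \<bullet> x)\<^sup>2)"
        by (rule arg_cong[where f = "set_lebesgue_integral lborel L"]) (simp add: fun_eq_iff power2_eq_square algebra_simps)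
      also have "\<dots> = (LINT x:L|lborel. (1 - t)\<^sup>2 + (2 * t * (1 - t)) * (w \<bullet> x)) + (LINT x:L|lborel. t\<^sup>2 * (w \<bullet> x)\<^sup>2)"
        by (rule set_integral_add(2)) (intro si continuous_intros)+
      also have "(LINT x:L|lborel. (1 - t)\<^sup>2 + (2 * t * (1 - t)) * (w \<bullet> x))
         = (LINT x:L|lborel. (1 - t)\<^sup>2) + (LINT x:L|lborel. (2 * t * (1 - t)) * (w \<bullet> x))"
        by (rule set_integral_add(2)) (intro si continuous_intros)+
      also have "\<dots> = (1 - t)\<^sup>2 * I 0 + 2 * t * (1 - t) * I 1"
        unfolding set_integral_const_compact[OF L] I0 by (simp add: I_def)
      finally have e: "(LINT x:L|lborel. (1 - t + t * (w \<bullet> x))\<^sup>2) = (1 - t)\<^sup>2 * I 0 + 2 * t * (1 - t) * I 1 + t\<^sup>2 * I 2"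
        by (simp add: I_def)
      have "I 2 \<le> t ^ DIM('a) * ((1 - t)\<^sup>2 * I 0 + 2 * t * (1 - t) * I 1 + t\<^sup>2 * I 2) + (1 - t)\<^sup>2 * ((1 - t ^ DIM('a)) * I 0)"
        using step[OF t, of 2] unfolding e .
      then have "(1 - t ^ (DIM('a) + 2)) * I 2 \<le> (1 - t) * ((1 - t) * I 0 + 2 * t ^ Suc DIM('a) * I 1)"
        by (simp add: power_add power2_eq_square algebra_simps)
      then have "(1 - t) * ((\<Sum>k<DIM('a) + 2. t ^ k) * I 2) \<le> (1 - t) * ((1 - t) * I 0 + 2 * t ^ Suc DIM('a) * I 1)"
        unfolding one_diff_power_eq by (simp only: mult.assoc)
      then show ?thesis using t by simp
    qed
    have "((\<lambda>t. ((1 - t) * I 0 + 2 * t ^ Suc DIM('a) * I 1) - (\<Sum>k<DIM('a) + 2. t ^ k) * I 2) \<longlongrightarrow>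
       ((1 - 1) * I 0 + 2 * 1 ^ Suc DIM('a) * I 1) - (\<Sum>k<DIM('a) + 2. 1 ^ k) * I 2) (at_left 1)"
      by (intro tendsto_intros)
    moreover have "\<forall>\<^sub>F t in at_left (1::real). t \<in> {0<..<1}" by (rule eventually_at_left_real) simp
    then have "\<forall>\<^sub>F t in at_left (1::real). 0 \<le> ((1 - t) * I 0 + 2 * t ^ Suc DIM('a) * I 1) - (\<Sum>k<DIM('a) + 2. t ^ k) * I 2"
      by eventually_elim (use le in auto)
    ultimately have "0 \<le> ((1 - 1) * I 0 + 2 * 1 ^ Suc DIM('a) * I 1) - (\<Sum>k<DIM('a) + 2. 1 ^ k) * I 2"
      by (rule tendsto_lowerbound) simp
    then show ?thesis by (simp add: D_def add.commute)
  qed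
  have "(D + 1) * ((D + 2) * I 2) \<le> (D + 1) * (2 * I 1)" by (rule mult_left_mono[OF I2]) (simp add: D_def)
  also have "\<dots> \<le> 2 * I 0" using I1 by simp
  finally show ?thesis unfolding I0 by (simp add: I_def mult.assoc)
qed

lemma l1_norm_split:
  fixes x :: "real ^ 'n::finite"
  shows "(\<Sum>i\<in>UNIV. \<bar>x $ i\<bar>) = \<bar>x $ j\<bar> + (\<Sum>i\<in>UNIV - {j}. \<bar>x $ i\<bar>)"
  by (rule sum.remove) auto

lemma cross_polytope_compact: "compact (cross_polytope :: (real ^ 'n::finite) set)"
proof -
  have "closed (cross_polytope :: (real ^ 'n) set)"
    unfolding cross_polytope_def by (intro closed_Collect_le continuous_intros)
  moreover have "cross_polytope \<subseteq> cball (0 :: real ^ 'n) 1"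
  proof
    fix x :: "real ^ 'n" assume "x \<in> cross_polytope"
    then show "x \<in> cball 0 1" using norm_le_l1_cart[of x] by (simp add: cross_polytope_def)
  qed
  ultimately show ?thesis by (meson bounded_cball bounded_subset compact_eq_bounded_closed)
qed

lemma cross_polytope_convex: "convex (cross_polytope :: (real ^ 'n::finite) set)"
proof (rule convexI)
  fix x y :: "real ^ 'n" and u v :: real
  assume xy: "x \<in> cross_polytope" "y \<in> cross_polytope" and uv: "0 \<le> u" "0 \<le> v" "u + v = 1"
  have "(\<Sum>i\<in>UNIV. \<bar>(u *\<^sub>R x + v *\<^sub>R y) $ i\<bar>) \<le> (\<Sum>i\<in>UNIV. u * \<bar>x $ i\<bar> + v * \<bar>y $ i\<bar>)"
  proof (rule sum_mono)
    fix i
    have "\<bar>u * x $ i + v * y $ i\<bar> \<le> \<bar>u * x $ i\<bar> + \<bar>v * y $ i\<bar>" by (rule abs_triangle_ineq)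
    then show "\<bar>(u *\<^sub>R x + v *\<^sub>R y) $ i\<bar> \<le> u * \<bar>x $ i\<bar> + v * \<bar>y $ i\<bar>" using uv by (simp add: abs_mult)
  qed
  also have "\<dots> = u * (\<Sum>i\<in>UNIV. \<bar>x $ i\<bar>) + v * (\<Sum>i\<in>UNIV. \<bar>y $ i\<bar>)" by (simp add: sum.distrib sum_distrib_left)
  also have "\<dots> \<le> u * 1 + v * 1" using xy uv by (intro add_mono mult_left_mono) (auto simp: cross_polytope_def)
  finally show "u *\<^sub>R x + v *\<^sub>R y \<in> cross_polytope" using uv by (simp add: cross_polytope_def)
qed

text \<open>
  The coordinate hyperplane \<open>x $ j = 0\<close> cuts the cross-polytope into two cones with apexes
  \<open>axis j 1\<close> and \<open>axis j (- 1)\<close>.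
\<close>

lemma cross_polytope_second_moment:
  fixes j :: "'n::finite"
  defines "D \<equiv> real CARD('n)"
  shows "(D + 1) * (D + 2) * (LINT x:(cross_polytope :: (real ^ 'n) set)|lborel. (x $ j)\<^sup>2)
     \<le> 2 * measure lborel (cross_polytope :: (real ^ 'n) set)"
proof -
  define K where "K = (cross_polytope :: (real ^ 'n) set)"
  define L where "L = (\<lambda>w. K \<inter> {x. 0 \<le> w \<bullet> x})"
  have K: "compact K" "convex K" by (simp_all add: K_def cross_polytope_compact cross_polytope_convex)
  have cL: "compact (L w)" for w unfolding L_def using K(1)
    by (intro compact_Int_closed closed_Collect_le continuous_intros)
  have half: "(D + 1) * (D + 2) * (LINT x:L w|lborel. (x $ j)\<^sup>2) \<le> 2 * measure lborel (L w)"
    if w: "w = axis j \<sigma>" and \<sigma>: "\<bar>\<sigma>\<bar> = 1" for w \<sigma>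
  proof -
    have \<sigma>2: "\<sigma> * \<sigma> = 1" using \<sigma> by (metis abs_mult_self_eq mult_1)
    have wx: "w \<bullet> x = \<sigma> * x $ j" for x by (simp add: w inner_axis' )
    have abs: "\<bar>x $ j\<bar> = \<bar>w \<bullet> x\<bar>" for x by (simp add: wx abs_mult \<sigma>)
    have wi: "w $ i = 0" if "i \<noteq> j" for i using that by (simp add: w axis_def)
    have ww: "w \<bullet> w = 1" using \<sigma>2 by (simp add: wx) (simp add: w axis_def)
    have wL: "w \<in> K"
      using \<sigma> by (simp add: K_def cross_polytope_def l1_norm_split[of w j] wi) (simp add: w axis_def)
    have "(D + 1) * (D + 2) * (LINT x:L w|lborel. (w \<bullet> x)\<^sup>2) \<le> 2 * measure lborel (L w)"
    proof -
      have "(real DIM(real ^ 'n) + 1) * (real DIM(real ^ 'n) + 2) * (LINT x:L w|lborel. (w \<bullet> x)\<^sup>2) \<le> 2 * measure lborel (L w)"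
      proof (rule cone_second_moment[OF cL ww])
        fix x assume x: "x \<in> L w"
        then show "0 \<le> w \<bullet> x" by (simp add: L_def)
        have "\<bar>x $ j\<bar> \<le> 1" 
        proof -
          have "0 \<le> (\<Sum>i\<in>UNIV - {j}. \<bar>x $ i\<bar>)" by (rule sum_nonneg) simp
          moreover have "(\<Sum>i\<in>UNIV. \<bar>x $ i\<bar>) \<le> 1" using x by (simp add: L_def K_def cross_polytope_def)
          ultimately show ?thesis using l1_norm_split[of x j] by linarith
        qed
        then show "w \<bullet> x \<le> 1" unfolding abs by simp
      next
        fix t :: real assume t: "0 < t" "t < 1"
        have wS: "w \<bullet> (w + t *\<^sub>R (x - w)) = 1 - t + t * (w \<bullet> x)" for x
          using ww by (simp add: inner_add_right inner_diff_right algebra_simps)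
        show "(\<lambda>x. w + t *\<^sub>R (x - w)) ` L w = L w \<inter> {x. 1 - t \<le> w \<bullet> x}"
        proof (rule set_eqI, rule iffI)
          fix z assume "z \<in> (\<lambda>x. w + t *\<^sub>R (x - w)) ` L w"
          then obtain x where x: "x \<in> L w" "z = w + t *\<^sub>R (x - w)" by auto
          have "(1 - t) *\<^sub>R w + t *\<^sub>R x \<in> K" using K(2) wL x(1) t by (intro convexD) (auto simp: L_def)
          then have "z \<in> K" unfolding x(2) by (simp add: algebra_simps)
          moreover have "w \<bullet> z = 1 - t + t * (w \<bullet> x)" unfolding x(2) by (rule wS)
          moreover have "0 \<le> t * (w \<bullet> x)" using x(1) t by (simp add: L_def)
          ultimately show "z \<in> L w \<inter> {x. 1 - t \<le> w \<bullet> x}" using t by (simp add: L_def)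
        next
          fix z assume z: "z \<in> L w \<inter> {x. 1 - t \<le> w \<bullet> x}"
          define x where "x = w + (1/t) *\<^sub>R (z - w)"
          have zx: "z = w + t *\<^sub>R (x - w)" using t by (simp add: x_def)
          have hx: "w \<bullet> x = (w \<bullet> z - (1 - t)) / t"
            using wS[of x] t unfolding zx[symmetric] by (simp add: field_simps)
          then have h0: "0 \<le> w \<bullet> x" using z t by simp
          have "x $ i = z $ i / t" if "i \<noteq> j" for i using wi[OF that] by (simp add: x_def)
          then have "(\<Sum>i\<in>UNIV - {j}. \<bar>x $ i\<bar>) = (\<Sum>i\<in>UNIV - {j}. \<bar>z $ i\<bar>) / t"
            using t by (simp add: sum_divide_distrib)
          also have "\<dots> \<le> (1 - w \<bullet> z) / t"
          proof -
            have "\<bar>z $ j\<bar> = w \<bullet> z" unfolding abs using z by (simp add: L_def)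
            then show ?thesis using z t l1_norm_split[of z j]
              by (intro divide_right_mono) (auto simp: L_def K_def cross_polytope_def)
          qed
          finally have "(\<Sum>i\<in>UNIV. \<bar>x $ i\<bar>) \<le> w \<bullet> x + (1 - w \<bullet> z) / t"
            unfolding l1_norm_split[of x j] abs using h0 by simp
          also have "\<dots> = 1" unfolding hx using t by (simp add: field_simps)
          finally have "x \<in> L w" using h0 by (simp add: L_def K_def cross_polytope_def)
          then show "z \<in> (\<lambda>x. w + t *\<^sub>R (x - w)) ` L w" using zx by blast
        qed
      qed
      then show ?thesis by (simp add: D_def)
    qed
    moreover have "(w \<bullet> x)\<^sup>2 = (x $ j)\<^sup>2" for x by (metis abs power2_abs)
    ultimately show ?thesis by simp
  qed
  define A B where "A = L (axis j 1)" and "B = L (axis j (- 1))"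
  have AB: "compact A" "compact B" using cL by (simp_all add: A_def B_def)
  have x: "axis j s \<bullet> x = s * x $ j" for s :: real and x by (simp add: inner_axis')
  have KAB: "K = A \<union> B" by (auto simp: A_def B_def L_def x)
  have "A \<inter> B \<subseteq> {x. axis j 1 \<bullet> x = 0}" by (auto simp: A_def B_def L_def x)
  moreover have "{x. axis j (1::real) \<bullet> x = 0} \<in> null_sets lborel"
    by (rule null_sets_hyperplane) (simp add: axis_eq_0_iff)
  ultimately have "A \<inter> B \<in> null_sets lborel"
    by (rule null_sets_subset[rotated 2]) (use AB in \<open>auto simp: borel_compact\<close>)
  then have "measure lborel (A \<inter> B) = 0" by (simp add: measure_eq_0_null_sets)
  moreover have "measure lborel (A \<union> B) = measure lborel A + measure lborel B - measure lborel (A \<inter> B)"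
    using AB by (intro measure_Un3) (auto simp: fmeasurable_compact)
  ultimately have vol: "measure lborel K = measure lborel A + measure lborel B" by (simp add: KAB)
  have i: "integrable lborel (\<lambda>x. indicat_real S x *\<^sub>R (x $ j)\<^sup>2)" if "compact S" for S :: "(real ^ 'n) set"
    by (rule borel_integrable_compact[OF that]) (intro continuous_intros)
  have "(LINT x:K|lborel. (x $ j)\<^sup>2) \<le> (LINT x|lborel. indicat_real A x *\<^sub>R (x $ j)\<^sup>2 + indicat_real B x *\<^sub>R (x $ j)\<^sup>2)"
    unfolding set_lebesgue_integral_def
  proof (rule integral_mono)
    show "integrable lborel (\<lambda>x. indicat_real K x *\<^sub>R (x $ j)\<^sup>2)" by (rule i[OF K(1)])
    show "integrable lborel (\<lambda>x. indicat_real A x *\<^sub>R (x $ j)\<^sup>2 + indicat_real B x *\<^sub>R (x $ j)\<^sup>2)"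
      by (intro Bochner_Integration.integrable_add i AB)
  qed (auto simp: KAB indicator_def)
  also have "\<dots> = (LINT x:A|lborel. (x $ j)\<^sup>2) + (LINT x:B|lborel. (x $ j)\<^sup>2)"
    unfolding set_lebesgue_integral_def using i AB by simp
  finally have "(D + 1) * (D + 2) * (LINT x:K|lborel. (x $ j)\<^sup>2)
     \<le> (D + 1) * (D + 2) * ((LINT x:A|lborel. (x $ j)\<^sup>2) + (LINT x:B|lborel. (x $ j)\<^sup>2))"
    by (rule mult_left_mono) (simp add: D_def)
  also have "\<dots> = (D + 1) * (D + 2) * (LINT x:A|lborel. (x $ j)\<^sup>2) + (D + 1) * (D + 2) * (LINT x:B|lborel. (x $ j)\<^sup>2)"
    by (simp only: distrib_left)
  also have "\<dots> \<le> 2 * measure lborel A + 2 * measure lborel B"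
    unfolding A_def B_def by (intro add_mono half[OF refl]) auto
  finally show ?thesis by (simp add: vol K_def[symmetric])
qed

text \<open>
  Compress the \<open>j\<close>-th coordinate by \<open>t\<close>: on the part of the box that is left out, the coordinate is
  at least \<open>t * h $ j\<close> in absolute value. The limit \<open>t \<longrightarrow> 1\<close> gives the claim.
\<close>

lemma box_second_moment:
  fixes h :: "real ^ 'n::finite"
  assumes h: "\<And>i. 0 < h $ i"
  shows "(h $ j)\<^sup>2 * measure lborel (cbox (- h) h) \<le> 3 * (LINT x:cbox (- h) h|lborel. (x $ j)\<^sup>2)"
proof -
  define B where "B = cbox (- h) h"
  define I where "I = (LINT x:B|lborel. (x $ j)\<^sup>2)"
  define V where "V = measure lborel B"
  have cB: "compact B" by (simp add: B_def)
  have memB: "x \<in> B \<longleftrightarrow> (\<forall>i. \<bar>x $ i\<bar> \<le> h $ i)" for x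
    by (auto simp: B_def mem_box_cart abs_le_iff) (metis minus_le_iff)+
  have le: "t\<^sup>2 * (h $ j)\<^sup>2 * V \<le> (\<Sum>k<3. t ^ k) * I" if t: "0 < t" "t < 1" for t
  proof -
    define c where "c = (\<lambda>b :: real ^ 'n. if b = axis j 1 then t else 1)"
    define T where "T = (\<lambda>x :: real ^ 'n. 0 + (\<Sum>b\<in>Basis. (c b * (x \<bullet> b)) *\<^sub>R b))"
    have Tnth: "T x $ i = (if i = j then t else 1) * x $ i" for x i
    proof -
      have "T x $ i = T x \<bullet> axis i 1" by (simp add: inner_axis)
      also have "\<dots> = c (axis i 1) * (x \<bullet> axis i 1)"
      proof -
        have "axis i 1 \<in> (Basis :: (real ^ 'n) set)" by (simp add: axis_in_Basis_iff)
        then show ?thesis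
          by (simp add: T_def inner_sum_left inner_Basis if_distrib sum.delta cong: if_cong)
      qed
      also have "\<dots> = (if i = j then t else 1) * x $ i" by (simp add: c_def inner_axis axis_eq_axis)
      finally show ?thesis .
    qed
    have pc: "(\<Prod>b\<in>Basis. \<bar>c b\<bar>) = t"
    proof -
      have ax: "axis j 1 \<in> (Basis :: (real ^ 'n) set)" by (simp add: axis_in_Basis_iff)
      have "(\<Prod>b\<in>Basis. \<bar>c b\<bar>) = \<bar>c (axis j 1)\<bar> * (\<Prod>b\<in>Basis - {axis j 1}. \<bar>c b\<bar>)"
        by (rule prod.remove) (use ax in auto)
      also have "(\<Prod>b\<in>Basis - {axis j 1}. \<bar>c b\<bar>) = 1" by (rule prod.neutral) (auto simp: c_def)
      finally show ?thesis using t by (simp add: c_def)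
    qed
    have TB: "T ` B = B \<inter> {x. \<bar>x $ j\<bar> \<le> t * h $ j}"
    proof (rule set_eqI, rule iffI)
      fix z assume "z \<in> T ` B"
      then obtain x where x: "x \<in> B" "z = T x" by auto
      have "\<bar>z $ i\<bar> \<le> h $ i" for i
      proof -
        have "\<bar>z $ i\<bar> \<le> \<bar>x $ i\<bar>" using t unfolding x(2) Tnth by (auto simp: abs_mult mult_left_le_one_le)
        then show ?thesis using x(1) memB by (meson order_trans)
      qed
      moreover have "\<bar>z $ j\<bar> \<le> t * h $ j" using t x(1) unfolding x(2) Tnth by (simp add: abs_mult memB)
      ultimately show "z \<in> B \<inter> {x. \<bar>x $ j\<bar> \<le> t * h $ j}" by (simp add: memB)
    next
      fix z assume z: "z \<in> B \<inter> {x. \<bar>x $ j\<bar> \<le> t * h $ j}"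
      define x where "x = (\<chi> i. (if i = j then 1 / t else 1) * z $ i)"
      have "T x = z" using t by (simp add: vec_eq_iff Tnth x_def)
      moreover have "x \<in> B" using z t by (auto simp: memB x_def abs_mult field_simps)
      ultimately show "z \<in> T ` B" by blast
    qed
    have cT: "compact (T ` B)" unfolding TB using cB
      by (intro compact_Int_closed closed_Collect_le continuous_intros)
    have scale: "(LINT x:T ` B|lborel. \<psi> x) = t * (LINT x:B|lborel. \<psi> (T x))"
      if "continuous_on (T ` B) \<psi>" for \<psi> :: "real ^ 'n \<Rightarrow> real"
    proof -
      have c0: "c b \<noteq> 0" for b using t by (simp add: c_def)
      show ?thesis
        using set_integral_diagonal_affine[OF c0 cB that[unfolded T_def]] by (simp only: pc T_def)
    qed
    have v: "measure lborel (T ` B) = t * V"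
      using scale[of "\<lambda>_. 1"] set_integral_const_compact[OF cT, of 1] set_integral_const_compact[OF cB, of 1]
      by (simp add: V_def)
    have s: "(LINT x:T ` B|lborel. (x $ j)\<^sup>2) = t ^ 3 * I"
    proof -
      have "(LINT x:T ` B|lborel. (x $ j)\<^sup>2) = t * (LINT x:B|lborel. t\<^sup>2 * (x $ j)\<^sup>2)"
        by (subst scale) (auto intro!: continuous_intros simp: Tnth power_mult_distrib)
      then show ?thesis by (simp add: I_def power2_eq_square power3_eq_cube)
    qed
    have i: "integrable lborel (\<lambda>x. indicat_real S x *\<^sub>R (x $ j)\<^sup>2)" if "compact S" for S :: "(real ^ 'n) set"
      by (rule borel_integrable_compact[OF that]) (intro continuous_intros)
    have i1: "integrable lborel (indicat_real S)" if "compact S" for S :: "(real ^ 'n) set"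
      using borel_integrable_compact[OF that, of "\<lambda>_. 1::real"] by simp
    have "(t * h $ j)\<^sup>2 * (V - t * V) = (LINT x|lborel. (t * h $ j)\<^sup>2 * (indicat_real B x - indicat_real (T ` B) x))"
      using i1[OF cB] i1[OF cT] cB cT v by (simp add: V_def borel_compact)
    also have "\<dots> \<le> (LINT x|lborel. indicat_real B x *\<^sub>R (x $ j)\<^sup>2 - indicat_real (T ` B) x *\<^sub>R (x $ j)\<^sup>2)"
    proof (rule integral_mono)
      fix x
      have "(t * h $ j)\<^sup>2 \<le> (x $ j)\<^sup>2" if "x \<in> B" "x \<notin> T ` B"
      proof -
        have "\<bar>t * h $ j\<bar> \<le> \<bar>x $ j\<bar>" using that TB t h[of j] by (auto simp: abs_mult)
        then show ?thesis by (simp only: abs_le_square_iff)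
      qed
      then show "(t * h $ j)\<^sup>2 * (indicat_real B x - indicat_real (T ` B) x)
        \<le> indicat_real B x *\<^sub>R (x $ j)\<^sup>2 - indicat_real (T ` B) x *\<^sub>R (x $ j)\<^sup>2"
        using TB by (auto simp: indicator_def)
    qed (use i[OF cB] i[OF cT] i1[OF cB] i1[OF cT] in simp_all)
    also have "\<dots> = I - t ^ 3 * I"
      using i[OF cB] i[OF cT] s by (simp add: I_def set_lebesgue_integral_def)
    finally have "(t * h $ j)\<^sup>2 * (V - t * V) \<le> (1 - t ^ 3) * I" by (simp add: algebra_simps)
    also have "\<dots> = (1 - t) * ((\<Sum>k<3. t ^ k) * I)" by (simp add: one_diff_power_eq)
    finally have "(1 - t) * (t\<^sup>2 * (h $ j)\<^sup>2 * V) \<le> (1 - t) * ((\<Sum>k<3. t ^ k) * I)"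
      by (simp add: power_mult_distrib algebra_simps)
    then show ?thesis using t by simp
  qed
  have "((\<lambda>t. (\<Sum>k<3. t ^ k) * I - t\<^sup>2 * (h $ j)\<^sup>2 * V) \<longlongrightarrow> (\<Sum>k<3. 1 ^ k) * I - 1\<^sup>2 * (h $ j)\<^sup>2 * V) (at_left 1)"
    by (intro tendsto_intros)
  moreover have "\<forall>\<^sub>F t in at_left (1::real). t \<in> {0<..<1}" by (rule eventually_at_left_real) simp
  then have "\<forall>\<^sub>F t in at_left (1::real). 0 \<le> (\<Sum>k<3. t ^ k) * I - t\<^sup>2 * (h $ j)\<^sup>2 * V"
    by eventually_elim (use le in auto)
  ultimately have "0 \<le> (\<Sum>k<3. 1 ^ k) * I - 1\<^sup>2 * (h $ j)\<^sup>2 * V" by (rule tendsto_lowerbound) simp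
  then show ?thesis by (simp add: I_def V_def B_def)
qed

section \<open>Projective transformations in homogeneous coordinates\<close>

definition denominator :: "real ^ 'n::finite \<Rightarrow> real ^ 'n \<Rightarrow> real ^ 'n \<Rightarrow> real" where
  "denominator p c x = 1 + c \<bullet> (x - p)"

text \<open>
  The representative of its class modulo affine maps that sends \<open>p\<close> to the origin, with derivative
  the identity at \<open>p\<close>.
\<close>

definition centred_map :: "real ^ 'n::finite \<Rightarrow> real ^ 'n \<Rightarrow> real ^ 'n \<Rightarrow> real ^ 'n" where
  "centred_map p c x = inverse (denominator p c x) *\<^sub>R (x - p)"

text \<open>
  Up to a factor depending only on the transformation, the volume of the image of \<open>K\<close>; the exponent
  is that of the Jacobian determinant of a projective map in dimension \<open>d\<close>.
\<close>

definition weighted_volume :: "real ^ 'n::finite \<Rightarrow> real ^ 'n \<Rightarrow> (real ^ 'n) set \<Rightarrow> real" where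
  "weighted_volume p c K = (LINT x:K|lborel. 1 / denominator p c x ^ Suc CARD('n))"

text \<open>
  The centroid of the image of \<open>K\<close> under \<open>centred_map p c\<close>, pulled back to \<open>K\<close>.
\<close>

definition weighted_moment :: "real ^ 'n::finite \<Rightarrow> real ^ 'n \<Rightarrow> (real ^ 'n) set \<Rightarrow> real ^ 'n" where
  "weighted_moment p c K = inverse (weighted_volume p c K) *\<^sub>R
     (LINT x:K|lborel. inverse (denominator p c x ^ Suc CARD('n)) *\<^sub>R centred_map p c x)"

definition represents :: "(real \<times> (real ^ 'n::finite) \<Rightarrow> real \<times> (real ^ 'n)) \<Rightarrow> ('n rproj \<Rightarrow> 'n rproj) \<Rightarrow> bool" where
  "represents T \<phi> \<longleftrightarrow> linear T \<and> bij T \<and> (\<forall>P. Rep_rproj (\<phi> P) = T ` Rep_rproj P)"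

lemma continuous_denominator: "continuous_on A (denominator p c)"
  unfolding denominator_def by (intro continuous_intros)

lemma denominator_center [simp]: "denominator p c p = 1"
  by (simp add: denominator_def)

lemma line_image:
  fixes T :: "real \<times> (real ^ 'n::finite) \<Rightarrow> real \<times> (real ^ 'n)"
  assumes "linear T" "bij T" "subspace L" "dim L = 1"
  shows "subspace (T ` L)" "dim (T ` L) = 1"
  using assms linear_subspace_image[of T L] dim_image_eq[of T L]
  by (auto simp: bij_is_inj inj_on_subset[OF bij_is_inj])

lemma represents_exists:
  fixes T :: "real \<times> (real ^ 'n::finite) \<Rightarrow> real \<times> (real ^ 'n)"
  assumes "linear T" "bij T"
  obtains \<phi> where "represents T \<phi>"
proof
  show "represents T (\<lambda>P. Abs_rproj (T ` Rep_rproj P))"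
    unfolding represents_def
  proof (intro conjI assms allI)
    fix P :: "'n rproj"
    have "subspace (Rep_rproj P)" "dim (Rep_rproj P) = 1" using Rep_rproj[of P] by auto
    from line_image[OF assms this]
    show "Rep_rproj (Abs_rproj (T ` Rep_rproj P)) = T ` Rep_rproj P"
      by (intro Abs_rproj_inverse) simp
  qed
qed

lemma chart_inj: "chart x = chart y \<longleftrightarrow> x = y"
proof
  assume "chart x = chart y"
  then have "span {(1::real, x)} = span {(1, y)}" by (metis Rep_chart)
  then have "(1::real, x) \<in> span {(1, y)}" by (metis insertI1 span_base)
  then obtain k where "(1::real, x) = k *\<^sub>R (1, y)" by (auto simp: span_singleton)
  then show "x = y" by simp
qed simp

lemma represents_chart:
  fixes T :: "real \<times> (real ^ 'n::finite) \<Rightarrow> real \<times> (real ^ 'n)"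
  assumes "represents T \<phi>"
  shows "Rep_rproj (\<phi> (chart x)) = span {T (1, x)}"
  using assms by (simp add: represents_def Rep_chart linear_span_image[symmetric])

lemma represents_chart_eq:
  assumes T: "represents T \<phi>" and ne: "fst (T (1, x)) \<noteq> 0"
  shows "\<phi> (chart x) = chart (inverse (fst (T (1, x))) *\<^sub>R snd (T (1, x)))"
proof -
  define f where "f = fst (T (1, x))"
  have f: "f \<noteq> 0" using ne by (simp add: f_def)
  have "T (1, x) = f *\<^sub>R (1::real, inverse f *\<^sub>R snd (T (1, x)))"
    using f by (simp add: f_def prod_eq_iff)
  then have "span {T (1, x)} = span {f *\<^sub>R (1::real, inverse f *\<^sub>R snd (T (1, x)))}" by simp
  also have "\<dots> = span {(1::real, inverse f *\<^sub>R snd (T (1, x)))}"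
  proof (rule set_eqI)
    fix z show "z \<in> span {f *\<^sub>R (1::real, inverse f *\<^sub>R snd (T (1, x)))} \<longleftrightarrow> z \<in> span {(1::real, inverse f *\<^sub>R snd (T (1, x)))}"
    proof
      assume "z \<in> span {f *\<^sub>R (1::real, inverse f *\<^sub>R snd (T (1, x)))}"
      then show "z \<in> span {(1::real, inverse f *\<^sub>R snd (T (1, x)))}"
        by (auto simp: span_singleton)
    next
      assume "z \<in> span {(1::real, inverse f *\<^sub>R snd (T (1, x)))}"
      then obtain k where "z = k *\<^sub>R (1::real, inverse f *\<^sub>R snd (T (1, x)))" by (auto simp: span_singleton)
      then have "z = (k / f) *\<^sub>R (f *\<^sub>R (1::real, inverse f *\<^sub>R snd (T (1, x))))" using f by (simp add: divide_inverse)
      then show "z \<in> span {f *\<^sub>R (1::real, inverse f *\<^sub>R snd (T (1, x)))}" unfolding span_singleton by blast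
    qed
  qed
  finally have "Rep_rproj (\<phi> (chart x)) = Rep_rproj (chart (inverse f *\<^sub>R snd (T (1, x))))"
    by (simp add: represents_chart[OF T] Rep_chart)
  then show ?thesis by (simp add: Rep_rproj_inject f_def)
qed

lemma represents_chart_finite:
  assumes T: "represents T \<phi>" and "\<phi> (chart x) \<in> range chart"
  shows "fst (T (1, x)) \<noteq> 0"
proof
  assume z: "fst (T (1, x)) = 0"
  obtain y where "\<phi> (chart x) = chart y" using assms(2) by auto
  then have "span {T (1, x)} = span {(1, y)}" using represents_chart[OF T, of x] by (simp add: Rep_chart)
  then have "(1, y) \<in> span {T (1, x)}" by (metis insertI1 span_base)
  then obtain k where "(1, y) = k *\<^sub>R T (1, x)" by (auto simp: span_singleton)
  then have "1 = k * fst (T (1, x))" by (metis fst_conv fst_scaleR real_scaleR_def)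
  then show False using z by simp
qed

lemma represents_chart_image:
  assumes T: "represents T \<phi>" and ne: "\<And>x. x \<in> K \<Longrightarrow> fst (T (1, x)) \<noteq> 0"
  shows "chart_image \<phi> K = (\<lambda>x. inverse (fst (T (1, x))) *\<^sub>R snd (T (1, x))) ` K"
proof -
  have "\<phi> ` chart ` K = chart ` (\<lambda>x. inverse (fst (T (1, x))) *\<^sub>R snd (T (1, x))) ` K"
    using represents_chart_eq[OF T ne] by (auto simp: image_iff)
  then show ?thesis unfolding chart_image_def by (auto simp: chart_inj)
qed

lemma represents_scale:
  fixes T :: "real \<times> (real ^ 'n::finite) \<Rightarrow> real \<times> (real ^ 'n)"
  assumes T: "represents T \<phi>" and k: "k \<noteq> 0"
  shows "represents (\<lambda>z. k *\<^sub>R T z) \<phi>"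
proof -
  have lin: "linear T" and bij: "bij T" and im: "\<And>P. Rep_rproj (\<phi> P) = T ` Rep_rproj P"
    using T by (auto simp: represents_def)
  have lin': "linear (\<lambda>z. k *\<^sub>R T z)" using lin by (rule linear_compose_scale_right)
  have "bij (\<lambda>z::real \<times> (real ^ 'n). k *\<^sub>R z)"
    by (rule o_bij[of "\<lambda>z. inverse k *\<^sub>R z"]) (use k in \<open>simp_all add: fun_eq_iff\<close>)
  from bij_comp[OF bij this] have "bij ((\<lambda>z. k *\<^sub>R z) \<circ> T)" .
  then have bij': "bij (\<lambda>z. k *\<^sub>R T z)" by (simp add: comp_def)
  have "Rep_rproj (\<phi> P) = (\<lambda>z. k *\<^sub>R T z) ` Rep_rproj P" for P
  proof -
    have sub: "subspace (Rep_rproj P)" using Rep_rproj[of P] by auto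
    have "(\<lambda>z. k *\<^sub>R z) ` Rep_rproj P = Rep_rproj P"
    proof
      show "(\<lambda>z. k *\<^sub>R z) ` Rep_rproj P \<subseteq> Rep_rproj P"
        by (rule image_subsetI) (rule subspace_scale[OF sub])
      show "Rep_rproj P \<subseteq> (\<lambda>z. k *\<^sub>R z) ` Rep_rproj P"
      proof
        fix z assume "z \<in> Rep_rproj P"
        then have "inverse k *\<^sub>R z \<in> Rep_rproj P" using sub by (simp add: subspace_scale)
        moreover have "z = k *\<^sub>R (inverse k *\<^sub>R z)" using k by simp
        ultimately show "z \<in> (\<lambda>z. k *\<^sub>R z) ` Rep_rproj P" by blast
      qed
    qed
    then have "T ` Rep_rproj P = T ` (\<lambda>z. k *\<^sub>R z) ` Rep_rproj P" by simp
    also have "\<dots> = (\<lambda>z. k *\<^sub>R T z) ` Rep_rproj P"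
      by (simp add: image_image linear_scale[OF lin])
    finally show ?thesis by (simp add: im)
  qed
  then show ?thesis using lin' bij' by (simp add: represents_def)
qed

lemma linear_pair_expand:
  fixes T :: "real \<times> (real ^ 'n::finite) \<Rightarrow> real \<times> (real ^ 'n)"
  assumes "linear T"
  shows "T (1, x) = T (1, p) + T (0, x - p)"
  using linear_add[OF assms, of "(1, p)" "(0, x - p)"] by simp

text \<open>
  The first coordinate of \<open>T (1, x)\<close> is affine in \<open>x\<close>, hence of this form as soon as it equals \<open>1\<close>
  at \<open>p\<close>.
\<close>

lemma represents_denominator:
  fixes T :: "real \<times> (real ^ 'n::finite) \<Rightarrow> real \<times> (real ^ 'n)"
  assumes "linear T" "fst (T (1, p)) = 1"
  obtains c where "\<And>x. fst (T (1, x)) = denominator p c x"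
proof -
  define l where "l = (\<lambda>z. fst (T (0, z)))"
  have "linear l"
  proof (rule linearI)
    show "l (x + y) = l x + l y" for x y
      using linear_add[OF assms(1), of "(0, x)" "(0, y)"] by (simp add: l_def)
    show "l (k *\<^sub>R x) = k *\<^sub>R l x" for k x
      using linear_scale[OF assms(1), of k "(0, x)"] by (simp add: l_def)
  qed
  then have "l z = z \<bullet> adjoint l 1" for z
    using adjoint_works[of l z 1] by simp
  note lz = this
  have "fst (T (1, x)) = denominator p (adjoint l 1) x" for x
  proof -
    have "fst (T (1, x)) = 1 + l (x - p)"
      using arg_cong[OF linear_pair_expand[OF assms(1), of x p], of fst] assms(2)
      by (simp only: fst_add l_def)
    also have "l (x - p) = adjoint l 1 \<bullet> (x - p)" using lz[of "x - p"] by (simp only: inner_commute)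
    finally show ?thesis by (simp only: denominator_def)
  qed
  then show thesis by (rule that)
qed

text \<open>
  A point is sent to infinity exactly where the first homogeneous coordinate of its image vanishes.
  Rescaling \<open>T\<close> makes this coordinate \<open>1\<close> at \<open>p\<close>; since it has no zero on the segment from \<open>p\<close> to
  any point of the convex set \<open>K\<close>, it stays positive.
\<close>

lemma admissible_normal_form:
  fixes \<phi> :: "'n::finite rproj \<Rightarrow> 'n rproj"
  assumes \<phi>: "projective_transformation \<phi>" "admissible \<phi> K" and K: "convex K" "p \<in> K"
  obtains T c where "represents T \<phi>" "\<And>x. fst (T (1, x)) = denominator p c x"
    "\<And>x. x \<in> K \<Longrightarrow> 0 < denominator p c x"
proof -
  have "\<exists>T0. represents T0 \<phi>"
    using \<phi>(1) unfolding projective_transformation_def represents_def .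
  then obtain T0 where T0: "represents T0 \<phi>" ..
  have fin: "\<phi> (chart x) \<in> range chart" if "x \<in> K" for x
  proof -
    have "convex hull K = K" using K(1) by (rule hull_same)
    then show ?thesis using \<phi>(2) that unfolding admissible_def by blast
  qed
  define k where "k = inverse (fst (T0 (1, p)))"
  have k0: "fst (T0 (1, p)) \<noteq> 0" by (rule represents_chart_finite[OF T0 fin[OF K(2)]])
  define T where "T = (\<lambda>z. k *\<^sub>R T0 z)"
  have T: "represents T \<phi>" unfolding T_def by (rule represents_scale[OF T0]) (use k0 in \<open>simp add: k_def\<close>)
  have "fst (T (1, p)) = 1" using k0 by (simp add: T_def k_def)
  then obtain c where c: "\<And>x. fst (T (1, x)) = denominator p c x"
    using represents_denominator T unfolding represents_def by metis
  have "0 < denominator p c x" if x: "x \<in> K" for x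
  proof (rule ccontr)
    assume n: "\<not> 0 < denominator p c x"
    \<comment> \<open>The denominator, affine on the segment from \<open>p\<close> to \<open>x\<close>, would vanish at the parameter \<open>s\<close>.\<close>
    define s where "s = 1 / (1 - denominator p c x)"
    have s: "0 \<le> s" "s \<le> 1" using n by (auto simp: s_def)
    define z where "z = (1 - s) *\<^sub>R p + s *\<^sub>R x"
    have "z \<in> K" unfolding z_def using K x s by (intro convexD) auto
    have "z - p = s *\<^sub>R (x - p)" by (simp add: z_def algebra_simps)
    then have "denominator p c z = 1 + s * (denominator p c x - 1)" by (simp add: denominator_def)
    also have "\<dots> = 0" using n by (simp add: s_def field_simps)
    finally show False using represents_chart_finite[OF T fin[OF \<open>z \<in> K\<close>]] c by simp
  qed
  then show thesis using that T c by blast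
qed

text \<open>
  A transformation with the given denominator is the centred map followed by the affine map
  \<open>y \<mapsto> q + B y\<close>, and the centroid commutes with affine maps. The pair \<open>B, q\<close> is chosen before \<open>K\<close>,
  so the same affine map serves for both bodies.
\<close>

lemma centroid_represented:
  fixes T :: "real \<times> (real ^ 'n::finite) \<Rightarrow> real \<times> (real ^ 'n)"
  assumes T: "represents T \<phi>" and c: "\<And>x. fst (T (1, x)) = denominator p c x"
  obtains B q where "linear B" "inj B"
    "\<And>K. compact K \<Longrightarrow> 0 < measure lborel K \<Longrightarrow> (\<And>x. x \<in> K \<Longrightarrow> 0 < denominator p c x) \<Longrightarrow>
       centroid (chart_image \<phi> K) = q + B (weighted_moment p c K)"
proof -
  have lin: "linear T" and bij: "bij T" using T by (auto simp: represents_def)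
  \<comment> \<open>Obtained from \<open>snd (T (1, x)) = q + snd (T (0, x - p))\<close> by subtracting \<open>q\<close> times the denominator.\<close>
  define q where "q = snd (T (1, p))"
  define B where "B = (\<lambda>y. snd (T (0, y)) - (c \<bullet> y) *\<^sub>R q)"
  have fT0: "fst (T (0, y)) = c \<bullet> y" for y
    using c[of "p + y"] linear_pair_expand[OF lin, of "p + y" p] c[of p] by (simp add: denominator_def)
  have linB: "linear B"
  proof (rule linearI)
    show "B (x + y) = B x + B y" for x y
      using linear_add[OF lin, of "(0, x)" "(0, y)"] by (simp add: B_def inner_add_right algebra_simps)
    show "B (k *\<^sub>R x) = k *\<^sub>R B x" for k x
      using linear_scale[OF lin, of k "(0, x)"] by (simp add: B_def algebra_simps)
  qed
  have injB: "inj B"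
  proof (rule linear_injective_0[OF linB, THEN iffD2], intro allI impI)
    fix y assume "B y = 0"
    then have "snd (T (0, y)) = (c \<bullet> y) *\<^sub>R q" by (simp add: B_def)
    then have "T (0, y) = (c \<bullet> y) *\<^sub>R T (1, p)" by (simp add: prod_eq_iff fT0 q_def c)
    also have "\<dots> = T ((c \<bullet> y) *\<^sub>R (1, p))" by (simp only: linear_scale[OF lin])
    finally have "(0, y) = (c \<bullet> y) *\<^sub>R (1::real, p)" by (rule injD[OF bij_is_inj[OF bij]])
    then show "y = 0" by auto
  qed
  define P where "P = (\<lambda>x. inverse (fst (T (1, x))) *\<^sub>R snd (T (1, x)))"
  have P: "P x = q + B (centred_map p c x)" if "denominator p c x \<noteq> 0" for x
  proof -
    define f where "f = denominator p c x"
    have f: "f \<noteq> 0" using that by (simp add: f_def)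
    have "snd (T (1, x)) = q + snd (T (0, x - p))"
      using linear_pair_expand[OF lin, of x p] by (simp add: q_def)
    then have e1: "P x = inverse f *\<^sub>R q + inverse f *\<^sub>R snd (T (0, x - p))"
      by (simp add: P_def c f_def scaleR_add_right)
    have e2: "inverse f *\<^sub>R snd (T (0, x - p)) = snd (T (0, centred_map p c x))"
      using linear_scale[OF lin, of "inverse f" "(0, x - p)"] by (simp add: centred_map_def f_def)
    have e3: "inverse f = 1 - c \<bullet> centred_map p c x"
    proof -
      have "c \<bullet> centred_map p c x = inverse f * (f - 1)"
        by (simp add: centred_map_def f_def denominator_def)
      then show ?thesis using f by (simp add: right_diff_distrib)
    qed
    have "P x = (1 - c \<bullet> centred_map p c x) *\<^sub>R q + snd (T (0, centred_map p c x))"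
      unfolding e1 e2 unfolding e3 ..
    then show ?thesis by (simp add: B_def algebra_simps)
  qed
  have "centroid (chart_image \<phi> K) = q + B (weighted_moment p c K)"
    if K: "compact K" "0 < measure lborel K" and pos: "\<And>x. x \<in> K \<Longrightarrow> 0 < denominator p c x" for K
  proof -
    have pos': "0 < fst (T (1, x))" if "x \<in> K" for x using pos[OF that] c by simp
    have im: "chart_image \<phi> K = P ` K" unfolding P_def
      by (rule represents_chart_image[OF T]) (use pos' in force)
    have cd: "continuous_on K (denominator p c)" by (rule continuous_denominator)
    have cinv: "continuous_on K (\<lambda>x. inverse (denominator p c x ^ Suc CARD('n)))"
      by (intro continuous_intros cd ballI) (metis less_irrefl pos power_eq_0_iff)
    have c\<pi>: "continuous_on K (centred_map p c)"
      unfolding centred_map_def by (intro continuous_intros cd ballI) (metis less_irrefl pos)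
    have cP: "continuous_on K P"
    proof -
      have "continuous_on K (\<lambda>x. q + B (centred_map p c x))"
        by (intro continuous_intros continuous_on_compose2[OF linear_continuous_on[of B UNIV] c\<pi>])
          (use linB in \<open>auto simp: linear_conv_bounded_linear\<close>)
      then show ?thesis
      proof (rule continuous_on_eq)
        fix x assume "x \<in> K"
        then show "q + B (centred_map p c x) = P x" using P[of x] pos[of x] by simp
      qed
    qed
    obtain k where k: "k > 0" and cov: "\<And>F :: real^'n \<Rightarrow> real. continuous_on (P ` K) F \<Longrightarrow>
      (LINT y:P ` K|lborel. F y) = k * (LINT x:K|lborel. F (P x) / fst (T (1, x)) ^ Suc CARD('n))"
      using set_integral_projective[OF lin bij K(1) pos'] unfolding P_def by blast
    have cPK: "compact (P ` K)" by (rule compact_continuous_image[OF cP K(1)])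
    define W where "W = weighted_volume p c K"
    have "W > 0" unfolding W_def weighted_volume_def
      by (rule set_integral_pos_compact) (use K pos cinv in \<open>auto simp: divide_inverse\<close>)
    have vol: "measure lborel (P ` K) = k * W"
      using cov[of "\<lambda>_. 1"] set_integral_const_compact[OF cPK, of 1]
      by (simp add: W_def weighted_volume_def c)
    define M where "M = (LINT x:K|lborel. inverse (denominator p c x ^ Suc CARD('n)) *\<^sub>R centred_map p c x)"
    have cM: "continuous_on K (\<lambda>x. inverse (denominator p c x ^ Suc CARD('n)) *\<^sub>R centred_map p c x)"
      by (intro continuous_intros cinv c\<pi>)
    have key: "w \<bullet> centroid (P ` K) = w \<bullet> (q + B (inverse W *\<^sub>R M))" for w
    proof -
      have "w \<bullet> centroid (P ` K) = (1 / (k * W)) * (w \<bullet> (LINT y:P ` K|lborel. y))"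
        by (simp add: centroid_def vol)
      also have "w \<bullet> (LINT y:P ` K|lborel. y) = (LINT y:P ` K|lborel. w \<bullet> y)"
        by (rule inner_set_integral[OF cPK]) (intro continuous_intros)
      also have "\<dots> = k * (LINT x:K|lborel. (w \<bullet> P x) / fst (T (1, x)) ^ Suc CARD('n))"
        by (rule cov) (intro continuous_intros)
      also have "(LINT x:K|lborel. (w \<bullet> P x) / fst (T (1, x)) ^ Suc CARD('n))
         = (LINT x:K|lborel. (w \<bullet> q) * inverse (denominator p c x ^ Suc CARD('n)) +
              adjoint B w \<bullet> (inverse (denominator p c x ^ Suc CARD('n)) *\<^sub>R centred_map p c x))"
      proof (rule set_lebesgue_integral_cong)
        show "\<forall>x. x \<in> K \<longrightarrow> (w \<bullet> P x) / fst (T (1, x)) ^ Suc CARD('n) = (w \<bullet> q) * inverse (denominator p c x ^ Suc CARD('n)) +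
              adjoint B w \<bullet> (inverse (denominator p c x ^ Suc CARD('n)) *\<^sub>R centred_map p c x)"
        proof (intro allI impI)
          fix x assume x: "x \<in> K"
          then have "w \<bullet> P x = w \<bullet> q + adjoint B w \<bullet> centred_map p c x"
            using P[of x] pos[OF x] adjoint_works[OF linB, of "centred_map p c x" w]
            by (simp add: inner_add_right inner_commute)
          then show "(w \<bullet> P x) / fst (T (1, x)) ^ Suc CARD('n) = (w \<bullet> q) * inverse (denominator p c x ^ Suc CARD('n)) +
              adjoint B w \<bullet> (inverse (denominator p c x ^ Suc CARD('n)) *\<^sub>R centred_map p c x)"
            by (simp add: c divide_inverse distrib_right)
        qed
      qed (use K(1) in \<open>simp add: borel_compact\<close>)
      also have "\<dots> = (LINT x:K|lborel. (w \<bullet> q) * inverse (denominator p c x ^ Suc CARD('n)))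
         + (LINT x:K|lborel. adjoint B w \<bullet> (inverse (denominator p c x ^ Suc CARD('n)) *\<^sub>R centred_map p c x))"
        by (rule set_integral_add(2)) (intro set_integrable_compact K(1) continuous_intros cinv cM)+
      also have "(LINT x:K|lborel. (w \<bullet> q) * inverse (denominator p c x ^ Suc CARD('n))) = (w \<bullet> q) * W"
        by (simp add: W_def weighted_volume_def divide_inverse)
      also have "(LINT x:K|lborel. adjoint B w \<bullet> (inverse (denominator p c x ^ Suc CARD('n)) *\<^sub>R centred_map p c x)) = adjoint B w \<bullet> M"
        unfolding M_def by (rule inner_set_integral[OF K(1) cM, symmetric])
      also have "adjoint B w \<bullet> M = w \<bullet> B M" using adjoint_works[OF linB, of M w] by (simp add: inner_commute)
      also have "1 / (k * W) * (k * ((w \<bullet> q) * W + w \<bullet> B M)) = w \<bullet> (q + B (inverse W *\<^sub>R M))"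
        using k \<open>W > 0\<close> by (simp add: inner_add_right linear_scale[OF linB] field_simps)
      finally show ?thesis .
    qed
    then have "\<forall>w. w \<bullet> centroid (P ` K) = w \<bullet> (q + B (inverse W *\<^sub>R M))" by blast
    then have "centroid (P ` K) = q + B (inverse W *\<^sub>R M)" using vector_eq_ldot by blast
    then show ?thesis by (simp add: im weighted_moment_def W_def M_def)
  qed
  with linB injB show thesis using that by blast
qed

text \<open>
  \<open>T \<circ> inv S\<close> preserves the first coordinate, and a linear map of the homogeneous coordinates that
  does so acts on the chart by an affine map.
\<close>

lemma same_denominator_affine:
  fixes T S :: "real \<times> (real ^ 'n::finite) \<Rightarrow> real \<times> (real ^ 'n)"
  assumes T: "represents T \<phi>" and S: "represents S \<psi>"
    and eq: "\<And>x. fst (T (1, x)) = fst (S (1, x))"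
  shows "affine_transformation (\<phi> \<circ> inv \<psi>)"
proof -
  have linT: "linear T" and bijT: "bij T" and linS: "linear S" and bijS: "bij S" using T S by (auto simp: represents_def)
  have fst_eq: "fst (T z) = fst (S z)" for z
  proof -
    obtain a x where z: "z = (a, x)" by (cases z)
    have "F z = (a - 1) *\<^sub>R F (1, 0) + F (1, x)" if "linear F"
      for F :: "real \<times> (real ^ 'n) \<Rightarrow> real \<times> (real ^ 'n)"
      using linear_add[OF that, of "(a - 1) *\<^sub>R (1, 0)" "(1, x)"] linear_scale[OF that, of "a - 1" "(1, 0)"]
      by (simp add: z)
    from this[OF linT] this[OF linS] show ?thesis using eq by simp
  qed
  define S' where "S' = inv S"
  have S': "linear S'" unfolding S'_def using linS bijS by (meson bij_is_inj bij_is_surj inj_linear_imp_inv_linear)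
  have SS: "S (S' z) = z" "S' (S z) = z" for z
    using bijS by (auto simp: S'_def bij_is_surj surj_f_inv_f bij_is_inj)
  have bijS': "bij S'" unfolding S'_def by (rule bij_imp_bij_inv[OF bijS])
  obtain \<psi>' where \<psi>': "represents S' \<psi>'" using represents_exists[OF S' bijS'] .
  have "\<psi> (\<psi>' P) = P" for P
  proof -
    have "Rep_rproj (\<psi> (\<psi>' P)) = S ` S' ` Rep_rproj P" using S \<psi>' by (simp add: represents_def)
    also have "\<dots> = Rep_rproj P" by (simp add: image_image SS)
    finally show ?thesis by (simp add: Rep_rproj_inject)
  qed
  moreover have "\<psi>' (\<psi> P) = P" for P
  proof -
    have "Rep_rproj (\<psi>' (\<psi> P)) = S' ` S ` Rep_rproj P" using S \<psi>' by (simp add: represents_def)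
    also have "\<dots> = Rep_rproj P" by (simp add: image_image SS)
    finally show ?thesis by (simp add: Rep_rproj_inject)
  qed
  ultimately have inv: "inv \<psi> = \<psi>'" by (intro inv_unique_comp) (auto simp: fun_eq_iff)
  define M where "M = T \<circ> S'"
  have linM: "linear M" unfolding M_def by (rule linear_compose[OF S' linT])
  have bijM: "bij M" unfolding M_def by (rule bij_comp[OF bijS' bijT])
  have M: "represents M (\<phi> \<circ> inv \<psi>)"
    using linM bijM T \<psi>' by (simp add: represents_def M_def inv image_image)
  have fM: "fst (M z) = fst z" for z by (simp add: M_def fst_eq SS)
  define A where "A = (\<lambda>x. snd (M (0, x)))"
  have linA: "linear A"
  proof (rule linearI)
    show "A (x + y) = A x + A y" for x y
      using linear_add[OF linM, of "(0, x)" "(0, y)"] by (simp add: A_def)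
    show "A (k *\<^sub>R x) = k *\<^sub>R A x" for k x
      using linear_scale[OF linM, of k "(0, x)"] by (simp add: A_def)
  qed
  have mA: "matrix A *v x = A x" for x using matrix_vector_mul(2)[OF linA] by metis
  have "inj A"
  proof (rule linear_injective_0[OF linA, THEN iffD2], intro allI impI)
    fix y assume "A y = 0"
    then have "M (0, y) = 0" by (simp add: A_def prod_eq_iff fM)
    then have "M (0, y) = M 0" using linear_0[OF linM] by simp
    then have "(0::real, y) = 0" by (rule injD[OF bij_is_inj[OF bijM]])
    then show "y = 0" by (simp add: zero_prod_def)
  qed
  then have invA: "invertible (matrix A)"
    unfolding invertible_left_inverse matrix_left_invertible_injective
    by (simp add: mA inj_def)
  have "(\<phi> \<circ> inv \<psi>) (chart x) = chart (matrix A *v x + snd (M (1, 0)))" for x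
  proof -
    have "fst (M (1, x)) = 1" by (simp add: fM)
    then have "(\<phi> \<circ> inv \<psi>) (chart x) = chart (snd (M (1, x)))"
      using represents_chart_eq[OF M, of x] by simp
    also have "snd (M (1, x)) = matrix A *v x + snd (M (1, 0))"
      using linear_pair_expand[OF linM, of x 0] unfolding mA by (simp add: A_def)
    finally show ?thesis .
  qed
  then show ?thesis unfolding affine_transformation_def using invA by blast
qed

lemma affine_denominator_trivial:
  assumes T: "represents T \<phi>" and c: "\<And>x. fst (T (1, x)) = denominator p c x"
    and aff: "affine_transformation \<phi>"
  shows "c = 0"
proof (rule ccontr)
  assume c0: "c \<noteq> 0"
  define x where "x = p - (1 / (c \<bullet> c)) *\<^sub>R c"
  have "denominator p c x = 0" using c0 by (simp add: denominator_def x_def)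
  moreover have "\<phi> (chart x) \<in> range chart" using aff by (auto simp: affine_transformation_def)
  ultimately show False using represents_chart_finite[OF T] c by metis
qed

lemma centred_map_realised:
  fixes p c :: "real ^ 'n::finite"
  obtains T \<phi> where "represents T \<phi>" "\<And>x. fst (T (1, x)) = denominator p c x" "\<And>x. snd (T (1, x)) = x - p"
proof -
  define T where "T = (\<lambda>(a::real, z). (a + c \<bullet> (z - a *\<^sub>R p), z - a *\<^sub>R p))"
  have T: "linear T" unfolding T_def
    by (rule linearI) (auto simp: algebra_simps inner_add_right inner_diff_right)
  have "bij T"
  proof (rule o_bij)
    show "(\<lambda>(a, z). (a - c \<bullet> z, z + (a - c \<bullet> z) *\<^sub>R p)) \<circ> T = id"
      by (auto simp: T_def fun_eq_iff algebra_simps inner_add_right inner_diff_right)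
    show "T \<circ> (\<lambda>(a, z). (a - c \<bullet> z, z + (a - c \<bullet> z) *\<^sub>R p)) = id"
      by (auto simp: T_def fun_eq_iff algebra_simps inner_add_right inner_diff_right)
  qed
  then obtain \<phi> where \<phi>: "represents T \<phi>" using represents_exists[OF T] by blast
  show thesis by (rule that[OF \<phi>]) (simp_all add: T_def denominator_def)
qed

section \<open>The ratio of the image volumes and its derivatives\<close>

text \<open>
  The moment of order \<open>k\<close> of the function \<open>w\<close> on the image of \<open>K\<close> under \<open>centred_map p c\<close>, pulled
  back to \<open>K\<close>: \<open>w\<close> pulls back to \<open>(w \<bullet> (x - p)) / denominator p c x\<close>, which raises the exponent of
  the denominator by \<open>k\<close>.
\<close>

definition directional_moment :: "real ^ 'n::finite \<Rightarrow> real ^ 'n \<Rightarrow> real ^ 'n \<Rightarrow> nat \<Rightarrow> (real ^ 'n) set \<Rightarrow> real" where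
  "directional_moment p c w k K =
     (LINT x:K|lborel. (w \<bullet> (x - p)) ^ k / denominator p c x ^ (Suc CARD('n) + k))"

lemma denominator_add: "denominator p (c + t *\<^sub>R w) x = denominator p c x + t * (w \<bullet> (x - p))"
  by (simp add: denominator_def inner_add_left)

lemma weighted_volume_pos:
  assumes "compact K" "0 < measure lborel K" "\<And>x. x \<in> K \<Longrightarrow> 0 < denominator p c x"
  shows "0 < weighted_volume p c K"
  unfolding weighted_volume_def
proof (rule set_integral_pos_compact[OF assms(1) _ _ assms(2)])
  show "continuous_on K (\<lambda>x. 1 / denominator p c x ^ Suc CARD('a))"
    by (intro continuous_intros continuous_denominator ballI) (metis assms(3) less_irrefl power_eq_0_iff)
qed (use assms(3) in auto)

lemma directional_moment_0: "directional_moment p c w 0 K = weighted_volume p c K"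
  by (simp add: directional_moment_def weighted_volume_def)

lemma inner_weighted_moment:
  assumes K: "compact K" and pos: "\<And>x. x \<in> K \<Longrightarrow> 0 < denominator p c x"
  shows "w \<bullet> weighted_moment p c K = directional_moment p c w 1 K / directional_moment p c w 0 K"
proof -
  have ne: "denominator p c x \<noteq> 0" if "x \<in> K" for x using pos[OF that] by simp
  have cM: "continuous_on K (\<lambda>x. inverse (denominator p c x ^ Suc CARD('a)) *\<^sub>R centred_map p c x)"
    unfolding centred_map_def by (intro continuous_intros continuous_denominator ballI) (auto simp: ne)
  have "w \<bullet> (LINT x:K|lborel. inverse (denominator p c x ^ Suc CARD('a)) *\<^sub>R centred_map p c x)
      = (LINT x:K|lborel. w \<bullet> (inverse (denominator p c x ^ Suc CARD('a)) *\<^sub>R centred_map p c x))"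
    by (rule inner_set_integral[OF K cM])
  also have "(\<lambda>x. w \<bullet> (inverse (denominator p c x ^ Suc CARD('a)) *\<^sub>R centred_map p c x))
      = (\<lambda>x. (w \<bullet> (x - p)) ^ 1 / denominator p c x ^ (Suc CARD('a) + 1))"
    by (simp add: fun_eq_iff centred_map_def divide_inverse mult_ac)
  finally show ?thesis
    by (simp add: weighted_moment_def directional_moment_0) (simp add: directional_moment_def divide_inverse mult.commute)
qed

text \<open>
  Moving \<open>c\<close> in the direction \<open>w\<close> raises the order of the moment by one; this is why derivatives of
  volumes are centroids and derivatives of centroids are variances.
\<close>

lemma directional_moment_derivative:
  assumes K: "compact K" and pos: "\<And>x. x \<in> K \<Longrightarrow> 0 < denominator p (c + t0 *\<^sub>R w) x"
  shows "((\<lambda>t. directional_moment p (c + t *\<^sub>R w) w k K) has_real_derivative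
     - real (Suc CARD('n) + k) * directional_moment p (c + t0 *\<^sub>R w) w (Suc k) (K :: (real ^ 'n::finite) set)) (at t0)"
proof -
  have "((\<lambda>t. LINT x:K|lborel. (w \<bullet> (x - p)) ^ k / (denominator p c x + t * (w \<bullet> (x - p))) ^ (Suc CARD('n) + k))
     has_real_derivative - real (Suc CARD('n) + k) *
       (LINT x:K|lborel. (w \<bullet> (x - p)) ^ k * (w \<bullet> (x - p)) / (denominator p c x + t0 * (w \<bullet> (x - p))) ^ Suc (Suc CARD('n) + k))) (at t0)"
    by (rule has_real_derivative_set_integral_power[OF K])
      (use pos in \<open>auto simp: denominator_add intro!: continuous_intros continuous_denominator\<close>)
  then show ?thesis by (simp add: directional_moment_def denominator_add mult.commute)
qed

lemma weighted_mean_derivative: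
  fixes K :: "(real ^ 'n::finite) set"
  assumes K: "compact K" "0 < measure lborel K" and pos: "\<And>x. x \<in> K \<Longrightarrow> 0 < denominator p (c + t0 *\<^sub>R w) x"
  defines "A \<equiv> \<lambda>k t. directional_moment p (c + t *\<^sub>R w) w k K"
  shows "((\<lambda>t. A 1 t / A 0 t) has_real_derivative
     (real CARD('n) + 1) * (A 1 t0 / A 0 t0)\<^sup>2 - (real CARD('n) + 2) * (A 2 t0 / A 0 t0)) (at t0)"
proof -
  have V: "A 0 t0 > 0" unfolding A_def directional_moment_0 by (rule weighted_volume_pos[OF K pos])
  have d0: "((\<lambda>t. A 0 t) has_real_derivative - real (Suc CARD('n) + 0) * A (Suc 0) t0) (at t0)"
    and d1: "((\<lambda>t. A 1 t) has_real_derivative - real (Suc CARD('n) + 1) * A (Suc 1) t0) (at t0)"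
    unfolding A_def by (rule directional_moment_derivative[OF K(1) pos]; assumption)+
  from DERIV_divide[OF d1 d0] V
  have "((\<lambda>t. A 1 t / A 0 t) has_real_derivative
    (- real (Suc CARD('n) + 1) * A (Suc 1) t0 * A 0 t0 - A 1 t0 * (- real (Suc CARD('n) + 0) * A (Suc 0) t0)) / (A 0 t0 * A 0 t0)) (at t0)"
    by simp
  also have "(- real (Suc CARD('n) + 1) * A (Suc 1) t0 * A 0 t0 - A 1 t0 * (- real (Suc CARD('n) + 0) * A (Suc 0) t0)) / (A 0 t0 * A 0 t0)
     = (real CARD('n) + 1) * (A 1 t0 / A 0 t0)\<^sup>2 - (real CARD('n) + 2) * (A 2 t0 / A 0 t0)"
    using V by (simp add: power2_eq_square field_simps numeral_2_eq_2)
  finally show ?thesis .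
qed

text \<open>
  Critical points of the ratio of the volumes are therefore the parameters for which the centroids
  of the two images agree.
\<close>

lemma volume_ratio_derivative:
  fixes K1 K2 :: "(real ^ 'n::finite) set"
  assumes K1: "compact K1" "0 < measure lborel K1" and K2: "compact K2" "0 < measure lborel K2"
    and pos1: "\<And>x. x \<in> K1 \<Longrightarrow> 0 < denominator p (c + t0 *\<^sub>R w) x"
    and pos2: "\<And>x. x \<in> K2 \<Longrightarrow> 0 < denominator p (c + t0 *\<^sub>R w) x"
  defines "F \<equiv> \<lambda>t. weighted_volume p (c + t *\<^sub>R w) K1 / weighted_volume p (c + t *\<^sub>R w) K2"
  shows "(F has_real_derivative - (real CARD('n) + 1) * F t0 *
     (w \<bullet> weighted_moment p (c + t0 *\<^sub>R w) K1 - w \<bullet> weighted_moment p (c + t0 *\<^sub>R w) K2)) (at t0)"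
proof -
  define A where "A = (\<lambda>k t. directional_moment p (c + t *\<^sub>R w) w k K1)"
  define B where "B = (\<lambda>k t. directional_moment p (c + t *\<^sub>R w) w k K2)"
  have V: "A 0 t0 > 0" "B 0 t0 > 0" unfolding A_def B_def directional_moment_0
    by (rule weighted_volume_pos[OF K1 pos1] weighted_volume_pos[OF K2 pos2]; assumption)+
  have dA: "((\<lambda>t. A 0 t) has_real_derivative - real (Suc CARD('n) + 0) * A (Suc 0) t0) (at t0)"
    unfolding A_def by (rule directional_moment_derivative[OF K1(1) pos1])
  have dB: "((\<lambda>t. B 0 t) has_real_derivative - real (Suc CARD('n) + 0) * B (Suc 0) t0) (at t0)"
    unfolding B_def by (rule directional_moment_derivative[OF K2(1) pos2])
  have F: "F = (\<lambda>t. A 0 t / B 0 t)" by (simp add: F_def A_def B_def directional_moment_0)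
  have m: "w \<bullet> weighted_moment p (c + t0 *\<^sub>R w) K1 = A 1 t0 / A 0 t0" "w \<bullet> weighted_moment p (c + t0 *\<^sub>R w) K2 = B 1 t0 / B 0 t0"
    unfolding A_def B_def by (rule inner_weighted_moment[OF K1(1) pos1] inner_weighted_moment[OF K2(1) pos2]; assumption)+
  from DERIV_divide[OF dA dB] V
  have "(F has_real_derivative
    (- real (Suc CARD('n) + 0) * A (Suc 0) t0 * B 0 t0 - A 0 t0 * (- real (Suc CARD('n) + 0) * B (Suc 0) t0)) / (B 0 t0 * B 0 t0)) (at t0)"
    by (simp add: F)
  also have "(- real (Suc CARD('n) + 0) * A (Suc 0) t0 * B 0 t0 - A 0 t0 * (- real (Suc CARD('n) + 0) * B (Suc 0) t0)) / (B 0 t0 * B 0 t0)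
     = - (real CARD('n) + 1) * F t0 * (w \<bullet> weighted_moment p (c + t0 *\<^sub>R w) K1 - w \<bullet> weighted_moment p (c + t0 *\<^sub>R w) K2)"
    unfolding m F using V by (simp add: field_simps)
  finally show ?thesis .
qed

lemma positive_denominator_open:
  fixes K :: "(real ^ 'n::finite) set"
  assumes K: "compact K" and pos: "\<And>x. x \<in> K \<Longrightarrow> 0 < denominator p c x"
  obtains \<delta> where "\<delta> > 0" "\<And>t x. \<bar>t\<bar> < \<delta> \<Longrightarrow> x \<in> K \<Longrightarrow> 0 < denominator p (c + t *\<^sub>R w) x"
proof (cases "K = {}")
  case True then show thesis by (intro that[of 1]) auto
next
  case False
  obtain y where y: "y \<in> K" "\<And>x. x \<in> K \<Longrightarrow> denominator p c y \<le> denominator p c x"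
    using continuous_attains_inf[OF K False continuous_denominator[of K p c]] by blast
  have "compact ((\<lambda>x. w \<bullet> (x - p)) ` K)" by (intro compact_continuous_image K continuous_intros)
  then obtain B where B: "B > 0" "\<And>x. x \<in> K \<Longrightarrow> \<bar>w \<bullet> (x - p)\<bar> \<le> B"
    using compact_imp_bounded[of "(\<lambda>x. w \<bullet> (x - p)) ` K"] unfolding bounded_pos by auto
  define \<delta> where "\<delta> = denominator p c y / B"
  have \<delta>: "\<delta> > 0" using pos[OF y(1)] B by (simp add: \<delta>_def)
  show thesis
  proof (rule that[OF \<delta>])
    fix t x assume t: "\<bar>t\<bar> < \<delta>" and x: "x \<in> K"
    have "\<bar>t * (w \<bullet> (x - p))\<bar> \<le> \<bar>t\<bar> * B" unfolding abs_mult using B(2)[OF x] by (intro mult_left_mono) auto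
    also have "\<dots> < \<delta> * B" using t B by simp
    also have "\<dots> = denominator p c y" using B by (simp add: \<delta>_def)
    also have "\<dots> \<le> denominator p c x" by (rule y(2)[OF x])
    finally show "0 < denominator p (c + t *\<^sub>R w) x" unfolding denominator_add by linarith
  qed
qed

text \<open>
  As the hyperplane sent to infinity approaches the point \<open>y\<close> of \<open>K\<close>, the image volume grows at
  least like the inverse of the denominator at \<open>y\<close>: on the copy of \<open>K\<close> shrunk towards \<open>y\<close> by the
  factor \<open>\<epsilon> = denominator p c y\<close>, which has volume \<open>\<epsilon> ^ d\<close> times that of \<open>K\<close>, the denominator is at
  most of order \<open>\<epsilon>\<close>, and it enters with the power \<open>d + 1\<close>.
\<close>

lemma weighted_volume_lower_bound:
  fixes K :: "(real ^ 'n::finite) set"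
  assumes K: "compact K" "convex K" and y: "y \<in> K" and \<epsilon>: "0 < denominator p c y" "denominator p c y \<le> 1"
    and bd: "\<And>x. x \<in> K \<Longrightarrow> denominator p c y \<le> denominator p c x" "\<And>x. x \<in> K \<Longrightarrow> denominator p c x \<le> M"
  shows "measure lborel K / (denominator p c y * (1 + M) ^ Suc CARD('n)) \<le> weighted_volume p c K"
proof -
  define \<epsilon> where "\<epsilon> = denominator p c y"
  have e: "0 < \<epsilon>" "\<epsilon> \<le> 1" using \<epsilon> by (simp_all add: \<epsilon>_def)
  have M: "M \<ge> \<epsilon>" using bd(2)[OF y] by (simp add: \<epsilon>_def)
  define S where "S = (\<lambda>x. y + \<epsilon> *\<^sub>R (x - y)) ` K"
  have SK: "S \<subseteq> K"
  proof
    fix z assume "z \<in> S"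
    then obtain x where x: "x \<in> K" "z = y + \<epsilon> *\<^sub>R (x - y)" by (auto simp: S_def)
    have "(1 - \<epsilon>) *\<^sub>R y + \<epsilon> *\<^sub>R x \<in> K" using K(2) x(1) y e by (intro convexD) auto
    then show "z \<in> K" unfolding x(2) by (simp add: algebra_simps)
  qed
  have cS: "compact S" unfolding S_def by (intro compact_continuous_image K continuous_intros)
  have pos: "0 < denominator p c x" if "x \<in> K" for x using bd(1)[OF that] \<epsilon>(1) by linarith
  have ci: "continuous_on K (\<lambda>x. 1 / denominator p c x ^ Suc CARD('n))"
    by (intro continuous_intros continuous_denominator ballI) (metis less_irrefl pos power_eq_0_iff)
  have den: "denominator p c (y + \<epsilon> *\<^sub>R (x - y)) = \<epsilon> + \<epsilon> * (denominator p c x - \<epsilon>)" for x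
    by (simp add: \<epsilon>_def denominator_def inner_add_right inner_diff_right algebra_simps)
  have "measure lborel K / (\<epsilon> * (1 + M) ^ Suc CARD('n)) = \<epsilon> ^ CARD('n) * (measure lborel K * (1 / (\<epsilon> * (1 + M)) ^ Suc CARD('n)))"
    using e by (simp add: power_mult_distrib)
  also have "measure lborel K * (1 / (\<epsilon> * (1 + M)) ^ Suc CARD('n)) = (LINT x:K|lborel. 1 / (\<epsilon> * (1 + M)) ^ Suc CARD('n))"
    by (rule set_integral_const_compact[OF K(1), symmetric])
  also have "\<epsilon> ^ CARD('n) * \<dots> \<le> \<epsilon> ^ CARD('n) * (LINT x:K|lborel. 1 / denominator p c (y + \<epsilon> *\<^sub>R (x - y)) ^ Suc CARD('n))"
  proof (rule mult_left_mono)
    show "(LINT x:K|lborel. 1 / (\<epsilon> * (1 + M)) ^ Suc CARD('n)) \<le> (LINT x:K|lborel. 1 / denominator p c (y + \<epsilon> *\<^sub>R (x - y)) ^ Suc CARD('n))"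
    proof (rule set_integral_mono_compact[OF K(1)])
      have "(\<lambda>x. y + \<epsilon> *\<^sub>R (x - y)) ` K \<subseteq> K" using SK by (simp add: S_def)
      then show "continuous_on K (\<lambda>x. 1 / denominator p c (y + \<epsilon> *\<^sub>R (x - y)) ^ Suc CARD('n))"
        by (intro continuous_on_compose2[OF ci, of K "\<lambda>x. y + \<epsilon> *\<^sub>R (x - y)"] continuous_intros)
    next
      fix x assume x: "x \<in> K"
      have "denominator p c (y + \<epsilon> *\<^sub>R (x - y)) \<le> \<epsilon> * (1 + M)"
      proof -
        have "\<epsilon> * (denominator p c x - \<epsilon>) \<le> \<epsilon> * M" using bd(2)[OF x] e by (intro mult_left_mono) auto
        then show ?thesis unfolding den by (simp add: distrib_left)
      qed
      moreover have "0 < denominator p c (y + \<epsilon> *\<^sub>R (x - y))"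
        using pos SK x by (auto simp: S_def)
      ultimately show "1 / (\<epsilon> * (1 + M)) ^ Suc CARD('n) \<le> 1 / denominator p c (y + \<epsilon> *\<^sub>R (x - y)) ^ Suc CARD('n)"
        by (intro divide_left_mono power_mono mult_pos_pos zero_less_power) (use e M in auto)
    qed (intro continuous_intros)
  qed (use e in simp)
  also have "\<dots> = (LINT x:S|lborel. 1 / denominator p c x ^ Suc CARD('n))"
    unfolding S_def
    using set_integral_homothety[OF e(1) K(1), of y "\<lambda>x. 1 / denominator p c x ^ Suc CARD('n)"]
      continuous_on_subset[OF ci SK] by (simp add: S_def)
  also have "\<dots> \<le> weighted_volume p c K"
    unfolding weighted_volume_def
    by (rule set_integral_mono_set_compact[OF cS K(1) SK ci]) (use pos in \<open>auto simp: less_imp_le\<close>)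
  finally show ?thesis by (simp add: \<epsilon>_def)
qed

section \<open>Existence\<close>

text \<open>
  The distance from the compact set \<open>K2\<close> to the complement of \<open>interior K1\<close> is positive.
\<close>

lemma interior_enlargement:
  fixes K1 K2 :: "'a::euclidean_space set"
  assumes K1: "compact K1" and K2: "compact K2" "K2 \<subseteq> interior K1" and p: "p \<in> K2"
  obtains \<eta> where "\<eta> > 0" "\<And>x. x \<in> K2 \<Longrightarrow> x + \<eta> *\<^sub>R (x - p) \<in> K1"
proof -
  obtain e where e: "e > 0" "(\<Union>x\<in>K2. ball x e) \<subseteq> interior K1"
    using compact_subset_open_imp_ball_epsilon_subset[OF K2(1) open_interior K2(2)] by blast
  obtain R where R: "R > 0" "\<And>x. x \<in> K2 \<Longrightarrow> norm (x - p) \<le> R"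
  proof -
    have "bounded ((\<lambda>x. x - p) ` K2)" by (intro compact_imp_bounded compact_continuous_image K2(1) continuous_intros)
    then show thesis using that unfolding bounded_pos by auto
  qed
  define \<eta> where "\<eta> = e / (2 * R)"
  have \<eta>: "\<eta> > 0" using e R by (simp add: \<eta>_def)
  show thesis
  proof (rule that[OF \<eta>])
    fix x assume x: "x \<in> K2"
    have "norm (\<eta> *\<^sub>R (x - p)) \<le> \<eta> * R" using R(2)[OF x] \<eta> by simp
    also have "\<dots> < e" using e R by (simp add: \<eta>_def)
    finally have "x + \<eta> *\<^sub>R (x - p) \<in> ball x e" by (simp add: dist_norm)
    then show "x + \<eta> *\<^sub>R (x - p) \<in> K1" using e(2) x interior_subset by blast
  qed
qed

text \<open>
  The admissible \<open>c\<close> form a bounded set, as \<open>K1\<close> contains a ball around \<open>p\<close>. On \<open>K2\<close> the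
  denominators are bounded below uniformly in \<open>c\<close>, because \<open>K2\<close> stays away from the boundary of
  \<open>K1\<close>; so the volume of the image of \<open>K2\<close> is bounded, and where the ratio does not exceed its value
  at \<open>0\<close>, the preceding lower bound keeps the denominators away from zero on \<open>K1\<close>. The minimum may
  hence be sought on a compact set.
\<close>

lemma volume_ratio_minimiser:
  fixes K1 K2 :: "(real ^ 'n::finite) set"
  assumes K1: "compact K1" "convex K1" and K2: "compact K2" "0 < measure lborel K2"
    and sub: "K2 \<subseteq> interior K1" and p: "p \<in> K2"
  obtains c where "\<And>x. x \<in> K1 \<Longrightarrow> 0 < denominator p c x"
    "\<And>c'. (\<And>x. x \<in> K1 \<Longrightarrow> 0 < denominator p c' x) \<Longrightarrow>
       weighted_volume p c K1 / weighted_volume p c K2 \<le> weighted_volume p c' K1 / weighted_volume p c' K2"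
proof -
  define U where "U = {c. \<forall>x\<in>K1. 0 < denominator p c x}"
  define F where "F = (\<lambda>c. weighted_volume p c K1 / weighted_volume p c K2)"
  have sub': "K2 \<subseteq> K1" using sub interior_subset by blast
  have pK1: "p \<in> K1" using p sub' by blast
  have V1: "0 < measure lborel K1" using measure_lborel_pos[OF K1(1)] p sub by blast
  have wv1: "0 < weighted_volume p c K1" if "c \<in> U" for c
    using that by (intro weighted_volume_pos[OF K1(1) V1]) (auto simp: U_def)
  have wv2: "0 < weighted_volume p c K2" if "c \<in> U" for c
    using that sub' by (intro weighted_volume_pos[OF K2]) (auto simp: U_def)
  have U0: "0 \<in> U" by (simp add: U_def denominator_def)
  \<comment> \<open>A ball of radius \<open>r\<close> around \<open>p\<close> in \<open>K1\<close> bounds the norm of \<open>c\<close>.\<close>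
  obtain r where r: "r > 0" "ball p r \<subseteq> K1" using p sub by (meson mem_interior subsetD)
  have normU: "norm c < 2 / r" if c: "c \<in> U" for c
  proof (cases "c = 0")
    case False
    \<comment> \<open>A point of the ball in the direction in which the denominator decreases fastest.\<close>
    define x where "x = p - (r / 2 / norm c) *\<^sub>R c"
    have "x \<in> ball p r" using r False by (simp add: x_def dist_norm)
    then have "0 < denominator p c x" using c r by (auto simp: U_def)
    then have "0 < 1 - r / 2 * norm c"
      using False by (simp add: denominator_def x_def dot_square_norm power2_eq_square)
    then show ?thesis using r by (simp add: field_simps)
  qed (use r in simp)
  obtain R where R: "R > 0" "\<And>x. x \<in> K1 \<Longrightarrow> norm (x - p) \<le> R"
  proof -
    have "bounded ((\<lambda>x. x - p) ` K1)" by (intro compact_imp_bounded compact_continuous_image K1(1) continuous_intros)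
    then show thesis using that unfolding bounded_pos by auto
  qed
  define M where "M = 1 + 2 / r * R"
  have M: "denominator p c x \<le> M" if c: "c \<in> U" and x: "x \<in> K1" for c x
  proof -
    have "c \<bullet> (x - p) \<le> norm c * norm (x - p)" by (rule norm_cauchy_schwarz)
    also have "\<dots> \<le> 2 / r * R" using normU[OF c] R(2)[OF x] r by (intro mult_mono) auto
    finally show ?thesis by (simp add: denominator_def M_def)
  qed
  have Mpos: "M > 0" using r R by (simp add: M_def add_pos_pos)
  obtain \<eta> where \<eta>: "\<eta> > 0" "\<And>x. x \<in> K2 \<Longrightarrow> x + \<eta> *\<^sub>R (x - p) \<in> K1"
    using interior_enlargement[OF K1(1) K2(1) sub p] by blast
  \<comment> \<open>Each \<open>x\<close> in \<open>K2\<close> divides the segment from \<open>p\<close>, where the denominator is \<open>1\<close>, to a point of \<open>K1\<close>, where it is positive.\<close>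
  define \<delta> where "\<delta> = \<eta> / (1 + \<eta>)"
  have \<delta>: "\<delta> > 0" using \<eta> by (simp add: \<delta>_def)
  have low2: "\<delta> \<le> denominator p c x" if c: "c \<in> U" and x: "x \<in> K2" for c x
  proof -
    have "0 < denominator p c (x + \<eta> *\<^sub>R (x - p))" using c \<eta>(2)[OF x] by (auto simp: U_def)
    also have "denominator p c (x + \<eta> *\<^sub>R (x - p)) = (1 + \<eta>) * denominator p c x - \<eta>"
      by (simp add: denominator_def inner_add_right inner_diff_right algebra_simps)
    finally show ?thesis using \<eta>(1) by (simp add: \<delta>_def field_simps)
  qed
  have up2: "weighted_volume p c K2 \<le> measure lborel K2 / \<delta> ^ Suc CARD('n)" if c: "c \<in> U" for c
  proof -
    have ne: "denominator p c x \<noteq> 0" if "x \<in> K2" for x using low2[OF c that] \<delta> by linarith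
    have "weighted_volume p c K2 \<le> (LINT x:K2|lborel. 1 / \<delta> ^ Suc CARD('n))"
      unfolding weighted_volume_def
    proof (rule set_integral_mono_compact[OF K2(1)])
      show "continuous_on K2 (\<lambda>x. 1 / denominator p c x ^ Suc CARD('n))"
        by (intro continuous_intros continuous_denominator ballI) (metis ne power_eq_0_iff)
      fix x assume x: "x \<in> K2"
      show "1 / denominator p c x ^ Suc CARD('n) \<le> 1 / \<delta> ^ Suc CARD('n)"
        using low2[OF c x] \<delta> by (intro divide_left_mono power_mono mult_pos_pos zero_less_power) auto
    qed (intro continuous_intros)
    then show ?thesis unfolding set_integral_const_compact[OF K2(1)] by simp
  qed
  define W where "W = measure lborel K2 / \<delta> ^ Suc CARD('n)"
  have W: "W > 0" using K2(2) \<delta> by (simp add: W_def)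
  have F0: "F 0 > 0" unfolding F_def using wv1[OF U0] wv2[OF U0] by simp
  \<comment> \<open>The value forced on the smallest denominator by \<open>F c \<le> F 0\<close>.\<close>
  define \<epsilon> where "\<epsilon> = measure lborel K1 / ((1 + M) ^ Suc CARD('n) * (F 0 * W))"
  have \<epsilon>: "\<epsilon> > 0" using V1 F0 W Mpos by (simp add: \<epsilon>_def)
  have deep: "\<epsilon> \<le> denominator p c x" if c: "c \<in> U" "F c \<le> F 0" and x: "x \<in> K1" for c x
  proof -
    obtain y where y: "y \<in> K1" "\<And>x. x \<in> K1 \<Longrightarrow> denominator p c y \<le> denominator p c x"
      using continuous_attains_inf[OF K1(1) _ continuous_denominator[of K1 p c]] pK1 by blast
    have yp: "0 < denominator p c y" using c(1) y(1) by (simp add: U_def)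
    have y1: "denominator p c y \<le> 1" using y(2)[OF pK1] by simp
    have "measure lborel K1 / (denominator p c y * (1 + M) ^ Suc CARD('n)) \<le> weighted_volume p c K1"
      by (rule weighted_volume_lower_bound[OF K1 y(1) yp y1 y(2) M[OF c(1)]])
    also have "\<dots> = F c * weighted_volume p c K2" using wv2[OF c(1)] by (simp add: F_def)
    also have "\<dots> \<le> F 0 * W" using c(2) up2[OF c(1)] wv2[OF c(1)] F0 by (intro mult_mono) (auto simp: W_def)
    finally have "measure lborel K1 / (denominator p c y * (1 + M) ^ Suc CARD('n)) \<le> F 0 * W" .
    then have "measure lborel K1 \<le> F 0 * W * (denominator p c y * (1 + M) ^ Suc CARD('n))"
      using yp Mpos by (simp add: pos_divide_le_eq)
    then have "\<epsilon> \<le> denominator p c y"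
      using F0 W Mpos by (simp add: \<epsilon>_def pos_divide_le_eq mult_ac)
    then show ?thesis using y(2)[OF x] by linarith
  qed
  define C where "C = {c. \<forall>x\<in>K1. \<epsilon> \<le> denominator p c x}"
  have CU: "C \<subseteq> U" using \<epsilon> by (auto simp: C_def U_def)
  have C0: "0 \<in> C" using deep[OF U0] by (auto simp: C_def)
  have "compact C"
  proof -
    have "C = (\<Inter>x\<in>K1. {c. \<epsilon> \<le> denominator p c x})" by (auto simp: C_def)
    moreover have "closed {c. \<epsilon> \<le> denominator p c x}" for x
      unfolding denominator_def by (intro closed_Collect_le continuous_intros)
    ultimately have "closed C" by auto
    moreover have "C \<subseteq> ball 0 (2 / r)" using CU normU by auto
    ultimately show ?thesis by (meson bounded_ball bounded_subset compact_eq_bounded_closed)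
  qed
  have cont: "continuous_on C (\<lambda>c. weighted_volume p c K)" if K: "compact K" "K \<subseteq> K1" for K
    unfolding weighted_volume_def
  proof (rule continuous_set_integral_sequentially[OF K(1), where B = "1 / \<epsilon> ^ Suc CARD('n)"])
    have ne: "denominator p c x \<noteq> 0" if "c \<in> C" "x \<in> K" for c x
    proof -
      have "\<epsilon> \<le> denominator p c x" using that K by (auto simp: C_def)
      then show ?thesis using \<epsilon> by linarith
    qed
    show "continuous_on K (\<lambda>x. 1 / denominator p c x ^ Suc CARD('n))" if "c \<in> C" for c
      by (intro continuous_intros continuous_denominator ballI) (metis ne[OF that] power_eq_0_iff)
    show "continuous_on C (\<lambda>c. 1 / denominator p c x ^ Suc CARD('n))" if "x \<in> K" for x
    proof -
      have "continuous_on C (\<lambda>c. denominator p c x)" unfolding denominator_def by (intro continuous_intros)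
      then show ?thesis by (intro continuous_intros ballI) (use ne[OF _ that] in auto)
    qed
    show "\<bar>1 / denominator p c x ^ Suc CARD('n)\<bar> \<le> 1 / \<epsilon> ^ Suc CARD('n)" if "c \<in> C" "x \<in> K" for c x
    proof -
      have l: "\<epsilon> \<le> denominator p c x" using that K by (auto simp: C_def)
      then have "1 / denominator p c x ^ Suc CARD('n) \<le> 1 / \<epsilon> ^ Suc CARD('n)"
        using \<epsilon> by (intro divide_left_mono power_mono mult_pos_pos zero_less_power) auto
      moreover have "0 \<le> 1 / denominator p c x ^ Suc CARD('n)" using l \<epsilon> by simp
      ultimately show ?thesis by linarith
    qed
  qed
  have "continuous_on C F" unfolding F_def
    by (intro continuous_intros cont K1(1) K2(1) sub' subset_refl ballI) (metis CU less_irrefl subsetD wv2)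
  then obtain c where c: "c \<in> C" "\<And>c'. c' \<in> C \<Longrightarrow> F c \<le> F c'"
    using continuous_attains_inf[OF \<open>compact C\<close>] C0 by blast
  show thesis
  proof (rule that[of c])
    show "0 < denominator p c x" if "x \<in> K1" for x using c(1) CU that by (auto simp: U_def)
    fix c' assume "\<And>x. x \<in> K1 \<Longrightarrow> 0 < denominator p c' x"
    then have c': "c' \<in> U" by (simp add: U_def)
    have "F c \<le> F c'"
    proof (cases "F c' \<le> F 0")
      case True
      then have "c' \<in> C" using deep[OF c'] by (auto simp: C_def)
      then show ?thesis by (rule c(2))
    next
      case False
      then show ?thesis using c(2)[OF C0] by linarith
    qed
    then show "weighted_volume p c K1 / weighted_volume p c K2 \<le> weighted_volume p c' K1 / weighted_volume p c' K2"
      by (simp add: F_def)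
  qed
qed

text \<open>
  All directional derivatives of the ratio vanish at an interior minimum.
\<close>

lemma minimiser_equates_moments:
  fixes K1 K2 :: "(real ^ 'n::finite) set"
  assumes K1: "compact K1" "0 < measure lborel K1" and K2: "compact K2" "0 < measure lborel K2" and sub: "K2 \<subseteq> K1"
    and pos: "\<And>x. x \<in> K1 \<Longrightarrow> 0 < denominator p c x"
    and min: "\<And>c'. (\<And>x. x \<in> K1 \<Longrightarrow> 0 < denominator p c' x) \<Longrightarrow>
       weighted_volume p c K1 / weighted_volume p c K2 \<le> weighted_volume p c' K1 / weighted_volume p c' K2"
  shows "weighted_moment p c K1 = weighted_moment p c K2"
proof -
  have "w \<bullet> weighted_moment p c K1 = w \<bullet> weighted_moment p c K2" for w
  proof -
    define F where "F = (\<lambda>t. weighted_volume p (c + t *\<^sub>R w) K1 / weighted_volume p (c + t *\<^sub>R w) K2)"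
    obtain \<delta> where \<delta>: "\<delta> > 0" "\<And>t x. \<bar>t\<bar> < \<delta> \<Longrightarrow> x \<in> K1 \<Longrightarrow> 0 < denominator p (c + t *\<^sub>R w) x"
      using positive_denominator_open[OF K1(1) pos] by blast
    have pos0: "0 < denominator p (c + 0 *\<^sub>R w) x" if "x \<in> K1" for x using pos[OF that] by simp
    have pos2: "0 < denominator p (c + 0 *\<^sub>R w) x" if "x \<in> K2" for x using pos0 sub that by blast
    have der: "(F has_real_derivative - (real CARD('n) + 1) * F 0 *
     (w \<bullet> weighted_moment p (c + 0 *\<^sub>R w) K1 - w \<bullet> weighted_moment p (c + 0 *\<^sub>R w) K2)) (at 0)"
      unfolding F_def by (rule volume_ratio_derivative[OF K1 K2 pos0 pos2])
    have "- (real CARD('n) + 1) * F 0 *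
     (w \<bullet> weighted_moment p (c + 0 *\<^sub>R w) K1 - w \<bullet> weighted_moment p (c + 0 *\<^sub>R w) K2) = 0"
    proof (rule DERIV_local_min[OF der \<delta>(1)], intro allI impI)
      fix t assume "\<bar>0 - t\<bar> < \<delta>"
      then have "\<And>x. x \<in> K1 \<Longrightarrow> 0 < denominator p (c + t *\<^sub>R w) x" using \<delta>(2)[of t] by simp
      from min[OF this] show "F 0 \<le> F t" by (simp add: F_def)
    qed
    moreover have "F 0 > 0"
      unfolding F_def using weighted_volume_pos[OF K1 pos0] weighted_volume_pos[OF K2 pos2] by simp
    moreover have "real CARD('n) + 1 \<noteq> 0" by (simp add: add_nonneg_eq_0_iff)
    ultimately show ?thesis by simp
  qed
  then show ?thesis using vector_eq_ldot by blast
qed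

lemma equates_centroids_iff:
  fixes K1 K2 :: "(real ^ 'n::finite) set"
  assumes T: "represents T \<phi>" and c: "\<And>x. fst (T (1, x)) = denominator p c x"
    and K1: "compact K1" "convex K1" "0 < measure lborel K1" and K2: "compact K2" "0 < measure lborel K2" and sub: "K2 \<subseteq> K1"
    and pos: "\<And>x. x \<in> K1 \<Longrightarrow> 0 < denominator p c x"
  shows "equates_centroids \<phi> K1 K2 \<longleftrightarrow> weighted_moment p c K1 = weighted_moment p c K2"
proof -
  obtain B q where B: "linear B" "inj B" and cen:
    "\<And>K. compact K \<Longrightarrow> 0 < measure lborel K \<Longrightarrow> (\<And>x. x \<in> K \<Longrightarrow> 0 < denominator p c x) \<Longrightarrow>
       centroid (chart_image \<phi> K) = q + B (weighted_moment p c K)"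
    using centroid_represented[OF T c] by blast
  have "projective_transformation \<phi>" using T unfolding represents_def projective_transformation_def by blast
  moreover have "admissible \<phi> K1"
  proof -
    have "\<phi> (chart x) \<in> range chart" if "x \<in> K1" for x
    proof -
      have "fst (T (1, x)) \<noteq> 0" using c[of x] pos[OF that] by simp
      from represents_chart_eq[OF T this] show ?thesis by simp
    qed
    moreover have "convex hull K1 = K1" using K1(2) by (rule hull_same)
    ultimately show ?thesis unfolding admissible_def by auto
  qed
  moreover have "centroid (chart_image \<phi> K1) = q + B (weighted_moment p c K1)"
    by (rule cen[OF K1(1,3) pos])
  moreover have "centroid (chart_image \<phi> K2) = q + B (weighted_moment p c K2)"
    by (rule cen[OF K2]) (use pos sub in blast)
  ultimately show ?thesis unfolding equates_centroids_def using inj_eq[OF B(2)] by simp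
qed

lemma equating_minimiser_exists:
  fixes K1 K2 :: "(real ^ 'n::finite) set"
  assumes "convex_body K1" "convex_body K2" "K2 \<subseteq> interior K1" "p \<in> K2"
  obtains T \<phi> c where "represents T \<phi>" "\<And>x. fst (T (1, x)) = denominator p c x"
    "\<And>x. x \<in> K1 \<Longrightarrow> 0 < denominator p c x" "equates_centroids \<phi> K1 K2"
    "\<And>c'. (\<And>x. x \<in> K1 \<Longrightarrow> 0 < denominator p c' x) \<Longrightarrow>
       weighted_volume p c K1 / weighted_volume p c K2 \<le> weighted_volume p c' K1 / weighted_volume p c' K2"
proof -
  have K1: "compact K1" "convex K1" "0 < measure lborel K1" and K2: "compact K2" "0 < measure lborel K2"
    using assms measure_lborel_pos by (auto simp: convex_body_def)
  have sub: "K2 \<subseteq> K1" using assms(3) interior_subset by blast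
  obtain c where c: "\<And>x. x \<in> K1 \<Longrightarrow> 0 < denominator p c x" and min:
    "\<And>c'. (\<And>x. x \<in> K1 \<Longrightarrow> 0 < denominator p c' x) \<Longrightarrow>
       weighted_volume p c K1 / weighted_volume p c K2 \<le> weighted_volume p c' K1 / weighted_volume p c' K2"
    using volume_ratio_minimiser[OF K1(1,2) K2 assms(3,4)] by blast
  obtain T \<phi> where T: "represents T \<phi>" "\<And>x. fst (T (1, x)) = denominator p c x"
    using centred_map_realised[of p c] by blast
  have "weighted_moment p c K1 = weighted_moment p c K2"
    by (rule minimiser_equates_moments[OF K1(1,3) K2 sub c min])
  then have "equates_centroids \<phi> K1 K2" using equates_centroids_iff[OF T K1 K2 sub c] by simp
  then show thesis using that[OF T c _ min] by blast
qed

section \<open>The Hilbert width in terms of affine functions\<close>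

definition lin_indep2 :: "'a::real_vector \<Rightarrow> 'a \<Rightarrow> bool" where
  "lin_indep2 a b \<longleftrightarrow> (\<forall>s t. s *\<^sub>R a + t *\<^sub>R b = 0 \<longrightarrow> s = 0 \<and> t = 0)"

lemma lin_indep2_nonzero: "lin_indep2 a b \<Longrightarrow> a \<noteq> 0 \<and> b \<noteq> 0"
  unfolding lin_indep2_def by (metis add.right_neutral add.left_neutral scaleR_zero_left scaleR_zero_right zero_neq_one)

text \<open>
  Cramer's rule with the Gram matrix of \<open>a\<close> and \<open>b\<close>.
\<close>

lemma lin_indep2_solve:
  fixes a b :: "'a::real_inner"
  assumes ab: "lin_indep2 a b"
  obtains x where "a \<bullet> x = r" "b \<bullet> x = s"
proof -
  define D where "D = (a \<bullet> a) * (b \<bullet> b) - (a \<bullet> b)\<^sup>2"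
  define b' where "b' = (a \<bullet> a) *\<^sub>R b - (a \<bullet> b) *\<^sub>R a"
  have a0: "a \<bullet> a \<noteq> 0" using lin_indep2_nonzero[OF ab] by simp
  have "b' \<noteq> 0"
  proof
    assume "b' = 0"
    then have "(- (a \<bullet> b)) *\<^sub>R a + (a \<bullet> a) *\<^sub>R b = 0" by (simp add: b'_def)
    then show False using ab a0 unfolding lin_indep2_def by blast
  qed
  then have "b' \<bullet> b' \<noteq> 0" by simp
  moreover have "b' \<bullet> b' = (a \<bullet> a) * D"
    by (simp add: b'_def D_def inner_diff_left inner_diff_right inner_commute[of b a] power2_eq_square algebra_simps)
  ultimately have D: "D \<noteq> 0" by auto
  define x where "x = (1 / D) *\<^sub>R ((r * (b \<bullet> b) - s * (a \<bullet> b)) *\<^sub>R a + (s * (a \<bullet> a) - r * (a \<bullet> b)) *\<^sub>R b)"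
  have "a \<bullet> x = (1 / D) * ((r * (b \<bullet> b) - s * (a \<bullet> b)) * (a \<bullet> a) + (s * (a \<bullet> a) - r * (a \<bullet> b)) * (a \<bullet> b))"
    by (simp add: x_def inner_add_right)
  also have "\<dots> = (1 / D) * (r * D)" by (simp add: D_def power2_eq_square algebra_simps)
  finally have 1: "a \<bullet> x = r" using D by simp
  have "b \<bullet> x = (1 / D) * ((r * (b \<bullet> b) - s * (a \<bullet> b)) * (a \<bullet> b) + (s * (a \<bullet> a) - r * (a \<bullet> b)) * (b \<bullet> b))"
    by (simp add: x_def inner_add_right inner_commute[of b a])
  also have "\<dots> = (1 / D) * (s * D)" by (simp add: D_def power2_eq_square algebra_simps)
  finally have 2: "b \<bullet> x = s" using D by simp
  from 1 2 show thesis by (rule that)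
qed

text \<open>
  Hyperplanes through the intersection of two hyperplanes in general position are given by the
  linear combinations of their two equations.
\<close>

lemma pencil_member:
  fixes a b e :: "'a::euclidean_space"
  assumes ab: "lin_indep2 a b" and sub: "{x. a \<bullet> x = \<alpha>0 \<and> b \<bullet> x = \<beta>0} \<subseteq> {x. e \<bullet> x = k}"
  obtains s t where "e = s *\<^sub>R a + t *\<^sub>R b" "\<And>x. e \<bullet> x - k = s * (a \<bullet> x - \<alpha>0) + t * (b \<bullet> x - \<beta>0)"
proof -
  obtain x0 where x0: "a \<bullet> x0 = \<alpha>0" "b \<bullet> x0 = \<beta>0" using lin_indep2_solve[OF ab] by blast
  have k: "e \<bullet> x0 = k" using sub x0 by blast
  obtain y z where yz: "y \<in> span {a, b}" "\<And>w. w \<in> span {a, b} \<Longrightarrow> orthogonal z w" "e = y + z"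
    using orthogonal_subspace_decomp_exists[of "{a, b}" e] by blast
  have az: "z \<bullet> a = 0" "z \<bullet> b = 0" using yz(2) by (auto simp: orthogonal_def span_base)
  have "a \<bullet> (x0 + z) = \<alpha>0" "b \<bullet> (x0 + z) = \<beta>0" using x0 az by (simp_all add: inner_add_right inner_commute)
  then have "e \<bullet> (x0 + z) = k" using sub by blast
  then have "e \<bullet> z = 0" using k by (simp add: inner_add_right)
  moreover have "y \<bullet> z = 0" using yz(2)[OF yz(1)] by (simp add: orthogonal_def inner_commute)
  ultimately have "z = 0" using yz(3) by (simp add: inner_add_left)
  then have "e \<in> span {a, b}" using yz by simp
  then obtain s t where st: "e = s *\<^sub>R a + t *\<^sub>R b"
  proof -
    assume h: "\<And>s t. e = s *\<^sub>R a + t *\<^sub>R b \<Longrightarrow> thesis"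
    obtain s where "e - s *\<^sub>R a \<in> span {b}" using \<open>e \<in> span {a, b}\<close> span_breakdown_eq[of e a "{b}"] by blast
    then obtain t where "e - s *\<^sub>R a = t *\<^sub>R b" by (auto simp: span_singleton)
    then have "e = s *\<^sub>R a + t *\<^sub>R b" by (simp add: algebra_simps)
    then show thesis by (rule h)
  qed
  have "e \<bullet> x - k = s * (a \<bullet> x - \<alpha>0) + t * (b \<bullet> x - \<beta>0)" for x
    unfolding k[symmetric] x0[symmetric] st by (simp add: inner_add_left algebra_simps)
  with st show thesis by (rule that)
qed

lemma aff_dim_pencil_axis:
  fixes a b :: "'a::euclidean_space"
  assumes ab: "lin_indep2 a b"
  shows "aff_dim {x. a \<bullet> x = \<alpha>0 \<and> b \<bullet> x = \<beta>0} = int DIM('a) - 2" "affine {x. a \<bullet> x = \<alpha>0 \<and> b \<bullet> x = \<beta>0}"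
proof -
  have eq: "{x. a \<bullet> x = \<alpha>0 \<and> b \<bullet> x = \<beta>0} = {x. a \<bullet> x = \<alpha>0} \<inter> {x. b \<bullet> x = \<beta>0}" by auto
  obtain x0 where x0: "a \<bullet> x0 = \<alpha>0" "b \<bullet> x0 = \<beta>0" using lin_indep2_solve[OF ab] by blast
  obtain x1 where x1: "a \<bullet> x1 = \<alpha>0" "b \<bullet> x1 = \<beta>0 + 1" using lin_indep2_solve[OF ab] by blast
  have "aff_dim ({x. a \<bullet> x = \<alpha>0} \<inter> {x. b \<bullet> x = \<beta>0}) = aff_dim {x. a \<bullet> x = \<alpha>0} - 1"
    using aff_dim_affine_Int_hyperplane[OF affine_hyperplane, of a \<alpha>0 b \<beta>0] x0 x1 by auto
  then show "aff_dim {x. a \<bullet> x = \<alpha>0 \<and> b \<bullet> x = \<beta>0} = int DIM('a) - 2"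
    unfolding eq using lin_indep2_nonzero[OF ab] by (simp add: aff_dim_hyperplane)
  show "affine {x. a \<bullet> x = \<alpha>0 \<and> b \<bullet> x = \<beta>0}"
    unfolding eq by (intro affine_Int affine_hyperplane)
qed

text \<open>
  On a transversal, \<open>U\<close> and \<open>V\<close> are affine functions of the parameter that vanish only at \<open>a\<close> and
  \<open>b\<close>, respectively. So the cross-ratio is the quotient of the values of \<open>U / V\<close> at the points of
  the first two hyperplanes, and \<open>U / V\<close> is constant on each of them.
\<close>

lemma pencil_cross_ratio_eq:
  fixes a b :: "real ^ 'n::finite" and \<alpha>0 \<beta>0 l m :: real
  assumes ab: "lin_indep2 a b" and lm: "0 < l" "0 < m"
  defines "U \<equiv> \<lambda>x. a \<bullet> x - \<alpha>0" and "V \<equiv> \<lambda>x. b \<bullet> x - \<beta>0"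
  shows "pencil_cross_ratio {x. a \<bullet> x = \<alpha>0 \<and> b \<bullet> x = \<beta>0} {x. U x = l * V x} {x. U x = m * V x} {x. U x = 0} {x. V x = 0} = l / m"
  unfolding pencil_cross_ratio_def
proof (rule the_equality)
  obtain v where v: "a \<bullet> v = 1" "b \<bullet> v = -1" using lin_indep2_solve[OF ab] by blast
  obtain u where u: "a \<bullet> u = \<alpha>0" "b \<bullet> u = \<beta>0 + 1" using lin_indep2_solve[OF ab] by blast
  have U: "U (u + t *\<^sub>R v) = t" and V: "V (u + t *\<^sub>R v) = 1 - t" for t
    using u v by (simp_all add: U_def V_def inner_add_right)
  have P: "U (u + t *\<^sub>R v) = k * V (u + t *\<^sub>R v) \<longleftrightarrow> t = k / (1 + k)" if "k > 0" for k t
    unfolding U V using that by (simp add: field_simps)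
  show "\<exists>u v p q a' b'. v \<noteq> 0 \<and>
      (\<forall>t. u + t *\<^sub>R v \<notin> {x. a \<bullet> x = \<alpha>0 \<and> b \<bullet> x = \<beta>0}) \<and>
      (\<forall>t. u + t *\<^sub>R v \<in> {x. U x = l * V x} \<longleftrightarrow> t = p) \<and>
      (\<forall>t. u + t *\<^sub>R v \<in> {x. U x = m * V x} \<longleftrightarrow> t = q) \<and>
      (\<forall>t. u + t *\<^sub>R v \<in> {x. U x = 0} \<longleftrightarrow> t = a') \<and>
      (\<forall>t. u + t *\<^sub>R v \<in> {x. V x = 0} \<longleftrightarrow> t = b') \<and>
      l / m = cross_ratio p q a' b'"
  proof (intro exI conjI allI)
    show "v \<noteq> 0" using v by auto
    show "u + t *\<^sub>R v \<notin> {x. a \<bullet> x = \<alpha>0 \<and> b \<bullet> x = \<beta>0}" for t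
      using U[of t] V[of t] by (auto simp: U_def V_def)
    show "u + t *\<^sub>R v \<in> {x. U x = l * V x} \<longleftrightarrow> t = l / (1 + l)" for t using P[OF lm(1)] by simp
    show "u + t *\<^sub>R v \<in> {x. U x = m * V x} \<longleftrightarrow> t = m / (1 + m)" for t using P[OF lm(2)] by simp
    show "u + t *\<^sub>R v \<in> {x. U x = 0} \<longleftrightarrow> t = 0" for t using U by simp
    show "u + t *\<^sub>R v \<in> {x. V x = 0} \<longleftrightarrow> t = 1" for t using V by auto
    have e: "k / (1 + k) - 1 = - 1 / (1 + k)" if "k > 0" for k :: real using that by (simp add: field_simps)
    show "l / m = cross_ratio (l / (1 + l)) (m / (1 + m)) 0 1"
      unfolding cross_ratio_def e[OF lm(1)] e[OF lm(2)] using lm by simp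
  qed
next
  fix r
  assume "\<exists>u v p q a' b'. v \<noteq> 0 \<and>
      (\<forall>t. u + t *\<^sub>R v \<notin> {x. a \<bullet> x = \<alpha>0 \<and> b \<bullet> x = \<beta>0}) \<and>
      (\<forall>t. u + t *\<^sub>R v \<in> {x. U x = l * V x} \<longleftrightarrow> t = p) \<and>
      (\<forall>t. u + t *\<^sub>R v \<in> {x. U x = m * V x} \<longleftrightarrow> t = q) \<and>
      (\<forall>t. u + t *\<^sub>R v \<in> {x. U x = 0} \<longleftrightarrow> t = a') \<and>
      (\<forall>t. u + t *\<^sub>R v \<in> {x. V x = 0} \<longleftrightarrow> t = b') \<and>
      r = cross_ratio p q a' b'"
  then obtain u v p q a' b' where
    miss: "\<And>t. u + t *\<^sub>R v \<notin> {x. a \<bullet> x = \<alpha>0 \<and> b \<bullet> x = \<beta>0}" and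
    p: "\<And>t. u + t *\<^sub>R v \<in> {x. U x = l * V x} \<longleftrightarrow> t = p" and
    q: "\<And>t. u + t *\<^sub>R v \<in> {x. U x = m * V x} \<longleftrightarrow> t = q" and
    a': "\<And>t. u + t *\<^sub>R v \<in> {x. U x = 0} \<longleftrightarrow> t = a'" and
    b': "\<And>t. u + t *\<^sub>R v \<in> {x. V x = 0} \<longleftrightarrow> t = b'" and
    r: "r = cross_ratio p q a' b'" by blast
  have Ut: "U (u + t *\<^sub>R v) = (t - a') * (a \<bullet> v)" for t
  proof -
    have "U (u + a' *\<^sub>R v) = 0" using a'[of a'] by simp
    then show ?thesis by (simp add: U_def inner_add_right algebra_simps)
  qed
  have Vt: "V (u + t *\<^sub>R v) = (t - b') * (b \<bullet> v)" for t
  proof -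
    have "V (u + b' *\<^sub>R v) = 0" using b'[of b'] by simp
    then show ?thesis by (simp add: V_def inner_add_right algebra_simps)
  qed
  have av: "a \<bullet> v \<noteq> 0" using a'[of "a' + 1"] Ut[of "a' + 1"] by auto
  have bv: "b \<bullet> v \<noteq> 0" using b'[of "b' + 1"] Vt[of "b' + 1"] by auto
  have not_both: "U (u + t *\<^sub>R v) \<noteq> 0 \<or> V (u + t *\<^sub>R v) \<noteq> 0" for t
    using miss[of t] by (auto simp: U_def V_def)
  have pp: "(p - a') * (a \<bullet> v) = l * ((p - b') * (b \<bullet> v))" using p[of p] Ut[of p] Vt[of p] by simp
  have qq: "(q - a') * (a \<bullet> v) = m * ((q - b') * (b \<bullet> v))" using q[of q] Ut[of q] Vt[of q] by simp
  have pb: "p \<noteq> b'" using not_both[of p] Ut[of p] Vt[of p] pp by auto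
  have qb: "q \<noteq> b'" using not_both[of q] Ut[of q] Vt[of q] qq by auto
  have qa: "q \<noteq> a'" using qq qb lm bv by auto
  have "(p - a') * (q - b') * m = (p - b') * (q - a') * l"
  proof -
    have "((p - a') * (a \<bullet> v)) * (m * ((q - b') * (b \<bullet> v))) = (l * ((p - b') * (b \<bullet> v))) * ((q - a') * (a \<bullet> v))"
      using pp qq by simp
    then have "(a \<bullet> v * (b \<bullet> v)) * ((p - a') * (q - b') * m) = (a \<bullet> v * (b \<bullet> v)) * ((p - b') * (q - a') * l)"
      by (simp add: mult_ac)
    then show ?thesis using av bv by simp
  qed
  moreover have "(p - b') * (q - a') \<noteq> 0" using pb qa by simp
  ultimately show "r = l / m" unfolding r cross_ratio_def using lm
    by (subst frac_eq_eq) (auto simp: mult.commute mult.left_commute)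
qed

text \<open>
  The axis \<open>{U = 0, V = 0}\<close> is disjoint from \<open>K1\<close>; the support hyperplanes of \<open>K1\<close> through it are
  \<open>U = 0\<close> and \<open>V = 0\<close>, and those of \<open>K2\<close> are the hyperplanes where \<open>U / V\<close> takes its maximum \<open>l\<close> and
  its minimum \<open>m\<close> over \<open>K2\<close>. This pencil contributes \<open>l / m\<close> to the supremum, which is at least the
  quotient of the values of \<open>U / V\<close> at any two points of \<open>K2\<close>.
\<close>

lemma hilbert_width_ge_independent:
  fixes K1 K2 :: "(real ^ 'n::finite) set" and a b :: "real ^ 'n" and \<alpha>0 \<beta>0 :: real
  assumes ab: "lin_indep2 a b" and K2: "compact K2" "interior K2 \<noteq> {}"
  defines "U \<equiv> \<lambda>x. a \<bullet> x - \<alpha>0" and "V \<equiv> \<lambda>x. b \<bullet> x - \<beta>0"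
  assumes nonneg: "\<And>x. x \<in> K1 \<Longrightarrow> 0 \<le> U x" "\<And>x. x \<in> K1 \<Longrightarrow> 0 \<le> V x"
    and touch: "xa \<in> K1" "U xa = 0" "xb \<in> K1" "V xb = 0"
    and disj: "\<And>x. x \<in> K1 \<Longrightarrow> 0 < U x + V x"
    and pos: "\<And>x. x \<in> K2 \<Longrightarrow> 0 < U x" "\<And>x. x \<in> K2 \<Longrightarrow> 0 < V x"
    and xy: "x \<in> K2" "y \<in> K2"
  shows "ereal (1 / 2 * ln ((U x / V x) / (U y / V y))) \<le> hilbert_width K1 K2"
proof -
  define \<alpha> where "\<alpha> = {x. a \<bullet> x = \<alpha>0 \<and> b \<bullet> x = \<beta>0}"
  have mem\<alpha>: "x \<in> \<alpha> \<longleftrightarrow> U x = 0 \<and> V x = 0" for x by (simp add: \<alpha>_def U_def V_def)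
  have ne: "K2 \<noteq> {}" using xy by auto
  have V0: "V x \<noteq> 0" if "x \<in> K2" for x using pos(2)[OF that] by simp
  have cR: "continuous_on K2 (\<lambda>x. U x / V x)"
    unfolding U_def V_def by (intro continuous_intros ballI) (use V0 in \<open>auto simp: V_def\<close>)
  obtain xM where xM: "xM \<in> K2" "\<And>x. x \<in> K2 \<Longrightarrow> U x / V x \<le> U xM / V xM"
    using continuous_attains_sup[OF K2(1) ne cR] by blast
  obtain xm where xm: "xm \<in> K2" "\<And>x. x \<in> K2 \<Longrightarrow> U xm / V xm \<le> U x / V x"
    using continuous_attains_inf[OF K2(1) ne cR] by blast
  define l m where "l = U xM / V xM" and "m = U xm / V xm"
  have lpos: "0 < l" "0 < m" using pos xM(1) xm(1) by (auto simp: l_def m_def)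
  have ml: "m \<le> l" using xm(2)[OF xM(1)] by (simp add: l_def m_def)
  have Ul: "U x \<le> l * V x" "m * V x \<le> U x" if "x \<in> K2" for x
    using xM(2)[OF that] xm(2)[OF that] pos(2)[OF that] by (simp_all add: l_def m_def pos_divide_le_eq pos_le_divide_eq)
  have eqM: "U xM = l * V xM" "U xm = m * V xm" using V0 xM(1) xm(1) by (auto simp: l_def m_def)
  have lm: "l \<noteq> m"
  proof
    assume "l = m"
    then have z: "(a - l *\<^sub>R b) \<bullet> x = \<alpha>0 - l * \<beta>0" if "x \<in> K2" for x
      using Ul[OF that] by (simp add: U_def V_def inner_diff_left algebra_simps)
    have "interior K2 \<subseteq> interior {x. (a - l *\<^sub>R b) \<bullet> x = \<alpha>0 - l * \<beta>0}" using z by (intro interior_mono) auto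
    moreover have "a - l *\<^sub>R b \<noteq> 0"
    proof
      assume "a - l *\<^sub>R b = 0"
      then have "1 *\<^sub>R a + (- l) *\<^sub>R b = 0" by simp
      then show False using ab unfolding lin_indep2_def by (metis zero_neq_one)
    qed
    ultimately show False using K2(2) by (simp add: interior_hyperplane)
  qed
  define l1 m1 l2 m2 where "l1 = {x. U x = 0}" and "m1 = {x. V x = 0}"
    and "l2 = {x. U x = m * V x}" and "m2 = {x. U x = l * V x}"
  have supp: "support_hyperplane K H"
    if "e \<noteq> 0" "H = {x. e \<bullet> x = k}" "\<And>x. x \<in> K \<Longrightarrow> e \<bullet> x \<le> k" "z \<in> K" "e \<bullet> z = k" for K H e k z
    unfolding support_hyperplane_def by (intro exI[of _ e] exI[of _ k]) (use that in auto)
  have ind: "s *\<^sub>R a + t *\<^sub>R b \<noteq> 0" if "s \<noteq> 0 \<or> t \<noteq> 0" for s t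
    using ab that unfolding lin_indep2_def by blast
  have s1: "support_hyperplane K1 l1"
    by (rule supp[of "(-1) *\<^sub>R a + 0 *\<^sub>R b" _ "- \<alpha>0" _ xa])
      (use ind[of "-1" 0] nonneg(1) touch in \<open>auto simp: l1_def U_def\<close>)
  have s2: "support_hyperplane K1 m1"
    by (rule supp[of "0 *\<^sub>R a + (-1) *\<^sub>R b" _ "- \<beta>0" _ xb])
      (use ind[of 0 "-1"] nonneg(2) touch in \<open>auto simp: m1_def V_def\<close>)
  have ex: "(s *\<^sub>R a + t *\<^sub>R b) \<bullet> x - (s * \<alpha>0 + t * \<beta>0) = s * U x + t * V x" for s t x
    by (simp add: U_def V_def inner_add_left algebra_simps)
  have s3: "support_hyperplane K2 m2"
  proof (rule supp[of "1 *\<^sub>R a + (- l) *\<^sub>R b" _ "1 * \<alpha>0 + (- l) * \<beta>0" _ xM])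
    show "m2 = {x. (1 *\<^sub>R a + (- l) *\<^sub>R b) \<bullet> x = 1 * \<alpha>0 + (- l) * \<beta>0}"
      unfolding m2_def
    proof (rule Collect_cong)
      fix x show "(U x = l * V x) = ((1 *\<^sub>R a + (- l) *\<^sub>R b) \<bullet> x = 1 * \<alpha>0 + (- l) * \<beta>0)"
        using ex[of 1 "- l" x] by linarith
    qed
    show "(1 *\<^sub>R a + (- l) *\<^sub>R b) \<bullet> x \<le> 1 * \<alpha>0 + (- l) * \<beta>0" if "x \<in> K2" for x
      using ex[of 1 "- l" x] Ul(1)[OF that] by linarith
    show "(1 *\<^sub>R a + (- l) *\<^sub>R b) \<bullet> xM = 1 * \<alpha>0 + (- l) * \<beta>0"
      using ex[of 1 "- l" xM] eqM by linarith
  qed (use ind[of 1 "- l"] xM in auto)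
  have s4: "support_hyperplane K2 l2"
  proof (rule supp[of "(-1) *\<^sub>R a + m *\<^sub>R b" _ "(-1) * \<alpha>0 + m * \<beta>0" _ xm])
    show "l2 = {x. ((-1) *\<^sub>R a + m *\<^sub>R b) \<bullet> x = (-1) * \<alpha>0 + m * \<beta>0}"
      unfolding l2_def
    proof (rule Collect_cong)
      fix x show "(U x = m * V x) = (((-1) *\<^sub>R a + m *\<^sub>R b) \<bullet> x = (-1) * \<alpha>0 + m * \<beta>0)"
        using ex[of "-1" m x] by linarith
    qed
    show "((-1) *\<^sub>R a + m *\<^sub>R b) \<bullet> x \<le> (-1) * \<alpha>0 + m * \<beta>0" if "x \<in> K2" for x
      using ex[of "-1" m x] Ul(2)[OF that] by linarith
    show "((-1) *\<^sub>R a + m *\<^sub>R b) \<bullet> xm = (-1) * \<alpha>0 + m * \<beta>0"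
      using ex[of "-1" m xm] eqM by linarith
  qed (use ind[of "-1" m] xm in auto)
  have sub: "\<alpha> \<subseteq> l1" "\<alpha> \<subseteq> m1" "\<alpha> \<subseteq> l2" "\<alpha> \<subseteq> m2"
    using mem\<alpha> by (auto simp: l1_def m1_def l2_def m2_def)
  have member: "\<exists>s t. (s \<noteq> 0 \<or> t \<noteq> 0) \<and> H = {x. s * U x + t * V x = 0} \<and> (\<forall>x\<in>K. s * U x + t * V x \<le> 0) \<and> (\<exists>z\<in>K. s * U z + t * V z = 0)"
    if H: "support_hyperplane K H" "\<alpha> \<subseteq> H" for K H
  proof -
    obtain e k where e: "e \<noteq> 0" "H = {x. e \<bullet> x = k}" "K \<subseteq> {x. e \<bullet> x \<le> k}" "H \<inter> K \<noteq> {}"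
      using H(1) unfolding support_hyperplane_def by blast
    have "{x. a \<bullet> x = \<alpha>0 \<and> b \<bullet> x = \<beta>0} \<subseteq> {x. e \<bullet> x = k}" using H(2) e(2) by (simp add: \<alpha>_def)
    then obtain s t
      where st: "e = s *\<^sub>R a + t *\<^sub>R b" "\<And>x. e \<bullet> x - k = s * (a \<bullet> x - \<alpha>0) + t * (b \<bullet> x - \<beta>0)"
      by (rule pencil_member[OF ab]) (rule that)
    have eq: "e \<bullet> x = k + (s * U x + t * V x)" for x using st(2)[of x] by (simp add: U_def V_def)
    have "s \<noteq> 0 \<or> t \<noteq> 0" using e(1) st(1) by auto
    then show ?thesis using e(2-4) unfolding eq by (intro exI[of _ s] exI[of _ t]) auto
  qed
  have set1: "{H. support_hyperplane K1 H \<and> \<alpha> \<subseteq> H} = {l1, m1}"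
  proof (rule equalityI)
    show "{l1, m1} \<subseteq> {H. support_hyperplane K1 H \<and> \<alpha> \<subseteq> H}" using s1 s2 sub by auto
    show "{H. support_hyperplane K1 H \<and> \<alpha> \<subseteq> H} \<subseteq> {l1, m1}"
    proof
      fix H assume "H \<in> {H. support_hyperplane K1 H \<and> \<alpha> \<subseteq> H}"
      then have "support_hyperplane K1 H" "\<alpha> \<subseteq> H" by auto
      from member[OF this] obtain s t z where st: "s \<noteq> 0 \<or> t \<noteq> 0" "H = {x. s * U x + t * V x = 0}"
        "\<And>x. x \<in> K1 \<Longrightarrow> s * U x + t * V x \<le> 0" "z \<in> K1" "s * U z + t * V z = 0" by blast
      have "0 < V xa" using disj[OF touch(1)] touch(2) by simp
      then have t: "t \<le> 0" using st(3)[OF touch(1)] touch(2) by (simp add: mult_le_0_iff)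
      have "0 < U xb" using disj[OF touch(3)] touch(4) by simp
      then have s: "s \<le> 0" using st(3)[OF touch(3)] touch(4) by (simp add: mult_le_0_iff)
      have "s * U z \<le> 0" "t * V z \<le> 0" using s t nonneg[OF st(4)] by (auto simp: mult_le_0_iff)
      then have z: "s * U z = 0" "t * V z = 0" using st(5) by linarith+
      have "s = 0 \<or> t = 0" using z disj[OF st(4)] by auto
      then show "H \<in> {l1, m1}" using st(1) unfolding st(2) l1_def m1_def by auto
    qed
  qed
  have set2: "{H. support_hyperplane K2 H \<and> \<alpha> \<subseteq> H} = {l2, m2}"
  proof (rule equalityI)
    show "{l2, m2} \<subseteq> {H. support_hyperplane K2 H \<and> \<alpha> \<subseteq> H}" using s3 s4 sub by auto
    show "{H. support_hyperplane K2 H \<and> \<alpha> \<subseteq> H} \<subseteq> {l2, m2}"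
    proof
      fix H assume "H \<in> {H. support_hyperplane K2 H \<and> \<alpha> \<subseteq> H}"
      then have "support_hyperplane K2 H" "\<alpha> \<subseteq> H" by auto
      from member[OF this] obtain s t z where st: "s \<noteq> 0 \<or> t \<noteq> 0" "H = {x. s * U x + t * V x = 0}"
        "\<And>x. x \<in> K2 \<Longrightarrow> s * U x + t * V x \<le> 0" "z \<in> K2" "s * U z + t * V z = 0" by blast
      have s: "s \<noteq> 0" using st(1,5) V0[OF st(4)] by auto
      define k where "k = - t / s"
      have t: "t = - (s * k)" using s by (simp add: k_def)
      have H: "H = {x. U x = k * V x}" unfolding st(2) t using s by (auto simp: mult.assoc right_diff_distrib[symmetric])
      have Uz: "U z = k * V z" using st(5) s unfolding t by (simp add: mult.assoc right_diff_distrib[symmetric])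
      have sgn: "s * (U x - k * V x) \<le> 0" if "x \<in> K2" for x
        using st(3)[OF that] unfolding t by (simp add: algebra_simps)
      show "H \<in> {l2, m2}"
      proof (cases "s > 0")
        case True
        then have "U xM - k * V xM \<le> 0" using sgn[OF xM(1)] by (simp add: mult_le_0_iff)
        then have "l * V xM \<le> k * V xM" using eqM by simp
        then have "l \<le> k" using pos(2)[OF xM(1)] by simp
        moreover have "k * V z \<le> l * V z" using Ul(1)[OF st(4)] Uz by simp
        then have "k \<le> l" using pos(2)[OF st(4)] by simp
        ultimately show ?thesis unfolding H m2_def by simp
      next
        case False
        then have "s < 0" using s by simp
        then have "U xm - k * V xm \<ge> 0" using sgn[OF xm(1)] by (simp add: mult_le_0_iff)
        then have "k * V xm \<le> m * V xm" using eqM by simp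
        then have "k \<le> m" using pos(2)[OF xm(1)] by simp
        moreover have "m * V z \<le> k * V z" using Ul(2)[OF st(4)] Uz by simp
        then have "m \<le> k" using pos(2)[OF st(4)] by simp
        ultimately show ?thesis unfolding H l2_def by simp
      qed
    qed
  qed
  have cr: "pencil_cross_ratio \<alpha> m2 l2 l1 m1 = l / m"
    unfolding \<alpha>_def m2_def l2_def l1_def m1_def U_def V_def by (rule pencil_cross_ratio_eq[OF ab lpos])
  have ne1: "l1 \<noteq> m1"
  proof
    assume "l1 = m1"
    then have "V xa = 0" using touch(2) by (auto simp: l1_def m1_def)
    then show False using disj[OF touch(1)] touch(2) by simp
  qed
  have ne2: "l2 \<noteq> m2"
  proof
    assume "l2 = m2"
    moreover have "xM \<in> m2" using eqM(1) by (simp add: m2_def)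
    ultimately have "xM \<in> l2" by simp
    then have "U xM = m * V xM" by (simp add: l2_def)
    then show False using eqM(1) lm V0[OF xM(1)] by simp
  qed
  have "\<alpha> \<inter> K1 = {}" using disj mem\<alpha> by force
  have one: "1 \<le> \<bar>l / m\<bar>" using ml lpos by simp
  have "ereal (1 / 2 * ln \<bar>l / m\<bar>) \<le> hilbert_width K1 K2"
    unfolding hilbert_width_def
  proof (rule Sup_upper, rule CollectI, rule exI[of _ "l / m"], rule exI[of _ \<alpha>], rule exI[of _ l1],
      rule exI[of _ m1], rule exI[of _ l2], rule exI[of _ m2], intro conjI)
    show "affine \<alpha>" "aff_dim \<alpha> = int CARD('n) - 2"
      using aff_dim_pencil_axis[OF ab, of \<alpha>0 \<beta>0] by (simp_all add: \<alpha>_def)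
  qed (rule refl \<open>\<alpha> \<inter> K1 = {}\<close> ne1 ne2 set1 set2 cr[symmetric] one)+
  moreover have "ln ((U x / V x) / (U y / V y)) \<le> ln \<bar>l / m\<bar>"
  proof -
    have "(U x / V x) / (U y / V y) \<le> l / m"
      using xM(2)[OF xy(1)] xm(2)[OF xy(2)] pos xy lpos
      by (intro frac_le) (auto simp: l_def m_def less_imp_le)
    moreover have "0 < (U x / V x) / (U y / V y)" using pos xy by simp
    ultimately show ?thesis using lpos by simp
  qed
  then have "ereal (1 / 2 * ln ((U x / V x) / (U y / V y))) \<le> ereal (1 / 2 * ln \<bar>l / m\<bar>)" by simp
  ultimately show ?thesis by (rule order_trans[rotated])
qed

text \<open>
  If \<open>a\<close> and \<open>b\<close> are parallel, adding to \<open>b\<close> a multiple of a vector \<open>w\<close> not parallel to \<open>a\<close>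
  separates them.
\<close>

lemma lin_indep2_perturb:
  assumes a: "a \<noteq> 0" and w: "lin_indep2 a w" and b: "\<not> lin_indep2 a b" and e: "e \<noteq> 0"
  shows "lin_indep2 a (b + e *\<^sub>R w)"
proof -
  obtain s0 t0 where st0: "s0 *\<^sub>R a + t0 *\<^sub>R b = 0" "s0 \<noteq> 0 \<or> t0 \<noteq> 0"
    using b unfolding lin_indep2_def by blast
  have t0: "t0 \<noteq> 0" using st0 a by auto
  define k where "k = - (s0 / t0)"
  have bk: "b = k *\<^sub>R a"
  proof -
    have "t0 *\<^sub>R b = (- s0) *\<^sub>R a" using st0(1) by (simp add: eq_neg_iff_add_eq_0 add.commute)
    then have "(1 / t0) *\<^sub>R (t0 *\<^sub>R b) = (1 / t0) *\<^sub>R ((- s0) *\<^sub>R a)" by simp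
    then show ?thesis using t0 by (simp add: k_def)
  qed
  show ?thesis unfolding lin_indep2_def
  proof (intro allI impI)
    fix s t assume "s *\<^sub>R a + t *\<^sub>R (b + e *\<^sub>R w) = 0"
    then have "(s + t * k) *\<^sub>R a + (t * e) *\<^sub>R w = 0" by (simp add: bk algebra_simps)
    then have "s + t * k = 0 \<and> t * e = 0" using w unfolding lin_indep2_def by blast
    then show "s = 0 \<and> t = 0" using e by auto
  qed
qed

lemma lin_indep2_exists:
  fixes a :: "'a::euclidean_space"
  assumes "2 \<le> DIM('a)" "a \<noteq> 0"
  obtains w where "lin_indep2 a w"
proof -
  obtain w where w: "w \<noteq> 0" "orthogonal a w" using orthogonal_to_vector_exists[OF assms(1)] .
  have "lin_indep2 a w" unfolding lin_indep2_def
  proof (intro allI impI)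
    fix s t assume z: "s *\<^sub>R a + t *\<^sub>R w = 0"
    have "a \<bullet> (s *\<^sub>R a + t *\<^sub>R w) = s * (a \<bullet> a)" "w \<bullet> (s *\<^sub>R a + t *\<^sub>R w) = t * (w \<bullet> w)"
      using w(2) by (simp_all add: inner_add_right orthogonal_def inner_commute)
    then show "s = 0 \<and> t = 0" using z w(1) assms(2) by simp
  qed
  then show thesis by (rule that)
qed

text \<open>
  The inequality extends to parallel hyperplanes \<open>U = 0\<close> and \<open>V = 0\<close>, whose axis is at infinity and
  so does not occur in the definition of the width: the second hyperplane is tilted by a small angle
  and moved so that it touches \<open>K1\<close> again, and the inequality passes to the limit. The bound is
  given without quotients and logarithms, the form in which it will be combined with the estimates
  of the moments.
\<close>

lemma hilbert_width_cross_ratio_bound: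
  fixes K1 K2 :: "(real ^ 'n::finite) set" and a b :: "real ^ 'n" and \<alpha>0 \<beta>0 :: real
  assumes d: "2 \<le> CARD('n)" and K1: "compact K1" and K2: "compact K2" "interior K2 \<noteq> {}" and sub: "K2 \<subseteq> K1"
    and width: "hilbert_width K1 K2 \<le> ereal r"
  defines "U \<equiv> \<lambda>x. a \<bullet> x - \<alpha>0" and "V \<equiv> \<lambda>x. b \<bullet> x - \<beta>0"
  assumes nonneg: "\<And>x. x \<in> K1 \<Longrightarrow> 0 \<le> U x" "\<And>x. x \<in> K1 \<Longrightarrow> 0 \<le> V x"
    and touch: "xa \<in> K1" "U xa = 0" "xb \<in> K1" "V xb = 0"
    and disj: "\<And>x. x \<in> K1 \<Longrightarrow> 0 < U x + V x"
    and pos: "\<And>x. x \<in> K2 \<Longrightarrow> 0 < U x" "\<And>x. x \<in> K2 \<Longrightarrow> 0 < V x"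
    and xy: "x \<in> K2" "y \<in> K2"
  shows "U x * V y \<le> exp (2 * r) * (V x * U y)"
proof -
  have indep: "U x * V' y \<le> exp (2 * r) * (V' x * U y)"
    if ab: "lin_indep2 a b'" and V': "V' = (\<lambda>x. b' \<bullet> x - \<beta>')"
      and h: "\<And>x. x \<in> K1 \<Longrightarrow> 0 \<le> V' x" "xb' \<in> K1" "V' xb' = 0"
       "\<And>x. x \<in> K1 \<Longrightarrow> 0 < U x + V' x" "\<And>x. x \<in> K2 \<Longrightarrow> 0 < V' x" for b' \<beta>' V' xb'
  proof -
    have "ereal (1 / 2 * ln ((U x / V' x) / (U y / V' y))) \<le> hilbert_width K1 K2"
      unfolding U_def V'
      by (rule hilbert_width_ge_independent[OF ab K2, of K1 \<alpha>0 \<beta>' xa xb'])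
        (use nonneg(1) touch h pos xy in \<open>simp_all add: U_def V'\<close>)
    also note width
    finally have "ln ((U x / V' x) / (U y / V' y)) \<le> 2 * r" by simp
    moreover have p: "0 < U x" "0 < V' x" "0 < U y" "0 < V' y" using pos(1) h(5) xy by auto
    ultimately have "(U x / V' x) / (U y / V' y) \<le> exp (2 * r)"
      by (metis divide_pos_pos exp_le_cancel_iff exp_ln)
    then have "(U x * V' y) / (V' x * U y) \<le> exp (2 * r)" by (simp add: divide_simps mult.commute)
    then show ?thesis using p by (simp add: pos_divide_le_eq)
  qed
  have a0: "a \<noteq> 0"
  proof
    assume "a = 0"
    then have "U z = U xa" for z by (simp add: U_def)
    then show False using pos(1)[OF xy(1)] touch(2) by simp
  qed
  show ?thesis
  proof (cases "lin_indep2 a b")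
    case True
    show ?thesis by (rule indep[OF True V_def[THEN meta_eq_to_obj_eq] nonneg(2) touch(3,4) disj pos(2)])
  next
    case False
    \<comment> \<open>Parallel hyperplanes. On the compact set \<open>K1\<close>, tilting by \<open>e\<close> changes \<open>V\<close> by at most \<open>2 * R * e\<close>.\<close>
    obtain w where w: "lin_indep2 a w" using lin_indep2_exists[of a] d a0 by auto
    obtain R where R: "R > 0" "\<And>x. x \<in> K1 \<Longrightarrow> \<bar>w \<bullet> x\<bar> \<le> R"
    proof -
      have "bounded ((\<lambda>x. w \<bullet> x) ` K1)" by (intro compact_imp_bounded compact_continuous_image K1 continuous_intros)
      then show thesis using that unfolding bounded_pos by auto
    qed
    have K1ne: "K1 \<noteq> {}" using touch by auto
    have cU: "continuous_on A U" and cV: "continuous_on A V" for A unfolding U_def V_def by (intro continuous_intros)+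
    obtain z1 where z1: "z1 \<in> K1" "\<And>x. x \<in> K1 \<Longrightarrow> U z1 + V z1 \<le> U x + V x"
      using continuous_attains_inf[OF K1 K1ne continuous_on_add[OF cU cV]] by blast
    obtain z2 where z2: "z2 \<in> K2" "\<And>x. x \<in> K2 \<Longrightarrow> V z2 \<le> V x"
      using continuous_attains_inf[OF K2(1) _ cV] xy(1) by blast
    define \<rho> where "\<rho> = min (U z1 + V z1) (V z2)"
    have \<rho>: "\<rho> > 0" using disj[OF z1(1)] pos(2)[OF z2(1)] by (simp add: \<rho>_def)
    define C where "C = 2 * R"
    have bound: "U x * (V y - e * C) \<le> exp (2 * r) * ((V x + e * C) * U y)" if e: "0 < e" "e * C < \<rho>" for e
    proof -
      define b' where "b' = b + e *\<^sub>R w"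
      obtain z where z: "z \<in> K1" "\<And>x. x \<in> K1 \<Longrightarrow> b' \<bullet> z \<le> b' \<bullet> x"
        using continuous_attains_inf[OF K1 K1ne, of "\<lambda>x. b' \<bullet> x"] continuous_on_inner[OF continuous_on_const continuous_on_id]
        by blast
      define V' where "V' = (\<lambda>x. b' \<bullet> x - b' \<bullet> z)"
      have ew: "\<bar>e * (w \<bullet> q)\<bar> \<le> e * R" if "q \<in> K1" for q
        using R(2)[OF that] e(1) by (simp add: abs_mult)
      have close: "\<bar>V' q - V q\<bar> \<le> e * C" if q: "q \<in> K1" for q
      proof -
        have 1: "b' \<bullet> z = \<beta>0 + V z + e * (w \<bullet> z)" and 2: "b' \<bullet> q = \<beta>0 + V q + e * (w \<bullet> q)"
          and 3: "b' \<bullet> xb = \<beta>0 + e * (w \<bullet> xb)" using touch(4) by (simp_all add: b'_def V_def inner_add_left)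
        have "V' q - V q = e * (w \<bullet> q) - V z - e * (w \<bullet> z)" unfolding V'_def 1 2 by simp
        moreover have "V z + e * (w \<bullet> z) \<le> e * (w \<bullet> xb)" using z(2)[OF touch(3)] unfolding 1 3 by simp
        ultimately show ?thesis
          using ew[OF q] ew[OF z(1)] ew[OF touch(3)] nonneg(2)[OF z(1)] by (simp add: C_def abs_le_iff)
      qed
      have "U x * V' y \<le> exp (2 * r) * (V' x * U y)"
      proof (rule indep[of b' V' "b' \<bullet> z" z])
        show "lin_indep2 a b'" unfolding b'_def by (rule lin_indep2_perturb[OF a0 w False]) (use e in simp)
        show "0 \<le> V' x" if "x \<in> K1" for x using z(2)[OF that] by (simp add: V'_def)
        show "0 < U x + V' x" if x: "x \<in> K1" for x
          using close[OF x] z1(2)[OF x] e(2) by (simp add: \<rho>_def abs_le_iff)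
        show "0 < V' x" if x: "x \<in> K2" for x
          using close[of x] z2(2)[OF x] e(2) x sub by (auto simp: \<rho>_def abs_le_iff)
      qed (use z in \<open>simp_all add: V'_def\<close>)
      moreover have "U x * (V y - e * C) \<le> U x * V' y"
        using close[of y] xy sub pos(1)[OF xy(1)] by (intro mult_left_mono) (auto simp: abs_le_iff)
      moreover have "exp (2 * r) * (V' x * U y) \<le> exp (2 * r) * ((V x + e * C) * U y)"
        using close[of x] xy sub pos(1)[OF xy(2)] by (intro mult_left_mono mult_right_mono) (auto simp: abs_le_iff)
      ultimately show ?thesis by linarith
    qed
    have "((\<lambda>e. exp (2 * r) * ((V x + e * C) * U y) - U x * (V y - e * C)) \<longlongrightarrow>
        exp (2 * r) * ((V x + 0 * C) * U y) - U x * (V y - 0 * C)) (at_right 0)"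
      by (intro tendsto_intros)
    moreover have "\<forall>\<^sub>F e in at_right (0::real). e \<in> {0<..<\<rho> / C}"
      by (rule eventually_at_right_real) (use \<rho> R in \<open>simp add: C_def\<close>)
    then have "\<forall>\<^sub>F e in at_right (0::real). 0 \<le> exp (2 * r) * ((V x + e * C) * U y) - U x * (V y - e * C)"
    proof eventually_elim
      case (elim e)
      have "C > 0" using R by (simp add: C_def)
      then have "e * C < \<rho>" using elim by (simp add: pos_less_divide_eq)
      then show ?case using bound[of e] elim by simp
    qed
    ultimately have "0 \<le> exp (2 * r) * ((V x + 0 * C) * U y) - U x * (V y - 0 * C)"
      by (rule tendsto_lowerbound) simp
    then show ?thesis by simp
  qed
qed

text \<open>
  Under the hypotheses, a function \<open>e \<bullet> x + q\<close> that is nonnegative on \<open>K1\<close> takes values between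
  \<open>(1 - s) q\<close> and \<open>(1 + s) q\<close> on \<open>K2\<close>. Applied to the equations \<open>U\<close>, \<open>V\<close> of two support hyperplanes
  of \<open>K1\<close>, this bounds the quotient of any two values of \<open>U / V\<close> on \<open>K2\<close> by \<open>((1 + s) / (1 - s))\<^sup>2\<close>.
\<close>

lemma hilbert_width_symmetric_le:
  fixes K1 K2 :: "(real ^ 'n::finite) set"
  assumes d: "2 \<le> CARD('n)" and s: "0 < s" "s < 1" and int: "0 \<in> interior K1"
    and scaled: "\<And>x. x \<in> K2 \<Longrightarrow> (1 / s) *\<^sub>R x \<in> K1" "\<And>x. x \<in> K2 \<Longrightarrow> - ((1 / s) *\<^sub>R x) \<in> K1"
  shows "hilbert_width K1 K2 \<le> ereal (ln ((1 + s) / (1 - s)))"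
  unfolding hilbert_width_def
proof (rule Sup_least)
  fix u assume "u \<in> {ereal (1 / 2 * ln \<bar>c\<bar>) | c \<alpha> l1 m1 l2 m2.
      affine \<alpha> \<and> aff_dim \<alpha> = int CARD('n) - 2 \<and> \<alpha> \<inter> K1 = {} \<and>
      l1 \<noteq> m1 \<and> {H. support_hyperplane K1 H \<and> \<alpha> \<subseteq> H} = {l1, m1} \<and>
      l2 \<noteq> m2 \<and> {H. support_hyperplane K2 H \<and> \<alpha> \<subseteq> H} = {l2, m2} \<and>
      c = pencil_cross_ratio \<alpha> m2 l2 l1 m1 \<and> 1 \<le> \<bar>c\<bar>}"
  then obtain c \<alpha> l1 m1 l2 m2 where u: "u = ereal (1 / 2 * ln \<bar>c\<bar>)"
    and \<alpha>: "affine \<alpha>" "aff_dim \<alpha> = int CARD('n) - 2" "\<alpha> \<inter> K1 = {}"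
    and l1m1: "l1 \<noteq> m1" "{H. support_hyperplane K1 H \<and> \<alpha> \<subseteq> H} = {l1, m1}"
    and l2m2: "{H. support_hyperplane K2 H \<and> \<alpha> \<subseteq> H} = {l2, m2}"
    and c: "c = pencil_cross_ratio \<alpha> m2 l2 l1 m1" "1 \<le> \<bar>c\<bar>" by blast
  have "support_hyperplane K1 l1" "\<alpha> \<subseteq> l1" "support_hyperplane K1 m1" "\<alpha> \<subseteq> m1"
    using l1m1(2) by auto
  then obtain a1 k1 a2 k2 where
    l1: "a1 \<noteq> 0" "l1 = {x. a1 \<bullet> x = k1}" "K1 \<subseteq> {x. a1 \<bullet> x \<le> k1}" and
    m1: "a2 \<noteq> 0" "m1 = {x. a2 \<bullet> x = k2}" "K1 \<subseteq> {x. a2 \<bullet> x \<le> k2}" and sub: "\<alpha> \<subseteq> l1" "\<alpha> \<subseteq> m1"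
    unfolding support_hyperplane_def by blast
  have "aff_dim \<alpha> \<ge> 0" using \<alpha>(2) d by simp
  then have "\<alpha> \<noteq> {}" by auto
  then obtain x0 where x0: "x0 \<in> \<alpha>" by blast
  have ax0: "a1 \<bullet> x0 = k1" "a2 \<bullet> x0 = k2" using x0 sub l1(2) m1(2) by auto
  define a b where "a = - a1" and "b = - a2"
  \<comment> \<open>Two distinct hyperplanes with a common point \<open>x0\<close> are not parallel.\<close>
  have ab: "lin_indep2 a b" unfolding lin_indep2_def
  proof (intro allI impI, rule ccontr)
    fix s t assume z: "s *\<^sub>R a + t *\<^sub>R b = 0" and n: "\<not> (s = 0 \<and> t = 0)"
    have st: "s \<noteq> 0 \<and> t \<noteq> 0" using z n l1(1) m1(1) by (auto simp: a_def b_def)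
    have "s * (a1 \<bullet> x - k1) = - (t * (a2 \<bullet> x - k2))" for x
    proof -
      have "(s *\<^sub>R a + t *\<^sub>R b) \<bullet> (x - x0) = 0" unfolding z by simp
      then show ?thesis using ax0 by (simp add: a_def b_def inner_add_left inner_diff_right algebra_simps)
    qed
    then have "a1 \<bullet> x = k1 \<longleftrightarrow> a2 \<bullet> x = k2" for x
      using st by (metis eq_iff_diff_eq_0 mult_eq_0_iff neg_equal_0_iff_equal)
    then show False using l1m1(1) l1(2) m1(2) by auto
  qed
  define U V where "U = (\<lambda>x. a \<bullet> x - (- k1))" and "V = (\<lambda>x. b \<bullet> x - (- k2))"
  have l1U: "l1 = {x. U x = 0}" and m1V: "m1 = {x. V x = 0}" unfolding l1(2) m1(2) by (auto simp: U_def V_def a_def b_def)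
  have UV: "0 \<le> U x" "0 \<le> V x" if "x \<in> K1" for x using that l1(3) m1(3) by (auto simp: U_def V_def a_def b_def)
  have \<alpha>eq: "\<alpha> = {x. a \<bullet> x = - k1 \<and> b \<bullet> x = - k2}"
  proof (rule affine_dim_equal[OF \<alpha>(1) aff_dim_pencil_axis(2)[OF ab] \<open>\<alpha> \<noteq> {}\<close>])
    show "\<alpha> \<subseteq> {x. a \<bullet> x = - k1 \<and> b \<bullet> x = - k2}" using sub l1(2) m1(2) by (auto simp: a_def b_def)
    show "aff_dim \<alpha> = aff_dim {x. a \<bullet> x = - k1 \<and> b \<bullet> x = - k2}"
      unfolding aff_dim_pencil_axis(1)[OF ab] \<alpha>(2) by simp
  qed
  have range: "(1 - s) * q \<le> e \<bullet> x + q" "e \<bullet> x + q \<le> (1 + s) * q"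
    if "\<And>x. x \<in> K1 \<Longrightarrow> 0 \<le> e \<bullet> x + q" "x \<in> K2" for e q x
  proof -
    have "0 \<le> (1 / s) * (e \<bullet> x) + q" using that(1)[OF scaled(1)[OF that(2)]] by simp
    then have "0 \<le> s * ((1 / s) * (e \<bullet> x) + q)" using s by (intro mult_nonneg_nonneg) auto
    also have "s * ((1 / s) * (e \<bullet> x) + q) = e \<bullet> x + s * q" using s by (simp add: field_simps)
    finally have 1: "0 \<le> e \<bullet> x + s * q" .
    have "0 \<le> - ((1 / s) * (e \<bullet> x)) + q" using that(1)[OF scaled(2)[OF that(2)]] by simp
    then have "0 \<le> s * (- ((1 / s) * (e \<bullet> x)) + q)" using s by (intro mult_nonneg_nonneg) auto
    also have "s * (- ((1 / s) * (e \<bullet> x)) + q) = - (e \<bullet> x) + s * q" using s by (simp add: field_simps)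
    finally have 2: "0 \<le> - (e \<bullet> x) + s * q" .
    show "(1 - s) * q \<le> e \<bullet> x + q" "e \<bullet> x + q \<le> (1 + s) * q" using 1 2 by (simp_all add: algebra_simps)
  qed
  have rU: "(1 - s) * k1 \<le> U x" "U x \<le> (1 + s) * k1" if "x \<in> K2" for x
    using range[of a k1 x] UV(1) that by (simp_all add: U_def)
  have rV: "(1 - s) * k2 \<le> V x" "V x \<le> (1 + s) * k2" if "x \<in> K2" for x
    using range[of b k2 x] UV(2) that by (simp_all add: V_def)
  have kpos: "0 < q" if "e \<noteq> 0" "\<And>x. x \<in> K1 \<Longrightarrow> 0 \<le> e \<bullet> x + q" for e :: "real ^ 'n" and q
  proof -
    obtain r where r: "r > 0" "ball 0 r \<subseteq> K1" using int by (meson mem_interior)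
    define x where "x = - ((r / 2 / norm e) *\<^sub>R e)"
    have "x \<in> ball 0 r" using r(1) that(1) by (simp add: x_def)
    then have "0 \<le> e \<bullet> x + q" using that(2) r(2) by blast
    also have "e \<bullet> x = - (r / 2 * norm e)"
      using that(1) by (simp add: x_def dot_square_norm power2_eq_square)
    finally have "r / 2 * norm e \<le> q" by simp
    moreover have "0 < r / 2 * norm e" using r(1) that(1) by simp
    ultimately show ?thesis by linarith
  qed
  have k1: "0 < k1" using kpos[of a k1] UV(1) l1(1) by (simp add: U_def a_def)
  have k2: "0 < k2" using kpos[of b k2] UV(2) m1(1) by (simp add: V_def b_def)
  have Upos: "0 < U x" if "x \<in> K2" for x
  proof -
    have "0 < (1 - s) * k1" using s k1 by simp
    then show ?thesis using rU(1)[OF that] by linarith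
  qed
  have Vpos: "0 < V x" if "x \<in> K2" for x
  proof -
    have "0 < (1 - s) * k2" using s k2 by simp
    then show ?thesis using rV(1)[OF that] by linarith
  qed
  have pencil: "\<exists>z\<in>K2. H = {x. U x = (U z / V z) * V x}"
    if H: "support_hyperplane K2 H" "\<alpha> \<subseteq> H" for H
  proof -
    obtain e k where e: "e \<noteq> 0" "H = {x. e \<bullet> x = k}" "H \<inter> K2 \<noteq> {}"
      using H(1) unfolding support_hyperplane_def by blast
    have "{x. a \<bullet> x = - k1 \<and> b \<bullet> x = - k2} \<subseteq> {x. e \<bullet> x = k}" using H(2) e(2) \<alpha>eq by simp
    then obtain p t where st: "e = p *\<^sub>R a + t *\<^sub>R b" "\<And>x. e \<bullet> x - k = p * (a \<bullet> x - (- k1)) + t * (b \<bullet> x - (- k2))"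
      by (rule pencil_member[OF ab]) (rule that)
    have e_eq: "e \<bullet> x - k = p * U x + t * V x" for x unfolding U_def V_def by (rule st(2))
    have H': "H = {x. p * U x + t * V x = 0}" unfolding e(2) e_eq[symmetric] by simp
    obtain z where z: "z \<in> K2" "p * U z + t * V z = 0" using e(3) H' by auto
    have p: "p \<noteq> 0"
    proof
      assume "p = 0"
      then have "t = 0" using z Vpos[OF z(1)] by simp
      then show False using \<open>p = 0\<close> e(1) st(1) by simp
    qed
    have t: "t = - (p * (U z / V z))" using z(2) Vpos[OF z(1)] by (simp add: field_simps)
    have "H = {x. U x = (U z / V z) * V x}"
      unfolding H' t
    proof (rule Collect_cong)
      fix x
      have "p * U x + - (p * (U z / V z)) * V x = p * (U x - (U z / V z) * V x)" by (simp add: algebra_simps)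
      then show "(p * U x + - (p * (U z / V z)) * V x = 0) = (U x = (U z / V z) * V x)" using p by simp
    qed
    then show ?thesis using z(1) by blast
  qed
  obtain zl where zl: "zl \<in> K2" "l2 = {x. U x = (U zl / V zl) * V x}" using pencil[of l2] l2m2 by blast
  obtain zm where zm: "zm \<in> K2" "m2 = {x. U x = (U zm / V zm) * V x}" using pencil[of m2] l2m2 by blast
  have c_eq: "c = (U zm / V zm) / (U zl / V zl)"
    unfolding c(1) \<alpha>eq zl(2) zm(2) l1U m1V U_def V_def
    by (rule pencil_cross_ratio_eq[OF ab])
      (use Upos[OF zl(1)] Upos[OF zm(1)] Vpos[OF zl(1)] Vpos[OF zm(1)] in \<open>simp_all add: U_def V_def\<close>)
  have cp: "0 < c" unfolding c_eq using Upos zl(1) zm(1) Vpos by simp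
  have "c \<le> (((1 + s) * k1) / ((1 - s) * k2)) / (((1 - s) * k1) / ((1 + s) * k2))"
    unfolding c_eq
    using rU[OF zm(1)] rV[OF zm(1)] rU[OF zl(1)] rV[OF zl(1)] s k1 k2 Upos[OF zl(1)] Upos[OF zm(1)] Vpos[OF zl(1)] Vpos[OF zm(1)]
    by (intro frac_le divide_pos_pos divide_nonneg_pos mult_nonneg_nonneg mult_pos_pos) auto
  also have "\<dots> = ((1 + s) / (1 - s))\<^sup>2"
  proof -
    have "((P * k1) / (Q * k2)) / ((Q * k1) / (P * k2)) = (P / Q)\<^sup>2" if "P \<noteq> 0" "Q \<noteq> 0" for P Q
      using that k1 k2 by (simp add: power2_eq_square field_simps)
    then show ?thesis using s by simp
  qed
  finally have "ln c \<le> ln (((1 + s) / (1 - s))\<^sup>2)" using cp s by simp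
  also have "\<dots> = 2 * ln ((1 + s) / (1 - s))" using s by (simp add: ln_realpow)
  finally show "u \<le> ereal (ln ((1 + s) / (1 - s)))" unfolding u using cp by simp
qed

section \<open>Uniqueness for small width\<close>

lemma kappa_bounds:
  assumes "2 \<le> d"
  shows "0 < kappa d" "kappa d < 1" "(kappa d)\<^sup>2 = 6 / ((real d + 1) * (real d + 2))"
proof -
  have "12 \<le> (real d + 1) * (real d + 2)"
  proof -
    have "3 * 4 \<le> (real d + 1) * (real d + 2)" using assms by (intro mult_mono) auto
    then show ?thesis by simp
  qed
  then show "0 < kappa d" "kappa d < 1" "(kappa d)\<^sup>2 = 6 / ((real d + 1) * (real d + 2))"
    by (simp_all add: kappa_def real_sqrt_lt_1_iff)
qed

text \<open>
  For fixed \<open>X\<^sup>2 = p q\<close> and \<open>Y\<^sup>2 = a b\<close> the cross-ratio is smallest in the symmetric configuration: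
  by the arithmetic-geometric mean inequality the numerator is at least \<open>(X + Y)\<^sup>2\<close> and the
  denominator at most \<open>(Y - X)\<^sup>2\<close>. The quotient of these increases with \<open>X / Y \<ge> \<kappa>\<close>.
\<close>

lemma cross_ratio_lower_bound:
  fixes a b p q \<kappa> :: real
  assumes \<kappa>: "0 < \<kappa>" "\<kappa> < 1" and p: "0 \<le> p" "p < a" and q: "0 \<le> q" "q < b"
    and le: "\<kappa>\<^sup>2 * (a * b) \<le> p * q"
  shows "((1 + \<kappa>) / (1 - \<kappa>))\<^sup>2 * ((b - q) * (a - p)) \<le> (q + a) * (p + b)"
proof -
  define X Y where "X = sqrt (p * q)" and "Y = sqrt (a * b)"
  have X2: "X\<^sup>2 = p * q" and Y2: "Y\<^sup>2 = a * b" using p q by (simp_all add: X_def Y_def)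
  have XY: "0 \<le> X" "X \<le> Y" using p q by (auto simp: X_def Y_def intro!: real_sqrt_le_mono mult_mono)
  have "\<kappa> * Y \<le> X"
  proof (rule power2_le_imp_le)
    show "(\<kappa> * Y)\<^sup>2 \<le> X\<^sup>2" using le by (simp add: power_mult_distrib X2 Y2)
  qed (rule XY(1))
  then have "(1 + \<kappa>) * (Y - X) \<le> (1 - \<kappa>) * (X + Y)" by (simp add: algebra_simps)
  then have "(1 + \<kappa>) / (1 - \<kappa>) * (Y - X) \<le> X + Y" using \<kappa> by (simp add: pos_divide_le_eq mult.commute)
  then have 1: "((1 + \<kappa>) / (1 - \<kappa>) * (Y - X))\<^sup>2 \<le> (X + Y)\<^sup>2"
    using \<kappa> XY by (intro power_mono) auto
  have amgm: "2 * (X * Y) \<le> q * b + a * p"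
  proof -
    have "X * Y = sqrt (q * b) * sqrt (a * p)" by (simp add: X_def Y_def real_sqrt_mult[symmetric] mult_ac)
    moreover have "0 \<le> (sqrt (q * b) - sqrt (a * p))\<^sup>2" by simp
    moreover have "(sqrt (q * b) - sqrt (a * p))\<^sup>2 = q * b + a * p - 2 * (sqrt (q * b) * sqrt (a * p))"
      using p q by (simp add: power2_diff)
    ultimately show ?thesis by linarith
  qed
  have amgm2: "2 * (X * Y) \<le> b * p + q * a"
  proof -
    have "X * Y = sqrt (b * p) * sqrt (q * a)" by (simp add: X_def Y_def real_sqrt_mult[symmetric] mult_ac)
    moreover have "0 \<le> (sqrt (b * p) - sqrt (q * a))\<^sup>2" by simp
    moreover have "(sqrt (b * p) - sqrt (q * a))\<^sup>2 = b * p + q * a - 2 * (sqrt (b * p) * sqrt (q * a))"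
      using p q by (simp add: power2_diff)
    ultimately show ?thesis by linarith
  qed
  have "(b - q) * (a - p) \<le> (Y - X)\<^sup>2"
    using amgm2 by (simp add: power2_diff X2 Y2 algebra_simps)
  then have "((1 + \<kappa>) / (1 - \<kappa>))\<^sup>2 * ((b - q) * (a - p)) \<le> ((1 + \<kappa>) / (1 - \<kappa>))\<^sup>2 * (Y - X)\<^sup>2"
    by (rule mult_left_mono) simp
  also have "\<dots> \<le> (X + Y)\<^sup>2" using 1 by (simp only: power_mult_distrib)
  also have "\<dots> \<le> (q + a) * (p + b)" using amgm by (simp add: power2_sum X2 Y2 algebra_simps)
  finally show ?thesis .
qed

text \<open>
  The bounds \<open>2 a b / ((d + 1) (d + 2))\<close> from below and \<open>p q / 3\<close> from above. As \<open>p\<close> and \<open>q\<close> may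
  vanish here, the upper bound is applied to the slightly larger range \<open>[-(p + e), q + e]\<close>, for
  which the strict inequality persists.
\<close>

lemma variance_comparison:
  fixes L1 L2 :: "'a::euclidean_space set" and w :: 'a
  assumes L1: "compact L1" "convex L1" "0 < measure lborel L1" and L2: "compact L2" "convex L2" "0 < measure lborel L2"
    and w: "w \<noteq> 0" and ab: "0 < a" "0 < b" and pq: "0 \<le> p" "0 \<le> q"
    and x0: "x0 \<in> L1" "w \<bullet> x0 - m = - a" and y0: "y0 \<in> L1" "w \<bullet> y0 - m = b"
    and range1: "\<And>x. x \<in> L1 \<Longrightarrow> - a \<le> w \<bullet> x - m" "\<And>x. x \<in> L1 \<Longrightarrow> w \<bullet> x - m \<le> b"
    and range2: "\<And>x. x \<in> L2 \<Longrightarrow> - p \<le> w \<bullet> x - m" "\<And>x. x \<in> L2 \<Longrightarrow> w \<bullet> x - m \<le> q"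
    and mean: "(LINT x:L1|lborel. w \<bullet> x - m) = 0" "(LINT x:L2|lborel. w \<bullet> x - m) = 0"
    and less: "p * q < 6 / ((real DIM('a) + 1) * (real DIM('a) + 2)) * (a * b)"
  shows "(LINT x:L2|lborel. (w \<bullet> x - m)\<^sup>2) / measure lborel L2 < (LINT x:L1|lborel. (w \<bullet> x - m)\<^sup>2) / measure lborel L1"
proof -
  define D where "D = (real DIM('a) + 1) * (real DIM('a) + 2)"
  have D: "D > 0" by (simp add: D_def add_nonneg_pos)
  have "((\<lambda>e. (p + e) * (q + e)) \<longlongrightarrow> (p + 0) * (q + 0)) (at_right 0)" by (intro tendsto_intros)
  then have "\<forall>\<^sub>F e in at_right 0. (p + e) * (q + e) < 6 / D * (a * b)"
    by (rule order_tendstoD(2)) (use less in \<open>simp add: D_def\<close>)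
  moreover have "\<forall>\<^sub>F e in at_right (0::real). 0 < e" by (rule eventually_at_right_less)
  ultimately have "\<forall>\<^sub>F e in at_right (0::real). (p + e) * (q + e) < 6 / D * (a * b) \<and> 0 < e" by (rule eventually_conj)
  then obtain e where e: "(p + e) * (q + e) < 6 / D * (a * b)" "0 < e"
    using eventually_happens'[OF trivial_limit_at_right_real] by blast
  have up: "(LINT x:L2|lborel. (w \<bullet> x - m)\<^sup>2) \<le> (p + e) * (q + e) / 3 * measure lborel L2"
  proof (rule convex_second_moment_upper[OF L2(1,2) w])
    show "- (p + e) \<le> w \<bullet> x - m" "w \<bullet> x - m \<le> q + e" if "x \<in> L2" for x
      using range2[OF that] e(2) by linarith+
  qed (use pq e mean in auto)
  have lo: "2 * a * b * measure lborel L1 \<le> D * (LINT x:L1|lborel. (w \<bullet> x - m)\<^sup>2)"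
    unfolding D_def by (rule convex_second_moment_lower[OF L1(1,2) ab x0 y0 range1 mean(1)])
  have "(LINT x:L2|lborel. (w \<bullet> x - m)\<^sup>2) / measure lborel L2 \<le> (p + e) * (q + e) / 3"
    using up L2(3) by (simp add: pos_divide_le_eq)
  also have "\<dots> < 2 * a * b / D" using e(1) by simp
  also have "\<dots> \<le> (LINT x:L1|lborel. (w \<bullet> x - m)\<^sup>2) / measure lborel L1"
    using lo L1(3) D by (simp add: field_simps)
  finally show ?thesis .
qed

text \<open>
  Just after \<open>0\<close> the function is positive. Just before its first later zero it would have to be
  negative, so there would be an even earlier zero.
\<close>

lemma no_two_increasing_zeros:
  fixes G G' :: "real \<Rightarrow> real"
  assumes der: "\<And>t. 0 \<le> t \<Longrightarrow> t \<le> 1 \<Longrightarrow> (G has_real_derivative G' t) (at t)"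
    and zero: "G 0 = 0" "G 1 = 0"
    and inc: "\<And>t. 0 \<le> t \<Longrightarrow> t \<le> 1 \<Longrightarrow> G t = 0 \<Longrightarrow> 0 < G' t"
  shows False
proof -
  have cont: "continuous_on {a..b} G" if "0 \<le> a" "b \<le> 1" for a b
    by (intro continuous_at_imp_continuous_on ballI DERIV_isCont[OF der]) (use that in auto)
  obtain d where d: "d > 0" "\<And>h. 0 < h \<Longrightarrow> h < d \<Longrightarrow> G 0 < G (0 + h)"
    using DERIV_pos_inc_right[OF der[of 0] inc[of 0]] zero by auto
  define s where "s = min (d / 2) (1 / 2)"
  have s: "0 < s" "s < 1" "s < d" using d by (auto simp: s_def)
  have Gs: "0 < G s" using d(2)[of s] s zero by simp
  define S where "S = {t \<in> {s..1}. G t = 0}"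
  have "closed S"
    unfolding S_def
    by (rule continuous_closed_preimage_constant[OF cont]) (use s in auto)
  moreover have "1 \<in> S" using s zero by (simp add: S_def)
  moreover have bdd: "bdd_below S" unfolding S_def by (rule bdd_belowI[of _ s]) auto
  ultimately have "Inf S \<in> S" by (intro closed_contains_Inf) auto
  define t where "t = Inf S"
  have t: "s \<le> t" "t \<le> 1" "G t = 0" using \<open>Inf S \<in> S\<close> by (auto simp: t_def S_def)
  then have "s < t" using Gs by (cases "s = t") auto
  obtain d' where d': "d' > 0" "\<And>h. 0 < h \<Longrightarrow> h < d' \<Longrightarrow> G (t - h) < G t"
    using DERIV_pos_inc_left[OF der[of t] inc[of t]] t s by auto
  define e where "e = min (d' / 2) ((t - s) / 2)"
  have e: "0 < e" "e < d'" "e < t - s" using \<open>s < t\<close> d'(1) by (simp_all add: e_def min_less_iff_disj)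
  define u where "u = t - e"
  have u: "s < u" "u < t" using e by (simp_all add: u_def)
  have "G u < 0" using d'(2)[OF e(1,2)] t by (simp add: u_def)
  then obtain z where z: "s \<le> z" "z \<le> u" "G z = 0"
    using IVT2'[of G u 0 s] Gs u cont[of s u] s t by auto
  then have "z \<in> S" using u t by (simp add: S_def)
  then have "t \<le> z" unfolding t_def by (rule cInf_lower[OF _ bdd])
  then show False using z u by simp
qed

lemma affine_positive_interior:
  fixes K :: "'a::euclidean_space set"
  assumes "a \<noteq> 0" "\<And>x. x \<in> K \<Longrightarrow> 0 \<le> a \<bullet> x - \<alpha>" "x \<in> interior K"
  shows "0 < a \<bullet> x - \<alpha>"
proof (rule ccontr)
  assume n: "\<not> 0 < a \<bullet> x - \<alpha>"
  obtain e where e: "e > 0" "ball x e \<subseteq> K" using assms(3) by (meson mem_interior)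
  define y where "y = x - (e / 2 / norm a) *\<^sub>R a"
  have "y \<in> ball x e" using e(1) assms(1) by (simp add: y_def dist_norm)
  then have "0 \<le> a \<bullet> y - \<alpha>" using e(2) assms(2) by blast
  moreover have "a \<bullet> y = a \<bullet> x - e / 2 * norm a"
    using assms(1) by (simp add: y_def inner_diff_right dot_square_norm power2_eq_square)
  moreover have "0 < e / 2 * norm a" using e(1) assms(1) by simp
  ultimately show False using n by linarith
qed

text \<open>
  Translation between weighted integrals over \<open>K\<close> and plain integrals over the image body, to which
  the moment estimates for convex bodies apply: quotients of directional moments are the mean and
  the variance of \<open>w\<close> on the image.
\<close>

lemma centred_image:
  fixes K :: "(real ^ 'n::finite) set" and p c w :: "real ^ 'n"
  assumes K: "compact K" "0 < measure lborel K" and pos: "\<And>x. x \<in> K \<Longrightarrow> 0 < denominator p c x"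
  defines "L \<equiv> centred_map p c ` K" and "A \<equiv> \<lambda>k. directional_moment p c w k K"
  shows "compact L" "0 < measure lborel L" "convex K \<Longrightarrow> convex L"
    "(LINT y:L|lborel. w \<bullet> y - A 1 / A 0) = 0"
    "(LINT y:L|lborel. (w \<bullet> y - A 1 / A 0)\<^sup>2) / measure lborel L = A 2 / A 0 - (A 1 / A 0)\<^sup>2"
proof -
  have ne: "denominator p c x \<noteq> 0" if "x \<in> K" for x using pos[OF that] by simp
  have c\<pi>: "continuous_on K (centred_map p c)"
    unfolding centred_map_def by (intro continuous_intros continuous_denominator ballI) (rule ne)
  show cL: "compact L" unfolding L_def by (rule compact_continuous_image[OF c\<pi> K(1)])
  obtain T \<phi> where T: "represents T \<phi>" "\<And>x. fst (T (1, x)) = denominator p c x" "\<And>x. snd (T (1, x)) = x - p"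
    using centred_map_realised[of p c] by blast
  have lin: "linear T" and bij: "bij T" using T(1) by (auto simp: represents_def)
  have pos': "0 < fst (T (1, x))" if "x \<in> K" for x using pos[OF that] T(2) by simp
  have "\<exists>k>0. \<forall>F :: real^'n \<Rightarrow> real. continuous_on L F \<longrightarrow>
      (LINT y:L|lborel. F y) = k * (LINT x:K|lborel. F (centred_map p c x) / denominator p c x ^ Suc CARD('n))"
    by (rule set_integral_projective[OF lin bij K(1) pos'])
      (auto simp: T(2,3) L_def centred_map_def[abs_def])
  then obtain k where k: "k > 0" and cov: "\<And>F :: real^'n \<Rightarrow> real. continuous_on L F \<Longrightarrow>
      (LINT y:L|lborel. F y) = k * (LINT x:K|lborel. F (centred_map p c x) / denominator p c x ^ Suc CARD('n))"
    by blast
  have mom: "(LINT y:L|lborel. (w \<bullet> y) ^ n) = k * A n" for n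
  proof -
    have "(LINT y:L|lborel. (w \<bullet> y) ^ n) = k * (LINT x:K|lborel. (w \<bullet> centred_map p c x) ^ n / denominator p c x ^ Suc CARD('n))"
      by (rule cov) (intro continuous_intros)
    also have "(\<lambda>x. (w \<bullet> centred_map p c x) ^ n / denominator p c x ^ Suc CARD('n))
       = (\<lambda>x. (w \<bullet> (x - p)) ^ n / denominator p c x ^ (Suc CARD('n) + n))"
      by (simp add: fun_eq_iff centred_map_def divide_inverse power_mult_distrib power_add power_inverse mult_ac)
    finally show ?thesis by (simp add: A_def directional_moment_def)
  qed
  have A0: "A 0 > 0" unfolding A_def directional_moment_0 by (rule weighted_volume_pos[OF K pos])
  have vol: "measure lborel L = k * A 0"
    using mom[of 0] set_integral_const_compact[OF cL, of 1] by simp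
  show "0 < measure lborel L" using vol k A0 by simp
  have si: "set_integrable lborel L F" if "continuous_on L F" for F :: "real ^ 'n \<Rightarrow> real"
    by (rule set_integrable_compact[OF cL that])
  have const: "(LINT y:L|lborel. r) = r * (k * A 0)" for r :: real
    using set_integral_const_compact[OF cL, of r] vol by simp
  define m where "m = A 1 / A 0"
  have mA: "A 1 = m * A 0" using A0 by (simp add: m_def)
  have "(LINT y:L|lborel. w \<bullet> y - m) = (LINT y:L|lborel. w \<bullet> y) - (LINT y:L|lborel. m)"
    by (rule set_integral_diff(2)) (intro si continuous_intros)+
  also have "\<dots> = 0" using mom[of 1, unfolded mA power_one_right] by (simp add: const)
  finally show "(LINT y:L|lborel. w \<bullet> y - A 1 / A 0) = 0" by (simp add: m_def)
  have "(LINT y:L|lborel. (w \<bullet> y - m)\<^sup>2) = (LINT y:L|lborel. ((w \<bullet> y)\<^sup>2 - (2 * m) * (w \<bullet> y)) + m\<^sup>2)"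
    by (rule arg_cong[where f = "set_lebesgue_integral lborel L"]) (simp add: fun_eq_iff power2_diff)
  also have "\<dots> = (LINT y:L|lborel. (w \<bullet> y)\<^sup>2 - (2 * m) * (w \<bullet> y)) + (LINT y:L|lborel. m\<^sup>2)"
    by (rule set_integral_add(2)) (intro si continuous_intros)+
  also have "(LINT y:L|lborel. (w \<bullet> y)\<^sup>2 - (2 * m) * (w \<bullet> y)) = (LINT y:L|lborel. (w \<bullet> y)\<^sup>2) - (LINT y:L|lborel. (2 * m) * (w \<bullet> y))"
    by (rule set_integral_diff(2)) (intro si continuous_intros)+
  also have "(LINT y:L|lborel. (2 * m) * (w \<bullet> y)) = 2 * m * (k * (m * A 0))" using mom[of 1, unfolded mA power_one_right] by simp
  also have "(LINT y:L|lborel. (w \<bullet> y)\<^sup>2) = k * A 2" by (rule mom)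
  also have "(LINT y:L|lborel. m\<^sup>2) = m\<^sup>2 * (k * A 0)" by (rule const)
  finally have "(LINT y:L|lborel. (w \<bullet> y - m)\<^sup>2) = k * (A 2 - m\<^sup>2 * A 0)" by (simp add: power2_eq_square algebra_simps)
  then show "(LINT y:L|lborel. (w \<bullet> y - A 1 / A 0)\<^sup>2) / measure lborel L = A 2 / A 0 - (A 1 / A 0)\<^sup>2"
    unfolding m_def[symmetric] vol using k A0 by (simp add: field_simps)
  show "convex L" if conv: "convex K"
  proof (rule convexI)
    fix y z :: "real ^ 'n" and u v :: real
    assume yz: "y \<in> L" "z \<in> L" and uv: "0 \<le> u" "0 \<le> v" "u + v = 1"
    obtain x1 x2 where x: "x1 \<in> K" "y = centred_map p c x1" "x2 \<in> K" "z = centred_map p c x2"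
      using yz by (auto simp: L_def)
    define f1 f2 where "f1 = denominator p c x1" and "f2 = denominator p c x2"
    have f: "f1 > 0" "f2 > 0" using pos x by (auto simp: f1_def f2_def)
    define r s where "r = u / f1" and "s = v / f2"
    have rs: "0 \<le> r" "0 \<le> s" "r * f1 + s * f2 = 1" using uv f by (auto simp: r_def s_def)
    have rs0: "r + s > 0"
    proof (rule ccontr)
      assume "\<not> r + s > 0"
      then have "r = 0" "s = 0" using rs by auto
      then show False using rs(3) by simp
    qed
    define x' where "x' = (r / (r + s)) *\<^sub>R x1 + (s / (r + s)) *\<^sub>R x2"
    have "x' \<in> K" unfolding x'_def
      by (rule convexD[OF conv x(1,3)]) (use rs rs0 in \<open>auto simp: add_divide_distrib[symmetric]\<close>)
    have diff: "x' - p = inverse (r + s) *\<^sub>R (r *\<^sub>R (x1 - p) + s *\<^sub>R (x2 - p))"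
    proof -
      have pp: "(r / (r + s)) *\<^sub>R p + (s / (r + s)) *\<^sub>R p = p"
        using rs0 by (simp add: scaleR_add_left[symmetric] add_divide_distrib[symmetric])
      have "x' - p = x' - ((r / (r + s)) *\<^sub>R p + (s / (r + s)) *\<^sub>R p)" unfolding pp ..
      also have "\<dots> = (r / (r + s)) *\<^sub>R (x1 - p) + (s / (r + s)) *\<^sub>R (x2 - p)"
        by (simp add: x'_def scaleR_diff_right)
      finally show ?thesis by (simp add: scaleR_add_right divide_inverse mult.commute)
    qed
    have "denominator p c x' = 1 + inverse (r + s) * (r * (f1 - 1) + s * (f2 - 1))"
      by (simp add: denominator_def diff f1_def f2_def inner_add_right)
    also have "\<dots> = inverse (r + s)"
    proof -
      have e: "r * (f1 - 1) + s * (f2 - 1) = 1 - (r + s)" using rs(3) by (simp add: algebra_simps)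
      show ?thesis unfolding e using rs0 by (simp add: field_simps)
    qed
    finally have "centred_map p c x' = (r + s) *\<^sub>R (x' - p)" by (simp add: centred_map_def)
    also have "\<dots> = r *\<^sub>R (x1 - p) + s *\<^sub>R (x2 - p)" using rs0 by (simp add: diff)
    also have "\<dots> = u *\<^sub>R y + v *\<^sub>R z"
      by (simp add: x centred_map_def r_def s_def f1_def f2_def divide_inverse)
    finally have "u *\<^sub>R y + v *\<^sub>R z = centred_map p c x'" ..
    then show "u *\<^sub>R y + v *\<^sub>R z \<in> L" using \<open>x' \<in> K\<close> by (simp add: L_def)
  qed
qed

text \<open>
  The bounds of \<open>h = w \<bullet> centred_map p c\<close> on \<open>K1\<close> and on \<open>K2\<close> are attained on hyperplanes of one
  pencil, whose axis may be at infinity: \<open>h = s\<close> means \<open>w \<bullet> (x - p) = s * denominator p c x\<close>, which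
  is affine in \<open>x\<close>. The cross-ratio of these hyperplanes is that of the corresponding values of \<open>h\<close>.
  If the product of the distances of the mean from the bounds on \<open>K2\<close> were at least \<open>\<kappa>\<^sup>2\<close> times that
  for \<open>K1\<close>, this cross-ratio would be too large for the given width.
\<close>

lemma critical_variance:
  fixes K1 K2 :: "(real ^ 'n::finite) set"
  assumes d: "2 \<le> CARD('n)" and K1: "convex_body K1" and K2: "convex_body K2" and sub: "K2 \<subseteq> interior K1" and p: "p \<in> K2"
    and width: "hilbert_width K1 K2 < ereal (ln ((1 + kappa CARD('n)) / (1 - kappa CARD('n))))"
    and pos: "\<And>x. x \<in> K1 \<Longrightarrow> 0 < denominator p c x" and w: "w \<noteq> 0"
  defines "A \<equiv> \<lambda>k. directional_moment p c w k K1" and "B \<equiv> \<lambda>k. directional_moment p c w k K2"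
  assumes crit: "A 1 / A 0 = B 1 / B 0"
  shows "B 2 / B 0 < A 2 / A 0"
proof -
  have c1: "compact K1" "convex K1" "0 < measure lborel K1" and c2: "compact K2" "convex K2" "0 < measure lborel K2"
    and i2: "interior K2 \<noteq> {}"
    using K1 K2 measure_lborel_pos by (auto simp: convex_body_def)
  have sub': "K2 \<subseteq> K1" using sub interior_subset by blast
  have pos2: "0 < denominator p c x" if "x \<in> K2" for x using pos sub' that by blast
  define h where "h = (\<lambda>x. w \<bullet> centred_map p c x)"
  define L1 L2 where "L1 = centred_map p c ` K1" and "L2 = centred_map p c ` K2"
  define m where "m = A 1 / A 0"
  have mB: "B 1 / B 0 = m" using crit by (simp add: m_def)
  have I1: "compact L1" "0 < measure lborel L1" unfolding L1_def
    by (rule centred_image(1,2)[OF c1(1,3)]; rule pos; assumption)+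
  have I1': "convex L1" unfolding L1_def by (rule centred_image(3)[OF c1(1,3) _ c1(2)]) (rule pos)
  have I1m: "(LINT y:L1|lborel. w \<bullet> y - m) = 0" unfolding L1_def m_def A_def
    by (rule centred_image(4)[OF c1(1,3)]) (rule pos)
  have I1v: "(LINT y:L1|lborel. (w \<bullet> y - m)\<^sup>2) / measure lborel L1 = A 2 / A 0 - m\<^sup>2" unfolding L1_def m_def A_def
    by (rule centred_image(5)[OF c1(1,3)]) (rule pos)
  have I2: "compact L2" "0 < measure lborel L2" unfolding L2_def
    by (rule centred_image(1,2)[OF c2(1,3)]; rule pos2; assumption)+
  have I2': "convex L2" unfolding L2_def by (rule centred_image(3)[OF c2(1,3) _ c2(2)]) (rule pos2)
  have I2m: "(LINT y:L2|lborel. w \<bullet> y - m) = 0" unfolding L2_def mB[symmetric] B_def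
    by (rule centred_image(4)[OF c2(1,3)]) (rule pos2)
  have I2v: "(LINT y:L2|lborel. (w \<bullet> y - m)\<^sup>2) / measure lborel L2 = B 2 / B 0 - m\<^sup>2" unfolding L2_def mB[symmetric] B_def
    by (rule centred_image(5)[OF c2(1,3)]) (rule pos2)
  have hf: "h x = (w \<bullet> (x - p)) / denominator p c x" for x by (simp add: h_def centred_map_def divide_inverse mult.commute)
  have ch: "continuous_on K1 h" unfolding hf[abs_def]
    by (intro continuous_intros continuous_denominator ballI) (metis less_irrefl pos)
  have ch2: "continuous_on K2 h" by (rule continuous_on_subset[OF ch sub'])
  have ne: "K1 \<noteq> {}" "K2 \<noteq> {}" using p sub' by auto
  obtain x1 where x1: "x1 \<in> K1" "\<And>x. x \<in> K1 \<Longrightarrow> h x1 \<le> h x" using continuous_attains_inf[OF c1(1) ne(1) ch] by blast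
  obtain y1 where y1: "y1 \<in> K1" "\<And>x. x \<in> K1 \<Longrightarrow> h x \<le> h y1" using continuous_attains_sup[OF c1(1) ne(1) ch] by blast
  obtain x2 where x2: "x2 \<in> K2" "\<And>x. x \<in> K2 \<Longrightarrow> h x2 \<le> h x" using continuous_attains_inf[OF c2(1) ne(2) ch2] by blast
  obtain y2 where y2: "y2 \<in> K2" "\<And>x. x \<in> K2 \<Longrightarrow> h x \<le> h y2" using continuous_attains_sup[OF c2(1) ne(2) ch2] by blast
  define m1 M1 where "m1 = h x1" and "M1 = h y1"
  \<comment> \<open>The affine functions \<open>denominator * (h - m1)\<close> and \<open>denominator * (M1 - h)\<close>, written out.\<close>
  define u v where "u = w - m1 *\<^sub>R c" and "v = M1 *\<^sub>R c - w"
  define \<alpha> \<beta> where "\<alpha> = u \<bullet> p + m1" and "\<beta> = v \<bullet> p - M1"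
  have U: "u \<bullet> x - \<alpha> = denominator p c x * (h x - m1)" if "denominator p c x \<noteq> 0" for x
  proof -
    have "denominator p c x * h x = w \<bullet> (x - p)" using that by (simp add: hf)
    then have "denominator p c x * (h x - m1) = w \<bullet> (x - p) - m1 * denominator p c x" by (simp add: algebra_simps)
    then show ?thesis by (simp add: u_def \<alpha>_def denominator_def inner_diff_left inner_diff_right algebra_simps)
  qed
  have V: "v \<bullet> x - \<beta> = denominator p c x * (M1 - h x)" if "denominator p c x \<noteq> 0" for x
  proof -
    have "denominator p c x * h x = w \<bullet> (x - p)" using that by (simp add: hf)
    then have "denominator p c x * (M1 - h x) = M1 * denominator p c x - w \<bullet> (x - p)" by (simp add: algebra_simps)
    then show ?thesis by (simp add: v_def \<beta>_def denominator_def inner_diff_left inner_diff_right algebra_simps)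
  qed
  have den: "denominator p c x \<noteq> 0" if "x \<in> K1" for x using pos[OF that] by simp
  have pU: "0 \<le> u \<bullet> x - \<alpha>" if "x \<in> K1" for x
    unfolding U[OF den[OF that]] m1_def using pos[OF that] x1(2)[OF that] by (intro mult_nonneg_nonneg) auto
  have pV: "0 \<le> v \<bullet> x - \<beta>" if "x \<in> K1" for x
    unfolding V[OF den[OF that]] M1_def using pos[OF that] y1(2)[OF that] by (intro mult_nonneg_nonneg) auto
  have u0: "u \<noteq> 0"
  proof
    assume u: "u = 0"
    have "u \<bullet> x1 - \<alpha> = 0" unfolding U[OF den[OF x1(1)]] m1_def by simp
    then have "m1 = 0" using u by (simp add: \<alpha>_def)
    then show False using u w by (simp add: u_def)
  qed
  have v0: "v \<noteq> 0"
  proof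
    assume v: "v = 0"
    have "v \<bullet> y1 - \<beta> = 0" unfolding V[OF den[OF y1(1)]] M1_def by simp
    then have "M1 = 0" using v by (simp add: \<beta>_def)
    then show False using v w by (simp add: v_def)
  qed
  have Upos: "0 < u \<bullet> x - \<alpha>" and Vpos: "0 < v \<bullet> x - \<beta>" if "x \<in> K2" for x
    using affine_positive_interior[OF u0 pU] affine_positive_interior[OF v0 pV] sub that by blast+
  have strict: "m1 < h x" "h x < M1" if "x \<in> K2" for x
  proof -
    have n: "denominator p c x \<noteq> 0" using pos2[OF that] by simp
    show "m1 < h x" "h x < M1"
      using Upos[OF that] Vpos[OF that] pos2[OF that] unfolding U[OF n] V[OF n] by (simp_all add: zero_less_mult_iff)
  qed
  have mean_bounds: "h x2 \<le> m" "m \<le> h y2"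
  proof -
    have si: "set_integrable lborel L2 F" if "continuous_on L2 F" for F :: "real ^ 'n \<Rightarrow> real"
      by (rule set_integrable_compact[OF I2(1) that])
    have "(LINT y:L2|lborel. h x2 - m) \<le> (LINT y:L2|lborel. w \<bullet> y - m)"
      by (rule set_integral_mono_compact[OF I2(1)]) (use x2(2) in \<open>auto simp: L2_def h_def intro!: continuous_intros\<close>)
    then have "measure lborel L2 * (h x2 - m) \<le> 0"
      using set_integral_const_compact[OF I2(1), of "h x2 - m"] I2m by linarith
    then show "h x2 \<le> m" using I2(2) by (simp add: mult_le_0_iff)
    have "(LINT y:L2|lborel. w \<bullet> y - m) \<le> (LINT y:L2|lborel. h y2 - m)"
      by (rule set_integral_mono_compact[OF I2(1)]) (use y2(2) in \<open>auto simp: L2_def h_def intro!: continuous_intros\<close>)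
    then have "0 \<le> measure lborel L2 * (h y2 - m)"
      using set_integral_const_compact[OF I2(1), of "h y2 - m"] I2m by linarith
    then show "m \<le> h y2" using I2(2) by (simp add: zero_le_mult_iff)
  qed
  define a b p' q' where "a = m - m1" and "b = M1 - m" and "p' = m - h x2" and "q' = h y2 - m"
  have p': "0 \<le> p'" "p' < a" using mean_bounds strict[OF x2(1)] by (auto simp: p'_def a_def)
  have q': "0 \<le> q'" "q' < b" using mean_bounds strict[OF y2(1)] by (auto simp: q'_def b_def)
  define \<kappa> where "\<kappa> = kappa CARD('n)"
  have \<kappa>: "0 < \<kappa>" "\<kappa> < 1" "\<kappa>\<^sup>2 = 6 / ((real CARD('n) + 1) * (real CARD('n) + 2))"
    using kappa_bounds[OF d] by (simp_all add: \<kappa>_def)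
  define \<rho> where "\<rho> = (1 + \<kappa>) / (1 - \<kappa>)"
  have \<rho>: "\<rho> > 0" using \<kappa> by (simp add: \<rho>_def)
  have less: "p' * q' < \<kappa>\<^sup>2 * (a * b)"
  proof (rule ccontr)
    assume "\<not> p' * q' < \<kappa>\<^sup>2 * (a * b)"
    then have big: "\<rho>\<^sup>2 * ((b - q') * (a - p')) \<le> (q' + a) * (p' + b)"
      unfolding \<rho>_def using cross_ratio_lower_bound[OF \<kappa>(1,2) p' q'] by simp
    \<comment> \<open>A real number between the width, which is an extended real, and the bound.\<close>
    obtain r where r: "hilbert_width K1 K2 < ereal r" "ereal r < ereal (ln \<rho>)"
      using ereal_dense2[OF width] unfolding \<rho>_def \<kappa>_def by blast
    have "(u \<bullet> y2 - \<alpha>) * (v \<bullet> x2 - \<beta>) \<le> exp (2 * r) * ((v \<bullet> y2 - \<beta>) * (u \<bullet> x2 - \<alpha>))"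
    proof (rule hilbert_width_cross_ratio_bound[OF d c1(1) c2(1) i2 sub' less_imp_le[OF r(1)], of u \<alpha> v \<beta> x1 y1])
      show "u \<bullet> x1 - \<alpha> = 0" unfolding U[OF den[OF x1(1)]] m1_def by simp
      show "v \<bullet> y1 - \<beta> = 0" unfolding V[OF den[OF y1(1)]] M1_def by simp
      have "m1 < M1" using strict[OF x2(1)] by simp
      then show "0 < u \<bullet> x - \<alpha> + (v \<bullet> x - \<beta>)" if "x \<in> K1" for x
        unfolding U[OF den[OF that]] V[OF den[OF that]] distrib_left[symmetric] using pos[OF that] by simp
    qed (use pU pV Upos Vpos x1 y1 x2 y2 in auto)
    define D where "D = denominator p c y2 * denominator p c x2"
    have D: "D > 0" using pos2 x2(1) y2(1) by (simp add: D_def)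
    have n2: "denominator p c x2 \<noteq> 0" "denominator p c y2 \<noteq> 0" using pos2[OF x2(1)] pos2[OF y2(1)] by auto
    have "D * ((h y2 - m1) * (M1 - h x2)) \<le> D * (exp (2 * r) * ((M1 - h y2) * (h x2 - m1)))"
      using \<open>(u \<bullet> y2 - \<alpha>) * (v \<bullet> x2 - \<beta>) \<le> exp (2 * r) * ((v \<bullet> y2 - \<beta>) * (u \<bullet> x2 - \<alpha>))\<close>
      unfolding U[OF n2(1)] U[OF n2(2)] V[OF n2(1)] V[OF n2(2)] D_def by (simp only: mult.assoc mult.commute mult.left_commute)
    then have "(h y2 - m1) * (M1 - h x2) \<le> exp (2 * r) * ((M1 - h y2) * (h x2 - m1))" using D by simp
    moreover have "h y2 - m1 = q' + a" "M1 - h x2 = p' + b" "M1 - h y2 = b - q'" "h x2 - m1 = a - p'"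
      by (simp_all add: q'_def a_def p'_def b_def)
    ultimately have "\<rho>\<^sup>2 * ((b - q') * (a - p')) \<le> exp (2 * r) * ((b - q') * (a - p'))" using big by simp
    then have "\<rho>\<^sup>2 \<le> exp (2 * r)" using p' q' by simp
    moreover have "exp (2 * r) < \<rho>\<^sup>2"
    proof -
      have "exp (2 * r) < exp (2 * ln \<rho>)" using r(2) by simp
      also have "\<dots> = \<rho>\<^sup>2" using \<rho> by (metis exp_double exp_ln mult.commute power2_eq_square)
      finally show ?thesis .
    qed
    ultimately show False by simp
  qed
  have "(LINT y:L2|lborel. (w \<bullet> y - m)\<^sup>2) / measure lborel L2 < (LINT y:L1|lborel. (w \<bullet> y - m)\<^sup>2) / measure lborel L1"
  proof (rule variance_comparison[OF I1(1) I1' I1(2) I2(1) I2' I2(2) w, of a b p' q' "centred_map p c x1" m "centred_map p c y1"])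
    show "0 < a" "0 < b" using p' q' by auto
    show "w \<bullet> centred_map p c x1 - m = - a" "w \<bullet> centred_map p c y1 - m = b"
      by (simp_all add: a_def b_def m1_def M1_def h_def)
    show "- a \<le> w \<bullet> y - m" "w \<bullet> y - m \<le> b" if "y \<in> L1" for y
      using that x1(2) y1(2) by (auto simp: L1_def a_def b_def m1_def M1_def h_def)
    show "- p' \<le> w \<bullet> y - m" "w \<bullet> y - m \<le> q'" if "y \<in> L2" for y
      using that x2(2) y2(2) by (auto simp: L2_def p'_def q'_def h_def)
    show "p' * q' < 6 / ((real DIM(real ^ 'n) + 1) * (real DIM(real ^ 'n) + 2)) * (a * b)"
      using less by (simp add: \<kappa>(3))
  qed (use p' q' x1 y1 I1m I2m in \<open>auto simp: L1_def\<close>)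
  then show ?thesis unfolding I1v I2v by simp
qed

text \<open>
  On the segment between two critical parameters, the difference of the \<open>w\<close>-components of the
  centroids would vanish at both ends while increasing at each of its zeros.
\<close>

lemma unique_if_small_width:
  fixes K1 K2 :: "(real ^ 'n::finite) set"
  assumes d: "2 \<le> CARD('n)" and K1: "convex_body K1" and K2: "convex_body K2" and sub: "K2 \<subseteq> interior K1"
    and width: "hilbert_width K1 K2 < ereal (ln ((1 + kappa CARD('n)) / (1 - kappa CARD('n))))"
  shows "unique_modulo_affine K1 K2"
  unfolding unique_modulo_affine_def
proof (intro allI impI)
  fix \<phi> \<psi> assume eq: "equates_centroids \<phi> K1 K2 \<and> equates_centroids \<psi> K1 K2"
  have c1: "compact K1" "convex K1" "0 < measure lborel K1" and c2: "compact K2" "convex K2" "0 < measure lborel K2"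
    using K1 K2 measure_lborel_pos by (auto simp: convex_body_def)
  have "interior K2 \<noteq> {}" using K2 by (simp add: convex_body_def)
  then obtain p where p: "p \<in> K2" using interior_subset by blast
  have sub': "K2 \<subseteq> K1" using sub interior_subset by blast
  have pK1: "p \<in> K1" using p sub' by blast
  obtain T c0 where T: "represents T \<phi>" "\<And>x. fst (T (1, x)) = denominator p c0 x" "\<And>x. x \<in> K1 \<Longrightarrow> 0 < denominator p c0 x"
    using admissible_normal_form[of \<phi> K1 p] eq c1(2) pK1 unfolding equates_centroids_def by blast
  obtain S c1' where S: "represents S \<psi>" "\<And>x. fst (S (1, x)) = denominator p c1' x" "\<And>x. x \<in> K1 \<Longrightarrow> 0 < denominator p c1' x"
    using admissible_normal_form[of \<psi> K1 p] eq c1(2) pK1 unfolding equates_centroids_def by blast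
  have "c0 = c1'"
  proof (rule ccontr)
    assume "c0 \<noteq> c1'"
    define w where "w = c1' - c0"
    have w: "w \<noteq> 0" using \<open>c0 \<noteq> c1'\<close> by (simp add: w_def)
    have cw: "c0 + 1 *\<^sub>R w = c1'" "c0 + 0 *\<^sub>R w = c0" by (simp_all add: w_def)
    have pos: "0 < denominator p (c0 + t *\<^sub>R w) x" if "0 \<le> t" "t \<le> 1" "x \<in> K1" for t x
    proof -
      have "denominator p (c0 + t *\<^sub>R w) x = (1 - t) * denominator p c0 x + t * denominator p c1' x"
        by (simp add: denominator_def w_def inner_add_left inner_diff_left algebra_simps)
      moreover have "0 < (1 - t) * denominator p c0 x + t * denominator p c1' x"
      proof (cases "t = 0")
        case True then show ?thesis using T(3)[OF that(3)] by simp
      next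
        case False
        then have "0 < t * denominator p c1' x" using S(3)[OF that(3)] that by simp
        moreover have "0 \<le> (1 - t) * denominator p c0 x" using T(3)[OF that(3)] that by simp
        ultimately show ?thesis by linarith
      qed
      ultimately show ?thesis by simp
    qed
    have pos2: "0 < denominator p (c0 + t *\<^sub>R w) x" if "0 \<le> t" "t \<le> 1" "x \<in> K2" for t x using pos that sub' by blast
    define A where "A = (\<lambda>k t. directional_moment p (c0 + t *\<^sub>R w) w k K1)"
    define B where "B = (\<lambda>k t. directional_moment p (c0 + t *\<^sub>R w) w k K2)"
    define D where "D = real CARD('n)"
    define G where "G = (\<lambda>t. B 1 t / B 0 t - A 1 t / A 0 t)"
    define G' where "G' = (\<lambda>t. ((D + 1) * (B 1 t / B 0 t)\<^sup>2 - (D + 2) * (B 2 t / B 0 t)) - ((D + 1) * (A 1 t / A 0 t)\<^sup>2 - (D + 2) * (A 2 t / A 0 t)))"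
    have moments: "w \<bullet> weighted_moment p (c0 + t *\<^sub>R w) K1 = A 1 t / A 0 t" "w \<bullet> weighted_moment p (c0 + t *\<^sub>R w) K2 = B 1 t / B 0 t"
      if "0 \<le> t" "t \<le> 1" for t
      unfolding A_def B_def
      using inner_weighted_moment[OF c1(1) pos[OF that]] inner_weighted_moment[OF c2(1) pos2[OF that]] by blast+
    show False
    proof (rule no_two_increasing_zeros[of G G'])
      fix t :: real assume t: "0 \<le> t" "t \<le> 1"
      show "(G has_real_derivative G' t) (at t)"
        unfolding G_def G'_def A_def B_def D_def
        by (intro DERIV_diff weighted_mean_derivative[OF c1(1,3) pos[OF t]] weighted_mean_derivative[OF c2(1,3) pos2[OF t]])
      assume "G t = 0"
      then have crit: "A 1 t / A 0 t = B 1 t / B 0 t" by (simp add: G_def)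
      have "B 2 t / B 0 t < A 2 t / A 0 t"
        unfolding A_def B_def
        by (rule critical_variance[OF d K1 K2 sub p width pos[OF t] w crit[unfolded A_def B_def]])
      then have "0 < (D + 2) * (A 2 t / A 0 t - B 2 t / B 0 t)" by (simp add: D_def)
      also have "\<dots> = G' t" unfolding G'_def crit by (simp add: algebra_simps)
      finally show "0 < G' t" .
    next
      have "weighted_moment p c0 K1 = weighted_moment p c0 K2"
        using equates_centroids_iff[OF T(1,2) c1 c2(1,3) sub' T(3)] eq by blast
      then show "G 0 = 0" using moments[of 0] unfolding G_def cw by simp
      have "weighted_moment p c1' K1 = weighted_moment p c1' K2"
        using equates_centroids_iff[OF S(1,2) c1 c2(1,3) sub' S(3)] eq by blast
      then show "G 1 = 0" using moments[of 1] unfolding G_def cw by simp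
    qed
  qed
  then show "affine_transformation (\<phi> \<circ> inv \<psi>)"
    using same_denominator_affine[OF T(1) S(1)] T(2) S(2) by simp
qed

section \<open>Non-uniqueness\<close>

lemma symmetric_odd_moment:
  fixes K :: "(real ^ 'n::finite) set"
  assumes K: "compact K" and sym: "uminus ` K = K"
  shows "(LINT x:K|lborel. w \<bullet> x) = 0"
proof -
  have T: "0 + (\<Sum>j\<in>Basis. (- 1 * (x \<bullet> j)) *\<^sub>R j) = - x" for x :: "real ^ 'n"
    by (simp add: sum_negf euclidean_representation)
  have "(LINT x:uminus ` K|lborel. w \<bullet> x) = (\<Prod>j\<in>(Basis :: (real ^ 'n) set). \<bar>- 1 :: real\<bar>) * (LINT x:K|lborel. w \<bullet> (- x))"
    using set_integral_diagonal_affine[of "\<lambda>_. - 1" K 0 "\<lambda>x. w \<bullet> x"] K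
    unfolding T by (simp add: continuous_on_inner)
  then have "(LINT x:K|lborel. w \<bullet> x) = - (LINT x:K|lborel. w \<bullet> x)"
    unfolding sym by (simp add: set_lebesgue_integral_def)
  then show ?thesis by simp
qed

text \<open>
  By symmetry the identity equates the centroids. The condition on the variances says that the ratio
  of the volumes decreases strictly when \<open>c\<close> leaves \<open>0\<close> in the direction \<open>w\<close>, so the transformation
  that minimises this ratio has \<open>c \<noteq> 0\<close> and is not affine.
\<close>

lemma not_unique_if_variance_larger:
  fixes K1 K2 :: "(real ^ 'n::finite) set"
  assumes K1: "convex_body K1" and K2: "convex_body K2" and sub: "K2 \<subseteq> interior K1"
    and sym: "uminus ` K1 = K1" "uminus ` K2 = K2" and w: "w \<noteq> 0"
    and var: "(LINT x:K1|lborel. (w \<bullet> x)\<^sup>2) / measure lborel K1 < (LINT x:K2|lborel. (w \<bullet> x)\<^sup>2) / measure lborel K2"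
  shows "\<exists>\<phi> \<psi>. equates_centroids \<phi> K1 K2 \<and> equates_centroids \<psi> K1 K2 \<and> \<not> affine_transformation (\<phi> \<circ> inv \<psi>)"
proof -
  have c1: "compact K1" "convex K1" "0 < measure lborel K1" and c2: "compact K2" "convex K2" "0 < measure lborel K2"
    using K1 K2 measure_lborel_pos by (auto simp: convex_body_def)
  have sub': "K2 \<subseteq> K1" using sub interior_subset by blast
  have "K2 \<noteq> {}" using c2(3) by auto
  then obtain x where x: "x \<in> K2" by blast
  then have "- x \<in> K2" using sym(2) by blast
  then have "(1/2) *\<^sub>R x + (1/2) *\<^sub>R (- x) \<in> K2" using x c2(2) by (intro convexD) auto
  then have p: "0 \<in> K2" by simp
  have den0: "denominator 0 0 x = 1" for x :: "real ^ 'n" by (simp add: denominator_def)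
  have pos0: "0 < denominator 0 0 x" if "x \<in> K1" for x :: "real ^ 'n" by (simp add: den0)
  obtain T \<phi> c where T: "represents T \<phi>" "\<And>x. fst (T (1, x)) = denominator 0 c x"
    "\<And>x. x \<in> K1 \<Longrightarrow> 0 < denominator 0 c x" "equates_centroids \<phi> K1 K2"
    and min: "\<And>c'. (\<And>x. x \<in> K1 \<Longrightarrow> 0 < denominator 0 c' x) \<Longrightarrow>
       weighted_volume 0 c K1 / weighted_volume 0 c K2 \<le> weighted_volume 0 c' K1 / weighted_volume 0 c' K2"
    using equating_minimiser_exists[OF K1 K2 sub p] by blast
  have id: "represents (\<lambda>z. z) (\<lambda>P. P)" by (simp add: represents_def bij_id[unfolded id_def] linear_ident)
  have mom0: "directional_moment 0 0 v 1 K = 0" if "compact K" "uminus ` K = K" for K :: "(real ^ 'n) set" and v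
    using symmetric_odd_moment[OF that, of v] by (simp add: directional_moment_def den0)
  have wm: "weighted_moment 0 0 K = 0" if K: "compact K" "uminus ` K = K" for K :: "(real ^ 'n) set"
  proof -
    have "v \<bullet> weighted_moment 0 0 K = v \<bullet> 0" for v
      using inner_weighted_moment[OF K(1), of 0 0 v] mom0[OF K, of v] by (simp add: den0)
    then show ?thesis using vector_eq_ldot by blast
  qed
  have fst0: "fst (1, x) = denominator 0 0 x" for x :: "real ^ 'n" by (simp add: den0)
  have "weighted_moment 0 0 K1 = weighted_moment 0 0 K2" using wm[OF c1(1) sym(1)] wm[OF c2(1) sym(2)] by simp
  then have eq_id: "equates_centroids (\<lambda>P. P) K1 K2"
    using equates_centroids_iff[OF id fst0 c1 c2(1,3) sub' pos0] by blast
  have "c \<noteq> 0"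
  proof
    assume c0: "c = 0"
    define F where "F = (\<lambda>t. weighted_volume 0 (0 + t *\<^sub>R w) K1 / weighted_volume 0 (0 + t *\<^sub>R w) K2)"
    define A where "A = (\<lambda>k t. directional_moment 0 (0 + t *\<^sub>R w) w k K1)"
    define B where "B = (\<lambda>k t. directional_moment 0 (0 + t *\<^sub>R w) w k K2)"
    define D where "D = real CARD('n)"
    define G where "G = (\<lambda>t. A 1 t / A 0 t - B 1 t / B 0 t)"
    obtain \<delta> where \<delta>: "\<delta> > 0" "\<And>t x. \<bar>t\<bar> < \<delta> \<Longrightarrow> x \<in> K1 \<Longrightarrow> 0 < denominator 0 (0 + t *\<^sub>R w) x"
      using positive_denominator_open[OF c1(1) pos0, of w] by blast
    have \<delta>2: "0 < denominator 0 (0 + t *\<^sub>R w) x" if "\<bar>t\<bar> < \<delta>" "x \<in> K2" for t x using \<delta>(2) that sub' by blast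
    have A0: "A 1 0 = 0" "B 1 0 = 0" using mom0[OF c1(1) sym(1)] mom0[OF c2(1) sym(2)] by (simp_all add: A_def B_def)
    have dA: "((\<lambda>t. A 1 t / A 0 t) has_real_derivative (D + 1) * (A 1 0 / A 0 0)\<^sup>2 - (D + 2) * (A 2 0 / A 0 0)) (at 0)"
      unfolding A_def D_def by (rule weighted_mean_derivative[OF c1(1,3)]) (use \<delta>(1) \<delta>(2)[of 0] in simp)
    have dB: "((\<lambda>t. B 1 t / B 0 t) has_real_derivative (D + 1) * (B 1 0 / B 0 0)\<^sup>2 - (D + 2) * (B 2 0 / B 0 0)) (at 0)"
      unfolding B_def D_def by (rule weighted_mean_derivative[OF c2(1,3)]) (use \<delta>(1) \<delta>2[of 0] in simp)
    have m0: "directional_moment 0 (0 + 0 *\<^sub>R w) w 0 K = measure lborel K" "directional_moment 0 (0 + 0 *\<^sub>R w) w 2 K = (LINT x:K|lborel. (w \<bullet> x)\<^sup>2)"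
      if "compact K" for K :: "(real ^ 'n) set"
      using set_integral_const_compact[OF that, of 1] by (simp_all add: directional_moment_def den0)
    have var': "A 2 0 / A 0 0 < B 2 0 / B 0 0"
      unfolding A_def B_def m0[OF c1(1)] m0[OF c2(1)] by (rule var)
    have "(G has_real_derivative (D + 2) * (B 2 0 / B 0 0 - A 2 0 / A 0 0)) (at 0)"
      using DERIV_diff[OF dA dB, unfolded A0] unfolding G_def by (simp add: algebra_simps diff_divide_distrib add_divide_distrib)
    moreover have "0 < (D + 2) * (B 2 0 / B 0 0 - A 2 0 / A 0 0)" using var' by (simp add: D_def)
    ultimately obtain d where d: "d > 0" "\<And>h. 0 < h \<Longrightarrow> h < d \<Longrightarrow> G 0 < G (0 + h)"
      using DERIV_pos_inc_right by blast
    have G0: "G 0 = 0" unfolding G_def A0 by simp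
    define t where "t = min (d / 2) (\<delta> / 2)"
    have t: "0 < t" "t < d" "t < \<delta>" using d(1) \<delta>(1) by (simp_all add: t_def min_less_iff_disj)
    have Fpos: "0 < F s" if "\<bar>s\<bar> < \<delta>" for s
      unfolding F_def using weighted_volume_pos[OF c1(1,3) \<delta>(2)[OF that]] weighted_volume_pos[OF c2(1,3) \<delta>2[OF that]] by simp
    have derF: "(F has_real_derivative - (D + 1) * F s * G s) (at s)" if s: "\<bar>s\<bar> < \<delta>" for s
    proof -
      have "w \<bullet> weighted_moment 0 (0 + s *\<^sub>R w) K1 = A 1 s / A 0 s"
        unfolding A_def by (rule inner_weighted_moment[OF c1(1) \<delta>(2)[OF s]])
      moreover have "w \<bullet> weighted_moment 0 (0 + s *\<^sub>R w) K2 = B 1 s / B 0 s"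
        unfolding B_def by (rule inner_weighted_moment[OF c2(1) \<delta>2[OF s]])
      moreover have "(F has_real_derivative - (real CARD('n) + 1) * F s *
          (w \<bullet> weighted_moment 0 (0 + s *\<^sub>R w) K1 - w \<bullet> weighted_moment 0 (0 + s *\<^sub>R w) K2)) (at s)"
        unfolding F_def by (rule volume_ratio_derivative[OF c1(1,3) c2(1,3) \<delta>(2)[OF s] \<delta>2[OF s]])
      ultimately show ?thesis by (simp add: G_def D_def)
    qed
    have "\<exists>z>0. z < t \<and> F t - F 0 = (t - 0) * (- (D + 1) * F z * G z)"
      by (rule MVT2[OF t(1)]) (rule derF, use t in auto)
    then obtain z where z: "0 < z" "z < t" "F t - F 0 = t * (- (D + 1) * F z * G z)" by auto
    have "0 < G z" using d(2)[of z] z t G0 by simp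
    moreover have "0 < F z" using z t by (intro Fpos) auto
    ultimately have "0 < t * ((D + 1) * F z * G z)" using t by (simp add: D_def)
    moreover have "F t - F 0 = - (t * ((D + 1) * F z * G z))" using z(3) by (simp add: algebra_simps)
    ultimately have "F t < F 0" by linarith
    moreover have "F 0 \<le> F t"
      using min[of "0 + t *\<^sub>R w"] \<delta>(2)[of t] t unfolding F_def c0 by simp
    ultimately show False by simp
  qed
  then have "\<not> affine_transformation \<phi>" using affine_denominator_trivial[OF T(1,2)] by blast
  moreover have "\<phi> \<circ> inv (\<lambda>P. P) = \<phi>" by (simp add: fun_eq_iff inv_id[unfolded id_def])
  ultimately show ?thesis using T(4) eq_id by metis
qed

lemma cross_polytope_open_interior:
  "{x :: real ^ 'n::finite. (\<Sum>i\<in>UNIV. \<bar>x $ i\<bar>) < 1} \<subseteq> interior cross_polytope"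
  by (rule interior_maximal) (auto simp: cross_polytope_def intro!: open_Collect_less continuous_intros)

lemma cross_polytope_convex_body: "convex_body (cross_polytope :: (real ^ 'n::finite) set)"
proof -
  have "(0 :: real ^ 'n) \<in> interior cross_polytope" using cross_polytope_open_interior by force
  then show ?thesis unfolding convex_body_def using cross_polytope_compact cross_polytope_convex by blast
qed

lemma mem_symmetric_box: "x \<in> cbox (- h) h \<longleftrightarrow> (\<forall>i. \<bar>x $ i\<bar> \<le> h $ i)" for h :: "real ^ 'n::finite"
  unfolding mem_box_cart by (simp add: abs_le_iff) (metis minus_le_iff)

lemma box_convex_body:
  fixes h :: "real ^ 'n::finite"
  assumes "\<And>i. 0 < h $ i"
  shows "convex_body (cbox (- h) h)"
proof -
  have "0 \<in> box (- h) h" using assms by (simp add: mem_box_cart)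
  then show ?thesis unfolding convex_body_def by (auto simp: interior_cbox convex_box(1))
qed

text \<open>
  The two variances are \<open>2 / ((d + 1) * (d + 2)) = \<kappa>\<^sup>2 / 3\<close> and \<open>(h $ j)\<^sup>2 / 3\<close>.
\<close>

lemma cross_polytope_box_not_unique:
  fixes h :: "real ^ 'n::finite"
  assumes d: "2 \<le> CARD('n)" and h: "\<And>i. 0 < h $ i" "kappa CARD('n) < h $ j" and sub: "cbox (- h) h \<subseteq> interior cross_polytope"
  shows "\<exists>\<phi> \<psi>. equates_centroids \<phi> cross_polytope (cbox (- h) h) \<and> equates_centroids \<psi> cross_polytope (cbox (- h) h)
      \<and> \<not> affine_transformation (\<phi> \<circ> inv \<psi>)"
proof (rule not_unique_if_variance_larger[OF cross_polytope_convex_body box_convex_body[OF h(1)] sub, of "axis j 1"])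
  have sym: "uminus ` S = S" if "\<And>x. x \<in> S \<Longrightarrow> - x \<in> S" for S :: "(real ^ 'n) set"
    using that by force
  show "uminus ` (cross_polytope :: (real ^ 'n) set) = cross_polytope" by (rule sym) (simp add: cross_polytope_def)
  show "uminus ` cbox (- h) h = cbox (- h) h" by (rule sym) (simp add: mem_symmetric_box)
  show "axis j (1::real) \<noteq> 0" by (simp add: axis_eq_0_iff)
  define D where "D = (real CARD('n) + 1) * (real CARD('n) + 2)"
  have D: "D > 0" by (simp add: D_def add_nonneg_pos)
  have v1: "0 < measure lborel (cross_polytope :: (real ^ 'n) set)" and v2: "0 < measure lborel (cbox (- h) h)"
    using cross_polytope_convex_body[where 'n = 'n] box_convex_body[OF h(1)] measure_lborel_pos unfolding convex_body_def by blast+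
  have ax: "axis j 1 \<bullet> x = x $ j" for x :: "real ^ 'n" by (simp add: inner_axis')
  have "(LINT x:(cross_polytope :: (real ^ 'n) set)|lborel. (x $ j)\<^sup>2) / measure lborel (cross_polytope :: (real ^ 'n) set) \<le> 2 / D"
  proof -
    have "D * (LINT x:(cross_polytope :: (real ^ 'n) set)|lborel. (x $ j)\<^sup>2) \<le> 2 * measure lborel (cross_polytope :: (real ^ 'n) set)"
      unfolding D_def by (rule cross_polytope_second_moment)
    then show ?thesis using v1 D by (simp add: divide_le_eq le_divide_eq mult_ac)
  qed
  also have "2 / D = (kappa CARD('n))\<^sup>2 / 3" using kappa_bounds(3)[OF d] by (simp add: D_def)
  also have "\<dots> < (h $ j)\<^sup>2 / 3"
    using h(2) kappa_bounds(1)[OF d] by (simp add: power_strict_mono)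
  also have "\<dots> \<le> (LINT x:cbox (- h) h|lborel. (x $ j)\<^sup>2) / measure lborel (cbox (- h) h)"
    using box_second_moment[OF h(1), of j] v2 by (simp add: field_simps)
  finally show "(LINT x:(cross_polytope :: (real ^ 'n) set)|lborel. (axis j 1 \<bullet> x)\<^sup>2) / measure lborel (cross_polytope :: (real ^ 'n) set)
     < (LINT x:cbox (- h) h|lborel. (axis j 1 \<bullet> x)\<^sup>2) / measure lborel (cbox (- h) h)"
    by (simp only: ax)
qed

lemma box_in_scaled_cross_polytope:
  fixes h :: "real ^ 'n::finite"
  assumes "(\<Sum>i\<in>UNIV. h $ i) \<le> s" "x \<in> cbox (- h) h"
  shows "(\<Sum>i\<in>UNIV. \<bar>x $ i\<bar>) \<le> s"
  using sum_mono[of UNIV "\<lambda>i. \<bar>x $ i\<bar>" "\<lambda>i. h $ i"] assms by (simp add: mem_symmetric_box)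

text \<open>
  The box has one half-side strictly between \<open>\<kappa>\<close> and \<open>s\<close>, and the others so short that it fits into
  the cross-polytope scaled by \<open>s\<close>; the number \<open>s > \<kappa>\<close> is chosen so that the width bound
  \<open>ln ((1 + s) / (1 - s))\<close> for this scaling is below \<open>c\<close>.
\<close>

lemma width_bound_sharp:
  assumes d: "2 \<le> CARD('n::finite)" and c: "c > ln ((1 + kappa CARD('n)) / (1 - kappa CARD('n)))"
  shows "\<exists>K1 K2 :: (real ^ 'n) set. convex_body K1 \<and> convex_body K2 \<and> K2 \<subseteq> interior K1 \<and>
      hilbert_width K1 K2 < ereal c \<and> \<not> unique_modulo_affine K1 K2"
proof -
  define \<kappa> where "\<kappa> = kappa CARD('n)"
  have \<kappa>: "0 < \<kappa>" "\<kappa> < 1" using kappa_bounds[OF d] by (simp_all add: \<kappa>_def)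
  have "((\<lambda>s. ln ((1 + s) / (1 - s))) \<longlongrightarrow> ln ((1 + \<kappa>) / (1 - \<kappa>))) (at_right \<kappa>)"
    using \<kappa> by (intro tendsto_intros) auto
  then have "\<forall>\<^sub>F s in at_right \<kappa>. ln ((1 + s) / (1 - s)) < c"
    by (rule order_tendstoD(2)) (use c in \<open>simp add: \<kappa>_def\<close>)
  moreover have "\<forall>\<^sub>F s in at_right \<kappa>. s \<in> {\<kappa><..<1}" by (rule eventually_at_right_real[OF \<kappa>(2)])
  ultimately have "\<forall>\<^sub>F s in at_right \<kappa>. ln ((1 + s) / (1 - s)) < c \<and> s \<in> {\<kappa><..<1}" by (rule eventually_conj)
  then obtain s where s: "ln ((1 + s) / (1 - s)) < c" "\<kappa> < s" "s < 1"
    using eventually_happens'[OF trivial_limit_at_right_real] by auto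
  define j where "j = (undefined :: 'n)"
  define e where "e = (s - \<kappa>) / (2 * real CARD('n))"
  have e: "e > 0" using s by (simp add: e_def)
  define h where "h = (\<chi> i. if i = j then (\<kappa> + s) / 2 else e)"
  have hpos: "0 < h $ i" for i using e \<kappa> s by (simp add: h_def)
  have "(\<Sum>i\<in>UNIV. h $ i) = h $ j + (\<Sum>i\<in>UNIV - {j}. h $ i)" by (rule sum.remove) auto
  also have "(\<Sum>i\<in>UNIV - {j}. h $ i) = real (card (UNIV - {j})) * e" by (simp add: h_def)
  also have "\<dots> \<le> real CARD('n) * e" using e by (intro mult_right_mono) (auto intro!: card_mono)
  also have "\<dots> = (s - \<kappa>) / 2" using d by (simp add: e_def)
  finally have sum: "(\<Sum>i\<in>UNIV. h $ i) \<le> s" by (simp add: h_def field_simps)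
  define K2 where "K2 = cbox (- h) h"
  have l1: "(\<Sum>i\<in>UNIV. \<bar>x $ i\<bar>) \<le> s" if "x \<in> K2" for x
    using box_in_scaled_cross_polytope[OF sum] that by (simp add: K2_def)
  have sub: "K2 \<subseteq> interior cross_polytope"
    using l1 s(3) cross_polytope_open_interior by force
  have s0: "0 < s" using s \<kappa> by simp
  have scale: "(1 / s) *\<^sub>R x \<in> cross_polytope" if "x \<in> K2" for x
    using l1[OF that] s0 by (simp add: cross_polytope_def abs_mult sum_divide_distrib[symmetric])
  have "hilbert_width cross_polytope K2 \<le> ereal (ln ((1 + s) / (1 - s)))"
  proof (rule hilbert_width_symmetric_le[OF d s0 s(3)])
    show "0 \<in> interior (cross_polytope :: (real ^ 'n) set)" using cross_polytope_open_interior by force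
    show "- ((1 / s) *\<^sub>R x) \<in> cross_polytope" if "x \<in> K2" for x
      using scale[OF that] by (simp add: cross_polytope_def)
  qed (rule scale)
  then have "hilbert_width cross_polytope K2 < ereal c" using s(1) by (simp add: order.strict_trans1)
  moreover have "\<not> unique_modulo_affine cross_polytope K2"
    unfolding unique_modulo_affine_def K2_def
    using cross_polytope_box_not_unique[OF d hpos, of j] sub s(2) by (auto simp: h_def K2_def \<kappa>_def)
  ultimately show ?thesis
    using cross_polytope_convex_body box_convex_body[OF hpos] sub unfolding K2_def by blast
qed

text \<open>
  In the plane \<open>\<kappa> = sqrt (1 / 2) < 3 / 4\<close>, and \<open>3 / 4 + 1 / 8 < 1\<close>.
\<close>

lemma planar_not_unique:
  "\<exists>K1 K2 :: (real ^ 2) set. convex_body K1 \<and> convex_body K2 \<and> K2 \<subseteq> interior K1 \<and>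
     (\<exists>\<phi> \<psi>. equates_centroids \<phi> K1 K2 \<and> equates_centroids \<psi> K1 K2 \<and> \<not> affine_transformation (\<phi> \<circ> inv \<psi>))"
proof -
  define h :: "real ^ 2" where "h = (\<chi> i. if i = 1 then 3 / 4 else 1 / 8)"
  have hpos: "0 < h $ i" for i by (simp add: h_def)
  have "kappa CARD(2) < 3 / 4"
  proof -
    have "kappa CARD(2) = sqrt (1 / 2)" by (simp add: kappa_def)
    also have "\<dots> < sqrt ((3 / 4)\<^sup>2)" by (simp add: power2_eq_square)
    finally show ?thesis by simp
  qed
  then have k: "kappa CARD(2) < h $ 1" by (simp add: h_def)
  have "(\<Sum>i\<in>UNIV. h $ i) \<le> 7 / 8" by (simp add: h_def sum_2)
  then have "cbox (- h) h \<subseteq> {x. (\<Sum>i\<in>UNIV. \<bar>x $ i\<bar>) < 1}"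
    using box_in_scaled_cross_polytope[of h "7/8"] by force
  then have sub: "cbox (- h) h \<subseteq> interior cross_polytope" using cross_polytope_open_interior by blast
  show ?thesis
    using cross_polytope_box_not_unique[OF _ hpos k sub] cross_polytope_convex_body box_convex_body[OF hpos] sub
    by (intro exI[of _ cross_polytope] exI[of _ "cbox (- h) h"]) simp
qed

theorem theorem6:
  shows "(\<forall>K1 K2 :: (real ^ 'n::finite) set.
            convex_body K1 \<and> convex_body K2 \<and> K2 \<subseteq> interior K1 \<longrightarrow>
            (\<exists>\<phi>. equates_centroids \<phi> K1 K2))
       \<and> (\<exists>K1 K2 :: (real ^ 2) set.
            convex_body K1 \<and> convex_body K2 \<and> K2 \<subseteq> interior K1 \<and>
            (\<exists>\<phi> \<psi>. equates_centroids \<phi> K1 K2 \<and> equates_centroids \<psi> K1 K2 \<and>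
              \<not> affine_transformation (\<phi> \<circ> inv \<psi>)))
       \<and> (2 \<le> CARD('n) \<longrightarrow>
            (\<forall>K1 K2 :: (real ^ 'n) set.
               convex_body K1 \<and> convex_body K2 \<and> K2 \<subseteq> interior K1 \<and>
               hilbert_width K1 K2 < ereal (ln ((1 + kappa CARD('n)) / (1 - kappa CARD('n)))) \<longrightarrow>
               unique_modulo_affine K1 K2)
          \<and> (\<forall>c :: real. c > ln ((1 + kappa CARD('n)) / (1 - kappa CARD('n))) \<longrightarrow>
               (\<exists>K1 K2 :: (real ^ 'n) set.
                  convex_body K1 \<and> convex_body K2 \<and> K2 \<subseteq> interior K1 \<and>
                  hilbert_width K1 K2 < ereal c \<and> \<not> unique_modulo_affine K1 K2))
          \<and> (\<forall>h :: real ^ 'n.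
               (\<forall>i. 0 < h $ i) \<and> (\<exists>j. kappa CARD('n) < h $ j) \<and>
               cbox (- h) h \<subseteq> interior cross_polytope \<longrightarrow>
               \<not> unique_modulo_affine cross_polytope (cbox (- h) h)))"
proof (intro conjI impI)
  show "\<forall>K1 K2 :: (real ^ 'n) set.
            convex_body K1 \<and> convex_body K2 \<and> K2 \<subseteq> interior K1 \<longrightarrow>
            (\<exists>\<phi>. equates_centroids \<phi> K1 K2)"
  proof (intro allI impI)
    fix K1 K2 :: "(real ^ 'n) set"
    assume K: "convex_body K1 \<and> convex_body K2 \<and> K2 \<subseteq> interior K1"
    then have "interior K2 \<noteq> {}" by (simp add: convex_body_def)
    then obtain p where "p \<in> K2" using interior_subset by blast
    then show "\<exists>\<phi>. equates_centroids \<phi> K1 K2"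
      using equating_minimiser_exists[of K1 K2 p] K by metis
  qed
  show "\<exists>K1 K2 :: (real ^ 2) set.
            convex_body K1 \<and> convex_body K2 \<and> K2 \<subseteq> interior K1 \<and>
            (\<exists>\<phi> \<psi>. equates_centroids \<phi> K1 K2 \<and> equates_centroids \<psi> K1 K2 \<and>
              \<not> affine_transformation (\<phi> \<circ> inv \<psi>))"
    by (rule planar_not_unique)
  assume d: "2 \<le> CARD('n)"
  show "\<forall>K1 K2 :: (real ^ 'n) set.
               convex_body K1 \<and> convex_body K2 \<and> K2 \<subseteq> interior K1 \<and>
               hilbert_width K1 K2 < ereal (ln ((1 + kappa CARD('n)) / (1 - kappa CARD('n)))) \<longrightarrow>
               unique_modulo_affine K1 K2"
    using unique_if_small_width[OF d] by blast
  show "\<forall>c :: real. c > ln ((1 + kappa CARD('n)) / (1 - kappa CARD('n))) \<longrightarrow>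
               (\<exists>K1 K2 :: (real ^ 'n) set.
                  convex_body K1 \<and> convex_body K2 \<and> K2 \<subseteq> interior K1 \<and>
                  hilbert_width K1 K2 < ereal c \<and> \<not> unique_modulo_affine K1 K2)"
    using width_bound_sharp[OF d] by blast
  show "\<forall>h :: real ^ 'n.
               (\<forall>i. 0 < h $ i) \<and> (\<exists>j. kappa CARD('n) < h $ j) \<and>
               cbox (- h) h \<subseteq> interior cross_polytope \<longrightarrow>
               \<not> unique_modulo_affine cross_polytope (cbox (- h) h)"
    using cross_polytope_box_not_unique[OF d] unfolding unique_modulo_affine_def by blast
qed

end
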